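(* Let $M\ge\frac{n}{4\pi}$. Let $\{f_k\}$ be a sequence of functions on $\mathbb{R}^n$ which are normalized and centered in $L^2(dm)$, i.e. $\int|f_k|^2\,dm=1$ and $\int x|f_k|^2\,dm=0$, and suppose that $\int|x|^2|f_k|^2\,dm\le M$ for all $k$. If $\delta_c(f_k)\to0$ as $k\to\infty$, then $f_k\to1$ in $L^2(dm)$.
   Context: On $\mathbb{R}^n$, $dm=2^{n/2}e^{-2\pi|x|^2}dx$, a Gaussian probability measure. For $f\in L^2(dm)$ normalized by $\int|f|^2\,dm=1$, the deficit is $\delta_c(f)=\frac{1}{2\pi}\int|\nabla f|^2\,dm-\int|f|^2\log|f|^2\,dm$.
   Formalization: The functions f_k are taken real-valued and nonnegative almost everywhere; without a sign condition the claim is false, since f_k = -1 is normalized, centered, has second moment n/(4π) and zero deficit, but does not converge to 1. *)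

theory Defs
  imports "HOL-Probability.Probability"
begin

definition gauss :: "'a::euclidean_space measure" where
  "gauss = density lborel
     (\<lambda>x. ennreal (2 powr (real DIM('a) / 2) * exp (- 2 * pi * (norm x)\<^sup>2)))"

(* Being a greatest fixed point, this says that directional derivatives of every order
   exist and are Frechet differentiable everywhere, i.e. phi is C-infinity. *)
coinductive smooth :: "('a::euclidean_space \<Rightarrow> real) \<Rightarrow> bool" where
  "(\<And>x. \<phi> differentiable (at x)) \<Longrightarrow>
   (\<And>v. smooth (\<lambda>x. frechet_derivative \<phi> (at x) v)) \<Longrightarrow> smooth \<phi>"

definition test_function :: "('a::euclidean_space \<Rightarrow> real) \<Rightarrow> bool" where
  "test_function \<phi> \<longleftrightarrow> smooth \<phi> \<and> compact (closure {x. \<phi> x \<noteq> 0})"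

definition locally_integrable ::
    "('a::euclidean_space \<Rightarrow> 'b::euclidean_space) \<Rightarrow> bool" where
  "locally_integrable h \<longleftrightarrow>
     h \<in> borel_measurable borel \<and> (\<forall>K. compact K \<longrightarrow> set_integrable lborel K h)"

(* The distributional gradient is taken with respect to Lebesgue measure, as is usual also
   for the Gaussian Sobolev space. *)
definition has_weak_gradient ::
    "('a::euclidean_space \<Rightarrow> real) \<Rightarrow> ('a \<Rightarrow> 'a) \<Rightarrow> bool" where
  "has_weak_gradient f g \<longleftrightarrow>
     locally_integrable f \<and> locally_integrable g \<and>
     (\<forall>\<phi> v. test_function \<phi> \<longrightarrow>
        (\<integral>x. f x * frechet_derivative \<phi> (at x) v \<partial>lborel) =
        - (\<integral>x. (g x \<bullet> v) * \<phi> x \<partial>lborel))"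

(* The weak gradient is unique almost everywhere, so the infimum ranges over at most one value;
   it is infinite when f has no weak gradient. *)
definition dirichlet_energy :: "('a::euclidean_space \<Rightarrow> real) \<Rightarrow> ennreal" where
  "dirichlet_energy f =
     (INF g \<in> {g. has_weak_gradient f g}. \<integral>\<^sup>+x. ennreal ((norm (g x))\<^sup>2) \<partial>gauss)"

(* The integral of |f|^2 log |f|^2, with values in (-\<infinity>, \<infinity>]: since t * ln t is at least -1/e
   for t \<ge> 0 and gauss is a probability measure, the subtracted term is always finite.
   Note 0 * ln 0 = 0. *)
definition gauss_entropy :: "('a::euclidean_space \<Rightarrow> real) \<Rightarrow> ereal" where
  "gauss_entropy f =
     enn2ereal (\<integral>\<^sup>+x. ennreal (\<bar>f x\<bar>\<^sup>2 * ln (\<bar>f x\<bar>\<^sup>2)) \<partial>gauss)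
     - enn2ereal (\<integral>\<^sup>+x. ennreal (- (\<bar>f x\<bar>\<^sup>2 * ln (\<bar>f x\<bar>\<^sup>2))) \<partial>gauss)"

(* In ereal, \<infinity> - \<infinity> = \<infinity>, so the deficit is infinite whenever the Dirichlet energy is. *)
definition deficit :: "('a::euclidean_space \<Rightarrow> real) \<Rightarrow> ereal" where
  "deficit f = ereal (1 / (2 * pi)) * enn2ereal (dirichlet_energy f) - gauss_entropy f"

end

(* Let c = 1 / (4 pi). The measure |f|^2 dm is the law of a random vector X, and W = 2 c grad f / f is,
   up to the factor c, its score relative to the Gaussian of variance c; the deficit is then
   E|W|^2 / (2 c) minus the relative entropy. Send X through the Gaussian channel Y = X + Z. Following
   the entropy along the channel proves the logarithmic Sobolev inequality, and the loss
   E|W|^2 - E|E[W | Y]|^2 survives as a remainder that dominates a Gaussian-weighted average of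
   |W(x) - W(x')|^2. Hence a small deficit makes W almost constant. As X is centered, so is W, and
   E|W| tends to zero; the bound on E|W|^2 needed here comes from comparing the inequalities for the
   variances c and c / 2. Once E|W| is small, the law of Y is locally almost proportional to a Gaussian.
   The second moment bound prevents mass from escaping and the law of Y approximates that of X in total
   variation at a rate controlled by E|W| + E|X|, so |f|^2 dm tends to dm in total variation, which
   controls the L^2 distance because |f - 1|^2 <= |f^2 - 1| for f >= 0. *)

theory Submission
  imports Defs "HOL-Real_Asymp.Real_Asymp"
begin

section \<open>The heat kernel\<close>

text \<open>W is never differentiated, and neither is any density: all that is known of W is the
  identity \<open>W_law\<close> against heat kernels. It makes E[W | Y = y] equal to y + (c + t)
  \<open>score t y\<close>, again a score field, now of the law of Y relative to the Gaussian of
  variance c + t, so the situation reproduces itself along the channel. Derivatives are replaced by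
  one inequality, \<open>ln_smoothed_tangent\<close>: the logarithm of a Gaussian mixture lies above
  its tangent up to a quadratic error. Cutting a path into N pieces removes quadratic errors, which
  turns this inequality into one half of de Bruijn's identity, into a Lipschitz bound for
  logarithmic ratios and into an L^1 modulus for translations. On the side of f the obstacle is that
  weak gradients are tested only against smooth functions of compact support, that f is merely in
  L^2(dm), and that \<open>W_law\<close> is a statement about f^2. So the test functions are widened
  to Gaussians decaying faster than exp(-|x|^2 / (4c)), up to a constant the square root of the
  density of dm, and the chain rule for f^2 is replaced by a symmetrization.\<close>

definition heat_kernel :: "real \<Rightarrow> 'a::euclidean_space \<Rightarrow> real" where
  "heat_kernel t z = (2 * pi * t) powr (- (real DIM('a) / 2)) * exp (- (norm z)\<^sup>2 / (2 * t))"

lemma heat_kernel_pos [simp]: "t > 0 \<Longrightarrow> heat_kernel t z > 0"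
  by (simp add: heat_kernel_def)

lemma heat_kernel_nonneg [simp]: "heat_kernel t z \<ge> 0"
  by (simp add: heat_kernel_def)

lemma heat_kernel_minus [simp]: "heat_kernel t (- z) = heat_kernel t z"
  by (simp add: heat_kernel_def)

lemma heat_kernel_commute: "heat_kernel t (x - y) = heat_kernel t (y - x)"
  by (simp add: heat_kernel_def norm_minus_commute)

lemma borel_measurable_heat_kernel [measurable]: "heat_kernel t \<in> borel_measurable borel"
  unfolding heat_kernel_def by measurable

lemma heat_kernel_le:
  assumes "t > 0"
  shows "heat_kernel t (z::'a::euclidean_space) \<le> (2 * pi * t) powr (- (real DIM('a) / 2))"
  using assms unfolding heat_kernel_def by (simp add: mult_left_le)

lemma norm_power2_eq_sum: "(norm (z::'a::euclidean_space))\<^sup>2 = (\<Sum>b\<in>Basis. (z \<bullet> b)\<^sup>2)"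
  unfolding power2_norm_eq_inner by (subst euclidean_inner) (simp add: power2_eq_square)

text \<open>The Gaussian factorizes over the coordinates, so its mass and second moments reduce to
  facts on \<open>normal_density\<close>.\<close>

lemma heat_kernel_eq_prod:
  assumes "t > 0"
  shows "heat_kernel t (z::'a::euclidean_space) = (\<Prod>b\<in>Basis. normal_density 0 (sqrt t) (z \<bullet> b))"
proof -
  have "(\<Prod>b\<in>(Basis::'a set). normal_density 0 (sqrt t) (z \<bullet> b))
      = (1 / sqrt (2 * pi * t)) ^ DIM('a) * exp (\<Sum>b\<in>(Basis::'a set). - (z \<bullet> b)\<^sup>2 / (2 * t))"
    using assms by (simp add: normal_density_def prod.distrib exp_sum power_divide prod_dividef)
  also have "(\<Sum>b\<in>(Basis::'a set). - (z \<bullet> b)\<^sup>2 / (2 * t)) = - (norm z)\<^sup>2 / (2 * t)"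
    by (simp add: norm_power2_eq_sum sum_negf sum_divide_distrib)
  also have "(1 / sqrt (2 * pi * t)) ^ DIM('a) = (2 * pi * t) powr (- (real DIM('a) / 2))"
    using assms by (simp add: powr_half_sqrt[symmetric] powr_realpow[symmetric] powr_powr
        powr_minus_divide power_divide del: powr_half_sqrt powr_realpow)
  finally show ?thesis by (simp add: heat_kernel_def)
qed

lemma nn_integral_normal_density: "\<sigma> > 0 \<Longrightarrow> (\<integral>\<^sup>+x. ennreal (normal_density 0 \<sigma> x) \<partial>lborel) = 1"
  by (simp add: nn_integral_eq_integral)

lemma nn_integral_normal_density_sq:
  assumes "\<sigma> > 0"
  shows "(\<integral>\<^sup>+x. ennreal (normal_density 0 \<sigma> x * x\<^sup>2) \<partial>lborel) = ennreal (\<sigma>\<^sup>2)"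
proof -
  have "(\<integral>\<^sup>+x. ennreal (normal_density 0 \<sigma> x * x\<^sup>2) \<partial>lborel)
      = ennreal (\<integral>x. normal_density 0 \<sigma> x * x\<^sup>2 \<partial>lborel)"
    using integrable_normal_moment[OF assms, of 0 2] assms
    by (intro nn_integral_eq_integral) auto
  also have "(\<integral>x. normal_density 0 \<sigma> x * x\<^sup>2 \<partial>lborel) = \<sigma>\<^sup>2"
    using integral_normal_moment_even[OF assms, of 0 1] by (simp add: fact_numeral)
  finally show ?thesis .
qed

lemma nn_integral_heat_kernel:
  assumes "t > 0"
  shows "(\<integral>\<^sup>+z. ennreal (heat_kernel t (z::'a::euclidean_space)) \<partial>lborel) = 1"
proof -
  have "(\<integral>\<^sup>+z. ennreal (heat_kernel t (z::'a)) \<partial>lborel)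
      = (\<integral>\<^sup>+z. (\<Prod>b\<in>(Basis::'a set). ennreal (normal_density 0 (sqrt t) (z \<bullet> b))) \<partial>lborel)"
    using assms by (simp add: heat_kernel_eq_prod prod_ennreal)
  also have "\<dots> = 1"
    using assms by (subst nn_integral_lborel_prod) (auto simp: nn_integral_normal_density)
  finally show ?thesis .
qed

lemma nn_integral_heat_kernel_inner_sq:
  assumes "t > 0" and b: "b \<in> (Basis::'a::euclidean_space set)"
  shows "(\<integral>\<^sup>+z. ennreal (heat_kernel t z * (z \<bullet> b)\<^sup>2) \<partial>lborel) = ennreal t"
proof -
  \<comment> \<open>The weight on coordinate b is absorbed into its own factor, so that the
    integrand is still a product over \<open>Basis\<close>.\<close>
  define h where "h b' x = normal_density 0 (sqrt t) x * (if b' = b then x\<^sup>2 else 1)" for b' :: 'a and x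
  have h_nonneg: "h b' x \<ge> 0" for b' x by (simp add: h_def)
  have [measurable]: "h b' \<in> borel_measurable borel" for b' unfolding h_def by measurable
  have "heat_kernel t z * (z \<bullet> b)\<^sup>2 = (\<Prod>b'\<in>(Basis::'a set). h b' (z \<bullet> b'))" for z
    using assms by (simp add: h_def heat_kernel_eq_prod prod.distrib prod.delta)
  then have "(\<integral>\<^sup>+z. ennreal (heat_kernel t z * (z \<bullet> b)\<^sup>2) \<partial>lborel)
      = (\<integral>\<^sup>+z. (\<Prod>b'\<in>(Basis::'a set). ennreal (h b' (z \<bullet> b'))) \<partial>lborel)"
    by (simp add: prod_ennreal h_nonneg)
  also have "\<dots> = (\<Prod>b'\<in>(Basis::'a set). \<integral>\<^sup>+x. ennreal (h b' x) \<partial>lborel)"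
    by (subst nn_integral_lborel_prod) auto
  also have "\<dots> = (\<Prod>b'\<in>(Basis::'a set). if b' = b then ennreal t else 1)"
    using assms by (intro prod.cong)
      (auto simp: h_def nn_integral_normal_density nn_integral_normal_density_sq)
  also have "\<dots> = ennreal t" using b by (simp add: prod.delta)
  finally show ?thesis .
qed

lemma nn_integral_heat_kernel_norm_sq:
  assumes "t > 0"
  shows "(\<integral>\<^sup>+z. ennreal (heat_kernel t (z::'a::euclidean_space) * (norm z)\<^sup>2) \<partial>lborel)
    = ennreal (real DIM('a) * t)"
proof -
  have "(\<integral>\<^sup>+z. ennreal (heat_kernel t (z::'a) * (norm z)\<^sup>2) \<partial>lborel)
      = (\<integral>\<^sup>+z. (\<Sum>b\<in>(Basis::'a set). ennreal (heat_kernel t z * (z \<bullet> b)\<^sup>2)) \<partial>lborel)"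
    by (simp add: norm_power2_eq_sum sum_distrib_left sum_ennreal)
  also have "\<dots> = (\<Sum>b\<in>(Basis::'a set). ennreal t)"
    using assms by (subst nn_integral_sum) (auto simp: nn_integral_heat_kernel_inner_sq)
  also have "\<dots> = ennreal (real DIM('a) * t)"
    using assms by (simp add: ennreal_mult ennreal_of_nat_eq_real_of_nat)
  finally show ?thesis .
qed

text \<open>Origin of the variance c = 1 / (4 pi): \<open>heat_kernel t\<close> is normalized as the
  density of N(0, t I), and 1 / (2c) has to equal 2 pi.\<close>

lemma gauss_eq_heat_kernel: "(gauss :: 'a::euclidean_space measure) = density lborel (heat_kernel (1 / (4 * pi)))"
proof -
  have "2 powr (real DIM('a) / 2) = (2 * pi * (1 / (4 * pi))) powr (- (real DIM('a) / 2))"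
    by (simp add: powr_minus powr_divide inverse_eq_divide)
  then show ?thesis unfolding gauss_def heat_kernel_def by (simp add: field_simps)
qed

text \<open>Completing the square in y: as a function of y the product is a Gaussian of variance t /
  2 about the midpoint of x and x'. Integrating it over y leaves only the factor in |x - x'|, which
  becomes the weight in \<open>spread\<close>.\<close>

lemma heat_kernel_add_sq:
  assumes "t > 0"
  shows "heat_kernel t (y - x) * heat_kernel t (y - x') =
    (4 * pi * t) powr (- (real DIM('a) / 2)) * exp (- (norm (x - x'))\<^sup>2 / (4 * t))
      * heat_kernel (t / 2) (y - (1/2) *\<^sub>R (x + x' :: 'a::euclidean_space))"
proof -
  have *: "(norm (y - x))\<^sup>2 + (norm (y - x'))\<^sup>2
      = 2 * (norm (y - (1/2) *\<^sub>R (x + x')))\<^sup>2 + (norm (x - x'))\<^sup>2 / 2"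
    by (simp add: power2_norm_eq_inner inner_diff_left inner_diff_right inner_add_left inner_add_right
        inner_commute field_simps)
  have "exp (- (norm (y - x))\<^sup>2 / (2 * t)) * exp (- (norm (y - x'))\<^sup>2 / (2 * t))
      = exp (- (norm (x - x'))\<^sup>2 / (4 * t)) * exp (- (norm (y - (1/2) *\<^sub>R (x + x')))\<^sup>2 / (2 * (t/2)))"
  proof -
    have "- (norm (y - x))\<^sup>2 / (2 * t) + - (norm (y - x'))\<^sup>2 / (2 * t)
        = - ((norm (y - x))\<^sup>2 + (norm (y - x'))\<^sup>2) / (2 * t)"
      using assms by (simp add: field_simps)
    also have "\<dots> = - (norm (x - x'))\<^sup>2 / (4 * t) + - (norm (y - (1/2) *\<^sub>R (x + x')))\<^sup>2 / (2 * (t/2))"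
      unfolding * using assms by (simp add: divide_simps)
    finally show ?thesis by (simp only: exp_add[symmetric])
  qed
  moreover have "(2 * pi * t) powr (- (real DIM('a) / 2)) * (2 * pi * t) powr (- (real DIM('a) / 2)) =
      (4 * pi * t) powr (- (real DIM('a) / 2)) * (2 * pi * (t / 2)) powr (- (real DIM('a) / 2))"
    using assms by (subst (1 2) powr_mult[symmetric]) (auto intro!: arg_cong2[where f="(powr)"])
  ultimately show ?thesis unfolding heat_kernel_def by (simp add: mult_ac)
qed

section \<open>Translations of Lebesgue measure\<close>

lemma nn_integral_lborel_shift:
  fixes f :: "'a::euclidean_space \<Rightarrow> ennreal"
  assumes [measurable]: "f \<in> borel_measurable borel"
  shows "(\<integral>\<^sup>+x. f (x + a) \<partial>lborel) = (\<integral>\<^sup>+x. f x \<partial>lborel)"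
proof -
  have "(\<integral>\<^sup>+x. f x \<partial>lborel) = (\<integral>\<^sup>+x. f x \<partial>distr lborel borel ((+) a))"
    by (simp add: lborel_distr_plus)
  also have "\<dots> = (\<integral>\<^sup>+x. f (x + a) \<partial>lborel)"
    by (subst nn_integral_distr) (auto simp: add.commute)
  finally show ?thesis ..
qed

lemma lborel_reflect: "distr lborel borel (\<lambda>x. a - x) = (lborel :: 'a::euclidean_space measure)"
  using lborel_affine[of "-1" a] by (simp add: density_1)

lemma nn_integral_lborel_reflect:
  fixes f :: "'a::euclidean_space \<Rightarrow> ennreal"
  assumes [measurable]: "f \<in> borel_measurable borel"
  shows "(\<integral>\<^sup>+x. f (a - x) \<partial>lborel) = (\<integral>\<^sup>+x. f x \<partial>lborel)"
proof -
  have "(\<integral>\<^sup>+x. f x \<partial>lborel) = (\<integral>\<^sup>+x. f x \<partial>distr lborel borel (\<lambda>x. a - x))"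
    by (simp add: lborel_reflect)
  also have "\<dots> = (\<integral>\<^sup>+x. f (a - x) \<partial>lborel)"
    by (subst nn_integral_distr) auto
  finally show ?thesis ..
qed

lemma integral_lborel_shift:
  fixes f :: "'a::euclidean_space \<Rightarrow> 'b::{banach, second_countable_topology}"
  assumes [measurable]: "f \<in> borel_measurable borel"
  shows "(\<integral>x. f (x + a) \<partial>lborel) = (\<integral>x. f x \<partial>lborel)"
proof -
  have "(\<integral>x. f x \<partial>lborel) = (\<integral>x. f x \<partial>distr lborel borel ((+) a))"
    by (simp add: lborel_distr_plus)
  also have "\<dots> = (\<integral>x. f (x + a) \<partial>lborel)"
    by (subst integral_distr) (auto simp: add.commute)
  finally show ?thesis ..
qed

lemma integrable_lborel_shift:
  fixes f :: "'a::euclidean_space \<Rightarrow> 'b::{banach, second_countable_topology}"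
  assumes "integrable lborel f"
  shows "integrable lborel (\<lambda>x. f (x + a))"
proof -
  have [measurable]: "f \<in> borel_measurable borel" using assms by auto
  have "integrable (distr lborel borel ((+) a)) f" using assms by (simp add: lborel_distr_plus)
  then show ?thesis by (subst (asm) integrable_distr_eq) (auto simp: add.commute)
qed

lemma integral_lborel_reflect:
  fixes f :: "'a::euclidean_space \<Rightarrow> 'b::{banach, second_countable_topology}"
  assumes [measurable]: "f \<in> borel_measurable borel"
  shows "(\<integral>x. f (a - x) \<partial>lborel) = (\<integral>x. f x \<partial>lborel)"
proof -
  have "(\<integral>x. f x \<partial>lborel) = (\<integral>x. f x \<partial>distr lborel borel (\<lambda>x. a - x))"
    by (simp add: lborel_reflect)
  also have "\<dots> = (\<integral>x. f (a - x) \<partial>lborel)"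
    by (subst integral_distr) auto
  finally show ?thesis ..
qed

lemma integral_abs_shift_triangle:
  fixes f g :: "'a::euclidean_space \<Rightarrow> real"
  assumes f: "integrable lborel f" and g: "integrable lborel g"
  shows "(\<integral>x. \<bar>f (x + w) - f x\<bar> \<partial>lborel)
    \<le> (\<integral>x. \<bar>g (x + w) - g x\<bar> \<partial>lborel) + 2 * (\<integral>x. \<bar>f x - g x\<bar> \<partial>lborel)"
proof -
  note sh = integrable_lborel_shift[OF f, of w] integrable_lborel_shift[OF g, of w]
  have [measurable]: "f \<in> borel_measurable borel" "g \<in> borel_measurable borel" using f g by auto
  have "(\<integral>x. \<bar>f (x + w) - f x\<bar> \<partial>lborel)
      \<le> (\<integral>x. \<bar>g (x + w) - g x\<bar> + \<bar>f (x + w) - g (x + w)\<bar> + \<bar>f x - g x\<bar> \<partial>lborel)"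
    using f g sh by (intro integral_mono) auto
  also have "\<dots> = (\<integral>x. \<bar>g (x + w) - g x\<bar> \<partial>lborel) + (\<integral>x. \<bar>f (x + w) - g (x + w)\<bar> \<partial>lborel)
      + (\<integral>x. \<bar>f x - g x\<bar> \<partial>lborel)"
    using f g sh by simp
  also have "(\<integral>x. \<bar>f (x + w) - g (x + w)\<bar> \<partial>lborel) = (\<integral>x. \<bar>f x - g x\<bar> \<partial>lborel)"
    by (rule integral_lborel_shift[where f="\<lambda>x. \<bar>f x - g x\<bar>"]) auto
  finally show ?thesis by simp
qed

text \<open>Translation is an isometry of L^1, so the functions along which it is continuous form a
  closed set; this reduces \<open>L1_shift_tendsto\<close> to approximation.\<close>

lemma L1_shift_approx:
  fixes f :: "'a::euclidean_space \<Rightarrow> real"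
  assumes f: "integrable lborel f"
    and approx: "\<And>e. e > 0 \<Longrightarrow> \<exists>g. integrable lborel g \<and> (\<integral>x. \<bar>f x - g x\<bar> \<partial>lborel) < e \<and>
      (\<lambda>j. \<integral>x. \<bar>g (x + W j) - g x\<bar> \<partial>lborel) \<longlonglongrightarrow> 0"
  shows "(\<lambda>j. \<integral>x. \<bar>f (x + W j) - f x\<bar> \<partial>lborel) \<longlonglongrightarrow> 0"
proof (rule LIMSEQ_I)
  fix e :: real assume "e > 0"
  then obtain g where g: "integrable lborel g" "(\<integral>x. \<bar>f x - g x\<bar> \<partial>lborel) < e / 4"
    and lim: "(\<lambda>j. \<integral>x. \<bar>g (x + W j) - g x\<bar> \<partial>lborel) \<longlonglongrightarrow> 0"
    using approx[of "e / 4"] by auto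
  from LIMSEQ_D[OF lim, of "e / 2"] \<open>e > 0\<close> obtain N where
    N: "\<And>j. j \<ge> N \<Longrightarrow> \<bar>\<integral>x. \<bar>g (x + W j) - g x\<bar> \<partial>lborel\<bar> < e / 2" by auto
  show "\<exists>N. \<forall>j\<ge>N. norm ((\<integral>x. \<bar>f (x + W j) - f x\<bar> \<partial>lborel) - 0) < e"
  proof (intro exI allI impI)
    fix j assume "j \<ge> N"
    have "(\<integral>x. \<bar>f (x + W j) - f x\<bar> \<partial>lborel) \<ge> 0" by (intro integral_nonneg_AE) auto
    with integral_abs_shift_triangle[OF f g(1), of "W j"] N[OF \<open>j \<ge> N\<close>] g(2)
    show "norm ((\<integral>x. \<bar>f (x + W j) - f x\<bar> \<partial>lborel) - 0) < e" by simp
  qed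
qed

text \<open>A point of an open set stays in it under small translations, which gives pointwise
  convergence on A. The points entering A are not controlled pointwise, but they have the same total
  measure as those leaving.\<close>

lemma L1_shift_indicator_open:
  fixes A :: "'a::euclidean_space set"
  assumes A: "open A" "emeasure lborel A < \<infinity>" and W: "W \<longlonglongrightarrow> 0"
  shows "(\<lambda>j. \<integral>x. \<bar>indicator A (x + W j) - indicator A x :: real\<bar> \<partial>lborel) \<longlonglongrightarrow> 0"
proof -
  let ?i = "indicator A :: 'a \<Rightarrow> real"
  have [measurable]: "A \<in> sets borel" using A by auto
  have int: "integrable lborel ?i" using A by (simp add: integrable_indicator_iff)
  note sh = integrable_lborel_shift[OF int]
  have int2: "integrable lborel (\<lambda>x. ?i x * ?i (x + w))" for w
    by (rule Bochner_Integration.integrable_bound[OF int]) (auto split: split_indicator)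
  have eq: "(\<integral>x. \<bar>?i (x + w) - ?i x\<bar> \<partial>lborel) = 2 * (\<integral>x. ?i x * (1 - ?i (x + w)) \<partial>lborel)" for w
  proof -
    have "\<bar>?i (x + w) - ?i x\<bar> = 2 * (?i x * (1 - ?i (x + w))) + (?i (x + w) - ?i x)" for x
      by (auto split: split_indicator)
    then have "(\<integral>x. \<bar>?i (x + w) - ?i x\<bar> \<partial>lborel)
        = (\<integral>x. 2 * (?i x * (1 - ?i (x + w))) + (?i (x + w) - ?i x) \<partial>lborel)" by simp
    also have "\<dots> = 2 * (\<integral>x. ?i x * (1 - ?i (x + w)) \<partial>lborel)
        + ((\<integral>x. ?i (x + w) \<partial>lborel) - (\<integral>x. ?i x \<partial>lborel))"
    proof -
      have "integrable lborel (\<lambda>x. ?i x * (1 - ?i (x + w)))"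
        using int int2[of w] by (simp add: right_diff_distrib)
      then show ?thesis using int sh[of w] by simp
    qed
    also have "(\<integral>x. ?i (x + w) \<partial>lborel) = (\<integral>x. ?i x \<partial>lborel)"
      by (rule integral_lborel_shift) auto
    finally show ?thesis by simp
  qed
  have "(\<lambda>j. \<integral>x. ?i x * (1 - ?i (x + W j)) \<partial>lborel) \<longlonglongrightarrow> (\<integral>x. 0 \<partial>(lborel :: 'a measure))"
  proof (rule integral_dominated_convergence[where w="?i"])
    show "AE x in lborel. (\<lambda>j. ?i x * (1 - ?i (x + W j))) \<longlonglongrightarrow> 0"
    proof (rule AE_I2)
      fix x :: 'a
      show "(\<lambda>j. ?i x * (1 - ?i (x + W j))) \<longlonglongrightarrow> 0"
      proof (cases "x \<in> A")
        case True
        have "(\<lambda>j. x + W j) \<longlonglongrightarrow> x" using tendsto_add[OF tendsto_const[of x] W] by simp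
        then have "eventually (\<lambda>j. x + W j \<in> A) sequentially"
          using A(1) True by (rule topological_tendstoD)
        then have "eventually (\<lambda>j. ?i x * (1 - ?i (x + W j)) = 0) sequentially"
          by eventually_elim auto
        then show ?thesis by (rule tendsto_eventually)
      qed simp
    qed
  qed (use int in \<open>auto split: split_indicator\<close>)
  then show ?thesis unfolding eq by (auto intro!: tendsto_eq_intros)
qed

lemma L1_shift_tendsto:
  fixes f :: "'a::euclidean_space \<Rightarrow> real"
  assumes "integrable lborel f" and W: "W \<longlonglongrightarrow> 0"
  shows "(\<lambda>j. \<integral>x. \<bar>f (x + W j) - f x\<bar> \<partial>lborel) \<longlonglongrightarrow> 0"
  using assms(1)
proof (induction f rule: integrable_induct)
  case (base A c)
  have A[measurable]: "A \<in> sets borel" and Afin: "emeasure lborel A < \<infinity>" using base by auto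
  have int: "integrable lborel (indicator A :: 'a \<Rightarrow> real)" using base by (simp add: integrable_indicator_iff)
  have "(\<lambda>j. \<integral>x. \<bar>indicator A (x + W j) - indicator A x :: real\<bar> \<partial>lborel) \<longlonglongrightarrow> 0"
  proof (rule L1_shift_approx[OF int])
    fix e :: real assume "e > 0"
    \<comment> \<open>Outer regularity replaces A by an open set; the measure of the excess T - A is
      exactly the L^1 distance of the indicators.\<close>
    obtain T where T: "open T" "A \<subseteq> T" "emeasure lebesgue (T - A) < ennreal e"
      using sets_lebesgue_outer_open[of A e] A \<open>e > 0\<close> by auto
    have [measurable]: "T \<in> sets borel" using T by auto
    have TA: "emeasure lborel (T - A) < ennreal e" using T by simp
    have "emeasure lborel T \<le> emeasure lborel A + emeasure lborel (T - A)"
      by (rule order_trans[OF emeasure_mono emeasure_subadditive]) auto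
    also have "\<dots> < \<infinity>" using Afin TA by (auto simp: less_top[symmetric])
    finally have Tfin: "emeasure lborel T < \<infinity>" .
    have "(\<integral>x. \<bar>indicator A x - indicator T x :: real\<bar> \<partial>lborel) = (\<integral>x. indicator (T - A) x \<partial>lborel)"
      using T(2) by (intro Bochner_Integration.integral_cong) (auto split: split_indicator)
    also have "\<dots> = measure lborel (T - A)" by simp
    also have "\<dots> < e"
    proof -
      have "emeasure lborel (T - A) \<noteq> \<infinity>" using TA by auto
      then have "ennreal (measure lborel (T - A)) < ennreal e"
        using TA by (simp add: emeasure_eq_ennreal_measure)
      then show ?thesis by (simp add: ennreal_less_iff)
    qed
    finally show "\<exists>g. integrable lborel g \<and> (\<integral>x. \<bar>indicator A x - g x\<bar> \<partial>lborel) < e \<and>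
      (\<lambda>j. \<integral>x. \<bar>g (x + W j) - g x\<bar> \<partial>lborel) \<longlonglongrightarrow> 0"
      using L1_shift_indicator_open[OF T(1) Tfin W] Tfin
      by (intro exI[of _ "indicator T"]) (auto simp: integrable_indicator_iff)
  qed
  then have "(\<lambda>j. (\<integral>x. \<bar>indicator A (x + W j) - indicator A x :: real\<bar> \<partial>lborel) * \<bar>c\<bar>) \<longlonglongrightarrow> 0 * \<bar>c\<bar>"
    by (intro tendsto_intros)
  moreover have "(\<integral>x. \<bar>indicator A (x + W j) *\<^sub>R c - indicator A x *\<^sub>R c\<bar> \<partial>lborel)
     = (\<integral>x. \<bar>indicator A (x + W j) - indicator A x :: real\<bar> \<partial>lborel) * \<bar>c\<bar>" for j
    by (subst integral_mult_left_zero[symmetric])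
      (auto intro!: Bochner_Integration.integral_cong simp: abs_mult[symmetric] left_diff_distrib)
  ultimately show ?case by simp
next
  case (add f g)
  note sh = integrable_lborel_shift[OF add(1)] integrable_lborel_shift[OF add(2)]
  show ?case
  proof (rule tendsto_sandwich[OF _ _ tendsto_const])
    show "\<forall>\<^sub>F j in sequentially. 0 \<le> (\<integral>x. \<bar>f (x + W j) + g (x + W j) - (f x + g x)\<bar> \<partial>lborel)"
      by (intro always_eventually allI integral_nonneg_AE) auto
    show "\<forall>\<^sub>F j in sequentially. (\<integral>x. \<bar>f (x + W j) + g (x + W j) - (f x + g x)\<bar> \<partial>lborel)
      \<le> (\<integral>x. \<bar>f (x + W j) - f x\<bar> \<partial>lborel) + (\<integral>x. \<bar>g (x + W j) - g x\<bar> \<partial>lborel)"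
    proof (intro always_eventually allI)
      fix j
      have "(\<integral>x. \<bar>f (x + W j) + g (x + W j) - (f x + g x)\<bar> \<partial>lborel)
          \<le> (\<integral>x. \<bar>f (x + W j) - f x\<bar> + \<bar>g (x + W j) - g x\<bar> \<partial>lborel)"
        using add(1,2) sh by (intro integral_mono) auto
      also have "\<dots> = (\<integral>x. \<bar>f (x + W j) - f x\<bar> \<partial>lborel) + (\<integral>x. \<bar>g (x + W j) - g x\<bar> \<partial>lborel)"
        using add(1,2) sh by (intro Bochner_Integration.integral_add) auto
      finally show "(\<integral>x. \<bar>f (x + W j) + g (x + W j) - (f x + g x)\<bar> \<partial>lborel)
          \<le> (\<integral>x. \<bar>f (x + W j) - f x\<bar> \<partial>lborel) + (\<integral>x. \<bar>g (x + W j) - g x\<bar> \<partial>lborel)" .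
    qed
    show "(\<lambda>j. (\<integral>x. \<bar>f (x + W j) - f x\<bar> \<partial>lborel) + (\<integral>x. \<bar>g (x + W j) - g x\<bar> \<partial>lborel)) \<longlonglongrightarrow> 0"
      using tendsto_add[OF add(3,4)] by simp
  qed
next
  case (lim f s)
  have [measurable]: "f \<in> borel_measurable borel" using lim(4) by auto
  have [measurable]: "s i \<in> borel_measurable borel" for i using lim(1)[of i] by auto
  have L1: "(\<lambda>i. \<integral>x. \<bar>f x - s i x\<bar> \<partial>lborel) \<longlonglongrightarrow> (\<integral>x. 0 \<partial>(lborel::'a measure))"
  proof (rule integral_dominated_convergence[where w="\<lambda>x. 3 * \<bar>f x\<bar>"])
    show "AE x in lborel. (\<lambda>i. \<bar>f x - s i x\<bar>) \<longlonglongrightarrow> 0"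
    proof (rule AE_I2)
      fix x :: 'a
      have "(\<lambda>i. s i x) \<longlonglongrightarrow> f x" using lim(2) by simp
      from tendsto_rabs[OF tendsto_diff[OF tendsto_const[of "f x"] this]]
      show "(\<lambda>i. \<bar>f x - s i x\<bar>) \<longlonglongrightarrow> 0" by simp
    qed
    show "AE x in lborel. norm \<bar>f x - s i x\<bar> \<le> 3 * \<bar>f x\<bar>" for i
    proof (rule AE_I2)
      fix x :: 'a
      have "\<bar>s i x\<bar> \<le> 2 * \<bar>f x\<bar>" using lim(3)[of x i] by simp
      then show "norm \<bar>f x - s i x\<bar> \<le> 3 * \<bar>f x\<bar>" by auto
    qed
  qed (use lim(4) in auto)
  show ?case
  proof (rule L1_shift_approx[OF lim(4)])
    fix e :: real assume "e > 0"
    then obtain i where "(\<integral>x. \<bar>f x - s i x\<bar> \<partial>lborel) < e"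
      using order_tendstoD(2)[OF L1, of e] by (auto simp: eventually_sequentially)
    then show "\<exists>g. integrable lborel g \<and> (\<integral>x. \<bar>f x - g x\<bar> \<partial>lborel) < e \<and>
      (\<lambda>j. \<integral>x. \<bar>g (x + W j) - g x\<bar> \<partial>lborel) \<longlonglongrightarrow> 0"
      using lim(1,5) by blast
  qed
qed

section \<open>The Gaussian channel\<close>

text \<open>Cauchy-Schwarz in the form that the k-weighted variance of v about its barycenter
  \<open>a\<close> is nonnegative.\<close>

lemma weighted_barycenter_le:
  fixes v :: "'c \<Rightarrow> 'a::euclidean_space"
  assumes k: "integrable M k" "\<And>x. k x \<ge> 0" and K: "(\<integral>x. k x \<partial>M) > 0"
    and kv: "integrable M (\<lambda>x. k x *\<^sub>R v x)" and kv2: "integrable M (\<lambda>x. k x * (norm (v x))\<^sup>2)"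
  shows "(norm (\<integral>x. k x *\<^sub>R v x \<partial>M))\<^sup>2 / (\<integral>x. k x \<partial>M) \<le> (\<integral>x. k x * (norm (v x))\<^sup>2 \<partial>M)"
proof -
  define K where "K = (\<integral>x. k x \<partial>M)"
  define S where "S = (\<integral>x. k x *\<^sub>R v x \<partial>M)"
  define a where "a = (1 / K) *\<^sub>R S"
  have "K > 0" using K by (simp add: K_def)
  have eq: "k x * (norm (v x - a))\<^sup>2 = k x * (norm (v x))\<^sup>2 - 2 * ((k x *\<^sub>R v x) \<bullet> a) + (norm a)\<^sup>2 * k x" for x
    by (simp add: power2_norm_eq_inner inner_diff_left inner_diff_right inner_commute algebra_simps)
  have "0 \<le> (\<integral>x. k x * (norm (v x - a))\<^sup>2 \<partial>M)"
    using k by (intro integral_nonneg_AE) auto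
  also have "\<dots> = (\<integral>x. k x * (norm (v x))\<^sup>2 \<partial>M) - 2 * (S \<bullet> a) + (norm a)\<^sup>2 * K"
    unfolding eq using k kv kv2 by (simp add: K_def S_def del: inner_scaleR_left)
  also have "\<dots> = (\<integral>x. k x * (norm (v x))\<^sup>2 \<partial>M) - (norm S)\<^sup>2 / K"
  proof -
    have "S \<bullet> a = (norm S)\<^sup>2 / K" by (simp add: a_def power2_norm_eq_inner)
    moreover have "(norm a)\<^sup>2 * K = (norm S)\<^sup>2 / K"
      using \<open>K > 0\<close> by (simp add: a_def power_divide power2_eq_square)
    ultimately show ?thesis by simp
  qed
  finally show ?thesis by (simp add: K_def S_def)
qed

locale gaussian_channel = prob_space \<mu> for \<mu> :: "'a::euclidean_space measure" +
  assumes sets_\<mu> [measurable_cong, simp]: "sets \<mu> = sets borel"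
    and second_moment: "integrable \<mu> (\<lambda>x. (norm x)\<^sup>2)"
begin

lemma space_\<mu> [simp]: "space \<mu> = UNIV"
  using sets_eq_imp_space_eq[OF sets_\<mu>] by simp

lemma prob_UNIV [simp]: "measure \<mu> UNIV = 1" "emeasure \<mu> UNIV = 1"
  using prob_space emeasure_space_1 by simp_all

definition smoothed :: "real \<Rightarrow> 'a \<Rightarrow> real" where
  "smoothed t y = (\<integral>x. heat_kernel t (y - x) \<partial>\<mu>)"

text \<open>Tweedie's formula taken as a definition: E[X - Y | Y = y] / t is the gradient of
  \<open>ln (smoothed t)\<close> at y, expressed without a derivative.\<close>

definition score :: "real \<Rightarrow> 'a \<Rightarrow> 'a" where
  "score t y = (1 / (t * smoothed t y)) *\<^sub>R (\<integral>x. heat_kernel t (y - x) *\<^sub>R (x - y) \<partial>\<mu>)"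

text \<open>The law of (X, X + Z) with X distributed by \<mu> and Z independent of X, of law N(0, t
  I).\<close>

definition joint :: "real \<Rightarrow> ('a \<times> 'a) measure" where
  "joint t = density (\<mu> \<Otimes>\<^sub>M lborel) (\<lambda>(x, y). ennreal (heat_kernel t (y - x)))"

sublocale pair: pair_sigma_finite \<mu> lborel ..

lemma integrable_of_sq:
  fixes v :: "'a \<Rightarrow> 'b::euclidean_space"
  assumes [measurable]: "v \<in> borel_measurable borel" and "integrable \<mu> (\<lambda>x. (norm (v x))\<^sup>2)"
  shows "integrable \<mu> v"
proof (rule Bochner_Integration.integrable_bound)
  show "integrable \<mu> (\<lambda>x. 1 + (norm (v x))\<^sup>2)" using assms by simp
  have "norm (v x) \<le> 1 + (norm (v x))\<^sup>2" for x
    using sum_squares_bound[of "norm (v x)" 1] norm_ge_zero[of "v x"] by (simp only: mult_1_right power_one)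
  then show "AE x in \<mu>. norm (v x) \<le> norm (1 + (norm (v x))\<^sup>2)" by (auto intro: order_trans)
qed simp

lemma integrable_id: "integrable \<mu> (\<lambda>x. x)"
  using integrable_of_sq[of "\<lambda>x. x"] second_moment by simp

lemma integrable_kernel:
  fixes h :: "'a \<Rightarrow> 'b::{banach, second_countable_topology}"
  assumes t: "t > 0" and h: "integrable \<mu> h"
  shows "integrable \<mu> (\<lambda>x. heat_kernel t (y - x) *\<^sub>R h x)"
proof (rule Bochner_Integration.integrable_bound)
  let ?C = "(2 * pi * t) powr (- (real DIM('a) / 2))"
  show "integrable \<mu> (\<lambda>x. ?C * norm (h x))" using h by simp
  show "AE x in \<mu>. norm (heat_kernel t (y - x) *\<^sub>R h x) \<le> norm (?C * norm (h x))"
    using t by (auto intro!: mult_right_mono heat_kernel_le)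
qed (use h in measurable)

lemma integrable_kernel_real:
  assumes "t > 0" and "integrable \<mu> (h :: 'a \<Rightarrow> real)"
  shows "integrable \<mu> (\<lambda>x. heat_kernel t (y - x) * h x)"
  using integrable_kernel[OF assms] by simp

lemma integrable_kernel_1: "t > 0 \<Longrightarrow> integrable \<mu> (\<lambda>x. heat_kernel t (y - x))"
  using integrable_kernel[of t "\<lambda>_. 1::real" y] by simp

lemma smoothed_pos: assumes "t > 0" shows "smoothed t y > 0"
proof -
  have "smoothed t y \<noteq> 0"
  proof
    assume "smoothed t y = 0"
    then have "AE x in \<mu>. heat_kernel t (y - x) = 0"
      unfolding smoothed_def using integrable_kernel_1[OF assms]
      by (subst (asm) integral_nonneg_eq_0_iff_AE) auto
    then have "AE x in \<mu>. False" by (rule AE_mp) (use assms heat_kernel_pos in \<open>auto simp: less_le\<close>)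
    then show False by (simp add: AE_False)
  qed
  moreover have "smoothed t y \<ge> 0" unfolding smoothed_def by (intro integral_nonneg_AE) auto
  ultimately show ?thesis by simp
qed

lemma smoothed_le:
  assumes "t > 0" shows "smoothed t y \<le> (2 * pi * t) powr (- (real DIM('a) / 2))"
proof -
  have "smoothed t y \<le> (\<integral>x. (2 * pi * t) powr (- (real DIM('a) / 2)) \<partial>\<mu>)"
    unfolding smoothed_def using assms
    by (intro integral_mono integrable_kernel_1) (auto intro: heat_kernel_le)
  then show ?thesis by (simp add: prob_space)
qed

lemma borel_measurable_smoothed [measurable]: "smoothed t \<in> borel_measurable borel"
proof -
  have "(\<lambda>y. \<integral>x. heat_kernel t (y - x) \<partial>\<mu>) \<in> borel_measurable borel"
    by (rule borel_measurable_lebesgue_integral) measurable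
  then show ?thesis unfolding smoothed_def[abs_def] .
qed

lemma borel_measurable_score [measurable]: "score t \<in> borel_measurable borel"
proof -
  have [measurable]: "(\<lambda>y. \<integral>x. heat_kernel t (y - x) *\<^sub>R (x - y) \<partial>\<mu>) \<in> borel_measurable borel"
    by (rule borel_measurable_lebesgue_integral) measurable
  show ?thesis unfolding score_def[abs_def] by measurable
qed

lemma nn_integral_smoothed:
  assumes "t > 0"
  shows "ennreal (smoothed t y) = (\<integral>\<^sup>+x. ennreal (heat_kernel t (y - x)) \<partial>\<mu>)"
  unfolding smoothed_def using integrable_kernel_1[OF assms]
  by (subst nn_integral_eq_integral) auto

lemma integral_kernel_diff:
  assumes "t > 0"
  shows "(\<integral>x. heat_kernel t (y - x) *\<^sub>R (x - y) \<partial>\<mu>) = (t * smoothed t y) *\<^sub>R score t y"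
  using smoothed_pos[OF assms, of y] assms by (simp add: score_def)

lemma integrable_kernel_diff:
  assumes "t > 0"
  shows "integrable \<mu> (\<lambda>x. heat_kernel t (y - x) *\<^sub>R (x - y))"
  using integrable_kernel[OF assms, of "\<lambda>x. x - y"] integrable_id by simp

lemma integrable_diff_sq: "integrable \<mu> (\<lambda>x. (norm (x - y))\<^sup>2)"
proof -
  have "(norm (x - y))\<^sup>2 = (norm x)\<^sup>2 - 2 * (x \<bullet> y) + (norm y)\<^sup>2" for x
    by (simp add: power2_norm_eq_inner inner_diff_left inner_diff_right inner_commute)
  then show ?thesis using second_moment integrable_id by simp
qed

text \<open>Moving from y to y' multiplies the kernel by exp (U x) with U affine in x, and m is the
  mean of U under the conditional law of X given Y = y; Jensen's inequality for exp does the rest.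
  This semiconvexity replaces the differentiation of \<open>smoothed\<close> throughout.\<close>

lemma ln_smoothed_tangent:
  assumes t: "t > 0"
  shows "ln (smoothed t y') \<ge> ln (smoothed t y) + score t y \<bullet> (y' - y) - (norm (y' - y))\<^sup>2 / (2 * t)"
proof -
  define d where "d = y' - y"
  define U where "U x = (1 / t) * ((x - y) \<bullet> d) - (norm d)\<^sup>2 / (2 * t)" for x
  define m where "m = score t y \<bullet> d - (norm d)\<^sup>2 / (2 * t)"
  let ?k = "\<lambda>x. heat_kernel t (y - x)"
  note ik = integrable_kernel_1[OF t, of y] integrable_kernel_diff[OF t, of y]
  have kU: "?k x * U x = (1 / t) * ((?k x *\<^sub>R (x - y)) \<bullet> d) - (norm d)\<^sup>2 / (2 * t) * ?k x" for x
    by (simp add: U_def algebra_simps)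
  have int_kU: "integrable \<mu> (\<lambda>x. ?k x * U x)" unfolding kU using ik by (simp del: inner_scaleR_left)
  have "(\<integral>x. ?k x * U x \<partial>\<mu>) = (1 / t) * (((t * smoothed t y) *\<^sub>R score t y) \<bullet> d)
      - (norm d)\<^sup>2 / (2 * t) * smoothed t y"
    unfolding kU using ik by (simp add: integral_kernel_diff[OF t] smoothed_def del: inner_scaleR_left)
  also have "\<dots> = smoothed t y * m" using t by (simp add: m_def right_diff_distrib)
  finally have iU: "(\<integral>x. ?k x * U x \<partial>\<mu>) = smoothed t y * m" .
  have kern: "heat_kernel t (y' - x) = ?k x * exp (U x)" for x
  proof -
    have "(norm (y' - x))\<^sup>2 = (norm (y - x))\<^sup>2 - 2 * ((x - y) \<bullet> d) + (norm d)\<^sup>2"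
      unfolding d_def by (simp add: power2_norm_eq_inner inner_diff_left inner_diff_right inner_commute algebra_simps)
    then have "- (norm (y' - x))\<^sup>2 / (2 * t)
        = - ((norm (y - x))\<^sup>2 - 2 * ((x - y) \<bullet> d) + (norm d)\<^sup>2) / (2 * t)" by simp
    also have "\<dots> = - (norm (y - x))\<^sup>2 / (2 * t) + U x"
      using t by (simp add: U_def divide_simps)
    finally have "- (norm (y' - x))\<^sup>2 / (2 * t) = - (norm (y - x))\<^sup>2 / (2 * t) + U x" .
    then show ?thesis unfolding heat_kernel_def by (simp only: exp_add mult.assoc)
  qed
  \<comment> \<open>Jensen's inequality through the tangent of exp at m: the term U - m integrates
    to zero against the kernel.\<close>
  have "exp m * smoothed t y = (\<integral>x. exp m * (?k x + ?k x * U x - m * ?k x) \<partial>\<mu>)"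
    using ik int_kU by (simp add: iU) (simp add: smoothed_def algebra_simps)
  also have "\<dots> \<le> (\<integral>x. heat_kernel t (y' - x) \<partial>\<mu>)"
  proof (rule integral_mono)
    show "integrable \<mu> (\<lambda>x. exp m * (?k x + ?k x * U x - m * ?k x))" using ik int_kU by simp
    show "integrable \<mu> (\<lambda>x. heat_kernel t (y' - x))" by (rule integrable_kernel_1[OF t])
    fix x
    have "exp m * (1 + (U x - m)) \<le> exp m * exp (U x - m)"
      using exp_ge_add_one_self[of "U x - m"] by (intro mult_left_mono) auto
    then have "?k x * (exp m * (1 + (U x - m))) \<le> ?k x * exp (U x)"
      by (intro mult_left_mono) (auto simp: exp_add[symmetric])
    then show "exp m * (?k x + ?k x * U x - m * ?k x) \<le> heat_kernel t (y' - x)"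
      by (simp add: kern algebra_simps)
  qed
  finally have "exp m * smoothed t y \<le> smoothed t y'" by (simp add: smoothed_def)
  then have "ln (exp m * smoothed t y) \<le> ln (smoothed t y')"
    using smoothed_pos[OF t] by (subst ln_le_cancel_iff) auto
  then show ?thesis using smoothed_pos[OF t, of y] by (simp add: ln_mult m_def d_def)
qed

lemma score_sq_le:
  assumes t: "t > 0"
  shows "smoothed t y * (norm (score t y))\<^sup>2 \<le> (1 / t\<^sup>2) * (\<integral>x. heat_kernel t (y - x) * (norm (x - y))\<^sup>2 \<partial>\<mu>)"
proof -
  have "(norm (\<integral>x. heat_kernel t (y - x) *\<^sub>R (x - y) \<partial>\<mu>))\<^sup>2 / (\<integral>x. heat_kernel t (y - x) \<partial>\<mu>)
      \<le> (\<integral>x. heat_kernel t (y - x) * (norm (x - y))\<^sup>2 \<partial>\<mu>)"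
    using integrable_kernel_1[OF t] integrable_kernel_diff[OF t]
      integrable_kernel_real[OF t integrable_diff_sq] smoothed_pos[OF t, of y]
    by (intro weighted_barycenter_le) (auto simp: smoothed_def)
  then have "(norm ((t * smoothed t y) *\<^sub>R score t y))\<^sup>2 / smoothed t y
      \<le> (\<integral>x. heat_kernel t (y - x) * (norm (x - y))\<^sup>2 \<partial>\<mu>)"
    by (simp add: integral_kernel_diff[OF t] smoothed_def[symmetric])
  also have "(norm ((t * smoothed t y) *\<^sub>R score t y))\<^sup>2 / smoothed t y
      = t\<^sup>2 * (smoothed t y * (norm (score t y))\<^sup>2)"
  proof -
    have "norm ((t * smoothed t y) *\<^sub>R score t y) = t * smoothed t y * norm (score t y)"
      using smoothed_pos[OF t, of y] t by simp
    then show ?thesis by (simp only: power_mult_distrib) (simp add: power2_eq_square)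
  qed
  finally show ?thesis using t by (simp add: field_simps)
qed

lemma sets_joint [measurable_cong, simp]: "sets (joint t) = sets (borel \<Otimes>\<^sub>M borel)"
  unfolding joint_def by (simp add: sets_pair_measure_cong[OF sets_\<mu> sets_lborel])

lemma space_joint [simp]: "space (joint t) = UNIV"
  unfolding joint_def by (simp add: space_pair_measure)

text \<open>Two disintegrations: over the output y, which produces conditional expectations given Y,
  and over the input x with noise z = y - x, which produces Gaussian moments.\<close>

lemma nn_integral_joint:
  assumes [measurable]: "case_prod h \<in> borel_measurable (borel \<Otimes>\<^sub>M borel)"
  shows "(\<integral>\<^sup>+(x, y). h x y \<partial>joint t) = (\<integral>\<^sup>+y. \<integral>\<^sup>+x. ennreal (heat_kernel t (y - x)) * h x y \<partial>\<mu> \<partial>lborel)"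
    and "(\<integral>\<^sup>+(x, y). h x y \<partial>joint t) = (\<integral>\<^sup>+x. \<integral>\<^sup>+z. ennreal (heat_kernel t z) * h x (x + z) \<partial>lborel \<partial>\<mu>)"
proof -
  have 1: "(\<integral>\<^sup>+(x, y). h x y \<partial>joint t)
      = (\<integral>\<^sup>+(x, y). ennreal (heat_kernel t (y - x)) * h x y \<partial>(\<mu> \<Otimes>\<^sub>M lborel))"
    unfolding joint_def by (subst nn_integral_density) (auto simp: case_prod_unfold)
  show "(\<integral>\<^sup>+(x, y). h x y \<partial>joint t) = (\<integral>\<^sup>+y. \<integral>\<^sup>+x. ennreal (heat_kernel t (y - x)) * h x y \<partial>\<mu> \<partial>lborel)"
    unfolding 1 by (subst pair.nn_integral_snd[symmetric]) auto
  have "(\<integral>\<^sup>+(x, y). h x y \<partial>joint t) = (\<integral>\<^sup>+x. \<integral>\<^sup>+y. ennreal (heat_kernel t (y - x)) * h x y \<partial>lborel \<partial>\<mu>)"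
    unfolding 1 by (subst lborel.nn_integral_fst[symmetric]) auto
  also have "\<dots> = (\<integral>\<^sup>+x. \<integral>\<^sup>+z. ennreal (heat_kernel t z) * h x (x + z) \<partial>lborel \<partial>\<mu>)"
  proof (rule nn_integral_cong)
    fix x :: 'a
    have "(\<integral>\<^sup>+y. ennreal (heat_kernel t (y - x)) * h x y \<partial>lborel)
        = (\<integral>\<^sup>+z. ennreal (heat_kernel t (z + x - x)) * h x (z + x) \<partial>lborel)"
      by (rule nn_integral_lborel_shift[symmetric]) measurable
    then show "(\<integral>\<^sup>+y. ennreal (heat_kernel t (y - x)) * h x y \<partial>lborel)
        = (\<integral>\<^sup>+z. ennreal (heat_kernel t z) * h x (x + z) \<partial>lborel)"
      by (simp add: add.commute)
  qed
  finally show "(\<integral>\<^sup>+(x, y). h x y \<partial>joint t)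
      = (\<integral>\<^sup>+x. \<integral>\<^sup>+z. ennreal (heat_kernel t z) * h x (x + z) \<partial>lborel \<partial>\<mu>)" .
qed

lemma distr_joint_fst: assumes "t > 0" shows "distr (joint t) borel fst = \<mu>"
proof (rule measure_eqI)
  fix A assume "A \<in> sets (distr (joint t) borel fst)"
  then have [measurable]: "A \<in> sets borel" by simp
  have "emeasure (distr (joint t) borel fst) A = (\<integral>\<^sup>+(x, y). indicator A x \<partial>joint t)"
    by (simp add: nn_integral_indicator[symmetric] nn_integral_distr case_prod_unfold del: nn_integral_indicator)
  also have "\<dots> = (\<integral>\<^sup>+x. indicator A x \<partial>\<mu>)"
    by (subst nn_integral_joint(2)) (auto simp: nn_integral_multc nn_integral_heat_kernel[OF assms])
  finally show "emeasure (distr (joint t) borel fst) A = emeasure \<mu> A" by simp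
qed simp

lemma distr_joint_diff:
  assumes "t > 0" shows "distr (joint t) borel (\<lambda>(x, y). y - x) = density lborel (heat_kernel t)"
proof (rule measure_eqI)
  fix A assume "A \<in> sets (distr (joint t) borel (\<lambda>(x, y). y - x))"
  then have [measurable]: "A \<in> sets borel" by simp
  have "emeasure (distr (joint t) borel (\<lambda>(x, y). y - x)) A = (\<integral>\<^sup>+(x, y). indicator A (y - x) \<partial>joint t)"
    by (simp add: nn_integral_indicator[symmetric] nn_integral_distr case_prod_unfold del: nn_integral_indicator)
  also have "\<dots> = (\<integral>\<^sup>+z. ennreal (heat_kernel t z) * indicator A z \<partial>lborel)"
    by (subst nn_integral_joint(2)) auto
  finally show "emeasure (distr (joint t) borel (\<lambda>(x, y). y - x)) A = emeasure (density lborel (heat_kernel t)) A"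
    by (simp add: emeasure_density)
qed simp

text \<open>Stretching the noise by \<rho> turns the channel at time t into the one at time \<rho>^2
  t. Both levels thus live on \<open>joint t\<close>, with the same X and the same Z, which is the
  coupling used in \<open>neg_entropy_step\<close>.\<close>

lemma distr_joint_dilate:
  assumes t: "t > 0" and \<rho>: "\<rho> > 0"
  shows "distr (joint t) borel (\<lambda>(x, y). x + \<rho> *\<^sub>R (y - x)) = density lborel (smoothed (\<rho>\<^sup>2 * t))"
proof (rule measure_eqI)
  have t': "\<rho>\<^sup>2 * t > 0" using t \<rho> by simp
  fix A assume "A \<in> sets (distr (joint t) borel (\<lambda>(x, y). x + \<rho> *\<^sub>R (y - x)))"
  then have [measurable]: "A \<in> sets borel" by simp
  have scale: "\<rho> ^ DIM('a) * heat_kernel (\<rho>\<^sup>2 * t) (\<rho> *\<^sub>R z) = heat_kernel t z" for z :: 'a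
  proof -
    have "(2 * pi * (\<rho>\<^sup>2 * t)) powr (- (real DIM('a) / 2))
        = (2 * pi * t) powr (- (real DIM('a) / 2)) * (\<rho>\<^sup>2) powr (- (real DIM('a) / 2))"
      using t \<rho> by (subst powr_mult[symmetric]) (auto simp: mult_ac)
    also have "(\<rho>\<^sup>2) powr (- (real DIM('a) / 2)) = 1 / \<rho> ^ DIM('a)"
    proof -
      have "\<rho>\<^sup>2 = \<rho> powr 2" using \<rho> by simp
      then have "(\<rho>\<^sup>2) powr (- (real DIM('a) / 2)) = \<rho> powr (- real DIM('a))"
        by (simp only: powr_powr) simp
      then show ?thesis using powr_realpow[OF \<rho>, of "DIM('a)"] by (simp only: powr_minus_divide)
    qed
    finally have "heat_kernel (\<rho>\<^sup>2 * t) (\<rho> *\<^sub>R z) = heat_kernel t z * (1 / \<rho> ^ DIM('a))"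
      using \<rho> t unfolding heat_kernel_def by (simp add: power_mult_distrib)
    then show ?thesis using \<rho> by simp
  qed
  have inner: "(\<integral>\<^sup>+z. ennreal (heat_kernel t z) * indicator A (x + \<rho> *\<^sub>R z) \<partial>lborel)
      = (\<integral>\<^sup>+y. ennreal (heat_kernel (\<rho>\<^sup>2 * t) (y - x)) * indicator A y \<partial>lborel)" for x
  proof -
    have "(\<integral>\<^sup>+y. ennreal (heat_kernel (\<rho>\<^sup>2 * t) (y - x)) * indicator A y \<partial>lborel)
      = (\<integral>\<^sup>+y. ennreal (heat_kernel (\<rho>\<^sup>2 * t) (y - x)) * indicator A y
          \<partial>density (distr lborel borel (\<lambda>z. x + \<rho> *\<^sub>R z)) (\<lambda>_. \<bar>\<rho>\<bar> ^ DIM('a)))"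
      using \<rho> by (subst lborel_affine[of \<rho> x, symmetric]) auto
    also have "\<dots> = (\<integral>\<^sup>+z. ennreal (\<rho> ^ DIM('a)) * (ennreal (heat_kernel (\<rho>\<^sup>2 * t) (\<rho> *\<^sub>R z)) * indicator A (x + \<rho> *\<^sub>R z)) \<partial>lborel)"
      using \<rho> by (simp add: nn_integral_density nn_integral_distr ennreal_power)
    also have "\<dots> = (\<integral>\<^sup>+z. ennreal (heat_kernel t z) * indicator A (x + \<rho> *\<^sub>R z) \<partial>lborel)"
      using \<rho> by (simp add: mult.assoc[symmetric] ennreal_mult[symmetric] scale)
    finally show ?thesis by simp
  qed
  have "emeasure (distr (joint t) borel (\<lambda>(x, y). x + \<rho> *\<^sub>R (y - x))) A
      = (\<integral>\<^sup>+(x, y). indicator A (x + \<rho> *\<^sub>R (y - x)) \<partial>joint t)"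
    by (simp add: nn_integral_indicator[symmetric] nn_integral_distr case_prod_unfold del: nn_integral_indicator)
  also have "\<dots> = (\<integral>\<^sup>+x. \<integral>\<^sup>+y. ennreal (heat_kernel (\<rho>\<^sup>2 * t) (y - x)) * indicator A y \<partial>lborel \<partial>\<mu>)"
    by (subst nn_integral_joint(2)) (auto simp: inner)
  also have "\<dots> = (\<integral>\<^sup>+y. \<integral>\<^sup>+x. ennreal (heat_kernel (\<rho>\<^sup>2 * t) (y - x)) * indicator A y \<partial>\<mu> \<partial>lborel)"
    by (rule pair.Fubini'[symmetric]) measurable
  also have "\<dots> = (\<integral>\<^sup>+y. ennreal (smoothed (\<rho>\<^sup>2 * t) y) * indicator A y \<partial>lborel)"
    by (simp add: nn_integral_multc nn_integral_smoothed[OF t'])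
  finally show "emeasure (distr (joint t) borel (\<lambda>(x, y). x + \<rho> *\<^sub>R (y - x))) A
      = emeasure (density lborel (smoothed (\<rho>\<^sup>2 * t))) A"
    by (simp add: emeasure_density)
qed simp

end

section \<open>Moments, Fisher information and conditional means of the output\<close>

context gaussian_channel
begin

lemma integrable_joint_fst:
  fixes h :: "'a \<Rightarrow> 'b::{banach, second_countable_topology}"
  assumes "t > 0" and "integrable \<mu> h"
  shows "integrable (joint t) (\<lambda>(x, y). h x)"
proof -
  have [measurable]: "h \<in> borel_measurable borel" using assms by auto
  have "integrable (distr (joint t) borel fst) h" using assms by (simp add: distr_joint_fst)
  then show ?thesis by (subst (asm) integrable_distr_eq) (auto simp: case_prod_unfold)
qed

lemma integral_joint_fst:
  fixes h :: "'a \<Rightarrow> 'b::{banach, second_countable_topology}"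
  assumes "t > 0" and [measurable]: "h \<in> borel_measurable borel"
  shows "(\<integral>(x, y). h x \<partial>joint t) = (\<integral>x. h x \<partial>\<mu>)"
proof -
  have "(\<integral>x. h x \<partial>distr (joint t) borel fst) = (\<integral>(x, y). h x \<partial>joint t)"
    by (subst integral_distr) (auto simp: case_prod_unfold)
  then show ?thesis using assms by (simp add: distr_joint_fst)
qed

lemma integrable_joint_dilate:
  fixes h :: "'a \<Rightarrow> real"
  assumes "t > 0" "\<rho> > 0" and [measurable]: "h \<in> borel_measurable borel"
  shows "integrable (joint t) (\<lambda>(x, y). h (x + \<rho> *\<^sub>R (y - x))) \<longleftrightarrow>
    integrable lborel (\<lambda>y. smoothed (\<rho>\<^sup>2 * t) y * h y)"
proof -
  have "integrable lborel (\<lambda>y. smoothed (\<rho>\<^sup>2 * t) y * h y)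
      \<longleftrightarrow> integrable (density lborel (smoothed (\<rho>\<^sup>2 * t))) h"
    using assms by (subst integrable_density) (auto intro!: less_imp_le smoothed_pos)
  also have "density lborel (smoothed (\<rho>\<^sup>2 * t)) = distr (joint t) borel (\<lambda>(x, y). x + \<rho> *\<^sub>R (y - x))"
    using assms by (simp add: distr_joint_dilate)
  also have "integrable \<dots> h \<longleftrightarrow> integrable (joint t) (\<lambda>(x, y). h (x + \<rho> *\<^sub>R (y - x)))"
    by (subst integrable_distr_eq) (auto simp: case_prod_unfold)
  finally show ?thesis ..
qed

lemma integral_joint_dilate:
  fixes h :: "'a \<Rightarrow> real"
  assumes "t > 0" "\<rho> > 0" and [measurable]: "h \<in> borel_measurable borel"
  shows "(\<integral>(x, y). h (x + \<rho> *\<^sub>R (y - x)) \<partial>joint t) = (\<integral>y. smoothed (\<rho>\<^sup>2 * t) y * h y \<partial>lborel)"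
proof -
  have "(\<integral>y. smoothed (\<rho>\<^sup>2 * t) y * h y \<partial>lborel) = (\<integral>y. h y \<partial>density lborel (smoothed (\<rho>\<^sup>2 * t)))"
    using assms by (subst integral_density) (auto intro!: less_imp_le smoothed_pos)
  also have "density lborel (smoothed (\<rho>\<^sup>2 * t)) = distr (joint t) borel (\<lambda>(x, y). x + \<rho> *\<^sub>R (y - x))"
    using assms by (simp add: distr_joint_dilate)
  also have "(\<integral>y. h y \<partial>\<dots>) = (\<integral>(x, y). h (x + \<rho> *\<^sub>R (y - x)) \<partial>joint t)"
    by (subst integral_distr) (auto simp: case_prod_unfold)
  finally show ?thesis ..
qed

lemma joint_snd:
  fixes h :: "'a \<Rightarrow> real"
  assumes "t > 0" and [measurable]: "h \<in> borel_measurable borel"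
  shows "integrable (joint t) (\<lambda>(x, y). h y) \<longleftrightarrow> integrable lborel (\<lambda>y. smoothed t y * h y)"
    and "(\<integral>(x, y). h y \<partial>joint t) = (\<integral>y. smoothed t y * h y \<partial>lborel)"
  using integrable_joint_dilate[OF assms(1), of 1 h] integral_joint_dilate[OF assms(1), of 1 h] by simp_all

lemma joint_disintegrate:
  fixes h :: "'a \<Rightarrow> 'a \<Rightarrow> real"
  assumes h: "integrable (joint t) (case_prod h)"
  shows "integrable lborel (\<lambda>y. \<integral>x. heat_kernel t (y - x) * h x y \<partial>\<mu>)"
    and "(\<integral>(x, y). h x y \<partial>joint t) = (\<integral>y. (\<integral>x. heat_kernel t (y - x) * h x y \<partial>\<mu>) \<partial>lborel)"
proof -
  have [measurable]: "case_prod h \<in> borel_measurable (borel \<Otimes>\<^sub>M borel)"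
    using borel_measurable_integrable[OF h] by (simp add: measurable_cong_sets[OF sets_joint refl])
  have dens: "joint t = density (\<mu> \<Otimes>\<^sub>M lborel) (\<lambda>z. ennreal (case z of (x, y) \<Rightarrow> heat_kernel t (y - x)))"
    unfolding joint_def by (simp add: case_prod_unfold)
  have int: "integrable (\<mu> \<Otimes>\<^sub>M lborel) (\<lambda>(x, y). heat_kernel t (y - x) * h x y)"
    using h unfolding dens by (subst (asm) integrable_density) (auto simp: case_prod_unfold)
  show "integrable lborel (\<lambda>y. \<integral>x. heat_kernel t (y - x) * h x y \<partial>\<mu>)"
    by (rule pair.integrable_snd[OF int])
  have "(\<integral>(x, y). h x y \<partial>joint t) = (\<integral>(x, y). heat_kernel t (y - x) * h x y \<partial>(\<mu> \<Otimes>\<^sub>M lborel))"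
    unfolding dens by (subst integral_density) (auto simp: case_prod_unfold)
  also have "\<dots> = (\<integral>y. (\<integral>x. heat_kernel t (y - x) * h x y \<partial>\<mu>) \<partial>lborel)"
    by (rule pair.integral_snd[OF int, symmetric])
  finally show "(\<integral>(x, y). h x y \<partial>joint t) = (\<integral>y. (\<integral>x. heat_kernel t (y - x) * h x y \<partial>\<mu>) \<partial>lborel)" .
qed

lemma prob_space_joint: assumes "t > 0" shows "prob_space (joint t)"
proof
  have "emeasure (distr (joint t) borel fst) UNIV = emeasure (joint t) UNIV"
    by (subst emeasure_distr) auto
  then show "emeasure (joint t) (space (joint t)) = 1" using assms by (simp add: distr_joint_fst)
qed

lemma integrable_joint_const: "t > 0 \<Longrightarrow> integrable (joint t) (\<lambda>_. c::real)"
  using prob_space_joint[of t] by (simp add: finite_measure.integrable_const prob_space.finite_measure)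

lemma integral_joint_const: assumes "t > 0" shows "(\<integral>_. c \<partial>joint t) = (c::real)"
proof -
  interpret J: prob_space "joint t" by (rule prob_space_joint[OF assms])
  show ?thesis using J.prob_space by simp
qed

lemma joint_diff_sq:
  assumes t: "t > 0"
  shows "integrable (joint t) (\<lambda>(x, y). (norm (y - x))\<^sup>2)"
    and "(\<integral>(x, y). (norm (y - x))\<^sup>2 \<partial>joint t) = real DIM('a) * t"
proof -
  have nn: "(\<integral>\<^sup>+(x, y). ennreal ((norm (y - x))\<^sup>2) \<partial>joint t) = ennreal (real DIM('a) * t)"
    using t by (subst nn_integral_joint(2))
      (simp_all add: ennreal_mult[symmetric] nn_integral_heat_kernel_norm_sq)
  show "integrable (joint t) (\<lambda>(x, y). (norm (y - x))\<^sup>2)"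
    using nn by (intro integrableI_nonneg) (auto simp: case_prod_unfold)
  show "(\<integral>(x, y). (norm (y - x))\<^sup>2 \<partial>joint t) = real DIM('a) * t"
    using nn t by (subst integral_eq_nn_integral) (auto simp: case_prod_unfold)
qed

text \<open>The cross term is removed by the symmetry Z -> -Z, which maps Y to 2 X - Y: both have
  the same second moment, and the parallelogram law evaluates the sum of the two.\<close>

lemma joint_snd_sq:
  assumes t: "t > 0"
  shows "integrable (joint t) (\<lambda>(x, y). (norm y)\<^sup>2)"
    and "(\<integral>(x, y). (norm y)\<^sup>2 \<partial>joint t) = (\<integral>x. (norm x)\<^sup>2 \<partial>\<mu>) + real DIM('a) * t"
proof -
  note [simp] = joint_diff_sq[OF t] 
  have [simp]: "integrable (joint t) (\<lambda>(x, y). (norm x)\<^sup>2)"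
    by (rule integrable_joint_fst[OF t second_moment])
  have s: "integrable (joint t) (\<lambda>z. 2 * (case z of (x, y) \<Rightarrow> (norm x)\<^sup>2) + 2 * (case z of (x, y) \<Rightarrow> (norm (y - x))\<^sup>2))"
    by simp
  have par: "(norm y)\<^sup>2 + (norm (2 *\<^sub>R x - y))\<^sup>2 = 2 * (norm x)\<^sup>2 + 2 * (norm (y - x))\<^sup>2" for x y :: 'a
    by (simp add: power2_norm_eq_inner inner_diff_left inner_diff_right inner_commute)
  have le: "(norm y)\<^sup>2 \<le> 2 * (norm x)\<^sup>2 + 2 * (norm (y - x))\<^sup>2"
    "(norm (2 *\<^sub>R x - y))\<^sup>2 \<le> 2 * (norm x)\<^sup>2 + 2 * (norm (y - x))\<^sup>2" for x y :: 'a
    using par[of y x] zero_le_power2[of "norm y"] zero_le_power2[of "norm (2 *\<^sub>R x - y)"] by linarith+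
  show i1: "integrable (joint t) (\<lambda>(x, y). (norm y)\<^sup>2)"
    using le by (intro Bochner_Integration.integrable_bound[OF s]) (auto simp: case_prod_unfold)
  have i2: "integrable (joint t) (\<lambda>(x, y). (norm (2 *\<^sub>R x - y))\<^sup>2)"
    using le by (intro Bochner_Integration.integrable_bound[OF s]) (auto simp: case_prod_unfold)
  have refl: "(\<integral>\<^sup>+z. ennreal (heat_kernel t z) * ennreal ((norm (x + z))\<^sup>2) \<partial>lborel)
      = (\<integral>\<^sup>+z. ennreal (heat_kernel t z) * ennreal ((norm (2 *\<^sub>R x - (x + z)))\<^sup>2) \<partial>lborel)" for x :: 'a
    by (subst nn_integral_lborel_reflect[where a=0, symmetric]) (simp_all add: scaleR_2)
  have "(\<integral>\<^sup>+(x, y). ennreal ((norm y)\<^sup>2) \<partial>joint t) = (\<integral>\<^sup>+(x, y). ennreal ((norm (2 *\<^sub>R x - y))\<^sup>2) \<partial>joint t)"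
  proof -
    have "(\<integral>\<^sup>+(x, y). ennreal ((norm y)\<^sup>2) \<partial>joint t)
        = (\<integral>\<^sup>+x. \<integral>\<^sup>+z. ennreal (heat_kernel t z) * ennreal ((norm (x + z))\<^sup>2) \<partial>lborel \<partial>\<mu>)"
      by (rule nn_integral_joint(2)) measurable
    also have "\<dots> = (\<integral>\<^sup>+x. \<integral>\<^sup>+z. ennreal (heat_kernel t z) * ennreal ((norm (2 *\<^sub>R x - (x + z)))\<^sup>2) \<partial>lborel \<partial>\<mu>)"
      by (simp only: refl)
    also have "\<dots> = (\<integral>\<^sup>+(x, y). ennreal ((norm (2 *\<^sub>R x - y))\<^sup>2) \<partial>joint t)"
      by (rule nn_integral_joint(2)[symmetric]) measurable
    finally show ?thesis .
  qed
  then have same: "(\<integral>(x, y). (norm y)\<^sup>2 \<partial>joint t) = (\<integral>(x, y). (norm (2 *\<^sub>R x - y))\<^sup>2 \<partial>joint t)"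
    by (subst (1 2) integral_eq_nn_integral) (auto simp: case_prod_unfold)
  have "(\<integral>(x, y). (norm y)\<^sup>2 \<partial>joint t) + (\<integral>(x, y). (norm (2 *\<^sub>R x - y))\<^sup>2 \<partial>joint t)
      = (\<integral>z. (case z of (x, y) \<Rightarrow> (norm y)\<^sup>2) + (case z of (x, y) \<Rightarrow> (norm (2 *\<^sub>R x - y))\<^sup>2) \<partial>joint t)"
    using i1 i2 by (rule Bochner_Integration.integral_add[symmetric])
  also have "\<dots> = (\<integral>z. 2 * (case z of (x, y) \<Rightarrow> (norm x)\<^sup>2) + 2 * (case z of (x, y) \<Rightarrow> (norm (y - x))\<^sup>2) \<partial>joint t)"
    using par by (intro Bochner_Integration.integral_cong) auto
  also have "\<dots> = 2 * (\<integral>x. (norm x)\<^sup>2 \<partial>\<mu>) + 2 * (real DIM('a) * t)"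
    using integral_joint_fst[OF t, of "\<lambda>x. (norm x)\<^sup>2"] by simp
  finally show "(\<integral>(x, y). (norm y)\<^sup>2 \<partial>joint t) = (\<integral>x. (norm x)\<^sup>2 \<partial>\<mu>) + real DIM('a) * t"
    using same by simp
qed

lemma smoothed_second_moment:
  assumes t: "t > 0"
  shows "integrable lborel (\<lambda>y. smoothed t y * (norm y)\<^sup>2)"
    and "(\<integral>y. smoothed t y * (norm y)\<^sup>2 \<partial>lborel) = (\<integral>x. (norm x)\<^sup>2 \<partial>\<mu>) + real DIM('a) * t"
  using joint_snd[OF t, of "\<lambda>y. (norm y)\<^sup>2"] joint_snd_sq[OF t] by simp_all

lemma smoothed_mass:
  assumes t: "t > 0"
  shows "integrable lborel (smoothed t)" and "(\<integral>y. smoothed t y \<partial>lborel) = 1"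
  using joint_snd[OF t, of "\<lambda>_. 1"] integrable_joint_const[OF t, of 1] integral_joint_const[OF t, of 1]
  by (simp_all add: case_prod_unfold)

definition fisher :: "real \<Rightarrow> real" where
  "fisher t = (\<integral>y. smoothed t y * (norm (score t y))\<^sup>2 \<partial>lborel)"

text \<open>Conditioning contracts: by \<open>score_sq_le\<close> the integrand is at most the
  conditional mean of |Y - X|^2 / t^2, weighted by the output density.\<close>

lemma integrable_fisher:
  assumes t: "t > 0"
  shows "integrable lborel (\<lambda>y. smoothed t y * (norm (score t y))\<^sup>2)"
proof (rule Bochner_Integration.integrable_bound)
  show "integrable lborel (\<lambda>y. (1 / t\<^sup>2) * (\<integral>x. heat_kernel t (y - x) * (norm (y - x))\<^sup>2 \<partial>\<mu>))"
    using joint_disintegrate(1)[OF joint_diff_sq(1)[OF t]] by simp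
  show "AE y in lborel. norm (smoothed t y * (norm (score t y))\<^sup>2)
      \<le> norm ((1 / t\<^sup>2) * (\<integral>x. heat_kernel t (y - x) * (norm (y - x))\<^sup>2 \<partial>\<mu>))"
  proof (rule AE_I2)
    fix y :: 'a
    have "0 \<le> smoothed t y * (norm (score t y))\<^sup>2"
      using smoothed_pos[OF t, of y] by simp
    with score_sq_le[OF t, of y]
    show "norm (smoothed t y * (norm (score t y))\<^sup>2)
      \<le> norm ((1 / t\<^sup>2) * (\<integral>x. heat_kernel t (y - x) * (norm (y - x))\<^sup>2 \<partial>\<mu>))"
      unfolding norm_minus_commute[of _ y] by simp
  qed
qed measurable

lemma joint_inner:
  fixes u v :: "'a \<Rightarrow> 'a \<Rightarrow> 'a"
  assumes [measurable]: "case_prod u \<in> borel_measurable (borel \<Otimes>\<^sub>M borel)"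
      "case_prod v \<in> borel_measurable (borel \<Otimes>\<^sub>M borel)"
    and u: "integrable (joint t) (\<lambda>(x, y). (norm (u x y))\<^sup>2)"
    and v: "integrable (joint t) (\<lambda>(x, y). (norm (v x y))\<^sup>2)"
  shows "integrable (joint t) (\<lambda>(x, y). u x y \<bullet> v x y)"
proof (rule Bochner_Integration.integrable_bound)
  show "integrable (joint t) (\<lambda>z. (case z of (x, y) \<Rightarrow> (norm (u x y))\<^sup>2) + (case z of (x, y) \<Rightarrow> (norm (v x y))\<^sup>2))"
    using u v by simp
  have "\<bar>a \<bullet> b\<bar> \<le> (norm a)\<^sup>2 + (norm b)\<^sup>2" for a b :: 'a
    using Cauchy_Schwarz_ineq2[of a b] sum_squares_bound[of "norm a" "norm b"]
      mult_nonneg_nonneg[OF norm_ge_zero[of a] norm_ge_zero[of b]] by linarith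
  then show "AE z in joint t. norm (case z of (x, y) \<Rightarrow> u x y \<bullet> v x y)
      \<le> norm ((case z of (x, y) \<Rightarrow> (norm (u x y))\<^sup>2) + (case z of (x, y) \<Rightarrow> (norm (v x y))\<^sup>2))"
    by auto
qed measurable

lemma joint_score_sq:
  assumes t: "t > 0"
  shows "integrable (joint t) (\<lambda>(x, y). (norm (score t y))\<^sup>2)"
  using joint_snd(1)[OF t, of "\<lambda>y. (norm (score t y))\<^sup>2"] integrable_fisher[OF t] by simp

text \<open>Tower property: given Y = y, the conditional mean of X - y is
  \<open>t *\<^sub>R score t y\<close>.\<close>

lemma joint_inner_diff:
  fixes u :: "'a \<Rightarrow> 'a"
  assumes t: "t > 0" and [measurable]: "u \<in> borel_measurable borel"
    and u: "integrable (joint t) (\<lambda>(x, y). (norm (u y))\<^sup>2)"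
  shows "integrable (joint t) (\<lambda>(x, y). u y \<bullet> (x - y))"
    and "(\<integral>(x, y). u y \<bullet> (x - y) \<partial>joint t) = t * (\<integral>y. smoothed t y * (u y \<bullet> score t y) \<partial>lborel)"
proof -
  show i: "integrable (joint t) (\<lambda>(x, y). u y \<bullet> (x - y))"
    using joint_diff_sq(1)[OF t] u
    by (intro joint_inner) (auto simp: norm_minus_commute)
  have "(\<integral>x. heat_kernel t (y - x) * (u y \<bullet> (x - y)) \<partial>\<mu>) = t * (smoothed t y * (u y \<bullet> score t y))" for y
  proof -
    have "(\<integral>x. heat_kernel t (y - x) * (u y \<bullet> (x - y)) \<partial>\<mu>)
        = (\<integral>x. u y \<bullet> (heat_kernel t (y - x) *\<^sub>R (x - y)) \<partial>\<mu>)" by simp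
    also have "\<dots> = u y \<bullet> (\<integral>x. heat_kernel t (y - x) *\<^sub>R (x - y) \<partial>\<mu>)"
      by (rule integral_inner_right) (rule integrable_kernel_diff[OF t])
    finally show ?thesis by (simp add: integral_kernel_diff[OF t])
  qed
  then show "(\<integral>(x, y). u y \<bullet> (x - y) \<partial>joint t) = t * (\<integral>y. smoothed t y * (u y \<bullet> score t y) \<partial>lborel)"
    by (subst joint_disintegrate(2)[OF i]) simp
qed

lemma integral_score_diff:
  assumes t: "t > 0"
  shows "(\<integral>(x, y). score t y \<bullet> (x - y) \<partial>joint t) = t * fisher t"
  using joint_inner_diff(2)[OF t _ joint_score_sq[OF t]]
  by (simp add: fisher_def power2_norm_eq_inner)

text \<open>This is the integration by parts E[Y . grad ln q(Y)] = -n, q being the output density,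
  obtained without a derivative: the score is the conditional mean of (X - Y) / t, and polarization
  expresses Y . (X - Y) through three known second moments.\<close>

lemma integral_inner_score:
  assumes t: "t > 0"
  shows "integrable lborel (\<lambda>y. smoothed t y * (y \<bullet> score t y))"
    and "(\<integral>y. smoothed t y * (y \<bullet> score t y) \<partial>lborel) = - real DIM('a)"
proof -
  have "integrable (joint t) (\<lambda>(x, y). y \<bullet> score t y)"
    using joint_snd_sq(1)[OF t] joint_score_sq[OF t] by (intro joint_inner) auto
  then show "integrable lborel (\<lambda>y. smoothed t y * (y \<bullet> score t y))"
    by (subst (asm) joint_snd(1)[OF t]) auto
  define a b c :: "'a \<times> 'a \<Rightarrow> real" where "a = (\<lambda>(x, y). (norm x)\<^sup>2)"
    and "b = (\<lambda>(x, y). (norm y)\<^sup>2)" and "c = (\<lambda>(x, y). (norm (y - x))\<^sup>2)"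
  note i = integrable_joint_fst[OF t second_moment] joint_snd_sq[OF t] joint_diff_sq[OF t]
  have eq: "2 * (y \<bullet> (x - y)) = (norm x)\<^sup>2 - (norm y)\<^sup>2 - (norm (y - x))\<^sup>2" for x y :: 'a
    by (simp add: power2_norm_eq_inner inner_diff_left inner_diff_right inner_commute)
  have "2 * (\<integral>(x, y). y \<bullet> (x - y) \<partial>joint t) = (\<integral>z. 2 * (case z of (x, y) \<Rightarrow> y \<bullet> (x - y)) \<partial>joint t)"
    by simp
  also have "\<dots> = (\<integral>z. a z - b z - c z \<partial>joint t)"
    by (intro Bochner_Integration.integral_cong) (auto simp: eq[symmetric] a_def b_def c_def)
  also have "\<dots> = - 2 * (real DIM('a) * t)"
    using i[folded a_def b_def c_def] integral_joint_fst[OF t, of "\<lambda>x. (norm x)\<^sup>2", folded a_def] by simp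
  finally have "(\<integral>(x, y). y \<bullet> (x - y) \<partial>joint t) = - (real DIM('a) * t)" by simp
  then show "(\<integral>y. smoothed t y * (y \<bullet> score t y) \<partial>lborel) = - real DIM('a)"
  proof -
    have "t * (\<integral>y. smoothed t y * (y \<bullet> score t y) \<partial>lborel) = t * (- real DIM('a))"
      using joint_inner_diff(2)[OF t, of "\<lambda>y. y"] joint_snd_sq(1)[OF t]
        \<open>(\<integral>(x, y). y \<bullet> (x - y) \<partial>joint t) = - (real DIM('a) * t)\<close> by (simp add: mult.commute)
    then show ?thesis using t by (simp only: mult_cancel_left) simp
  qed
qed

subsection \<open>Entropy along the heat flow\<close>

definition neg_entropy :: "real \<Rightarrow> real" where
  "neg_entropy t = (\<integral>y. smoothed t y * ln (smoothed t y) \<partial>lborel)"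

text \<open>The upper bound is the maximum of the kernel, the lower one the tangent inequality at 0.
  Quadratic growth suffices to integrate the logarithm against any \<open>smoothed t'\<close>, which
  has a finite second moment.\<close>

lemma abs_ln_smoothed_le:
  assumes t: "t > 0"
  shows "\<exists>C. \<forall>y. \<bar>ln (smoothed t y)\<bar> \<le> C * (1 + (norm y)\<^sup>2)"
proof -
  define A where "A = \<bar>ln ((2 * pi * t) powr (- (real DIM('a) / 2)))\<bar>"
  define B where "B = \<bar>ln (smoothed t 0)\<bar> + norm (score t 0) + 1 / (2 * t)"
  have "\<bar>ln (smoothed t y)\<bar> \<le> (A + B) * (1 + (norm y)\<^sup>2)" for y
  proof -
    define r where "r = norm y"
    have r: "r \<ge> 0" "r \<le> 1 + r\<^sup>2"
      using sum_squares_bound[of r 1] norm_ge_zero[of y] unfolding r_def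
      by (simp_all only: mult_1_right power_one)
    have "ln (smoothed t y) \<le> ln ((2 * pi * t) powr (- (real DIM('a) / 2)))"
      using smoothed_le[OF t] smoothed_pos[OF t] t by (subst ln_le_cancel_iff) auto
    also have "\<dots> \<le> A * 1" by (simp add: A_def)
    also have "\<dots> \<le> A * (1 + r\<^sup>2)" by (rule mult_left_mono) (auto simp: A_def)
    also have "\<dots> \<le> (A + B) * (1 + r\<^sup>2)" using t by (intro mult_right_mono) (auto simp: B_def)
    finally have up: "ln (smoothed t y) \<le> (A + B) * (1 + r\<^sup>2)" .
    have "- ln (smoothed t y) \<le> \<bar>ln (smoothed t 0)\<bar> + norm (score t 0) * r + (1 / (2 * t)) * r\<^sup>2"
      using ln_smoothed_tangent[OF t, of 0 y] Cauchy_Schwarz_ineq2[of "score t 0" y]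
      by (simp add: r_def abs_le_iff) linarith
    also have "\<dots> \<le> \<bar>ln (smoothed t 0)\<bar> * (1 + r\<^sup>2) + norm (score t 0) * (1 + r\<^sup>2) + (1 / (2 * t)) * (1 + r\<^sup>2)"
      using r t by (intro add_mono mult_left_mono) (auto simp: mult_le_cancel_left1)
    also have "\<dots> = B * (1 + r\<^sup>2)" by (simp add: B_def algebra_simps)
    also have "\<dots> \<le> (A + B) * (1 + r\<^sup>2)" by (intro mult_right_mono) (auto simp: A_def)
    finally show ?thesis using up by (simp add: r_def abs_le_iff)
  qed
  then show ?thesis by blast
qed

lemma integrable_cross_entropy:
  assumes t: "t > 0" and t': "t' > 0"
  shows "integrable lborel (\<lambda>y. smoothed t' y * ln (smoothed t y))"
proof -
  obtain C where C: "\<And>y. \<bar>ln (smoothed t y)\<bar> \<le> C * (1 + (norm y)\<^sup>2)"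
    using abs_ln_smoothed_le[OF t] by auto
  show ?thesis
  proof (rule Bochner_Integration.integrable_bound)
    show "integrable lborel (\<lambda>y. C * (smoothed t' y + smoothed t' y * (norm y)\<^sup>2))"
      using smoothed_mass[OF t'] smoothed_second_moment[OF t'] by simp
    show "AE y in lborel. norm (smoothed t' y * ln (smoothed t y))
        \<le> norm (C * (smoothed t' y + smoothed t' y * (norm y)\<^sup>2))"
    proof (rule AE_I2)
      fix y
      have "\<bar>smoothed t' y * ln (smoothed t y)\<bar> \<le> smoothed t' y * (C * (1 + (norm y)\<^sup>2))"
        using smoothed_pos[OF t', of y] C[of y] by (simp add: abs_mult mult_left_mono)
      also have "\<dots> = C * (smoothed t' y + smoothed t' y * (norm y)\<^sup>2)" by (simp add: algebra_simps)
      finally show "norm (smoothed t' y * ln (smoothed t y))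
        \<le> norm (C * (smoothed t' y + smoothed t' y * (norm y)\<^sup>2))" by simp
    qed
  qed measurable
qed

text \<open>Gibbs' inequality, from ln r <= r - 1 for the ratio of the two densities.\<close>

lemma cross_entropy_le:
  assumes t: "t > 0" and t': "t' > 0"
  shows "(\<integral>y. smoothed t' y * ln (smoothed t y) \<partial>lborel) \<le> neg_entropy t'"
proof -
  have "(\<integral>y. smoothed t' y * ln (smoothed t y) - smoothed t' y * ln (smoothed t' y) \<partial>lborel)
      \<le> (\<integral>y. smoothed t y - smoothed t' y \<partial>lborel)"
  proof (rule integral_mono)
    fix y
    note p = smoothed_pos[OF t, of y] smoothed_pos[OF t', of y]
    have "ln (smoothed t y / smoothed t' y) \<le> smoothed t y / smoothed t' y - 1"
      using p by (intro ln_le_minus_one) simp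
    then have "smoothed t' y * ln (smoothed t y / smoothed t' y) \<le> smoothed t' y * (smoothed t y / smoothed t' y - 1)"
      using p by (intro mult_left_mono) auto
    then show "smoothed t' y * ln (smoothed t y) - smoothed t' y * ln (smoothed t' y) \<le> smoothed t y - smoothed t' y"
      using p by (simp add: ln_div right_diff_distrib)
  qed (use integrable_cross_entropy[OF t t'] integrable_cross_entropy[OF t' t'] smoothed_mass[OF t] smoothed_mass[OF t'] in auto)
  then show ?thesis
    using integrable_cross_entropy[OF t t'] integrable_cross_entropy[OF t' t'] smoothed_mass[OF t] smoothed_mass[OF t']
    by (simp add: neg_entropy_def)
qed

text \<open>Both noise levels are coupled through the same Gaussian, so that the tangent bound of
  \<open>ln (smoothed t)\<close> gives de Bruijn's identity as an inequality with a quadratic error, without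
  differentiating anything.\<close>

lemma neg_entropy_step:
  assumes t: "t > 0" and \<rho>: "\<rho> > 1"
  shows "neg_entropy t - neg_entropy (\<rho>\<^sup>2 * t) \<le> (\<rho> - 1) * t * fisher t + (\<rho> - 1)\<^sup>2 * (real DIM('a) / 2)"
proof -
  have t': "\<rho>\<^sup>2 * t > 0" using t \<rho> by simp
  let ?g = "\<lambda>y. ln (smoothed t y)"
  let ?u = "\<lambda>z. case z of (x, y) \<Rightarrow> ?g y"
  let ?d = "\<lambda>z. case z of (x, y) \<Rightarrow> score t y \<bullet> (x - y)"
  let ?n = "\<lambda>z. case z of (x, y) \<Rightarrow> (norm (y - x))\<^sup>2"
  have i1: "integrable (joint t) ?u"
    using integrable_cross_entropy[OF t t] by (subst joint_snd(1)[OF t]) auto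
  have i2: "integrable (joint t) (\<lambda>(x, y). ?g (x + \<rho> *\<^sub>R (y - x)))"
    using integrable_cross_entropy[OF t t'] t \<rho> by (subst integrable_joint_dilate[OF t]) auto
  have i3: "integrable (joint t) ?d"
    by (rule joint_inner_diff(1)[OF t _ joint_score_sq[OF t]]) measurable
  note i4 = joint_diff_sq[OF t]
  have "neg_entropy t - (\<rho> - 1) * (t * fisher t) - ((\<rho> - 1)\<^sup>2 / (2 * t)) * (real DIM('a) * t)
      = (\<integral>z. ?u z - (\<rho> - 1) * ?d z - ((\<rho> - 1)\<^sup>2 / (2 * t)) * ?n z \<partial>joint t)"
    using i1 i3 i4 integral_score_diff[OF t] joint_snd(2)[OF t, of ?g] by (simp add: neg_entropy_def)
  also have "\<dots> \<le> (\<integral>(x, y). ?g (x + \<rho> *\<^sub>R (y - x)) \<partial>joint t)"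
  proof (rule integral_mono)
    fix z :: "'a \<times> 'a"
    obtain x y where z: "z = (x, y)" by (cases z)
    have diff: "x + \<rho> *\<^sub>R (y - x) - y = (\<rho> - 1) *\<^sub>R (y - x)" by (simp add: algebra_simps)
    have neg: "score t y \<bullet> (y - x) = - (score t y \<bullet> (x - y))" by (simp add: inner_diff_right)
    \<comment> \<open>Stretching the noise displaces the output by (\<rho> - 1) Z. The linear term
      then integrates to a multiple of \<open>fisher t\<close>, and the quadratic one uses E|Z|^2 =
      n t.\<close>
    from ln_smoothed_tangent[OF t, of y "x + \<rho> *\<^sub>R (y - x)", unfolded diff]
    show "?u z - (\<rho> - 1) * ?d z - ((\<rho> - 1)\<^sup>2 / (2 * t)) * ?n z \<le> (case z of (x, y) \<Rightarrow> ?g (x + \<rho> *\<^sub>R (y - x)))"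
      using \<rho> by (simp add: z neg power_mult_distrib)
  qed (use i1 i2 i3 i4 in auto)
  also have "\<dots> = (\<integral>y. smoothed (\<rho>\<^sup>2 * t) y * ?g y \<partial>lborel)"
    using \<rho> by (intro integral_joint_dilate[OF t]) auto
  also have "\<dots> \<le> neg_entropy (\<rho>\<^sup>2 * t)"
    by (rule cross_entropy_le[OF t t'])
  finally show ?thesis using t by simp
qed

text \<open>\<open>smoothed t y\<close> averages kernels over \<mu> and q ln q is convex, so
  Jensen's inequality compares with the entropy of the noise alone. This anchors the entropy at
  large times.\<close>

lemma neg_entropy_le:
  assumes t: "t > 0"
  shows "neg_entropy t \<le> - (real DIM('a) / 2) * ln (2 * pi * t) - real DIM('a) / 2"
proof -
  let ?k = "\<lambda>z. heat_kernel t (z :: 'a)"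
  have lnk: "ln (?k z) = - (real DIM('a) / 2) * ln (2 * pi * t) - (1 / (2 * t)) * (norm z)\<^sup>2" for z
    using t unfolding heat_kernel_def by (simp add: ln_mult ln_powr)
  have ij: "integrable (joint t) (\<lambda>(x, y). ln (?k (y - x)))"
    unfolding lnk using joint_diff_sq(1)[OF t] integrable_joint_const[OF t]
    by (simp add: case_prod_unfold)
  have ik: "integrable \<mu> (\<lambda>x. ?k (y - x) * ln (?k (y - x)))" for y
    unfolding lnk norm_minus_commute[of y] using integrable_diff_sq[of y]
    by (intro integrable_kernel_real[OF t]) simp
  have "neg_entropy t \<le> (\<integral>y. (\<integral>x. ?k (y - x) * ln (?k (y - x)) \<partial>\<mu>) \<partial>lborel)"
    unfolding neg_entropy_def
  proof (rule integral_mono)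
    show "integrable lborel (\<lambda>y. smoothed t y * ln (smoothed t y))" by (rule integrable_cross_entropy[OF t t])
    show "integrable lborel (\<lambda>y. \<integral>x. ?k (y - x) * ln (?k (y - x)) \<partial>\<mu>)"
      by (rule joint_disintegrate(1)[OF ij])
    fix y
    define q where "q = smoothed t y"
    have q: "q > 0" using smoothed_pos[OF t] by (simp add: q_def)
    have "q * ln q = (\<integral>x. ?k (y - x) * ln q + (?k (y - x) - q) \<partial>\<mu>)"
      using integrable_kernel_1[OF t, of y] by (simp add: q_def smoothed_def)
    also have "\<dots> \<le> (\<integral>x. ?k (y - x) * ln (?k (y - x)) \<partial>\<mu>)"
    proof (rule integral_mono)
      fix x
      have k: "?k (y - x) > 0" using t by simp
      have "ln (q / ?k (y - x)) \<le> q / ?k (y - x) - 1" using k q by (intro ln_le_minus_one) simp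
      then have "?k (y - x) * ln (q / ?k (y - x)) \<le> ?k (y - x) * (q / ?k (y - x) - 1)"
        using k by (intro mult_left_mono) auto
      then show "?k (y - x) * ln q + (?k (y - x) - q) \<le> ?k (y - x) * ln (?k (y - x))"
        using k q by (simp add: ln_div right_diff_distrib)
    qed (use ik integrable_kernel_1[OF t, of y] in auto)
    finally show "smoothed t y * ln (smoothed t y) \<le> (\<integral>x. ?k (y - x) * ln (?k (y - x)) \<partial>\<mu>)"
      by (simp add: q_def)
  qed
  also have "\<dots> = (\<integral>(x, y). ln (?k (y - x)) \<partial>joint t)"
    by (rule joint_disintegrate(2)[OF ij, symmetric])
  also have "\<dots> = (\<integral>z. - (real DIM('a) / 2) * ln (2 * pi * t) - (1 / (2 * t)) * (case z of (x, y) \<Rightarrow> (norm (y - x))\<^sup>2) \<partial>joint t)"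
    unfolding lnk by (simp add: case_prod_unfold)
  also have "\<dots> = - (real DIM('a) / 2) * ln (2 * pi * t) - (1 / (2 * t)) * (real DIM('a) * t)"
    using joint_diff_sq[OF t] integrable_joint_const[OF t] integral_joint_const[OF t]
    by (subst Bochner_Integration.integral_diff) auto
  finally show ?thesis using t by simp
qed

end

text \<open>When \<open>\<mu>\<close> has density \<open>p\<close>, the conservation law below says \<open>p W = c \<nabla>p + p x\<close> in the weak
  sense; \<open>W\<close> then vanishes exactly for the centered Gaussian of variance \<open>c\<close>.\<close>

locale score_field = gaussian_channel \<mu> for \<mu> :: "'a::euclidean_space measure" +
  fixes c :: real and W :: "'a \<Rightarrow> 'a"
  assumes c_pos [simp]: "c > 0"
    and W_measurable [measurable]: "W \<in> borel_measurable borel"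
    and W_sq: "integrable \<mu> (\<lambda>x. (norm (W x))\<^sup>2)"
    and W_law: "\<And>t y. t > 0 \<Longrightarrow> (\<integral>x. heat_kernel t (y - x) *\<^sub>R W x \<partial>\<mu>)
      = (\<integral>x. heat_kernel t (y - x) *\<^sub>R (x - (c / t) *\<^sub>R (y - x)) \<partial>\<mu>)"
begin

text \<open>The conditional mean E[W | Y = y], by \<open>integral_kernel_W\<close>. It equals c + t
  times the gradient of ln (\<open>smoothed t\<close> / \<open>heat_kernel (c + t)\<close>), hence
  it is the score field of the output relative to the Gaussian of variance c + t.\<close>

definition posterior :: "real \<Rightarrow> 'a \<Rightarrow> 'a" where
  "posterior t y = y + (c + t) *\<^sub>R score t y"

text \<open>A lower bound for the loss E|W|^2 - E|E[W | Y]|^2. The prefactor is (4 pi t)^(-n/2) from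
  \<open>heat_kernel_add_sq\<close>, divided by twice the bound (2 pi t)^(-n/2) of
  \<open>smoothed_le\<close>.\<close>

definition spread :: "real \<Rightarrow> real" where
  "spread t = 2 powr (- (real DIM('a) / 2)) / 2 *
    (\<integral>(x, x'). exp (- (norm (x - x'))\<^sup>2 / (4 * t)) * (norm (W x - W x'))\<^sup>2 \<partial>(\<mu> \<Otimes>\<^sub>M \<mu>))"

lemma integrable_W: "integrable \<mu> W"
  by (rule integrable_of_sq[OF W_measurable W_sq])

lemma borel_measurable_posterior [measurable]: "posterior t \<in> borel_measurable borel"
  unfolding posterior_def[abs_def] by measurable

text \<open>Since x - (c/t)(y - x) = y + (1 + c/t)(x - y), the right side of \<open>W_law\<close>
  involves only the conditional mean of x - y, which the score encodes.\<close>

lemma integral_kernel_W: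
  assumes t: "t > 0"
  shows "(\<integral>x. heat_kernel t (y - x) *\<^sub>R W x \<partial>\<mu>) = smoothed t y *\<^sub>R posterior t y"
proof -
  have eq: "heat_kernel t (y - x) *\<^sub>R (x - (c / t) *\<^sub>R (y - x))
      = (1 + c / t) *\<^sub>R (heat_kernel t (y - x) *\<^sub>R (x - y)) + heat_kernel t (y - x) *\<^sub>R y" for x
    by (simp add: algebra_simps)
  have "(\<integral>x. heat_kernel t (y - x) *\<^sub>R W x \<partial>\<mu>)
      = (1 + c / t) *\<^sub>R ((t * smoothed t y) *\<^sub>R score t y) + smoothed t y *\<^sub>R y"
    unfolding W_law[OF t] eq using integrable_kernel_diff[OF t, of y] integrable_kernel_1[OF t, of y]
    by (simp add: integral_kernel_diff[OF t] smoothed_def del: scaleR_scaleR)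
  also have "(1 + c / t) *\<^sub>R ((t * smoothed t y) *\<^sub>R score t y) = smoothed t y *\<^sub>R ((c + t) *\<^sub>R score t y)"
  proof -
    have "(1 + c / t) * (t * smoothed t y) = smoothed t y * (c + t)" using t by (simp add: field_simps)
    then show ?thesis by (simp only: scaleR_scaleR)
  qed
  finally show ?thesis by (simp add: posterior_def scaleR_add_right add.commute)
qed

text \<open>Expansion of the square, with the cross term given by
  \<open>integral_inner_score\<close>. It converts an upper bound on the energy of the posterior
  into one on \<open>fisher t\<close>.\<close>

lemma posterior_sq:
  assumes t: "t > 0"
  shows "integrable lborel (\<lambda>y. smoothed t y * (norm (posterior t y))\<^sup>2)"
    and "(\<integral>y. smoothed t y * (norm (posterior t y))\<^sup>2 \<partial>lborel)
      = (\<integral>x. (norm x)\<^sup>2 \<partial>\<mu>) + real DIM('a) * t - 2 * (c + t) * real DIM('a) + (c + t)\<^sup>2 * fisher t"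
proof -
  have eq: "smoothed t y * (norm (posterior t y))\<^sup>2 = smoothed t y * (norm y)\<^sup>2
      + (2 * (c + t)) * (smoothed t y * (y \<bullet> score t y)) + (c + t)\<^sup>2 * (smoothed t y * (norm (score t y))\<^sup>2)" for y
    unfolding posterior_def power2_norm_eq_inner
    by (simp add: inner_add_left inner_add_right inner_commute power2_eq_square algebra_simps)
  note i = smoothed_second_moment[OF t] integral_inner_score[OF t] integrable_fisher[OF t]
  show "integrable lborel (\<lambda>y. smoothed t y * (norm (posterior t y))\<^sup>2)"
    unfolding eq using i by simp
  show "(\<integral>y. smoothed t y * (norm (posterior t y))\<^sup>2 \<partial>lborel)
      = (\<integral>x. (norm x)\<^sup>2 \<partial>\<mu>) + real DIM('a) * t - 2 * (c + t) * real DIM('a) + (c + t)\<^sup>2 * fisher t"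
    unfolding eq using i by (simp add: fisher_def[symmetric])
qed

interpretation two: pair_prob_space \<mu> \<mu> ..

lemma sets_two [measurable_cong, simp]: "sets (\<mu> \<Otimes>\<^sub>M \<mu>) = sets (borel \<Otimes>\<^sub>M borel)"
  by (rule sets_pair_measure_cong) simp_all

lemma two_fst:
  fixes h :: "'a \<Rightarrow> real"
  assumes "integrable \<mu> h"
  shows "integrable (\<mu> \<Otimes>\<^sub>M \<mu>) (\<lambda>(x, x'). h x)" "(\<integral>(x, x'). h x \<partial>(\<mu> \<Otimes>\<^sub>M \<mu>)) = (\<integral>x. h x \<partial>\<mu>)"
proof -
  have [measurable]: "h \<in> borel_measurable borel" using assms by auto
  show i: "integrable (\<mu> \<Otimes>\<^sub>M \<mu>) (\<lambda>(x, x'). h x)"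
    using assms by (intro two.Fubini_integrable) auto
  show "(\<integral>(x, x'). h x \<partial>(\<mu> \<Otimes>\<^sub>M \<mu>)) = (\<integral>x. h x \<partial>\<mu>)"
    by (subst two.integral_fst'[symmetric, OF i]) simp
qed

lemma two_snd:
  fixes h :: "'a \<Rightarrow> real"
  assumes "integrable \<mu> h"
  shows "integrable (\<mu> \<Otimes>\<^sub>M \<mu>) (\<lambda>(x, x'). h x')" "(\<integral>(x, x'). h x' \<partial>(\<mu> \<Otimes>\<^sub>M \<mu>)) = (\<integral>x. h x \<partial>\<mu>)"
  using two.integrable_product_swap[OF two_fst(1)[OF assms]] two.integral_product_swap[of "\<lambda>(x, x'). h x"]
    two_fst[OF assms] by (simp_all add: case_prod_unfold)

lemma two_diff_sq:
  fixes v :: "'a \<Rightarrow> 'a"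
  assumes [measurable]: "v \<in> borel_measurable borel" and v: "integrable \<mu> (\<lambda>x. (norm (v x))\<^sup>2)"
  shows "integrable (\<mu> \<Otimes>\<^sub>M \<mu>) (\<lambda>(x, x'). (norm (v x - v x'))\<^sup>2)"
    and "(\<integral>(x, x'). (norm (v x - v x'))\<^sup>2 \<partial>(\<mu> \<Otimes>\<^sub>M \<mu>)) \<le> 4 * (\<integral>x. (norm (v x))\<^sup>2 \<partial>\<mu>)"
proof -
  define a b :: "'a \<times> 'a \<Rightarrow> real" where "a = (\<lambda>(x, x'). (norm (v x))\<^sup>2)" and "b = (\<lambda>(x, x'). (norm (v x'))\<^sup>2)"
  note ab = two_fst[OF v, folded a_def] two_snd[OF v, folded b_def]
  have par: "(norm (p - q))\<^sup>2 + (norm (p + q))\<^sup>2 = 2 * (norm p)\<^sup>2 + 2 * (norm q)\<^sup>2" for p q :: 'a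
    by (simp add: power2_norm_eq_inner inner_diff_left inner_diff_right inner_add_left inner_add_right inner_commute)
  have le: "(norm (v (fst z) - v (snd z)))\<^sup>2 \<le> 2 * a z + 2 * b z" for z
    using par[of "v (fst z)" "v (snd z)"] zero_le_power2[of "norm (v (fst z) + v (snd z))"]
    unfolding a_def b_def case_prod_unfold by linarith
  have nn: "0 \<le> a z" "0 \<le> b z" for z by (auto simp: a_def b_def case_prod_unfold)
  have s: "integrable (\<mu> \<Otimes>\<^sub>M \<mu>) (\<lambda>z. 2 * a z + 2 * b z)" using ab by simp
  show i: "integrable (\<mu> \<Otimes>\<^sub>M \<mu>) (\<lambda>(x, x'). (norm (v x - v x'))\<^sup>2)"
    using le nn by (intro Bochner_Integration.integrable_bound[OF s]) (auto simp: case_prod_unfold)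
  have "(\<integral>(x, x'). (norm (v x - v x'))\<^sup>2 \<partial>(\<mu> \<Otimes>\<^sub>M \<mu>)) \<le> (\<integral>z. 2 * a z + 2 * b z \<partial>(\<mu> \<Otimes>\<^sub>M \<mu>))"
    using le by (intro integral_mono[OF i s]) (auto simp: case_prod_unfold)
  also have "\<dots> = 4 * (\<integral>x. (norm (v x))\<^sup>2 \<partial>\<mu>)" using ab by simp
  finally show "(\<integral>(x, x'). (norm (v x - v x'))\<^sup>2 \<partial>(\<mu> \<Otimes>\<^sub>M \<mu>)) \<le> 4 * (\<integral>x. (norm (v x))\<^sup>2 \<partial>\<mu>)" .
qed

lemma integrable_spread:
  assumes "t > 0"
  shows "integrable (\<mu> \<Otimes>\<^sub>M \<mu>) (\<lambda>(x, x'). exp (- (norm (x - x'))\<^sup>2 / (4 * t)) * (norm (W x - W x'))\<^sup>2)"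
  using assms
  by (intro Bochner_Integration.integrable_bound[OF two_diff_sq(1)[OF W_measurable W_sq]])
    (auto simp: case_prod_unfold mult_left_le_one_le)

lemma spread_nonneg: "spread t \<ge> 0"
  unfolding spread_def by (intro mult_nonneg_nonneg integral_nonneg_AE) auto

lemma spread_mono:
  assumes "0 < s" "s \<le> t"
  shows "spread s \<le> spread t"
  unfolding spread_def
proof (rule mult_left_mono[OF integral_mono[OF integrable_spread integrable_spread]])
  fix z :: "'a \<times> 'a"
  show "(case z of (x, x') \<Rightarrow> exp (- (norm (x - x'))\<^sup>2 / (4 * s)) * (norm (W x - W x'))\<^sup>2)
      \<le> (case z of (x, x') \<Rightarrow> exp (- (norm (x - x'))\<^sup>2 / (4 * t)) * (norm (W x - W x'))\<^sup>2)"
    using assms by (auto intro!: mult_right_mono divide_left_mono simp: case_prod_unfold)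
qed (use assms in auto)

text \<open>A variance as a double integral over two independent copies: the weighted sum of squared
  differences is twice (mass times second moment minus the squared norm of the first
  moment).\<close>

lemma kernel_variance:
  assumes t: "t > 0"
  shows "integrable (\<mu> \<Otimes>\<^sub>M \<mu>) (\<lambda>(x, x'). heat_kernel t (y - x) * heat_kernel t (y - x') * (norm (W x - W x'))\<^sup>2)"
    and "(\<integral>(x, x'). heat_kernel t (y - x) * heat_kernel t (y - x') * (norm (W x - W x'))\<^sup>2 \<partial>(\<mu> \<Otimes>\<^sub>M \<mu>))
      = 2 * smoothed t y * ((\<integral>x. heat_kernel t (y - x) * (norm (W x))\<^sup>2 \<partial>\<mu>) - smoothed t y * (norm (posterior t y))\<^sup>2)"
proof -
  let ?k = "\<lambda>x. heat_kernel t (y - x)"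
  let ?K = "(2 * pi * t) powr (- (real DIM('a) / 2))"
  have "?k x * ?k x' \<le> ?K * ?K" for x x' by (intro mult_mono heat_kernel_le[OF t]) auto
  then show i: "integrable (\<mu> \<Otimes>\<^sub>M \<mu>) (\<lambda>(x, x'). ?k x * ?k x' * (norm (W x - W x'))\<^sup>2)"
    by (intro Bochner_Integration.integrable_bound[OF integrable_mult_right[OF two_diff_sq(1)[OF W_measurable W_sq], of "?K * ?K"]])
      (auto simp: case_prod_unfold abs_mult intro!: mult_right_mono)
  define Q where "Q = (\<integral>x. ?k x * (norm (W x))\<^sup>2 \<partial>\<mu>)"
  define m where "m = posterior t y"
  note ik = integrable_kernel_1[OF t, of y] integrable_kernel[OF t integrable_W, of y] integrable_kernel_real[OF t W_sq, of y]
  have in1: "(\<integral>x'. ?k x * ?k x' * (norm (W x - W x'))\<^sup>2 \<partial>\<mu>)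
      = ?k x * (norm (W x))\<^sup>2 * smoothed t y + ?k x * Q - 2 * smoothed t y * ((?k x *\<^sub>R W x) \<bullet> m)" for x
  proof -
    have "?k x * ?k x' * (norm (W x - W x'))\<^sup>2 = (?k x * (norm (W x))\<^sup>2) * ?k x'
        + ?k x * (?k x' * (norm (W x'))\<^sup>2) - 2 * ((?k x *\<^sub>R W x) \<bullet> (?k x' *\<^sub>R W x'))" for x'
      by (simp add: power2_norm_eq_inner inner_diff_left inner_diff_right inner_commute algebra_simps)
    then have "(\<integral>x'. ?k x * ?k x' * (norm (W x - W x'))\<^sup>2 \<partial>\<mu>)
        = (\<integral>x'. (?k x * (norm (W x))\<^sup>2) * ?k x' + ?k x * (?k x' * (norm (W x'))\<^sup>2)
            - 2 * ((?k x *\<^sub>R W x) \<bullet> (?k x' *\<^sub>R W x')) \<partial>\<mu>)" by simp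
    also have "\<dots> = ?k x * (norm (W x))\<^sup>2 * smoothed t y + ?k x * Q
        - 2 * ((?k x *\<^sub>R W x) \<bullet> (\<integral>x'. ?k x' *\<^sub>R W x' \<partial>\<mu>))"
      using ik by (simp add: smoothed_def Q_def del: inner_scaleR_left inner_scaleR_right)
    finally show ?thesis by (simp add: integral_kernel_W[OF t] m_def)
  qed
  have "(\<integral>(x, x'). ?k x * ?k x' * (norm (W x - W x'))\<^sup>2 \<partial>(\<mu> \<Otimes>\<^sub>M \<mu>))
      = (\<integral>x. (\<integral>x'. ?k x * ?k x' * (norm (W x - W x'))\<^sup>2 \<partial>\<mu>) \<partial>\<mu>)"
    by (subst two.integral_fst'[OF i, symmetric]) simp
  also have "\<dots> = Q * smoothed t y + smoothed t y * Q - 2 * smoothed t y * ((smoothed t y *\<^sub>R m) \<bullet> m)"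
    unfolding in1 using ik integral_kernel_W[OF t, of y]
    by (simp add: smoothed_def[symmetric] Q_def m_def del: inner_scaleR_left)
  also have "\<dots> = 2 * smoothed t y * (Q - smoothed t y * (norm m)\<^sup>2)"
    by (simp add: power2_norm_eq_inner algebra_simps)
  finally show "(\<integral>(x, x'). ?k x * ?k x' * (norm (W x - W x'))\<^sup>2 \<partial>(\<mu> \<Otimes>\<^sub>M \<mu>))
      = 2 * smoothed t y * ((\<integral>x. ?k x * (norm (W x))\<^sup>2 \<partial>\<mu>) - smoothed t y * (norm (posterior t y))\<^sup>2)"
    by (simp add: Q_def m_def)
qed

text \<open>The conditional variance of \<open>W\<close> given the channel output is a double integral against
  \<open>heat_kernel t (y - x) * heat_kernel t (y - x') / smoothed t y\<close>; bounding \<open>smoothed t y\<close> above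
  makes the integral over \<open>y\<close> explicit.\<close>

lemma posterior_sq_le:
  assumes t: "t > 0"
  shows "(\<integral>y. smoothed t y * (norm (posterior t y))\<^sup>2 \<partial>lborel) \<le> (\<integral>x. (norm (W x))\<^sup>2 \<partial>\<mu>) - spread t"
proof -
  let ?K = "(2 * pi * t) powr (- (real DIM('a) / 2))"
  let ?L = "(4 * pi * t) powr (- (real DIM('a) / 2))"
  let ?k = "\<lambda>y x. heat_kernel t (y - x :: 'a)"
  let ?G = "\<lambda>y. (\<integral>(x, x'). ?k y x * ?k y x' * (norm (W x - W x'))\<^sup>2 \<partial>(\<mu> \<Otimes>\<^sub>M \<mu>))"
  let ?S = "(\<integral>(x, x'). exp (- (norm (x - x'))\<^sup>2 / (4 * t)) * (norm (W x - W x'))\<^sup>2 \<partial>(\<mu> \<Otimes>\<^sub>M \<mu>))"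
  let ?Q = "\<lambda>y. (\<integral>x. ?k y x * (norm (W x))\<^sup>2 \<partial>\<mu>)"
  let ?P = "\<lambda>y. smoothed t y * (norm (posterior t y))\<^sup>2"
  have K: "?K > 0" using t by simp
  interpret tl: pair_sigma_finite "\<mu> \<Otimes>\<^sub>M \<mu>" lborel ..
  have G0: "?G y \<ge> 0" for y by (intro integral_nonneg_AE) auto
  have pw: "?P y + ?G y / (2 * ?K) \<le> ?Q y" for y
  proof -
    have q: "smoothed t y > 0" by (rule smoothed_pos[OF t])
    \<comment> \<open>The only loss in this proof: 1 / \<open>smoothed t y\<close> is replaced by
      its lower bound 1 / \<open>?K\<close>, uniform in y.\<close>
    have "?G y / (2 * ?K) \<le> ?G y / (2 * smoothed t y)"
      using smoothed_le[OF t, of y] q by (intro divide_left_mono G0) (auto intro!: mult_pos_pos K)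
    also have "\<dots> = ?Q y - ?P y"
      unfolding kernel_variance(2)[OF t] using q by simp
    finally show ?thesis by simp
  qed
  have GI: "(\<integral>\<^sup>+y. ennreal (?G y / (2 * ?K)) \<partial>lborel) = ennreal (spread t)"
  proof -
    have "ennreal (?G y / (2 * ?K)) = ennreal (1 / (2 * ?K)) * (\<integral>\<^sup>+z. (case z of (x, x') \<Rightarrow>
        ennreal (?k y x * ?k y x' * (norm (W x - W x'))\<^sup>2)) \<partial>(\<mu> \<Otimes>\<^sub>M \<mu>))" for y
    proof -
      have "ennreal (?G y) = (\<integral>\<^sup>+z. (case z of (x, x') \<Rightarrow>
        ennreal (?k y x * ?k y x' * (norm (W x - W x'))\<^sup>2)) \<partial>(\<mu> \<Otimes>\<^sub>M \<mu>))"
        using kernel_variance(1)[OF t, of y]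
        by (subst nn_integral_eq_integral[symmetric]) (auto simp: case_prod_unfold)
      moreover have "ennreal (?G y / (2 * ?K)) = ennreal (1 / (2 * ?K)) * ennreal (?G y)"
        using K G0[of y] by (subst ennreal_mult[symmetric]) auto
      ultimately show ?thesis by simp
    qed
    then have "(\<integral>\<^sup>+y. ennreal (?G y / (2 * ?K)) \<partial>lborel)
        = ennreal (1 / (2 * ?K)) * (\<integral>\<^sup>+y. (\<integral>\<^sup>+z. (case z of (x, x') \<Rightarrow>
            ennreal (?k y x * ?k y x' * (norm (W x - W x'))\<^sup>2)) \<partial>(\<mu> \<Otimes>\<^sub>M \<mu>)) \<partial>lborel)"
      by (simp add: nn_integral_cmult)
    also have "(\<integral>\<^sup>+y. (\<integral>\<^sup>+z. (case z of (x, x') \<Rightarrow>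
            ennreal (?k y x * ?k y x' * (norm (W x - W x'))\<^sup>2)) \<partial>(\<mu> \<Otimes>\<^sub>M \<mu>)) \<partial>lborel)
        = (\<integral>\<^sup>+z. (\<integral>\<^sup>+y. (case z of (x, x') \<Rightarrow>
            ennreal (?k y x * ?k y x' * (norm (W x - W x'))\<^sup>2)) \<partial>lborel) \<partial>(\<mu> \<Otimes>\<^sub>M \<mu>))"
      by (rule tl.Fubini') measurable
    also have "\<dots> = (\<integral>\<^sup>+z. (case z of (x, x') \<Rightarrow>
            ennreal (?L * (exp (- (norm (x - x'))\<^sup>2 / (4 * t)) * (norm (W x - W x'))\<^sup>2))) \<partial>(\<mu> \<Otimes>\<^sub>M \<mu>))"
    proof (rule nn_integral_cong, safe)
      fix x x' :: 'a
      let ?e = "?L * (exp (- (norm (x - x'))\<^sup>2 / (4 * t)) * (norm (W x - W x'))\<^sup>2)"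
      have "(\<integral>\<^sup>+y. ennreal (?k y x * ?k y x' * (norm (W x - W x'))\<^sup>2) \<partial>lborel)
          = (\<integral>\<^sup>+y. ennreal ?e * ennreal (heat_kernel (t / 2) (y + - (1/2) *\<^sub>R (x + x'))) \<partial>lborel)"
        unfolding heat_kernel_add_sq[OF t] by (simp add: ennreal_mult[symmetric] mult_ac)
      also have "\<dots> = ennreal ?e * (\<integral>\<^sup>+y. ennreal (heat_kernel (t / 2) (y + - (1/2) *\<^sub>R (x + x'))) \<partial>lborel)"
        by (rule nn_integral_cmult) measurable
      also have "\<dots> = ennreal ?e"
        using t by (subst nn_integral_lborel_shift) (auto simp: nn_integral_heat_kernel)
      finally show "(\<integral>\<^sup>+y. ennreal (?k y x * ?k y x' * (norm (W x - W x'))\<^sup>2) \<partial>lborel) = ennreal ?e" .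
    qed
    also have "\<dots> = ennreal (?L * ?S)"
    proof -
      define e where "e = (\<lambda>(x, x'). exp (- (norm (x - x'))\<^sup>2 / (4 * t)) * (norm (W x - W x'))\<^sup>2)"
      have "(\<integral>\<^sup>+z. ennreal (?L * e z) \<partial>(\<mu> \<Otimes>\<^sub>M \<mu>)) = ennreal (\<integral>z. ?L * e z \<partial>(\<mu> \<Otimes>\<^sub>M \<mu>))"
        using integrable_spread[OF t] unfolding e_def
        by (intro nn_integral_eq_integral integrable_mult_right) auto
      then show ?thesis by (simp add: e_def case_prod_unfold)
    qed
    also have "ennreal (1 / (2 * ?K)) * ennreal (?L * ?S) = ennreal (spread t)"
    proof -
      have "?L = 2 powr (- (real DIM('a) / 2)) * ?K"
        using t by (subst powr_mult[symmetric]) (auto simp: mult.assoc)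
      then have "1 / (2 * ?K) * (?L * ?S) = spread t"
        unfolding spread_def using K by (simp only:) (simp add: field_simps)
      then show ?thesis using K by (subst ennreal_mult'[symmetric]) auto
    qed
    finally show ?thesis .
  qed
  have Qj: "integrable (joint t) (\<lambda>(x, y). (norm (W x))\<^sup>2)" by (rule integrable_joint_fst[OF t W_sq])
  have QI: "(\<integral>\<^sup>+y. ennreal (?Q y) \<partial>lborel) = ennreal (\<integral>x. (norm (W x))\<^sup>2 \<partial>\<mu>)"
    using joint_disintegrate[OF Qj] integral_joint_fst[OF t, of "\<lambda>x. (norm (W x))\<^sup>2"]
    by (subst nn_integral_eq_integral) auto
  have P0: "?P y \<ge> 0" for y using smoothed_pos[OF t, of y] by simp
  have "ennreal (\<integral>y. ?P y \<partial>lborel) + ennreal (spread t)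
      = (\<integral>\<^sup>+y. ennreal (?P y) \<partial>lborel) + (\<integral>\<^sup>+y. ennreal (?G y / (2 * ?K)) \<partial>lborel)"
    using posterior_sq(1)[OF t] P0 by (simp add: GI nn_integral_eq_integral)
  also have "\<dots> = (\<integral>\<^sup>+y. ennreal (?P y) + ennreal (?G y / (2 * ?K)) \<partial>lborel)"
    by (subst nn_integral_add) auto
  also have "\<dots> \<le> (\<integral>\<^sup>+y. ennreal (?Q y) \<partial>lborel)"
    using pw P0 G0 K by (intro nn_integral_mono) (simp add: ennreal_plus[symmetric] ennreal_leI del: ennreal_plus)
  finally have "ennreal (\<integral>y. ?P y \<partial>lborel) + ennreal (spread t) \<le> ennreal (\<integral>x. (norm (W x))\<^sup>2 \<partial>\<mu>)"
    by (simp add: QI)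
  moreover have "(\<integral>y. ?P y \<partial>lborel) \<ge> 0" using P0 by (intro integral_nonneg_AE) auto
  ultimately have "ennreal ((\<integral>y. ?P y \<partial>lborel) + spread t) \<le> ennreal (\<integral>x. (norm (W x))\<^sup>2 \<partial>\<mu>)"
    using spread_nonneg[of t] by (subst ennreal_plus) auto
  moreover have "(\<integral>x. (norm (W x))\<^sup>2 \<partial>\<mu>) \<ge> 0" by (intro integral_nonneg_AE) auto
  ultimately have "(\<integral>y. ?P y \<partial>lborel) + spread t \<le> (\<integral>x. (norm (W x))\<^sup>2 \<partial>\<mu>)"
    by (simp add: ennreal_le_iff)
  then show ?thesis by simp
qed

end

section \<open>Integrating de Bruijn's inequality along the flow\<close>

text \<open>N multiplicative steps of size about 1 / N accumulate a total error of order N / N^2,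
  which vanishes as N grows, so an exact monotonicity results.\<close>

lemma quadratic_error_telescope:
  fixes F :: "real \<Rightarrow> real"
  assumes a: "0 < a" "a \<le> b" and C: "C \<ge> 0"
    and step: "\<And>t \<epsilon>. a \<le> t \<Longrightarrow> 0 < \<epsilon> \<Longrightarrow> \<epsilon> \<le> 1 \<Longrightarrow> F t \<le> F ((1 + \<epsilon>)\<^sup>2 * t) + C * \<epsilon>\<^sup>2"
  shows "F a \<le> F b"
proof (cases "a = b")
  case False
  \<comment> \<open>Each step multiplies time by (1 + \<epsilon>)^2; the half in \<open>l\<close>
    makes N steps with 1 + \<epsilon> = exp (l / N) lead exactly from a to b.\<close>
  define l where "l = ln (b / a) / 2"
  have l: "l > 0" using a False by (simp add: l_def)
  have bound: "F a \<le> F b + 4 * C * l\<^sup>2 / real N" if N: "N > 0" "real N \<ge> 2 * l" for N :: nat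
  proof -
    define \<epsilon> where "\<epsilon> = exp (l / N) - 1"
    define x where "x = l / N"
    have x: "0 < x" "x \<le> 1 / 2" using l N by (auto simp: x_def field_simps)
    have "exp x \<le> 1 + x + x\<^sup>2" using x by (intro exp_bound) auto
    also have "\<dots> \<le> 1 + 2 * x" using x by (simp add: power2_eq_square)
    finally have e: "0 < \<epsilon>" "\<epsilon> \<le> 2 * x" using x by (auto simp: \<epsilon>_def x_def)
    have pw: "F a \<le> F ((1 + \<epsilon>) ^ (2 * k) * a) + k * (C * \<epsilon>\<^sup>2)" for k :: nat
    proof (induction k)
      case (Suc k)
      have "1 \<le> (1 + \<epsilon>) ^ (2 * k)" using e by (intro one_le_power) auto
      then have "a \<le> (1 + \<epsilon>) ^ (2 * k) * a" using a by simp
      then have "F ((1 + \<epsilon>) ^ (2 * k) * a) \<le> F ((1 + \<epsilon>)\<^sup>2 * ((1 + \<epsilon>) ^ (2 * k) * a)) + C * \<epsilon>\<^sup>2"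
        using e x by (intro step) auto
      also have "(1 + \<epsilon>)\<^sup>2 * ((1 + \<epsilon>) ^ (2 * k) * a) = (1 + \<epsilon>) ^ (2 * Suc k) * a"
        by (simp add: power2_eq_square)
      finally show ?case using Suc by (simp add: algebra_simps)
    qed simp
    have "(1 + \<epsilon>) ^ (2 * N) = exp (real (2 * N) * x)"
      unfolding \<epsilon>_def x_def by (subst exp_of_nat_mult) simp
    also have "real (2 * N) * x = ln (b / a)" using N by (simp add: x_def l_def)
    finally have "(1 + \<epsilon>) ^ (2 * N) * a = b" using a by simp
    moreover have "N * (C * \<epsilon>\<^sup>2) \<le> 4 * C * l\<^sup>2 / N"
    proof -
      have "\<epsilon>\<^sup>2 \<le> (2 * x)\<^sup>2" using e by (intro power_mono) auto
      then have "N * (C * \<epsilon>\<^sup>2) \<le> N * (C * (2 * x)\<^sup>2)" using C by (intro mult_left_mono) auto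
      also have "\<dots> = 4 * C * l\<^sup>2 / N" using N by (simp add: x_def power2_eq_square field_simps)
      finally show ?thesis .
    qed
    ultimately show ?thesis using pw[of N] by simp
  qed
  have "(\<lambda>N. F b + 4 * C * l\<^sup>2 / real N) \<longlonglongrightarrow> F b + 0"
    by (intro tendsto_intros lim_const_over_n)
  moreover have "eventually (\<lambda>N. F a \<le> F b + 4 * C * l\<^sup>2 / real N) sequentially"
    using eventually_gt_at_top[of 0] eventually_ge_at_top[of "nat \<lceil>2 * l\<rceil>"]
    by eventually_elim (rule bound, auto simp: nat_le_iff ceiling_le_iff)
  ultimately show ?thesis by (auto intro: tendsto_lowerbound)
qed simp

lemma ln_one_plus_ge:
  fixes x :: real
  assumes "x \<ge> 0"
  shows "x - x\<^sup>2 / 2 \<le> ln (1 + x)"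
proof -
  let ?f = "\<lambda>u::real. ln (1 + u) - u + u\<^sup>2 / 2"
  have "?f 0 \<le> ?f x"
  proof (rule DERIV_nonneg_imp_nondecreasing[where f="?f"])
    fix u assume u: "0 \<le> u" "u \<le> x"
    have "(?f has_real_derivative (1 / (1 + u) - 1 + u)) (at u)"
      using u by (auto intro!: derivative_eq_intros simp: field_simps)
    moreover have "1 / (1 + u) - 1 + u = u\<^sup>2 / (1 + u)" using u by (simp add: field_simps power2_eq_square)
    ultimately show "\<exists>y. (?f has_real_derivative y) (at u) \<and> 0 \<le> y" using u by auto
  qed (use assms in auto)
  then show ?thesis by simp
qed

text \<open>First order expansion: K has derivative n / (2(c + t)) + \<alpha> / (2(c + t)^2), and t
  moves by about 2 \<epsilon> t. What matters is that the coefficient of \<epsilon>^2 does not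
  depend on t.\<close>

lemma gaussian_entropy_step:
  fixes c t \<epsilon> n \<alpha> :: real
  assumes c: "c > 0" and t: "t > 0" and e: "0 < \<epsilon>" "\<epsilon> \<le> 1" and n: "n \<ge> 0"
  defines "K \<equiv> \<lambda>t. (n / 2) * ln (c + t) - \<alpha> / (2 * (c + t))"
  shows "K ((1 + \<epsilon>)\<^sup>2 * t) - K t \<ge> \<epsilon> * (t * (\<alpha> / (c + t)\<^sup>2 + n / (c + t))) - (9 * n / 4 + 5 * \<bar>\<alpha>\<bar> / c) * \<epsilon>\<^sup>2"
proof -
  \<comment> \<open>\<open>w\<close> lies in (0, 1), and \<open>x\<close> is the relative increment
    of c + t; \<epsilon> <= 1 gives x <= 3 \<epsilon>, whence the uniform constants.\<close>
  define w where "w = t / (c + t)"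
  define x where "x = ((1 + \<epsilon>)\<^sup>2 - 1) * w"
  have ct: "c + t > 0" using c t by simp
  have w: "0 < w" "w < 1" using c t by (auto simp: w_def field_simps)
  have x_eq: "x = 2 * \<epsilon> * w + \<epsilon>\<^sup>2 * w" by (simp add: x_def power2_eq_square algebra_simps)
  have x0: "x > 0" using w e by (simp add: x_eq add_pos_pos)
  have "x \<le> 3 * \<epsilon> * w" using w e by (simp add: x_eq power2_eq_square mult_right_mono)
  also have "\<dots> \<le> 3 * \<epsilon> * 1" using w e by (intro mult_left_mono) auto
  finally have x3: "x \<le> 3 * \<epsilon>" by simp
  then have x9: "x\<^sup>2 \<le> 9 * \<epsilon>\<^sup>2" using power_mono[OF x3, of 2] x0 by (simp add: power_mult_distrib)
  have fac: "c + (1 + \<epsilon>)\<^sup>2 * t = (c + t) * (1 + x)" using ct by (simp add: x_def w_def field_simps)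
  have "ln (c + (1 + \<epsilon>)\<^sup>2 * t) - ln (c + t) = ln (1 + x)"
    unfolding fac using ct x0 by (simp add: ln_mult)
  then have ln_ge: "ln (c + (1 + \<epsilon>)\<^sup>2 * t) - ln (c + t) \<ge> x - x\<^sup>2 / 2"
    using ln_one_plus_ge[of x] x0 by simp
  have "x - x\<^sup>2 / 2 \<ge> 2 * \<epsilon> * w - (9 / 2) * \<epsilon>\<^sup>2"
  proof -
    have "0 \<le> \<epsilon>\<^sup>2 * w" using w by simp
    then show ?thesis using x9 x_eq by linarith
  qed
  with ln_ge have "ln (c + (1 + \<epsilon>)\<^sup>2 * t) - ln (c + t) \<ge> 2 * \<epsilon> * w - (9 / 2) * \<epsilon>\<^sup>2" by simp
  then have 1: "(n / 2) * (ln (c + (1 + \<epsilon>)\<^sup>2 * t) - ln (c + t)) \<ge> (n / 2) * (2 * \<epsilon> * w - (9 / 2) * \<epsilon>\<^sup>2)"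
    using n by (intro mult_left_mono) auto
  have inv: "1 / (c + t) - 1 / (c + (1 + \<epsilon>)\<^sup>2 * t) = (1 - w) / c * (x / (1 + x))"
  proof -
    have "1 - w = c / (c + t)" using ct by (simp add: w_def field_simps)
    then have "(1 - w) / c = 1 / (c + t)" using c by simp
    moreover have "1 / P - 1 / (P * (1 + x)) = 1 / P * (x / (1 + x))" if "P > 0" for P
    proof -
      have "1 / P - 1 / (P * (1 + x)) = 1 / P * (1 - 1 / (1 + x))" by (simp add: right_diff_distrib)
      also have "1 - 1 / (1 + x) = x / (1 + x)" using x0 by (simp add: field_simps)
      finally show ?thesis .
    qed
    from this[OF ct] have "1 / (c + t) - 1 / ((c + t) * (1 + x)) = 1 / (c + t) * (x / (1 + x))" .
    ultimately show ?thesis unfolding fac by simp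
  qed
  have "x / (1 + x) = x - x\<^sup>2 / (1 + x)" using x0 by (simp add: field_simps power2_eq_square)
  moreover have "0 \<le> x\<^sup>2 / (1 + x)" "x\<^sup>2 / (1 + x) \<le> x\<^sup>2" using x0 by (auto simp: divide_le_eq mult_le_cancel_left1)
  moreover have "\<epsilon>\<^sup>2 * w \<le> \<epsilon>\<^sup>2" "0 \<le> \<epsilon>\<^sup>2 * w" using w by (auto simp: mult_left_le)
  ultimately have dev: "\<bar>x / (1 + x) - 2 * \<epsilon> * w\<bar> \<le> 10 * \<epsilon>\<^sup>2" using x9 x_eq by linarith
  have "\<bar>\<alpha> / 2 * ((1 - w) / c) * (x / (1 + x) - 2 * \<epsilon> * w)\<bar> \<le> \<bar>\<alpha>\<bar> / 2 * (1 / c) * (10 * \<epsilon>\<^sup>2)"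
    unfolding abs_mult using dev w c by (intro mult_mono) (auto simp: field_simps)
  then have 2: "\<alpha> / 2 * ((1 - w) / c) * (x / (1 + x) - 2 * \<epsilon> * w) \<ge> - (5 * \<bar>\<alpha>\<bar> / c * \<epsilon>\<^sup>2)"
  proof -
    have "\<bar>\<alpha>\<bar> / 2 * (1 / c) * (10 * \<epsilon>\<^sup>2) = 5 * \<bar>\<alpha>\<bar> / c * \<epsilon>\<^sup>2" by simp
    moreover have "- X \<le> \<bar>X\<bar>" for X :: real by simp
    ultimately show ?thesis
      using \<open>\<bar>\<alpha> / 2 * ((1 - w) / c) * (x / (1 + x) - 2 * \<epsilon> * w)\<bar> \<le> \<bar>\<alpha>\<bar> / 2 * (1 / c) * (10 * \<epsilon>\<^sup>2)\<close>
      by linarith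
  qed
  have Kd: "K ((1 + \<epsilon>)\<^sup>2 * t) - K t = (n / 2) * (ln (c + (1 + \<epsilon>)\<^sup>2 * t) - ln (c + t))
      + \<alpha> / 2 * (1 / (c + t) - 1 / (c + (1 + \<epsilon>)\<^sup>2 * t))"
    unfolding K_def by (simp add: algebra_simps)
  have main: "\<alpha> / 2 * ((1 - w) / c) * (2 * \<epsilon> * w) = \<epsilon> * (t * (\<alpha> / (c + t)\<^sup>2))"
    "(n / 2) * (2 * \<epsilon> * w) = \<epsilon> * (t * (n / (c + t)))"
  proof -
    have "1 - w = c / (c + t)" using ct by (simp add: w_def field_simps)
    then have w1: "(1 - w) / c = 1 / (c + t)" using c by simp
    show "\<alpha> / 2 * ((1 - w) / c) * (2 * \<epsilon> * w) = \<epsilon> * (t * (\<alpha> / (c + t)\<^sup>2))"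
    proof -
      have "\<alpha> / 2 * (1 / P) * (2 * \<epsilon> * (t / P)) = \<epsilon> * (t * (\<alpha> / P\<^sup>2))" if "P > 0" for P
        using that by (simp add: power2_eq_square field_simps)
      from this[OF ct] show ?thesis unfolding w1 unfolding w_def .
    qed
    show "(n / 2) * (2 * \<epsilon> * w) = \<epsilon> * (t * (n / (c + t)))" by (simp add: w_def)
  qed
  have split: "\<alpha> / 2 * ((1 - w) / c * (x / (1 + x))) = \<alpha> / 2 * ((1 - w) / c) * (2 * \<epsilon> * w)
      + \<alpha> / 2 * ((1 - w) / c) * (x / (1 + x) - 2 * \<epsilon> * w)"
    by (simp add: algebra_simps)
  have "K ((1 + \<epsilon>)\<^sup>2 * t) - K t \<ge> (n / 2) * (2 * \<epsilon> * w - (9 / 2) * \<epsilon>\<^sup>2)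
      + (\<alpha> / 2 * ((1 - w) / c) * (2 * \<epsilon> * w) - 5 * \<bar>\<alpha>\<bar> / c * \<epsilon>\<^sup>2)"
    unfolding Kd inv split using 1 2 by linarith
  also have "(n / 2) * (2 * \<epsilon> * w - (9 / 2) * \<epsilon>\<^sup>2) = \<epsilon> * (t * (n / (c + t))) - 9 * n / 4 * \<epsilon>\<^sup>2"
    unfolding right_diff_distrib main(2) by simp
  finally show ?thesis unfolding main(1) by (simp add: algebra_simps)
qed

context score_field
begin

text \<open>Antiderivative of the bound on \<open>fisher t / 2\<close> that
  \<open>posterior_sq\<close> yields when the posterior energy is at most A. As
  \<open>neg_entropy\<close> falls at a rate of at most \<open>fisher t / 2\<close>, the sum of the
  two cannot decrease.\<close>

definition gaussian_correction :: "real \<Rightarrow> real \<Rightarrow> real" where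
  "gaussian_correction A t = (real DIM('a) / 2) * ln (c + t)
    - (A - (\<integral>x. (norm x)\<^sup>2 \<partial>\<mu>) + real DIM('a) * c) / (2 * (c + t))"

lemma neg_entropy_descent:
  assumes a: "0 < a" "a \<le> b"
    and A: "\<And>t. a \<le> t \<Longrightarrow> (\<integral>y. smoothed t y * (norm (posterior t y))\<^sup>2 \<partial>lborel) \<le> A"
  shows "neg_entropy a + gaussian_correction A a \<le> neg_entropy b + gaussian_correction A b"
proof -
  define n where "n = real DIM('a)"
  define \<alpha> where "\<alpha> = A - (\<integral>x. (norm x)\<^sup>2 \<partial>\<mu>) + n * c"
  define C where "C = n / 2 + (9 * n / 4 + 5 * \<bar>\<alpha>\<bar> / c)"
  have n: "n \<ge> 0" by (simp add: n_def)
  have K: "gaussian_correction A t = (n / 2) * ln (c + t) - \<alpha> / (2 * (c + t))" for t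
    by (simp add: gaussian_correction_def n_def \<alpha>_def)
  show ?thesis
  proof (rule quadratic_error_telescope[OF a, of C])
    show "C \<ge> 0" using n by (auto simp: C_def intro!: add_nonneg_nonneg divide_nonneg_pos)
    fix t \<epsilon> :: real
    assume t: "a \<le> t" and e: "0 < \<epsilon>" "\<epsilon> \<le> 1"
    have tp: "t > 0" using a t by simp
    have ct: "c + t > 0" using tp by (simp add: add_pos_pos)
    have "(c + t)\<^sup>2 * fisher t \<le> \<alpha> + n * (c + t)"
      using A[OF t] posterior_sq(2)[OF tp] by (simp add: \<alpha>_def n_def algebra_simps)
    then have "fisher t \<le> (\<alpha> + n * (c + t)) / (c + t)\<^sup>2"
      using ct by (simp add: pos_le_divide_eq mult.commute)
    also have "\<dots> = \<alpha> / (c + t)\<^sup>2 + n / (c + t)"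
      using ct by (simp add: add_divide_distrib power2_eq_square)
    finally have "\<epsilon> * (t * fisher t) \<le> \<epsilon> * (t * (\<alpha> / (c + t)\<^sup>2 + n / (c + t)))"
      using e tp by (intro mult_left_mono) auto
    moreover have "neg_entropy t - neg_entropy ((1 + \<epsilon>)\<^sup>2 * t) \<le> \<epsilon> * (t * fisher t) + \<epsilon>\<^sup>2 * (n / 2)"
      using neg_entropy_step[OF tp, of "1 + \<epsilon>"] e by (simp add: n_def)
    moreover have "gaussian_correction A ((1 + \<epsilon>)\<^sup>2 * t) - gaussian_correction A t
        \<ge> \<epsilon> * (t * (\<alpha> / (c + t)\<^sup>2 + n / (c + t))) - (9 * n / 4 + 5 * \<bar>\<alpha>\<bar> / c) * \<epsilon>\<^sup>2"
      unfolding K by (rule gaussian_entropy_step[OF c_pos tp e n])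
    moreover have "C * \<epsilon>\<^sup>2 = \<epsilon>\<^sup>2 * (n / 2) + (9 * n / 4 + 5 * \<bar>\<alpha>\<bar> / c) * \<epsilon>\<^sup>2"
      by (simp add: C_def algebra_simps)
    ultimately show "neg_entropy t + gaussian_correction A t
        \<le> neg_entropy ((1 + \<epsilon>)\<^sup>2 * t) + gaussian_correction A ((1 + \<epsilon>)\<^sup>2 * t) + C * \<epsilon>\<^sup>2"
      by linarith
  qed
qed

text \<open>The sum is nondecreasing in time, so any bound that holds as T tends to infinity holds
  at t. There \<open>neg_entropy_le\<close> applies, ln (c + T) - ln T tends to 0, and the term in 1
  / (c + T) vanishes.\<close>

lemma neg_entropy_correction_le:
  assumes t: "0 < t" and A: "\<And>s. t \<le> s \<Longrightarrow> (\<integral>y. smoothed s y * (norm (posterior s y))\<^sup>2 \<partial>lborel) \<le> A"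
  shows "neg_entropy t + gaussian_correction A t \<le> - (real DIM('a) / 2) * ln (2 * pi) - real DIM('a) / 2"
proof -
  define n where "n = real DIM('a)"
  define \<alpha> where "\<alpha> = A - (\<integral>x. (norm x)\<^sup>2 \<partial>\<mu>) + n * c"
  define C where "C = n * c / 2 + \<bar>\<alpha>\<bar> / 2"
  have bound: "neg_entropy t + gaussian_correction A t \<le> (- (n / 2) * ln (2 * pi) - n / 2) + C / T"
    if T: "T > 0" "t \<le> T" for T :: real
  proof -
    have cT: "c + T > 0" using T by (simp add: add_pos_pos)
    have "ln ((c + T) / T) \<le> (c + T) / T - 1" using T cT by (intro ln_le_minus_one) simp
    then have "ln (c + T) - ln T \<le> c / T" using T cT by (simp add: ln_div field_simps)
    then have 1: "(n / 2) * (ln (c + T) - ln T) \<le> (n / 2) * (c / T)"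
      by (intro mult_left_mono) (auto simp: n_def)
    have "- (\<alpha> / (2 * (c + T))) \<le> \<bar>\<alpha>\<bar> / (2 * (c + T))"
      using cT by (simp add: divide_right_mono minus_divide_left del: minus_divide_left[symmetric])
    also have "\<dots> \<le> \<bar>\<alpha>\<bar> / (2 * T)" using T cT less_imp_le[OF c_pos] by (intro divide_left_mono) (auto intro: less_imp_le)
    finally have 2: "- (\<alpha> / (2 * (c + T))) \<le> \<bar>\<alpha>\<bar> / (2 * T)" .
    have "neg_entropy T \<le> - (n / 2) * (ln (2 * pi) + ln T) - n / 2"
      using neg_entropy_le[OF T(1)] T(1) ln_mult[of "2 * pi" T] by (simp add: n_def)
    then have "neg_entropy T + gaussian_correction A T
        \<le> - (n / 2) * ln (2 * pi) - n / 2 + (n / 2) * (ln (c + T) - ln T) - \<alpha> / (2 * (c + T))"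
      unfolding gaussian_correction_def n_def[symmetric] \<alpha>_def[symmetric] by (simp add: algebra_simps)
    also have "\<dots> \<le> - (n / 2) * ln (2 * pi) - n / 2 + ((n / 2) * (c / T) + \<bar>\<alpha>\<bar> / (2 * T))"
      using 1 2 by linarith
    also have "(n / 2) * (c / T) + \<bar>\<alpha>\<bar> / (2 * T) = C / T" by (simp add: C_def add_divide_distrib)
    finally show ?thesis using neg_entropy_descent[OF t T(2), of A] A by simp
  qed
  have "(\<lambda>N. (- (n / 2) * ln (2 * pi) - n / 2) + C / real N) \<longlonglongrightarrow> (- (n / 2) * ln (2 * pi) - n / 2) + 0"
    by (intro tendsto_intros lim_const_over_n)
  moreover have "eventually (\<lambda>N. neg_entropy t + gaussian_correction A t
      \<le> (- (n / 2) * ln (2 * pi) - n / 2) + C / real N) sequentially"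
    using eventually_gt_at_top[of 0] eventually_ge_at_top[of "nat \<lceil>t\<rceil>"]
    by eventually_elim (rule bound, auto simp: nat_le_iff ceiling_le_iff)
  ultimately have "neg_entropy t + gaussian_correction A t \<le> (- (n / 2) * ln (2 * pi) - n / 2) + 0"
    by (auto intro: tendsto_lowerbound)
  then show ?thesis by (simp add: n_def)
qed

text \<open>Two energy bounds are used in succession: E|W|^2 up to time t, and from then on E|W|^2 -
  \<open>spread t\<close>, valid because \<open>spread\<close> is monotone. Changing A at time t
  gains \<open>spread t / (2 * (c + t))\<close>.\<close>

lemma neg_entropy_upper:
  assumes a: "0 < a" "a \<le> t"
  shows "neg_entropy a \<le> - (real DIM('a) / 2) * ln (2 * pi) - real DIM('a) / 2 - (real DIM('a) / 2) * ln (c + a)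
    + ((\<integral>x. (norm (W x))\<^sup>2 \<partial>\<mu>) - (\<integral>x. (norm x)\<^sup>2 \<partial>\<mu>) + real DIM('a) * c) / (2 * (c + a)) - spread t / (2 * (c + t))"
proof -
  define B where "B = (\<integral>x. (norm (W x))\<^sup>2 \<partial>\<mu>)"
  define D where "D = B - spread t"
  have t: "t > 0" using a by simp
  have "(\<integral>y. smoothed s y * (norm (posterior s y))\<^sup>2 \<partial>lborel) \<le> B" if "s > 0" for s
    using posterior_sq_le[OF that] spread_nonneg[of s] by (simp add: B_def)
  then have 1: "neg_entropy a + gaussian_correction B a \<le> neg_entropy t + gaussian_correction B t"
    using a by (intro neg_entropy_descent) auto
  have "(\<integral>y. smoothed s y * (norm (posterior s y))\<^sup>2 \<partial>lborel) \<le> D" if "t \<le> s" for s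
    using posterior_sq_le[of s] spread_mono[OF t that] t that by (simp add: B_def D_def)
  then have 2: "neg_entropy t + gaussian_correction D t \<le> - (real DIM('a) / 2) * ln (2 * pi) - real DIM('a) / 2"
    using t by (intro neg_entropy_correction_le) auto
  have "gaussian_correction B t - gaussian_correction D t = - spread t / (2 * (c + t))"
    unfolding gaussian_correction_def D_def by (simp add: diff_divide_distrib add_divide_distrib)
  moreover have "gaussian_correction B a = (real DIM('a) / 2) * ln (c + a)
      - (B - (\<integral>x. (norm x)\<^sup>2 \<partial>\<mu>) + real DIM('a) * c) / (2 * (c + a))"
    by (rule gaussian_correction_def)
  ultimately show ?thesis using 1 2 unfolding B_def by linarith
qed

end

section \<open>Convergence of the smoothed density as the noise vanishes\<close>

text \<open>The endpoint 0 matters: smoothed densities are positive, but their limit p may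
  vanish.\<close>

lemma continuous_on_mult_ln: "continuous_on {0..} (\<lambda>x::real. x * ln x)"
proof -
  have minus: "{0..} - {0::real} = {0<..} - {0}" by auto
  have eq: "at (0::real) within {0..} = at_right 0" unfolding at_within_def minus by (rule refl)
  have lim: "((\<lambda>x::real. x * ln x) \<longlongrightarrow> 0) (at_right 0)" by real_asymp
  have "((\<lambda>x::real. x * ln x) \<longlongrightarrow> x * ln x) (at x within {0..})" if "x \<ge> 0" for x
  proof (cases "x = 0")
    case True
    have "((\<lambda>x::real. x * ln x) \<longlongrightarrow> 0 * ln 0) (at 0 within {0..})"
      unfolding eq using lim by (simp only: mult_zero_left)
    then show ?thesis by (simp only: True)
  next
    case False
    then show ?thesis using that by (intro tendsto_intros) auto
  qed
  then show ?thesis unfolding continuous_on_def by auto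
qed

text \<open>The modulus is taken quadratic in w because the Gaussian average of |w|^2 is exactly n
  t.\<close>

lemma kernel_shift_le:
  fixes p :: "'a::euclidean_space \<Rightarrow> real"
  assumes p: "integrable lborel p" and t: "t > 0" and \<alpha>: "\<alpha> \<ge> 0" "\<beta> \<ge> 0"
    and w: "\<And>w. (\<integral>x. \<bar>p (x + w) - p x\<bar> \<partial>lborel) \<le> \<alpha> + \<beta> * (norm w)\<^sup>2"
  shows "(\<integral>\<^sup>+y. \<integral>\<^sup>+w. ennreal (heat_kernel t w * \<bar>p (y + w) - p y\<bar>) \<partial>lborel \<partial>lborel)
    \<le> ennreal (\<alpha> + \<beta> * (real DIM('a) * t))"
proof -
  note ip = p integrable_lborel_shift[OF p]
  have [measurable]: "p \<in> borel_measurable borel" using p by auto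
  have "(\<integral>\<^sup>+y. \<integral>\<^sup>+w. ennreal (heat_kernel t w * \<bar>p (y + w) - p y\<bar>) \<partial>lborel \<partial>lborel)
      = (\<integral>\<^sup>+w. \<integral>\<^sup>+y. ennreal (heat_kernel t w * \<bar>p (y + w) - p y\<bar>) \<partial>lborel \<partial>lborel)"
    by (rule lborel_pair.Fubini') measurable
  also have "\<dots> \<le> (\<integral>\<^sup>+w. ennreal (heat_kernel t w) * ennreal \<alpha> + ennreal \<beta> * ennreal (heat_kernel t w * (norm w)\<^sup>2) \<partial>(lborel :: 'a measure))"
  proof (rule nn_integral_mono)
    fix w :: 'a
    have "(\<integral>\<^sup>+y. ennreal (heat_kernel t w * \<bar>p (y + w) - p y\<bar>) \<partial>lborel)
        = ennreal (heat_kernel t w) * (\<integral>\<^sup>+y. ennreal \<bar>p (y + w) - p y\<bar> \<partial>lborel)"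
      by (simp add: ennreal_mult nn_integral_cmult)
    also have "(\<integral>\<^sup>+y. ennreal \<bar>p (y + w) - p y\<bar> \<partial>lborel) = ennreal (\<integral>y. \<bar>p (y + w) - p y\<bar> \<partial>lborel)"
      using ip by (intro nn_integral_eq_integral) auto
    also have "ennreal (heat_kernel t w) * \<dots> \<le> ennreal (heat_kernel t w) * ennreal (\<alpha> + \<beta> * (norm w)\<^sup>2)"
      using w[of w] by (intro mult_left_mono ennreal_leI) auto
    also have "\<dots> = ennreal (heat_kernel t w * \<alpha> + \<beta> * (heat_kernel t w * (norm w)\<^sup>2))"
      using \<alpha> by (simp add: ennreal_mult[symmetric] algebra_simps del: ennreal_plus)
    also have "\<dots> = ennreal (heat_kernel t w) * ennreal \<alpha> + ennreal \<beta> * ennreal (heat_kernel t w * (norm w)\<^sup>2)"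
      using \<alpha> by (simp add: ennreal_mult)
    finally show "(\<integral>\<^sup>+y. ennreal (heat_kernel t w * \<bar>p (y + w) - p y\<bar>) \<partial>lborel)
        \<le> ennreal (heat_kernel t w) * ennreal \<alpha> + ennreal \<beta> * ennreal (heat_kernel t w * (norm w)\<^sup>2)" .
  qed
  also have "\<dots> = ennreal \<alpha> + ennreal \<beta> * ennreal (real DIM('a) * t)"
    using t by (simp add: nn_integral_add nn_integral_multc nn_integral_cmult nn_integral_heat_kernel nn_integral_heat_kernel_norm_sq)
  also have "\<dots> = ennreal (\<alpha> + \<beta> * (real DIM('a) * t))"
    using \<alpha> t by (simp add: ennreal_mult)
  finally show ?thesis .
qed

text \<open>Below some radius d this is continuity of translation; beyond d the trivial bound 2
  ||p||_1 is at most 2 ||p||_1 |w|^2 / d^2.\<close>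

lemma shift_dist_modulus:
  fixes p :: "'a::euclidean_space \<Rightarrow> real"
  assumes p: "integrable lborel p" and e: "e > 0"
  shows "\<exists>C\<ge>0. \<forall>w. (\<integral>x. \<bar>p (x + w) - p x\<bar> \<partial>lborel) \<le> e + C * (norm w)\<^sup>2"
proof -
  have [measurable]: "p \<in> borel_measurable borel" using p by auto
  define I where "I = (\<integral>x. \<bar>p x\<bar> \<partial>lborel)"
  have I: "I \<ge> 0" unfolding I_def by (intro integral_nonneg_AE) auto
  have "((\<lambda>w. \<integral>x. \<bar>p (x + w) - p x\<bar> \<partial>lborel) \<longlongrightarrow> 0) (at 0)"
    unfolding tendsto_at_iff_sequentially using L1_shift_tendsto[OF p] by (auto simp: o_def)
  then have "eventually (\<lambda>w. (\<integral>x. \<bar>p (x + w) - p x\<bar> \<partial>lborel) < e) (at 0)"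
    using e by (rule order_tendstoD)
  then obtain d where d: "d > 0" "\<And>w. w \<noteq> 0 \<Longrightarrow> norm w < d \<Longrightarrow> (\<integral>x. \<bar>p (x + w) - p x\<bar> \<partial>lborel) < e"
    by (auto simp: eventually_at dist_norm)
  have "(\<integral>x. \<bar>p (x + w) - p x\<bar> \<partial>lborel) \<le> e + (2 * I / d\<^sup>2) * (norm w)\<^sup>2" for w
  proof (cases "norm w < d")
    case True
    have "(\<integral>x. \<bar>p (x + w) - p x\<bar> \<partial>lborel) < e" using d(2)[of w] True e by (cases "w = 0") auto
    moreover have "0 \<le> (2 * I / d\<^sup>2) * (norm w)\<^sup>2" using I by simp
    ultimately show ?thesis by linarith
  next
    case False
    note ip = p integrable_lborel_shift[OF p]
    have "(\<integral>x. \<bar>p (x + w) - p x\<bar> \<partial>lborel) \<le> (\<integral>x. \<bar>p (x + w)\<bar> + \<bar>p x\<bar> \<partial>lborel)"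
      using ip by (intro integral_mono) auto
    also have "\<dots> = 2 * I" using ip integral_lborel_shift[of "\<lambda>x. \<bar>p x\<bar>" w] by (simp add: I_def)
    also have "\<dots> \<le> (2 * I / d\<^sup>2) * (norm w)\<^sup>2"
    proof -
      have "d\<^sup>2 \<le> (norm w)\<^sup>2" using False d(1) by (intro power_mono) auto
      then have "(2 * I / d\<^sup>2) * d\<^sup>2 \<le> (2 * I / d\<^sup>2) * (norm w)\<^sup>2" using I by (intro mult_left_mono) auto
      then show ?thesis using d(1) by simp
    qed
    finally show ?thesis using e by simp
  qed
  moreover have "2 * I / d\<^sup>2 \<ge> 0" using I by simp
  ultimately show ?thesis by blast
qed

locale channel_density = gaussian_channel \<mu> for \<mu> :: "'a::euclidean_space measure" +
  fixes p :: "'a \<Rightarrow> real"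
  assumes p_measurable [measurable]: "p \<in> borel_measurable borel"
    and p_nonneg [simp]: "\<And>x. p x \<ge> 0"
    and \<mu>_density: "\<mu> = density lborel p"
begin

lemma integral_\<mu>:
  fixes h :: "'a \<Rightarrow> 'b::{banach, second_countable_topology}"
  assumes [measurable]: "h \<in> borel_measurable borel"
  shows "(\<integral>x. h x \<partial>\<mu>) = (\<integral>x. p x *\<^sub>R h x \<partial>lborel)"
  unfolding \<mu>_density by (subst integral_density) auto

lemma integrable_\<mu>:
  fixes h :: "'a \<Rightarrow> 'b::{banach, second_countable_topology}"
  assumes [measurable]: "h \<in> borel_measurable borel"
  shows "integrable \<mu> h \<longleftrightarrow> integrable lborel (\<lambda>x. p x *\<^sub>R h x)"
  unfolding \<mu>_density by (subst integrable_density) auto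

lemma integrable_p: "integrable lborel p" and integral_p: "(\<integral>x. p x \<partial>lborel) = 1"
  using integrable_\<mu>[of "\<lambda>_. 1::real"] integral_\<mu>[of "\<lambda>_. 1::real"] by simp_all

lemma smoothed_eq_integral: "smoothed t y = (\<integral>w. heat_kernel t w * p (y + w) \<partial>lborel)"
proof -
  have "smoothed t y = (\<integral>x. heat_kernel t (y - x) * p x \<partial>lborel)"
    unfolding smoothed_def by (subst integral_\<mu>) (auto simp: mult.commute)
  also have "\<dots> = (\<integral>w. heat_kernel t (y - (w + y)) * p (w + y) \<partial>lborel)"
    by (rule integral_lborel_shift[symmetric]) measurable
  finally show ?thesis by (simp add: add.commute)
qed

lemma smoothed_L1_dist:
  assumes t: "t > 0" and \<alpha>: "\<alpha> \<ge> 0" "\<beta> \<ge> 0"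
    and w: "\<And>w. (\<integral>x. \<bar>p (x + w) - p x\<bar> \<partial>lborel) \<le> \<alpha> + \<beta> * (norm w)\<^sup>2"
  shows "(\<integral>y. \<bar>smoothed t y - p y\<bar> \<partial>lborel) \<le> \<alpha> + \<beta> * (real DIM('a) * t)"
proof -
  have ik: "integrable lborel (heat_kernel t :: 'a \<Rightarrow> real)" "(\<integral>w. heat_kernel t (w::'a) \<partial>lborel) = 1"
    using nn_integral_heat_kernel[OF t, where 'a='a]
    by (auto intro!: integrableI_nonneg simp: integral_eq_nn_integral)
  have pw: "ennreal \<bar>smoothed t y - p y\<bar> \<le> (\<integral>\<^sup>+w. ennreal (heat_kernel t w * \<bar>p (y + w) - p y\<bar>) \<partial>lborel)" for y
  \<comment> \<open>If the right side is infinite nothing is to be shown; otherwise its finiteness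
    supplies the integrability needed to write the difference as one integral.\<close>
  proof (cases "(\<integral>\<^sup>+w. ennreal (heat_kernel t w * \<bar>p (y + w) - p y\<bar>) \<partial>lborel) = \<infinity>")
    case False
    have i1: "integrable lborel (\<lambda>w. heat_kernel t w * (p (y + w) - p y))"
      using False by (intro integrableI_bounded) (auto simp: abs_mult less_top)
    have "integrable lborel (\<lambda>w. heat_kernel t w * (p (y + w) - p y) + heat_kernel t w * p y)"
      using i1 ik by simp
    then have i2: "integrable lborel (\<lambda>w. heat_kernel t w * p (y + w))"
      by (simp add: algebra_simps)
    have "smoothed t y - p y = (\<integral>w. heat_kernel t w * (p (y + w) - p y) \<partial>lborel)"
      using i2 ik by (simp add: smoothed_eq_integral right_diff_distrib)
    also have "\<bar>\<dots>\<bar> \<le> (\<integral>w. \<bar>heat_kernel t w * (p (y + w) - p y)\<bar> \<partial>lborel)"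
      by (rule integral_abs_bound)
    finally have "\<bar>smoothed t y - p y\<bar> \<le> (\<integral>w. heat_kernel t w * \<bar>p (y + w) - p y\<bar> \<partial>lborel)"
      by (simp add: abs_mult)
    then have "ennreal \<bar>smoothed t y - p y\<bar> \<le> ennreal (\<integral>w. heat_kernel t w * \<bar>p (y + w) - p y\<bar> \<partial>lborel)"
      by (rule ennreal_leI)
    also have "\<dots> = (\<integral>\<^sup>+w. ennreal (heat_kernel t w * \<bar>p (y + w) - p y\<bar>) \<partial>lborel)"
      using integrable_abs[OF i1] by (intro nn_integral_eq_integral[symmetric]) (auto simp: abs_mult)
    finally show ?thesis .
  qed simp
  have "(\<integral>\<^sup>+y. ennreal \<bar>smoothed t y - p y\<bar> \<partial>lborel)
      \<le> (\<integral>\<^sup>+y. \<integral>\<^sup>+w. ennreal (heat_kernel t w * \<bar>p (y + w) - p y\<bar>) \<partial>lborel \<partial>lborel)"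
    by (intro nn_integral_mono pw)
  also have "\<dots> \<le> ennreal (\<alpha> + \<beta> * (real DIM('a) * t))"
    by (rule kernel_shift_le[OF integrable_p t \<alpha> w])
  finally have "(\<integral>\<^sup>+y. ennreal \<bar>smoothed t y - p y\<bar> \<partial>lborel) \<le> ennreal (\<alpha> + \<beta> * (real DIM('a) * t))" .
  moreover have "(\<integral>\<^sup>+y. ennreal \<bar>smoothed t y - p y\<bar> \<partial>lborel) = ennreal (\<integral>y. \<bar>smoothed t y - p y\<bar> \<partial>lborel)"
    using integrable_p smoothed_mass(1)[OF t] by (intro nn_integral_eq_integral) auto
  ultimately show ?thesis using \<alpha> t by (simp add: ennreal_le_iff del: ennreal_plus)
qed

lemma smoothed_L1_tendsto:
  assumes T: "T \<longlonglongrightarrow> 0" "\<And>j. T j > 0"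
  shows "(\<lambda>j. \<integral>y. \<bar>smoothed (T j) y - p y\<bar> \<partial>lborel) \<longlonglongrightarrow> 0"
proof (rule LIMSEQ_I)
  fix e :: real assume e: "e > 0"
  obtain C where C: "C \<ge> 0" "\<And>w. (\<integral>x. \<bar>p (x + w) - p x\<bar> \<partial>lborel) \<le> e / 2 + C * (norm w)\<^sup>2"
    using shift_dist_modulus[OF integrable_p, of "e / 2"] e by auto
  have "(\<lambda>j. C * (real DIM('a) * T j)) \<longlonglongrightarrow> C * (real DIM('a) * 0)"
    by (intro tendsto_intros T)
  then have "eventually (\<lambda>j. C * (real DIM('a) * T j) < e / 2) sequentially"
    using e by (intro order_tendstoD(2)) auto
  then obtain N where N: "\<And>j. j \<ge> N \<Longrightarrow> C * (real DIM('a) * T j) < e / 2"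
    by (auto simp: eventually_sequentially)
  show "\<exists>N. \<forall>j\<ge>N. norm ((\<integral>y. \<bar>smoothed (T j) y - p y\<bar> \<partial>lborel) - 0) < e"
  proof (intro exI allI impI)
    fix j assume j: "j \<ge> N"
    have "(\<integral>y. \<bar>smoothed (T j) y - p y\<bar> \<partial>lborel) \<ge> 0" by (intro integral_nonneg_AE) auto
    moreover have "(\<integral>y. \<bar>smoothed (T j) y - p y\<bar> \<partial>lborel) \<le> e / 2 + C * (real DIM('a) * T j)"
      using e C by (intro smoothed_L1_dist[OF T(2)]) auto
    ultimately show "norm ((\<integral>y. \<bar>smoothed (T j) y - p y\<bar> \<partial>lborel) - 0) < e"
      using N[OF j] by simp
  qed
qed

end

section \<open>The logarithmic Sobolev inequality with a remainder\<close>

locale score_density = score_field \<mu> c W + channel_density \<mu> p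
  for \<mu> :: "'a::euclidean_space measure" and c :: real and W :: "'a \<Rightarrow> 'a" and p :: "'a \<Rightarrow> real"
begin

text \<open>The terms - q + \<open>heat_kernel c y\<close> integrate to zero for a probability
  density q. They make the integrand of the relative entropy pointwise nonnegative, so that Fatou's
  lemma applies and \<open>ennreal\<close> truncates nothing.\<close>

definition relative_density :: "'a \<Rightarrow> real \<Rightarrow> real" where
  "relative_density y q = q * ln q - q * ln (heat_kernel c y) - q + heat_kernel c y"

lemma relative_density_nonneg:
  assumes "q \<ge> 0" shows "relative_density y q \<ge> 0"
proof (cases "q = 0")
  case False
  have g: "heat_kernel c y > 0" by simp
  have "ln (heat_kernel c y / q) \<le> heat_kernel c y / q - 1"
    using False assms g by (intro ln_le_minus_one) simp
  then have "q * ln (heat_kernel c y / q) \<le> q * (heat_kernel c y / q - 1)"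
    using assms by (intro mult_left_mono)
  then show ?thesis using False assms g unfolding relative_density_def
    by (simp add: ln_div right_diff_distrib)
qed (simp add: relative_density_def)

lemma ln_heat_kernel:
  assumes "t > 0"
  shows "ln (heat_kernel t (y::'a)) = - (real DIM('a) / 2) * ln (2 * pi * t) - (norm y)\<^sup>2 / (2 * t)"
  using assms unfolding heat_kernel_def by (simp add: ln_mult ln_powr)

lemma heat_kernel_mass:
  assumes "t > 0"
  shows "integrable lborel (heat_kernel t :: 'a \<Rightarrow> real)" "(\<integral>w. heat_kernel t (w::'a) \<partial>lborel) = 1"
  using nn_integral_heat_kernel[OF assms, where 'a='a]
  by (auto intro!: integrableI_nonneg simp: integral_eq_nn_integral)

lemma smoothed_relative_density:
  assumes a: "a > 0"
  shows "(\<integral>\<^sup>+y. ennreal (relative_density y (smoothed a y)) \<partial>lborel) = ennreal (neg_entropy a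
    + (real DIM('a) / 2) * ln (2 * pi * c) + ((\<integral>x. (norm x)\<^sup>2 \<partial>\<mu>) + real DIM('a) * a) / (2 * c))"
    and "0 \<le> neg_entropy a
    + (real DIM('a) / 2) * ln (2 * pi * c) + ((\<integral>x. (norm x)\<^sup>2 \<partial>\<mu>) + real DIM('a) * a) / (2 * c)"
proof -
  have eq: "relative_density y (smoothed a y) = smoothed a y * ln (smoothed a y)
      + (real DIM('a) / 2) * ln (2 * pi * c) * smoothed a y
      + (1 / (2 * c)) * (smoothed a y * (norm y)\<^sup>2) - smoothed a y + heat_kernel c y" for y
    unfolding relative_density_def ln_heat_kernel[OF c_pos] by (simp add: algebra_simps)
  note i = integrable_cross_entropy[OF a a] smoothed_mass[OF a] smoothed_second_moment[OF a] heat_kernel_mass[OF c_pos]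
  have int: "integrable lborel (\<lambda>y. relative_density y (smoothed a y))"
    unfolding eq using i by simp
  have val: "(\<integral>y. relative_density y (smoothed a y) \<partial>lborel) = neg_entropy a
    + (real DIM('a) / 2) * ln (2 * pi * c) + ((\<integral>x. (norm x)\<^sup>2 \<partial>\<mu>) + real DIM('a) * a) / (2 * c)"
    unfolding eq using i by (simp add: neg_entropy_def)
  have nonneg: "relative_density y (smoothed a y) \<ge> 0" for y
    using smoothed_pos[OF a, of y] by (intro relative_density_nonneg) simp
  show "(\<integral>\<^sup>+y. ennreal (relative_density y (smoothed a y)) \<partial>lborel) = ennreal (neg_entropy a
    + (real DIM('a) / 2) * ln (2 * pi * c) + ((\<integral>x. (norm x)\<^sup>2 \<partial>\<mu>) + real DIM('a) * a) / (2 * c))"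
    using nonneg int val by (subst nn_integral_eq_integral) auto
  show "0 \<le> neg_entropy a
    + (real DIM('a) / 2) * ln (2 * pi * c) + ((\<integral>x. (norm x)\<^sup>2 \<partial>\<mu>) + real DIM('a) * a) / (2 * c)"
    unfolding val[symmetric] using nonneg by (intro integral_nonneg_AE) auto
qed

text \<open>\<open>neg_entropy_upper\<close> is available only at positive noise; the limit a -> 0
  is taken along a subsequence with almost everywhere convergence, where Fatou's lemma passes to p.
  The second claim allows the first, stated in \<open>ennreal\<close>, to be read back in the
  reals.\<close>

theorem log_sobolev_remainder:
  assumes t: "t > 0"
  shows "(\<integral>\<^sup>+y. ennreal (relative_density y (p y)) \<partial>lborel)
    \<le> ennreal ((\<integral>x. (norm (W x))\<^sup>2 \<partial>\<mu>) / (2 * c) - spread t / (2 * (c + t)))"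
    and "0 \<le> (\<integral>x. (norm (W x))\<^sup>2 \<partial>\<mu>) / (2 * c) - spread t / (2 * (c + t))"
proof -
  define N2 where "N2 = (\<integral>x. (norm x)\<^sup>2 \<partial>\<mu>)"
  define B where "B = (\<integral>x. (norm (W x))\<^sup>2 \<partial>\<mu>)"
  define n where "n = real DIM('a)"
  define T :: "nat \<Rightarrow> real" where "T j = 1 / (Suc j)" for j
  have T: "T \<longlonglongrightarrow> 0" "\<And>j. T j > 0" unfolding T_def by (rule LIMSEQ_Suc[OF lim_1_over_n]) simp
  obtain r where r: "strict_mono r" "AE y in lborel. (\<lambda>j. smoothed (T (r j)) y - p y) \<longlonglongrightarrow> 0"
    using tendsto_L1_AE_subseq[of lborel "\<lambda>j y. smoothed (T j) y - p y"]
      smoothed_L1_tendsto[OF T] smoothed_mass(1)[OF T(2)] integrable_p by auto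
  define a where "a j = T (r j)" for j
  have a0: "a \<longlonglongrightarrow> 0" using LIMSEQ_subseq_LIMSEQ[OF T(1) r(1)] by (simp add: a_def[abs_def] o_def)
  have ap: "a j > 0" for j by (simp add: a_def T)
  \<comment> \<open>\<open>R x\<close> is the right side of \<open>neg_entropy_upper\<close> at a =
    x plus the two remaining terms of the relative entropy. At x = 0 all but the claimed terms
    cancel.\<close>
  define R where "R x = (- (n / 2) * ln (2 * pi) - n / 2 - (n / 2) * ln (c + x)
    + (B - N2 + n * c) / (2 * (c + x)) - spread t / (2 * (c + t)))
    + (n / 2) * ln (2 * pi * c) + (N2 + n * x) / (2 * c)" for x
  have lim: "AE y in lborel. (\<lambda>j. ennreal (relative_density y (smoothed (a j) y))) \<longlonglongrightarrow> ennreal (relative_density y (p y))"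
    using r(2)
  proof eventually_elim
    fix y assume "(\<lambda>j. smoothed (T (r j)) y - p y) \<longlonglongrightarrow> 0"
    then have q: "(\<lambda>j. smoothed (a j) y) \<longlonglongrightarrow> p y" by (simp add: a_def LIM_zero_iff)
    have ql: "(\<lambda>j. smoothed (a j) y * ln (smoothed (a j) y)) \<longlonglongrightarrow> p y * ln (p y)"
      by (intro continuous_on_tendsto_compose[OF continuous_on_mult_ln q])
        (auto simp: less_imp_le[OF smoothed_pos[OF ap]])
    show "(\<lambda>j. ennreal (relative_density y (smoothed (a j) y))) \<longlonglongrightarrow> ennreal (relative_density y (p y))"
      unfolding relative_density_def by (intro tendsto_ennrealI tendsto_intros ql q)
  qed
  have [measurable]: "(\<lambda>y. relative_density y (smoothed s y)) \<in> borel_measurable borel" for s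
    unfolding relative_density_def by measurable
  have upper: "neg_entropy (a j) + (n / 2) * ln (2 * pi * c) + (N2 + n * a j) / (2 * c) \<le> R (a j)" if "a j < t" for j
    using neg_entropy_upper[OF ap[of j], of t] that unfolding R_def by (simp add: n_def B_def N2_def)
  have small: "eventually (\<lambda>j. a j < t) sequentially" using order_tendstoD(2)[OF a0 t] .
  have Rlim: "(\<lambda>j. R (a j)) \<longlonglongrightarrow> R 0"
    unfolding R_def by (rule tendsto_intros a0 | use less_imp_neq[OF c_pos] in force)+
  have R0: "R 0 = B / (2 * c) - spread t / (2 * (c + t))"
  proof -
    have "ln (2 * pi * c) = ln (2 * pi) + ln c" using ln_mult_pos[of "2 * pi" c] c_pos by auto
    moreover have "(B - N2 + n * c) / (2 * c) = B / (2 * c) - N2 / (2 * c) + n / 2"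
      using less_imp_neq[OF c_pos] by (simp add: add_divide_distrib diff_divide_distrib)
    ultimately show ?thesis unfolding R_def by (simp add: algebra_simps)
  qed
  have "eventually (\<lambda>j. 0 \<le> R (a j)) sequentially"
    using small
  proof eventually_elim
    fix j assume "a j < t"
    then show "0 \<le> R (a j)"
      using upper smoothed_relative_density(2)[OF ap[of j]] unfolding n_def N2_def by (blast intro: order_trans)
  qed
  then have "0 \<le> R 0" by (intro tendsto_lowerbound[OF Rlim]) auto
  then show "0 \<le> (\<integral>x. (norm (W x))\<^sup>2 \<partial>\<mu>) / (2 * c) - spread t / (2 * (c + t))" by (simp add: R0 B_def)
  have "(\<integral>\<^sup>+y. ennreal (relative_density y (p y)) \<partial>lborel)
      = (\<integral>\<^sup>+y. liminf (\<lambda>j. ennreal (relative_density y (smoothed (a j) y))) \<partial>lborel)"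
    using lim by (intro nn_integral_cong_AE) (auto elim!: eventually_mono dest: lim_imp_Liminf[OF sequentially_bot])
  also have "\<dots> \<le> liminf (\<lambda>j. \<integral>\<^sup>+y. ennreal (relative_density y (smoothed (a j) y)) \<partial>lborel)"
    by (rule nn_integral_liminf) measurable
  also have "\<dots> \<le> liminf (\<lambda>j. ennreal (R (a j)))"
    by (intro Liminf_mono eventually_mono[OF small], unfold smoothed_relative_density(1)[OF ap])
      (use upper in \<open>auto simp: n_def N2_def intro!: ennreal_leI\<close>)
  also have "\<dots> = ennreal (R 0)"
    by (rule lim_imp_Liminf[OF sequentially_bot tendsto_ennrealI[OF Rlim]])
  finally show "(\<integral>\<^sup>+y. ennreal (relative_density y (p y)) \<partial>lborel)
    \<le> ennreal ((\<integral>x. (norm (W x))\<^sup>2 \<partial>\<mu>) / (2 * c) - spread t / (2 * (c + t)))"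
    by (simp add: R0 B_def)
qed

text \<open>Formally W - x = c grad ln p, so halving c halves W - x and gives the field (W + x) /
  2.\<close>

lemma score_density_half: "score_density \<mu> (c / 2) (\<lambda>x. (1 / 2) *\<^sub>R (W x + x)) p"
proof -
  have law: "(\<integral>x. heat_kernel t (y - x) *\<^sub>R ((1 / 2) *\<^sub>R (W x + x)) \<partial>\<mu>)
      = (\<integral>x. heat_kernel t (y - x) *\<^sub>R (x - ((c / 2) / t) *\<^sub>R (y - x)) \<partial>\<mu>)" if t: "t > 0" for t y
  proof -
    note i = integrable_kernel[OF t integrable_W, of y] integrable_kernel[OF t integrable_id, of y]
    have "integrable \<mu> (\<lambda>x. x - (c / t) *\<^sub>R (y - x))" using integrable_id by simp
    note i2 = integrable_kernel[OF t this, of y]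
    have "(\<integral>x. heat_kernel t (y - x) *\<^sub>R ((1 / 2) *\<^sub>R (W x + x)) \<partial>\<mu>)
        = (\<integral>x. (1 / 2) *\<^sub>R (heat_kernel t (y - x) *\<^sub>R W x) + (1 / 2) *\<^sub>R (heat_kernel t (y - x) *\<^sub>R x) \<partial>\<mu>)"
      by (intro Bochner_Integration.integral_cong) (auto simp: scaleR_add_right mult.commute)
    also have "\<dots> = (1 / 2) *\<^sub>R (\<integral>x. heat_kernel t (y - x) *\<^sub>R W x \<partial>\<mu>) + (1 / 2) *\<^sub>R (\<integral>x. heat_kernel t (y - x) *\<^sub>R x \<partial>\<mu>)"
      using i by (simp del: scaleR_scaleR)
    also have "\<dots> = (\<integral>x. (1 / 2) *\<^sub>R (heat_kernel t (y - x) *\<^sub>R (x - (c / t) *\<^sub>R (y - x))) + (1 / 2) *\<^sub>R (heat_kernel t (y - x) *\<^sub>R x) \<partial>\<mu>)"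
      unfolding W_law[OF t] using i i2 by (simp del: scaleR_scaleR)
    also have "\<dots> = (\<integral>x. heat_kernel t (y - x) *\<^sub>R (x - ((c / 2) / t) *\<^sub>R (y - x)) \<partial>\<mu>)"
    proof (rule Bochner_Integration.integral_cong[OF refl])
      fix x
      have "(1 / 2) *\<^sub>R (x - (c / t) *\<^sub>R (y - x)) + (1 / 2) *\<^sub>R x = x - ((c / 2) / t) *\<^sub>R (y - x)"
        by (simp add: scaleR_diff_right scaleR_left_distrib[symmetric])
      then show "(1 / 2) *\<^sub>R (heat_kernel t (y - x) *\<^sub>R (x - (c / t) *\<^sub>R (y - x))) + (1 / 2) *\<^sub>R (heat_kernel t (y - x) *\<^sub>R x)
          = heat_kernel t (y - x) *\<^sub>R (x - ((c / 2) / t) *\<^sub>R (y - x))"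
        by (metis (no_types, lifting) scaleR_add_right scaleR_left_commute)
    qed
    finally show ?thesis .
  qed
  have sq: "integrable \<mu> (\<lambda>x. (norm ((1 / 2) *\<^sub>R (W x + x)))\<^sup>2)"
  proof (rule Bochner_Integration.integrable_bound)
    show "integrable \<mu> (\<lambda>x. (norm (W x))\<^sup>2 + (norm x)\<^sup>2)" using W_sq second_moment by simp
    show "AE x in \<mu>. norm ((norm ((1 / 2) *\<^sub>R (W x + x)))\<^sup>2) \<le> norm ((norm (W x))\<^sup>2 + (norm x)\<^sup>2)"
    proof (rule AE_I2)
      fix x
      have "(norm (W x + x))\<^sup>2 \<le> (norm (W x) + norm x)\<^sup>2" by (intro power_mono norm_triangle_ineq) auto
      also have "\<dots> \<le> 2 * ((norm (W x))\<^sup>2 + (norm x)\<^sup>2)"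
        using sum_squares_bound[of "norm (W x)" "norm x"] by (simp add: power2_sum)
      finally have "(norm (W x + x))\<^sup>2 \<le> 2 * ((norm (W x))\<^sup>2 + (norm x)\<^sup>2)" .
      moreover have "0 \<le> (norm (W x))\<^sup>2" "0 \<le> (norm x)\<^sup>2" by simp_all
      moreover have "norm ((norm ((1 / 2) *\<^sub>R (W x + x)))\<^sup>2) = (norm (W x + x))\<^sup>2 / 4"
        by (simp add: power_divide)
      moreover have "n \<le> \<bar>A + B\<bar>" if "s \<le> 2 * (A + B)" "0 \<le> A" "0 \<le> B" "n = s / 4" for n s A B :: real
        using that by auto
      ultimately show "norm ((norm ((1 / 2) *\<^sub>R (W x + x)))\<^sup>2) \<le> norm ((norm (W x))\<^sup>2 + (norm x)\<^sup>2)"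
        unfolding real_norm_def[of "(norm (W x))\<^sup>2 + (norm x)\<^sup>2"] by metis
    qed
  qed measurable
  show ?thesis
  proof unfold_locales
    show "c / 2 > 0" using half_gt_zero[OF c_pos] .
    show "(\<lambda>x. (1 / 2) *\<^sub>R (W x + x)) \<in> borel_measurable borel" by measurable
  qed (use law sq in auto)
qed

text \<open>The inequality for the variances \<open>c\<close> and \<open>c / 2\<close> together bounds the Fisher information by the deficit:
  halving \<open>c\<close> changes the entropy by a bounded amount but shrinks the leading term by a factor.\<close>

lemma expectation_W_sq_le:
  assumes int: "integrable lborel (\<lambda>y. relative_density y (p y))"
  shows "(\<integral>x. (norm (W x))\<^sup>2 \<partial>\<mu>) / (8 * c) \<le> (\<integral>x. (norm (W x))\<^sup>2 \<partial>\<mu>) / (2 * c)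
    - (\<integral>y. relative_density y (p y) \<partial>lborel) + (real DIM('a) / 2) * ln 2 + (\<integral>x. (norm x)\<^sup>2 \<partial>\<mu>) / (4 * c)"
proof -
  define N2 where "N2 = (\<integral>x. (norm x)\<^sup>2 \<partial>\<mu>)"
  define B where "B = (\<integral>x. (norm (W x))\<^sup>2 \<partial>\<mu>)"
  define H where "H = (\<integral>y. relative_density y (p y) \<partial>lborel)"
  interpret half: score_density \<mu> "c / 2" "\<lambda>x. (1 / 2) *\<^sub>R (W x + x)" p by (rule score_density_half)
  have c0: "c \<noteq> 0" using less_imp_neq[OF c_pos] by simp
  have p2: "integrable lborel (\<lambda>y. p y * (norm y)\<^sup>2)" "(\<integral>y. p y * (norm y)\<^sup>2 \<partial>lborel) = N2"
    using integrable_\<mu>[of "\<lambda>x. (norm x)\<^sup>2"] integral_\<mu>[of "\<lambda>x. (norm x)\<^sup>2"] second_moment by (simp_all add: N2_def)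
  have lnc: "ln (2 * pi * (c / 2)) = ln (2 * pi * c) - ln 2"
    using ln_div[of "2 * pi * c" 2] c0 by simp
  have rel: "half.relative_density y (p y) = relative_density y (p y) - (real DIM('a) / 2) * ln 2 * p y
      + (1 / (2 * c)) * (p y * (norm y)\<^sup>2) - heat_kernel c y + heat_kernel (c / 2) y" for y
  proof -
    have l1: "ln (heat_kernel c y) = - (real DIM('a) / 2) * ln (2 * pi * c) - (norm y)\<^sup>2 / (2 * c)"
      by (rule ln_heat_kernel[OF c_pos])
    have l2: "ln (heat_kernel (c / 2) y) = - (real DIM('a) / 2) * (ln (2 * pi * c) - ln 2) - (norm y)\<^sup>2 / c"
      using ln_heat_kernel[OF half.c_pos, of y] unfolding lnc by simp
    have "(norm y)\<^sup>2 / c = 2 * ((norm y)\<^sup>2 / (2 * c))" by simp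
    then show ?thesis unfolding relative_density_def half.relative_density_def l1 l2
      by (simp add: algebra_simps)
  qed
  note hk = heat_kernel_mass[OF c_pos] heat_kernel_mass[OF half.c_pos]
  have int': "integrable lborel (\<lambda>y. half.relative_density y (p y))"
    unfolding rel using int p2 integrable_p hk by simp
  have H': "(\<integral>y. half.relative_density y (p y) \<partial>lborel) = H - (real DIM('a) / 2) * ln 2 + N2 / (2 * c)"
    unfolding rel using int p2 integrable_p integral_p hk by (simp add: H_def)
  define B' where "B' = (\<integral>x. (norm ((1 / 2) *\<^sub>R (W x + x)))\<^sup>2 \<partial>\<mu>)"
  \<comment> \<open>From (a + b)^2 <= (3/2) a^2 + 3 b^2. The weights are uneven so that the
    coefficient 3/8 stays below 1/2: after division by c, B / (8c) is left over from B /
    (2c).\<close>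
  have B': "B' \<le> (3 / 8) * B + (3 / 4) * N2"
  proof -
    have "B' \<le> (\<integral>x. (3 / 8) * (norm (W x))\<^sup>2 + (3 / 4) * (norm x)\<^sup>2 \<partial>\<mu>)"
      unfolding B'_def
    proof (rule integral_mono[OF half.W_sq])
      show "integrable \<mu> (\<lambda>x. (3 / 8) * (norm (W x))\<^sup>2 + (3 / 4) * (norm x)\<^sup>2)" using W_sq second_moment by simp
      fix x
      have "(norm (W x + x))\<^sup>2 \<le> (norm (W x) + norm x)\<^sup>2" by (intro power_mono norm_triangle_ineq) auto
      also have "\<dots> \<le> (3 / 2) * (norm (W x))\<^sup>2 + 3 * (norm x)\<^sup>2"
        using sum_squares_bound[of "norm (W x)" "2 * norm x"] by (simp add: power2_sum power_mult_distrib)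
      finally show "(norm ((1 / 2) *\<^sub>R (W x + x)))\<^sup>2 \<le> (3 / 8) * (norm (W x))\<^sup>2 + (3 / 4) * (norm x)\<^sup>2"
        by (simp add: power_divide)
    qed
    also have "\<dots> = (3 / 8) * B + (3 / 4) * N2" using W_sq second_moment by (simp add: B_def N2_def)
    finally show ?thesis .
  qed
  have one: "(1::real) > 0" by simp
  have "ennreal (\<integral>y. half.relative_density y (p y) \<partial>lborel) \<le> ennreal (B' / (2 * (c / 2)) - half.spread 1 / (2 * (c / 2 + 1)))"
    using half.log_sobolev_remainder(1)[OF one] int' half.relative_density_nonneg unfolding B'_def
    by (subst nn_integral_eq_integral[symmetric]) auto
  then have "(\<integral>y. half.relative_density y (p y) \<partial>lborel) \<le> B' / (2 * (c / 2)) - half.spread 1 / (2 * (c / 2 + 1))"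
    using half.log_sobolev_remainder(2)[OF one] by (subst (asm) ennreal_le_iff) (auto simp: B'_def)
  also have "\<dots> \<le> B' / c"
  proof -
    have "0 < 2 * (c / 2 + 1)" using mult_pos_pos[OF zero_less_numeral add_pos_pos[OF half.c_pos one]] .
    then have "0 \<le> half.spread 1 / (2 * (c / 2 + 1))" by (intro divide_nonneg_pos half.spread_nonneg)
    then show ?thesis by simp
  qed
  also have "\<dots> \<le> ((3 / 8) * B + (3 / 4) * N2) / c"
    using B' less_imp_le[OF c_pos] by (intro divide_right_mono)
  finally have main: "H - (real DIM('a) / 2) * ln 2 + N2 / (2 * c) \<le> ((3 / 8) * B + (3 / 4) * N2) / c" by (simp add: H')
  have "((3 / 8) * B + (3 / 4) * N2) / c = 3 * (B / (8 * c)) + 3 * (N2 / (4 * c))" by (simp add: add_divide_distrib)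
  moreover have "B / (2 * c) = 4 * (B / (8 * c))" "N2 / (2 * c) = 2 * (N2 / (4 * c))" by simp_all
  ultimately show ?thesis using main unfolding H_def[symmetric] B_def[symmetric] N2_def[symmetric] by argo
qed

end

section \<open>From small spread to small expectation of |W|\<close>

context score_field
begin

text \<open>Integrating \<open>W_law\<close> over y at any one time, here 1, gives E[W] = E[X] - c
  E[Z], and the noise is centered because its density is even.\<close>

lemma expectation_W: "(\<integral>x. W x \<partial>\<mu>) = (\<integral>x. x \<partial>\<mu>)"
proof (rule euclidean_eqI)
  fix b :: 'a assume b: "b \<in> Basis"
  have t: "(1::real) > 0" by simp
  have odd: "(\<integral>(x, y). (y - x) \<bullet> b \<partial>joint 1) = 0"
  proof -
    have "(\<integral>(x, y). (y - x) \<bullet> b \<partial>joint 1) = (\<integral>z. z \<bullet> b \<partial>distr (joint 1) borel (\<lambda>(x, y). y - x))"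
      by (subst integral_distr) (auto simp: case_prod_unfold)
    also have "\<dots> = (\<integral>z. heat_kernel 1 z * (z \<bullet> b) \<partial>lborel)"
      unfolding distr_joint_diff[OF t] by (subst integral_density) auto
    also have "\<dots> = (\<integral>z. heat_kernel 1 (0 - z) * ((0 - z) \<bullet> b) \<partial>lborel)"
      by (rule integral_lborel_reflect[symmetric]) measurable
    also have "\<dots> = - (\<integral>z. heat_kernel 1 z * (z \<bullet> b) \<partial>lborel)" by simp
    finally show ?thesis
      using \<open>(\<integral>z. z \<bullet> b \<partial>distr (joint 1) borel (\<lambda>(x, y). y - x)) = (\<integral>z. heat_kernel 1 z * (z \<bullet> b) \<partial>lborel)\<close>
        \<open>(\<integral>(x, y). (y - x) \<bullet> b \<partial>joint 1) = (\<integral>z. z \<bullet> b \<partial>distr (joint 1) borel (\<lambda>(x, y). y - x))\<close> by simp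
  qed
  have iW: "integrable (joint 1) (\<lambda>(x, y). W x \<bullet> b)"
    using integrable_W by (intro integrable_joint_fst) auto
  have iX: "integrable (joint 1) (\<lambda>(x, y). x \<bullet> b)"
    using integrable_id by (intro integrable_joint_fst) auto
  have iZ: "integrable (joint 1) (\<lambda>(x, y). (y - x) \<bullet> b)"
    using joint_diff_sq(1)[OF t] integrable_joint_const[OF t]
    by (intro joint_inner[of "\<lambda>x y. y - x" "\<lambda>x y. b"]) (auto simp: case_prod_unfold)
  have iXZ: "integrable (joint 1) (\<lambda>(x, y). (x - c *\<^sub>R (y - x)) \<bullet> b)"
    using Bochner_Integration.integrable_diff[OF iX integrable_mult_right[OF iZ, of c]]
    by (simp add: case_prod_unfold inner_diff_left)
  have "(\<integral>(x, y). W x \<bullet> b \<partial>joint 1) = (\<integral>(x, y). (x - c *\<^sub>R (y - x)) \<bullet> b \<partial>joint 1)"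
    unfolding joint_disintegrate(2)[OF iW] joint_disintegrate(2)[OF iXZ]
  proof (rule Bochner_Integration.integral_cong[OF refl])
    fix y :: 'a
    have "(\<integral>x. heat_kernel 1 (y - x) *\<^sub>R W x \<partial>\<mu>) \<bullet> b = (\<integral>x. heat_kernel 1 (y - x) *\<^sub>R (x - c *\<^sub>R (y - x)) \<partial>\<mu>) \<bullet> b"
      using W_law[OF t, of y] by simp
    moreover have "integrable \<mu> (\<lambda>x. x - c *\<^sub>R (y - x))" using integrable_id by simp
    ultimately show "(\<integral>x. heat_kernel 1 (y - x) * (W x \<bullet> b) \<partial>\<mu>)
        = (\<integral>x. heat_kernel 1 (y - x) * ((x - c *\<^sub>R (y - x)) \<bullet> b) \<partial>\<mu>)"
      using integrable_kernel[OF t integrable_W, of y] integrable_kernel[OF t, of "\<lambda>x. x - c *\<^sub>R (y - x)" y]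
      by (simp add: integral_inner_left[symmetric])
  qed
  also have "\<dots> = (\<integral>z. (case z of (x, y) \<Rightarrow> x \<bullet> b) - c * (case z of (x, y) \<Rightarrow> (y - x) \<bullet> b) \<partial>joint 1)"
    by (intro Bochner_Integration.integral_cong) (auto simp: inner_diff_left)
  also have "\<dots> = (\<integral>(x, y). x \<bullet> b \<partial>joint 1)"
    using Bochner_Integration.integral_diff[OF iX integrable_mult_right[OF iZ, of c]] odd by simp
  finally have "(\<integral>x. W x \<bullet> b \<partial>\<mu>) = (\<integral>x. x \<bullet> b \<partial>\<mu>)"
    using integral_joint_fst[OF t, of "\<lambda>x. W x \<bullet> b"] integral_joint_fst[OF t, of "\<lambda>x. x \<bullet> b"] by simp
  then show "(\<integral>x. W x \<partial>\<mu>) \<bullet> b = (\<integral>x. x \<partial>\<mu>) \<bullet> b"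
    using integrable_W integrable_id by simp
qed

text \<open>As W has mean zero, |W(x)| is at most the average of |W(x) - W(x')|. The part of this
  difference seen through the Gaussian weight is controlled by \<open>spread\<close>; the rest is of
  order t^(-1/2) by the second moments. The free parameter l comes from Young's inequality.\<close>

lemma expectation_norm_W_le:
  assumes centered: "(\<integral>x. x \<partial>\<mu>) = 0" and t: "t > 0" and l: "l > 0"
  shows "(\<integral>x. norm (W x) \<partial>\<mu>) \<le> l / 2 + 2 powr (real DIM('a) / 2) * spread t / l
    + 2 * ((\<integral>x. (norm x)\<^sup>2 \<partial>\<mu>) + (\<integral>x. (norm (W x))\<^sup>2 \<partial>\<mu>)) / sqrt (8 * t)"
proof -
  interpret two: pair_prob_space \<mu> \<mu> ..
  let ?MM = "\<mu> \<Otimes>\<^sub>M \<mu>"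
  define D d e where "D = (\<lambda>z. norm (W (fst z) - W (snd z)))"
    and "d = (\<lambda>z::'a \<times> 'a. norm (fst z - snd z))"
    and "e = (\<lambda>z. exp (- (d z)\<^sup>2 / (4 * t)) * (D z)\<^sup>2)"
  have int: "integrable ?MM (\<lambda>z. (D z)\<^sup>2)" "integrable ?MM (\<lambda>z. (d z)\<^sup>2)" "integrable ?MM e"
    using two_diff_sq(1)[OF W_measurable W_sq] two_diff_sq(1)[of "\<lambda>x. x"] second_moment integrable_spread[OF t]
    by (simp_all add: D_def d_def e_def case_prod_unfold)
  have bnd: "(\<integral>z. (D z)\<^sup>2 \<partial>?MM) \<le> 4 * (\<integral>x. (norm (W x))\<^sup>2 \<partial>\<mu>)" "(\<integral>z. (d z)\<^sup>2 \<partial>?MM) \<le> 4 * (\<integral>x. (norm x)\<^sup>2 \<partial>\<mu>)"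
    using two_diff_sq(2)[OF W_measurable W_sq] two_diff_sq(2)[of "\<lambda>x. x"] second_moment
    by (simp_all add: D_def d_def case_prod_unfold)
  have spr: "(\<integral>z. e z \<partial>?MM) = 2 * 2 powr (real DIM('a) / 2) * spread t"
    by (simp add: spread_def e_def D_def d_def case_prod_unfold powr_minus field_simps)
  define s where "s = sqrt (8 * t)"
  have s: "s > 0" "s\<^sup>2 = 8 * t" using t by (auto simp: s_def)
  have pw: "D z \<le> l / 2 + e z / (2 * l) + ((d z)\<^sup>2 + (D z)\<^sup>2) / (2 * s)" for z
  proof -
    \<comment> \<open>\<open>u\<close> is the square root of the weight in \<open>spread\<close>, so
      that \<open>e z\<close> is the square of u D.\<close>
    define u where "u = exp (- (d z)\<^sup>2 / (8 * t))"
    have u: "0 < u" "u \<le> 1" using t by (auto simp: u_def)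
    have "u\<^sup>2 = exp (- (d z)\<^sup>2 / (4 * t))"
      unfolding u_def power2_eq_square exp_add[symmetric] by (simp add: field_simps)
    then have e_eq: "e z = (u * D z)\<^sup>2" by (simp add: e_def power_mult_distrib)
    have D0: "D z \<ge> 0" "d z \<ge> 0" by (auto simp: D_def d_def)
    have "2 * (u * D z) * l \<le> (u * D z)\<^sup>2 + l\<^sup>2" by (rule sum_squares_bound)
    then have 1: "u * D z \<le> l / 2 + e z / (2 * l)"
      using l by (simp add: e_eq field_simps power2_eq_square)
    \<comment> \<open>With r = d / sqrt (8 t), the number 1 - exp (- r^2) is at most 1 and at most
      r^2, hence at most r.\<close>
    have "1 - u \<le> d z / s"
    proof (cases "d z / s \<le> 1")
      case True
      have "1 - u \<le> (d z)\<^sup>2 / (8 * t)" using exp_ge_add_one_self[of "- (d z)\<^sup>2 / (8 * t)"] by (simp add: u_def)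
      also have "\<dots> = (d z / s)\<^sup>2" using s by (simp add: power_divide)
      also have "\<dots> \<le> d z / s" unfolding power2_eq_square using True s D0 by (intro mult_left_le) auto
      finally show ?thesis .
    qed (use u in auto)
    then have "(1 - u) * D z \<le> d z / s * D z" using D0 by (intro mult_right_mono) auto
    also have "\<dots> \<le> ((d z)\<^sup>2 + (D z)\<^sup>2) / (2 * s)"
      using sum_squares_bound[of "d z" "D z"] s by (simp add: field_simps)
    finally show ?thesis using 1 by (simp add: algebra_simps)
  qed
  have iD: "integrable ?MM D"
  proof (rule Bochner_Integration.integrable_bound)
    show "integrable ?MM (\<lambda>z. l / 2 + e z / (2 * l) + ((d z)\<^sup>2 + (D z)\<^sup>2) / (2 * s))" using int by simp
    show "D \<in> borel_measurable ?MM" unfolding D_def by measurable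
    show "AE z in ?MM. norm (D z) \<le> norm (l / 2 + e z / (2 * l) + ((d z)\<^sup>2 + (D z)\<^sup>2) / (2 * s))"
    proof (rule AE_I2)
      fix z
      have "norm (D z) = D z" by (simp add: D_def)
      with pw[of z] show "norm (D z) \<le> norm (l / 2 + e z / (2 * l) + ((d z)\<^sup>2 + (D z)\<^sup>2) / (2 * s))"
        using abs_ge_self order_trans unfolding real_norm_def by (metis (no_types))
    qed
  qed
  have "norm (W x) \<le> (\<integral>x'. norm (W x - W x') \<partial>\<mu>)" for x
  proof -
    have "W x = (\<integral>x'. W x - W x' \<partial>\<mu>)"
      using integrable_W expectation_W centered by simp
    then have "norm (W x) = norm (\<integral>x'. W x - W x' \<partial>\<mu>)" by simp
    also have "\<dots> \<le> (\<integral>x'. norm (W x - W x') \<partial>\<mu>)" by (rule integral_norm_bound)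
    finally show ?thesis .
  qed
  then have "(\<integral>x. norm (W x) \<partial>\<mu>) \<le> (\<integral>x. (\<integral>x'. norm (W x - W x') \<partial>\<mu>) \<partial>\<mu>)"
    using two.integrable_fst'[OF iD] integrable_W by (intro integral_mono) (auto simp: D_def)
  also have "\<dots> = (\<integral>z. D z \<partial>?MM)"
    using two.integral_fst'[OF iD] by (simp add: D_def)
  also have "\<dots> \<le> (\<integral>z. l / 2 + e z / (2 * l) + ((d z)\<^sup>2 + (D z)\<^sup>2) / (2 * s) \<partial>?MM)"
    using int pw by (intro integral_mono iD) auto
  also have "\<dots> = l / 2 + (\<integral>z. e z \<partial>?MM) / (2 * l) + ((\<integral>z. (d z)\<^sup>2 \<partial>?MM) + (\<integral>z. (D z)\<^sup>2 \<partial>?MM)) / (2 * s)"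
    using int two.prob_space by simp
  also have "\<dots> \<le> l / 2 + (\<integral>z. e z \<partial>?MM) / (2 * l)
      + (4 * (\<integral>x. (norm x)\<^sup>2 \<partial>\<mu>) + 4 * (\<integral>x. (norm (W x))\<^sup>2 \<partial>\<mu>)) / (2 * s)"
    using bnd s by (intro add_left_mono divide_right_mono add_mono) auto
  also have "\<dots> = l / 2 + 2 powr (real DIM('a) / 2) * spread t / l
    + 2 * ((\<integral>x. (norm x)\<^sup>2 \<partial>\<mu>) + (\<integral>x. (norm (W x))\<^sup>2 \<partial>\<mu>)) / sqrt (8 * t)"
    unfolding spr s_def using l t by (simp add: field_simps)
  finally show ?thesis .
qed

end

section \<open>Stability in \<open>L\<^sup>1\<close>\<close>

text \<open>Cutting the segment into N pieces leaves a quadratic error of total size C |y' - y|^2 /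
  N. A one-sided tangent inequality thus becomes a Lipschitz estimate without a mean value
  theorem.\<close>

lemma segment_quadratic_error:
  fixes F :: "'a::real_normed_vector \<Rightarrow> real"
  assumes S: "convex S" "y \<in> S" "y' \<in> S"
    and F: "\<And>u v. u \<in> S \<Longrightarrow> v \<in> S \<Longrightarrow> F v \<ge> F u - L * norm (v - u) - C * (norm (v - u))\<^sup>2"
  shows "F y' \<ge> F y - L * norm (y' - y)"
proof -
  define d where "d = y' - y"
  have bound: "F y - L * norm d - C * (norm d)\<^sup>2 / real N \<le> F y'" if N: "N > 0" for N :: nat
  proof -
    have "F y - k * (L * norm d / N + C * (norm d)\<^sup>2 / (real N)\<^sup>2) \<le> F (y + (real k / N) *\<^sub>R d)" if "k \<le> N" for k :: nat
      using that
    proof (induction k)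
      case (Suc k)
      have mem: "y + (real j / N) *\<^sub>R d \<in> S" if "j \<le> N" for j :: nat
      proof -
        have "(1 - real j / N) *\<^sub>R y + (real j / N) *\<^sub>R y' \<in> S"
          using S that N by (intro convexD) auto
        then show ?thesis by (simp add: d_def algebra_simps)
      qed
      have diff: "y + (real (Suc k) / N) *\<^sub>R d - (y + (real k / N) *\<^sub>R d) = (1 / N) *\<^sub>R d"
        by (simp add: scaleR_left_distrib[symmetric] scaleR_diff_left[symmetric] add_divide_distrib)
      have "F (y + (real k / N) *\<^sub>R d) - (L * norm d / N + C * (norm d)\<^sup>2 / (real N)\<^sup>2) \<le> F (y + (real (Suc k) / N) *\<^sub>R d)"
        using F[OF mem mem, of k "Suc k"] Suc.prems unfolding diff by (simp add: power_divide)
      moreover have "F y - k * (L * norm d / N + C * (norm d)\<^sup>2 / (real N)\<^sup>2) \<le> F (y + (real k / N) *\<^sub>R d)"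
        using Suc by simp
      moreover have "b - real (Suc k) * e \<le> d" if "a - e \<le> d" "b - real k * e \<le> a" for a b d e :: real
        using that by (simp add: algebra_simps)
      ultimately show ?case by blast
    qed simp
    from this[of N] have "F y - N * (L * norm d / N + C * (norm d)\<^sup>2 / (real N)\<^sup>2) \<le> F y'"
      using N by (simp add: d_def)
    moreover have "N * (L * norm d / N + C * (norm d)\<^sup>2 / (real N)\<^sup>2) = L * norm d + C * (norm d)\<^sup>2 / real N"
      using N by (simp add: distrib_left power2_eq_square[of "real N"])
    ultimately show ?thesis by simp
  qed
  have "(\<lambda>N. F y - L * norm d - C * (norm d)\<^sup>2 / real N) \<longlonglongrightarrow> F y - L * norm d - 0"
    by (intro tendsto_intros lim_const_over_n)
  then show ?thesis
    using bound unfolding d_def[symmetric]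
    by (intro tendsto_upperbound) (auto intro: eventually_mono[OF eventually_gt_at_top[of 0]])
qed

context score_field
begin

lemma norm_expectation_kernel_W_le:
  assumes t: "t > 0"
  shows "norm (smoothed t y *\<^sub>R posterior t y) \<le> (2 * pi * t) powr (- (real DIM('a) / 2)) * (\<integral>x. norm (W x) \<partial>\<mu>)"
proof -
  have "norm (smoothed t y *\<^sub>R posterior t y) \<le> (\<integral>x. norm (heat_kernel t (y - x) *\<^sub>R W x) \<partial>\<mu>)"
    unfolding integral_kernel_W[OF t, symmetric] by (rule integral_norm_bound)
  also have "\<dots> \<le> (\<integral>x. (2 * pi * t) powr (- (real DIM('a) / 2)) * norm (W x) \<partial>\<mu>)"
    using integrable_kernel[OF t integrable_W, of y] integrable_W
    by (intro integral_mono integrable_norm) (auto intro!: mult_right_mono heat_kernel_le[OF t])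
  finally show ?thesis by simp
qed

text \<open>Jensen's inequality for exp: the average of the kernel is at least its value at the
  average exponent \<open>E\<close>, which the second moment bounds from below.\<close>

lemma smoothed_lower_bound:
  assumes t: "t > 0"
  shows "smoothed t y \<ge> (2 * pi * t) powr (- (real DIM('a) / 2)) * exp (- ((norm y)\<^sup>2 + (\<integral>x. (norm x)\<^sup>2 \<partial>\<mu>)) / t)"
proof -
  define q where "q = smoothed t y"
  define E where "E = (\<integral>x. - (norm (x - y))\<^sup>2 / (2 * t) \<partial>\<mu>)"
  let ?K = "(2 * pi * t) powr (- (real DIM('a) / 2))"
  have E: "E \<ge> - ((norm y)\<^sup>2 + (\<integral>x. (norm x)\<^sup>2 \<partial>\<mu>)) / t"
  proof -
    have "(norm (x - y))\<^sup>2 \<le> 2 * (norm x)\<^sup>2 + 2 * (norm y)\<^sup>2" for x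
    proof -
      have "(norm (x - y))\<^sup>2 + (norm (x + y))\<^sup>2 = 2 * (norm x)\<^sup>2 + 2 * (norm y)\<^sup>2"
        by (simp add: power2_norm_eq_inner inner_diff_left inner_diff_right inner_add_left inner_add_right inner_commute)
      then show ?thesis using zero_le_power2[of "norm (x + y)"] by linarith
    qed
    then have "(\<integral>x. (norm (x - y))\<^sup>2 \<partial>\<mu>) \<le> (\<integral>x. 2 * (norm x)\<^sup>2 + 2 * (norm y)\<^sup>2 \<partial>\<mu>)"
      using second_moment integrable_diff_sq by (intro integral_mono) auto
    also have "\<dots> = 2 * ((norm y)\<^sup>2 + (\<integral>x. (norm x)\<^sup>2 \<partial>\<mu>))"
      using second_moment by simp
    finally have "- (2 * ((norm y)\<^sup>2 + (\<integral>x. (norm x)\<^sup>2 \<partial>\<mu>))) / (2 * t) \<le> - (\<integral>x. (norm (x - y))\<^sup>2 \<partial>\<mu>) / (2 * t)"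
      using t by (intro divide_right_mono) auto
    moreover have "- (2 * X) / (2 * t) = - X / t" for X using t by simp
    ultimately have "- ((norm y)\<^sup>2 + (\<integral>x. (norm x)\<^sup>2 \<partial>\<mu>)) / t \<le> - (\<integral>x. (norm (x - y))\<^sup>2 \<partial>\<mu>) / (2 * t)"
      by (simp only:)
    then show ?thesis by (simp add: E_def)
  qed
  have i: "integrable \<mu> (\<lambda>x. - (norm (x - y))\<^sup>2 / (2 * t))" using integrable_diff_sq[of y] by simp
  have "?K * exp E * 1 \<le> q"
  proof -
    have "?K * exp E * (1 + (- (norm (x - y))\<^sup>2 / (2 * t) - E)) \<le> heat_kernel t (y - x)" for x
    proof -
      have "exp E * (1 + (- (norm (x - y))\<^sup>2 / (2 * t) - E)) \<le> exp E * exp (- (norm (x - y))\<^sup>2 / (2 * t) - E)"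
        by (intro mult_left_mono exp_ge_add_one_self) auto
      also have "\<dots> = exp (- (norm (y - x))\<^sup>2 / (2 * t))" by (simp add: exp_add[symmetric] norm_minus_commute)
      finally show ?thesis unfolding heat_kernel_def mult.assoc by (intro mult_left_mono) auto
    qed
    then have "(\<integral>x. ?K * exp E * (1 + (- (norm (x - y))\<^sup>2 / (2 * t) - E)) \<partial>\<mu>) \<le> q"
      unfolding q_def smoothed_def using i integrable_kernel_1[OF t, of y] by (intro integral_mono) auto
    also have "(\<integral>x. ?K * exp E * (1 + (- (norm (x - y))\<^sup>2 / (2 * t) - E)) \<partial>\<mu>) = ?K * exp E * (1 + (E - E))"
    proof -
      define U where "U x = - (norm (x - y))\<^sup>2 / (2 * t)" for x
      have "integrable \<mu> U" "(\<integral>x. U x \<partial>\<mu>) = E" using i unfolding U_def E_def by auto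
      then have "(\<integral>x. ?K * exp E * (1 + (U x - E)) \<partial>\<mu>) = ?K * exp E * (1 + (E - E))" by simp
      then show ?thesis unfolding U_def .
    qed
    finally show ?thesis by simp
  qed
  moreover have "?K * exp (- ((norm y)\<^sup>2 + (\<integral>x. (norm x)\<^sup>2 \<partial>\<mu>)) / t) \<le> ?K * exp E"
    using E by (intro mult_left_mono) auto
  ultimately show ?thesis by (simp add: q_def)
qed

text \<open>The gradient of ln (\<open>smoothed t\<close> / \<open>heat_kernel (c + t)\<close>) is
  \<open>posterior t\<close> / (c + t). On the ball of radius R it is at most a multiple of E|W|,
  the prefactor (2 pi t)^(-n/2) cancelling between the kernel bound and
  \<open>smoothed_lower_bound\<close>.\<close>

lemma ln_ratio_oscillation:
  assumes t: "t > 0" and R: "norm y \<le> R" and M: "(\<integral>x. (norm x)\<^sup>2 \<partial>\<mu>) \<le> M"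
  shows "\<bar>ln (smoothed t y / heat_kernel (c + t) y) - ln (smoothed t 0 / heat_kernel (c + t) (0::'a))\<bar>
    \<le> exp ((R\<^sup>2 + M) / t) / (c + t) * R * (\<integral>x. norm (W x) \<partial>\<mu>)"
proof -
  define F where "F y = ln (smoothed t y / heat_kernel (c + t) y)" for y
  define L where "L = exp ((R\<^sup>2 + M) / t) / (c + t) * (\<integral>x. norm (W x) \<partial>\<mu>)"
  let ?K = "(2 * pi * t) powr (- (real DIM('a) / 2))"
  have ct: "c + t > 0" using t by (simp add: add_pos_pos)
  have EW: "(\<integral>x. norm (W x) \<partial>\<mu>) \<ge> 0" by (intro integral_nonneg_AE) auto
  have L: "L \<ge> 0" using EW ct by (auto simp: L_def intro!: mult_nonneg_nonneg)
  have F_eq: "F y = ln (smoothed t y) - ln (heat_kernel (c + t) (0::'a)) + (norm y)\<^sup>2 / (2 * (c + t))" for y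
  proof -
    have "F y = ln (smoothed t y) - ln (heat_kernel (c + t) y)"
      unfolding F_def using smoothed_pos[OF t, of y] heat_kernel_pos[OF ct, of y] by (simp add: ln_div less_imp_neq[symmetric])
    also have "ln (heat_kernel (c + t) y) = ln (heat_kernel (c + t) (0::'a)) - (norm y)\<^sup>2 / (2 * (c + t))"
      unfolding heat_kernel_def using ct by (simp add: ln_mult)
    finally show ?thesis by simp
  qed
  have post: "norm (posterior t u) \<le> (c + t) * L" if "norm u \<le> R" for u
  proof -
    have q: "smoothed t u > 0" by (rule smoothed_pos[OF t])
    have "(norm u)\<^sup>2 \<le> R\<^sup>2" using that by (intro power_mono) auto
    then have "?K * exp (- (R\<^sup>2 + M) / t) \<le> ?K * exp (- ((norm u)\<^sup>2 + (\<integral>x. (norm x)\<^sup>2 \<partial>\<mu>)) / t)"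
      using M t by (intro mult_left_mono) (auto simp: divide_right_mono)
    also have "\<dots> \<le> smoothed t u" by (rule smoothed_lower_bound[OF t])
    finally have low: "?K * exp (- (R\<^sup>2 + M) / t) \<le> smoothed t u" .
    have "?K * exp (- (R\<^sup>2 + M) / t) * norm (posterior t u) \<le> smoothed t u * norm (posterior t u)"
      using low by (intro mult_right_mono) auto
    also have "\<dots> \<le> ?K * (\<integral>x. norm (W x) \<partial>\<mu>)"
      using norm_expectation_kernel_W_le[OF t, of u] q by simp
    finally have "?K * (exp (- (R\<^sup>2 + M) / t) * norm (posterior t u)) \<le> ?K * (\<integral>x. norm (W x) \<partial>\<mu>)"
      by (simp add: mult.assoc)
    then have "exp (- (R\<^sup>2 + M) / t) * norm (posterior t u) \<le> (\<integral>x. norm (W x) \<partial>\<mu>)"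
      using t by (simp add: mult_le_cancel_left_pos)
    then have "exp ((R\<^sup>2 + M) / t) * (exp (- (R\<^sup>2 + M) / t) * norm (posterior t u))
        \<le> exp ((R\<^sup>2 + M) / t) * (\<integral>x. norm (W x) \<partial>\<mu>)"
      by (intro mult_left_mono) auto
    also have "exp ((R\<^sup>2 + M) / t) * (exp (- (R\<^sup>2 + M) / t) * norm (posterior t u)) = norm (posterior t u)"
    proof -
      have "(R\<^sup>2 + M) / t + - (R\<^sup>2 + M) / t = 0" by (simp only: minus_divide_left[symmetric] right_minus)
      then show ?thesis unfolding mult.assoc[symmetric] exp_add[symmetric] by (simp only:) simp
    qed
    finally show ?thesis using ct by (simp add: L_def)
  qed
  \<comment> \<open>Tangent inequality for the log ratio: the quadratic term from the Gaussian
    denominator is convex, so it contributes only its own linear part, and the two linear parts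
    combine into the posterior.\<close>
  have step: "F v \<ge> F u - L * norm (v - u) - (1 / (2 * t)) * (norm (v - u))\<^sup>2" if "u \<in> cball 0 R" "v \<in> cball 0 R" for u v
  proof -
    have u: "norm u \<le> R" using that by simp
    have "(norm v)\<^sup>2 \<ge> (norm u)\<^sup>2 + 2 * (u \<bullet> (v - u))"
    proof -
      have "(norm v)\<^sup>2 = (norm u)\<^sup>2 + 2 * (u \<bullet> (v - u)) + (norm (v - u))\<^sup>2"
        by (simp add: power2_norm_eq_inner inner_diff_left inner_diff_right inner_commute)
      then show ?thesis using zero_le_power2[of "norm (v - u)"] by linarith
    qed
    then have "(norm v)\<^sup>2 / (2 * (c + t)) \<ge> ((norm u)\<^sup>2 + 2 * (u \<bullet> (v - u))) / (2 * (c + t))"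
      using ct by (intro divide_right_mono) auto
    then have 1: "(norm v)\<^sup>2 / (2 * (c + t)) \<ge> (norm u)\<^sup>2 / (2 * (c + t)) + (u \<bullet> (v - u)) / (c + t)"
    proof -
      have "(A + 2 * B) / (2 * P) = A / (2 * P) + B / P" for A B P :: real by (simp add: add_divide_distrib)
      with \<open>(norm v)\<^sup>2 / (2 * (c + t)) \<ge> ((norm u)\<^sup>2 + 2 * (u \<bullet> (v - u))) / (2 * (c + t))\<close>
      show ?thesis by (simp only:)
    qed
    have 2: "score t u \<bullet> (v - u) + (u \<bullet> (v - u)) / (c + t) = (posterior t u \<bullet> (v - u)) / (c + t)"
      using ct by (simp add: posterior_def inner_add_left add_divide_distrib)
    have "\<bar>posterior t u \<bullet> (v - u)\<bar> \<le> norm (posterior t u) * norm (v - u)" by (rule Cauchy_Schwarz_ineq2)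
    also have "\<dots> \<le> (c + t) * L * norm (v - u)" using post[OF u] by (intro mult_right_mono) auto
    finally have "- ((c + t) * (L * norm (v - u))) \<le> posterior t u \<bullet> (v - u)" by (simp add: abs_le_iff mult.assoc)
    then have "- ((c + t) * (L * norm (v - u))) / (c + t) \<le> (posterior t u \<bullet> (v - u)) / (c + t)"
      using ct by (intro divide_right_mono) auto
    then have 3: "- (L * norm (v - u)) \<le> (posterior t u \<bullet> (v - u)) / (c + t)" using ct by simp
    show ?thesis unfolding F_eq using ln_smoothed_tangent[OF t, of u v] 1 2 3 by simp
  qed
  have mem: "y \<in> cball 0 R" "0 \<in> cball (0::'a) R" using R norm_ge_zero[of y] by (auto simp del: norm_ge_zero intro: order_trans)
  have "F 0 \<ge> F y - L * norm (0 - y)"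
    by (rule segment_quadratic_error[OF convex_cball mem step])
  moreover have "F y \<ge> F 0 - L * norm (y - 0)"
    by (rule segment_quadratic_error[OF convex_cball mem(2) mem(1) step])
  moreover have "L * norm y \<le> L * R" using L R by (intro mult_left_mono)
  ultimately have "\<bar>F y - F 0\<bar> \<le> L * R" by simp
  then show ?thesis by (simp add: F_def L_def mult_ac)
qed

text \<open>\<open>c *\<^sub>R score t y\<close> is the conditional mean of W - X given Y = y, as
  the difference of E[W | Y] = y + (c + t) score and E[X | Y] = y + t score. Hence the bound is
  uniform in t, unlike the trivial one of order 1 / sqrt t.\<close>

lemma expectation_smoothed_score_le:
  assumes t: "t > 0"
  shows "integrable lborel (\<lambda>y. smoothed t y * norm (score t y))"
    and "(\<integral>y. smoothed t y * norm (score t y) \<partial>lborel) \<le> ((\<integral>x. norm (W x) \<partial>\<mu>) + (\<integral>x. norm x \<partial>\<mu>)) / c"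
proof -
  define h where "h x = (norm (W x) + norm x) / c" for x
  have [measurable]: "h \<in> borel_measurable borel" unfolding h_def by measurable
  have ih: "integrable \<mu> h" unfolding h_def using integrable_W integrable_id by simp
  note ij = integrable_joint_fst[OF t ih]
  have pw: "smoothed t y * norm (score t y) \<le> (\<integral>x. heat_kernel t (y - x) * h x \<partial>\<mu>)" for y
  proof -
    note ik = integrable_kernel[OF t integrable_W, of y] integrable_kernel[OF t integrable_id, of y]
    have x: "(\<integral>x. heat_kernel t (y - x) *\<^sub>R x \<partial>\<mu>) = (t * smoothed t y) *\<^sub>R score t y + smoothed t y *\<^sub>R y"
    proof -
      have "(\<integral>x. heat_kernel t (y - x) *\<^sub>R x \<partial>\<mu>) = (\<integral>x. heat_kernel t (y - x) *\<^sub>R (x - y) + heat_kernel t (y - x) *\<^sub>R y \<partial>\<mu>)"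
        by (simp add: scaleR_diff_right)
      also have "\<dots> = (t * smoothed t y) *\<^sub>R score t y + smoothed t y *\<^sub>R y"
        using integrable_kernel_diff[OF t, of y] integrable_kernel_1[OF t, of y]
        by (subst Bochner_Integration.integral_add) (simp_all add: integral_kernel_diff[OF t] smoothed_def)
      finally show ?thesis .
    qed
    have "(\<integral>x. heat_kernel t (y - x) *\<^sub>R (W x - x) \<partial>\<mu>) = (c * smoothed t y) *\<^sub>R score t y"
      using ik by (simp add: scaleR_diff_right integral_kernel_W[OF t] x posterior_def algebra_simps)
    then have "c * (smoothed t y * norm (score t y)) = norm (\<integral>x. heat_kernel t (y - x) *\<^sub>R (W x - x) \<partial>\<mu>)"
      using smoothed_pos[OF t, of y] less_imp_le[OF c_pos] by (simp add: abs_mult)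
    also have "\<dots> \<le> (\<integral>x. norm (heat_kernel t (y - x) *\<^sub>R (W x - x)) \<partial>\<mu>)" by (rule integral_norm_bound)
    also have "\<dots> \<le> (\<integral>x. c * (heat_kernel t (y - x) * h x) \<partial>\<mu>)"
    proof (rule integral_mono)
      show "integrable \<mu> (\<lambda>x. norm (heat_kernel t (y - x) *\<^sub>R (W x - x)))"
        using integrable_kernel[OF t, of "\<lambda>x. W x - x" y] integrable_W integrable_id by (intro integrable_norm) auto
      show "integrable \<mu> (\<lambda>x. c * (heat_kernel t (y - x) * h x))"
        using integrable_kernel_real[OF t ih] by simp
      fix x
      have "norm (W x - x) \<le> c * h x" using norm_triangle_ineq4[of "W x" x] less_imp_neq[OF c_pos] by (simp add: h_def)
      then have "heat_kernel t (y - x) * norm (W x - x) \<le> heat_kernel t (y - x) * (c * h x)"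
        by (intro mult_left_mono) auto
      then show "norm (heat_kernel t (y - x) *\<^sub>R (W x - x)) \<le> c * (heat_kernel t (y - x) * h x)"
        by (simp add: mult_ac)
    qed
    also have "\<dots> = c * (\<integral>x. heat_kernel t (y - x) * h x \<partial>\<mu>)" by simp
    finally show ?thesis by (rule mult_left_le_imp_le[OF _ c_pos])
  qed
  have nn: "0 \<le> smoothed t y * norm (score t y)" for y using smoothed_pos[OF t, of y] by simp
  show i: "integrable lborel (\<lambda>y. smoothed t y * norm (score t y))"
  proof (rule Bochner_Integration.integrable_bound[OF joint_disintegrate(1)[OF ij]])
    show "AE y in lborel. norm (smoothed t y * norm (score t y)) \<le> norm (\<integral>x. heat_kernel t (y - x) * h x \<partial>\<mu>)"
      using pw nn by (intro AE_I2) (simp add: order_trans[OF _ abs_ge_self] abs_of_nonneg del: abs_mult)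
  qed measurable
  have "(\<integral>y. smoothed t y * norm (score t y) \<partial>lborel) \<le> (\<integral>y. (\<integral>x. heat_kernel t (y - x) * h x \<partial>\<mu>) \<partial>lborel)"
    using pw by (intro integral_mono i joint_disintegrate(1)[OF ij])
  also have "\<dots> = (\<integral>x. h x \<partial>\<mu>)"
    unfolding joint_disintegrate(2)[OF ij, symmetric] by (rule integral_joint_fst[OF t]) measurable
  also have "\<dots> = ((\<integral>x. norm (W x) \<partial>\<mu>) + (\<integral>x. norm x \<partial>\<mu>)) / c"
    unfolding h_def using integrable_W integrable_id by simp
  finally show "(\<integral>y. smoothed t y * norm (score t y) \<partial>lborel) \<le> ((\<integral>x. norm (W x) \<partial>\<mu>) + (\<integral>x. norm x \<partial>\<mu>)) / c" .
qed

end

text \<open>The shift distance is subadditive in w, so N shifts by w / N reduce the quadratic term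
  to order 1 / N.\<close>

lemma shift_dist_iterate:
  fixes q :: "'a::euclidean_space \<Rightarrow> real"
  assumes q: "integrable lborel q"
    and a: "a \<ge> 0" and step: "\<And>d. (\<integral>y. \<bar>q (y + d) - q y\<bar> \<partial>lborel) \<le> a * norm d + b * (norm d)\<^sup>2"
  shows "(\<integral>y. \<bar>q (y + w) - q y\<bar> \<partial>lborel) \<le> a * norm w"
proof -
  have [measurable]: "q \<in> borel_measurable borel" using q by auto
  note sh = integrable_lborel_shift[OF q]
  let ?D = "\<lambda>w. (\<integral>y. \<bar>q (y + w) - q y\<bar> \<partial>lborel)"
  have tri: "?D (u + v) \<le> ?D u + ?D v" for u v
  proof -
    have s2: "integrable lborel (\<lambda>y. q (y + v + u))" using sh[of "v + u"] by (simp add: add.assoc)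
    have "?D (u + v) = (\<integral>y. \<bar>q (y + v + u) - q y\<bar> \<partial>lborel)" by (simp add: add_ac)
    also have "\<dots> \<le> (\<integral>y. \<bar>q (y + v + u) - q (y + v)\<bar> + \<bar>q (y + v) - q y\<bar> \<partial>lborel)"
      using q sh s2 by (intro integral_mono) auto
    also have "\<dots> = (\<integral>y. \<bar>q (y + v + u) - q (y + v)\<bar> \<partial>lborel) + ?D v"
      using q sh s2 by (intro Bochner_Integration.integral_add) auto
    also have "(\<integral>y. \<bar>q (y + v + u) - q (y + v)\<bar> \<partial>lborel) = ?D u"
      by (rule integral_lborel_shift[where f="\<lambda>y. \<bar>q (y + u) - q y\<bar>"]) measurable
    finally show ?thesis .
  qed
  have bound: "?D w \<le> a * norm w + b * (norm w)\<^sup>2 / real N" if N: "N > 0" for N :: nat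
  proof -
    define d where "d = (1 / real N) *\<^sub>R w"
    have "?D (real k *\<^sub>R d) \<le> k * ?D d" for k :: nat
    proof (induction k)
      case (Suc k)
      then show ?case using tri[of "real k *\<^sub>R d" d] by (simp add: algebra_simps)
    qed simp
    from this[of N] have "?D w \<le> N * ?D d" using N by (simp add: d_def)
    also have "\<dots> \<le> N * (a * norm d + b * (norm d)\<^sup>2)" using step[of d] by (intro mult_left_mono) auto
    also have "\<dots> = a * norm w + b * (norm w)\<^sup>2 / real N"
      using N by (simp add: d_def power_divide power2_eq_square field_simps)
    finally show ?thesis .
  qed
  have "(\<lambda>N. a * norm w + b * (norm w)\<^sup>2 / real N) \<longlonglongrightarrow> a * norm w + 0"
    by (intro tendsto_intros lim_const_over_n)
  then have "?D w \<le> a * norm w + 0"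
    by (rule tendsto_lowerbound) (auto intro: eventually_mono[OF eventually_gt_at_top[of 0] bound])
  then show ?thesis by simp
qed

context score_density
begin

text \<open>Dominates the L^1 norm of grad p, because formally c grad p = p (W - x).\<close>

definition variation :: real where
  "variation = ((\<integral>x. norm (W x) \<partial>\<mu>) + (\<integral>x. norm x \<partial>\<mu>)) / c"

lemma variation_nonneg: "variation \<ge> 0"
  unfolding variation_def by (intro divide_nonneg_pos add_nonneg_nonneg integral_nonneg_AE) auto

text \<open>The tangent inequality bounds only the drop
  \<open>smoothed t y - smoothed t (y + d)\<close> from above. Both functions have the same
  integral, so the L^1 distance is twice the integral of the positive part of the drop, whence the
  factor 2.\<close>

lemma smoothed_shift_dist:
  assumes t: "t > 0"
  shows "(\<integral>y. \<bar>smoothed t (y + w) - smoothed t y\<bar> \<partial>lborel) \<le> (2 * variation) * norm w"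
proof (rule shift_dist_iterate[OF smoothed_mass(1)[OF t], where b="1 / t"])
  show "0 \<le> 2 * variation" using variation_nonneg by simp
  fix d :: 'a
  let ?q = "smoothed t"
  note iq = smoothed_mass[OF t] integrable_lborel_shift[OF smoothed_mass(1)[OF t]] expectation_smoothed_score_le[OF t]
  have pw: "\<bar>?q (y + d) - ?q y\<bar> \<le> 2 * (norm d * (?q y * norm (score t y)) + (norm d)\<^sup>2 / (2 * t) * ?q y) + (?q (y + d) - ?q y)" for y
  proof -
    define u where "u = score t y \<bullet> d - (norm d)\<^sup>2 / (2 * t)"
    have q: "?q y > 0" "?q (y + d) > 0" using smoothed_pos[OF t] by auto
    have "ln (?q y) + u \<le> ln (?q (y + d))" using ln_smoothed_tangent[OF t, of y "y + d"] by (simp add: u_def)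
    then have "exp (ln (?q y) + u) \<le> ?q (y + d)" using q by (simp add: ln_ge_iff)
    then have "?q y * exp u \<le> ?q (y + d)" using q by (simp add: exp_add)
    moreover have "?q y * (1 + u) \<le> ?q y * exp u" using q by (intro mult_left_mono exp_ge_add_one_self) auto
    ultimately have 1: "?q y - ?q (y + d) \<le> ?q y * (- u)" by (simp add: algebra_simps)
    have "- u \<le> norm (score t y) * norm d + (norm d)\<^sup>2 / (2 * t)"
      using Cauchy_Schwarz_ineq2[of "score t y" d] by (simp add: u_def abs_le_iff)
    then have "?q y * (- u) \<le> ?q y * (norm (score t y) * norm d + (norm d)\<^sup>2 / (2 * t))"
      using q by (intro mult_left_mono) auto
    with 1 have 2: "?q y - ?q (y + d) \<le> norm d * (?q y * norm (score t y)) + (norm d)\<^sup>2 / (2 * t) * ?q y"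
      by (simp add: algebra_simps)
    have 3: "0 \<le> norm d * (?q y * norm (score t y)) + (norm d)\<^sup>2 / (2 * t) * ?q y"
      using q t by (intro add_nonneg_nonneg mult_nonneg_nonneg) auto
    have "\<bar>b - a\<bar> \<le> 2 * X + (b - a)" if "a - b \<le> X" "0 \<le> X" for a b X :: real
      using that by linarith
    from this[OF 2 3] show ?thesis .
  qed
  have "(\<integral>y. \<bar>?q (y + d) - ?q y\<bar> \<partial>lborel)
      \<le> (\<integral>y. 2 * (norm d * (?q y * norm (score t y)) + (norm d)\<^sup>2 / (2 * t) * ?q y) + (?q (y + d) - ?q y) \<partial>lborel)"
    using iq pw by (intro integral_mono) auto
  also have "\<dots> = 2 * (norm d * (\<integral>y. ?q y * norm (score t y) \<partial>lborel) + (norm d)\<^sup>2 / (2 * t))"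
  proof -
    have "integrable lborel (\<lambda>y. norm d * (?q y * norm (score t y)))" "integrable lborel (\<lambda>y. (norm d)\<^sup>2 / (2 * t) * ?q y)"
      using iq by auto
    moreover have "(\<integral>y. ?q (y + d) \<partial>lborel) = 1" using integral_lborel_shift[of ?q d] iq by simp
    ultimately show ?thesis using iq by simp
  qed
  also have "\<dots> \<le> 2 * (norm d * variation + (norm d)\<^sup>2 / (2 * t))"
    using iq by (intro mult_left_mono add_right_mono) (auto simp: variation_def)
  also have "\<dots> = 2 * variation * norm d + 1 / t * (norm d)\<^sup>2" using t by (simp add: field_simps)
  finally show "(\<integral>y. \<bar>?q (y + d) - ?q y\<bar> \<partial>lborel) \<le> 2 * variation * norm d + 1 / t * (norm d)\<^sup>2" .
qed

lemma density_shift_dist: "(\<integral>y. \<bar>p (y + w) - p y\<bar> \<partial>lborel) \<le> (2 * variation) * norm w"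
proof -
  define T :: "nat \<Rightarrow> real" where "T j = 1 / (Suc j)" for j
  have T: "T \<longlonglongrightarrow> 0" "\<And>j. T j > 0" unfolding T_def by (rule LIMSEQ_Suc[OF lim_1_over_n]) simp
  have "(\<integral>y. \<bar>p (y + w) - p y\<bar> \<partial>lborel) \<le> (2 * variation) * norm w + 2 * (\<integral>y. \<bar>smoothed (T j) y - p y\<bar> \<partial>lborel)" for j
    using integral_abs_shift_triangle[OF integrable_p smoothed_mass(1)[OF T(2)], of w j]
      smoothed_shift_dist[OF T(2), of j w] by (simp add: abs_minus_commute)
  moreover have "(\<lambda>j. (2 * variation) * norm w + 2 * (\<integral>y. \<bar>smoothed (T j) y - p y\<bar> \<partial>lborel)) \<longlonglongrightarrow> (2 * variation) * norm w + 2 * 0"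
    by (intro tendsto_intros smoothed_L1_tendsto T)
  ultimately show ?thesis by (intro tendsto_lowerbound[where F=sequentially]) auto
qed

lemma density_smoothed_dist:
  assumes t: "t > 0"
  shows "(\<integral>y. \<bar>smoothed t y - p y\<bar> \<partial>lborel) \<le> variation * (1 + real DIM('a)) * sqrt t"
proof -
  define s where "s = sqrt t"
  have s: "s > 0" "s * s = t" using t by (auto simp: s_def)
  have "(\<integral>y. \<bar>smoothed t y - p y\<bar> \<partial>lborel) \<le> variation * s + variation / s * (real DIM('a) * t)"
  proof (rule smoothed_L1_dist[OF t])
    fix w :: 'a
    \<comment> \<open>Young's inequality with s = sqrt t recasts the linear modulus in the quadratic
      form required by \<open>smoothed_L1_dist\<close>; with this s both resulting terms are of
      order sqrt t.\<close>
    have "2 * norm w \<le> s + (norm w)\<^sup>2 / s"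
      using sum_squares_bound[of "norm w" s] s by (simp add: field_simps power2_eq_square)
    then have "variation * (2 * norm w) \<le> variation * (s + (norm w)\<^sup>2 / s)"
      using variation_nonneg by (intro mult_left_mono)
    then show "(\<integral>y. \<bar>p (y + w) - p y\<bar> \<partial>lborel) \<le> variation * s + variation / s * (norm w)\<^sup>2"
      using density_shift_dist[of w] by (simp add: algebra_simps)
  qed (use variation_nonneg s in auto)
  also have "\<dots> = variation * (1 + real DIM('a)) * s" using s(1) unfolding s(2)[symmetric] by (simp add: field_simps)
  finally show ?thesis by (simp add: s_def)
qed

end

section \<open>From local convergence to convergence in L^1\<close>

text \<open>Scheffe's device: for equal masses only the positive part of g - f has to be integrated,
  and if f >= 0 <= g that part is dominated by g.\<close>

lemma L1_dist_via_positive_part: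
  fixes f g :: "'a \<Rightarrow> real"
  assumes "integrable M f" "integrable M g"
  shows "(\<integral>y. \<bar>f y - g y\<bar> \<partial>M) = 2 * (\<integral>y. max 0 (g y - f y) \<partial>M) + ((\<integral>y. f y \<partial>M) - (\<integral>y. g y \<partial>M))"
proof -
  have i: "integrable M (\<lambda>y. max 0 (g y - f y))" using assms by simp
  have "(\<integral>y. \<bar>f y - g y\<bar> \<partial>M) = (\<integral>y. 2 * max 0 (g y - f y) + (f y - g y) \<partial>M)"
    by (intro Bochner_Integration.integral_cong) (auto simp: max_def)
  also have "\<dots> = 2 * (\<integral>y. max 0 (g y - f y) \<partial>M) + ((\<integral>y. f y \<partial>M) - (\<integral>y. g y \<partial>M))"
    using assms i by simp
  finally show ?thesis .
qed

text \<open>Densities that are asymptotically proportional to \<open>g\<close>, locally uniformly, could a priori lose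
  mass at infinity; the second moment bound forces the proportionality factors \<open>q k 0 / g 0\<close> to
  tend to one.\<close>

lemma locally_proportional_imp_L1:
  fixes q :: "nat \<Rightarrow> 'a::euclidean_space \<Rightarrow> real" and g :: "'a \<Rightarrow> real"
  assumes g: "\<And>y. g y > 0" "integrable lborel g" "(\<integral>y. g y \<partial>lborel) = 1"
    and q: "\<And>k y. q k y > 0" "\<And>k. integrable lborel (q k)" "\<And>k. (\<integral>y. q k y \<partial>lborel) = 1" "\<And>k y. q k y \<le> K"
    and mom: "\<And>k. integrable lborel (\<lambda>y. q k y * (norm y)\<^sup>2)" "\<And>k. (\<integral>y. q k y * (norm y)\<^sup>2 \<partial>lborel) \<le> m"
    and loc: "\<And>y. (\<lambda>k. ln (q k y / g y) - ln (q k 0 / g 0)) \<longlonglongrightarrow> 0"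
  shows "(\<lambda>k. \<integral>y. \<bar>q k y - g y\<bar> \<partial>lborel) \<longlonglongrightarrow> 0"
proof -
  have [measurable]: "g \<in> borel_measurable borel" using g(2) by auto
  have [measurable]: "q k \<in> borel_measurable borel" for k using q(2)[of k] by auto
  \<comment> \<open>Candidates for the proportionality factors; \<open>D\<close> is the deviation of
    q from exact proportionality, and its integral is 1 - A.\<close>
  define A where "A k = q k 0 / g 0" for k
  define D where "D k y = q k y - A k * g y" for k y
  have [measurable]: "D k \<in> borel_measurable borel" for k unfolding D_def by measurable
  have A: "0 < A k" "A k \<le> K / g 0" for k
    using q(1)[of k 0] g(1)[of 0] q(4)[of k 0] by (auto simp: A_def divide_right_mono)
  have K: "K > 0" using q(1,4) less_le_trans by blast
  have D0: "(\<lambda>k. D k y) \<longlonglongrightarrow> 0" for y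
  proof -
    have "D k y = A k * g y * (exp (ln (q k y / g y) - ln (q k 0 / g 0)) - 1)" for k
    proof -
      have "exp (ln (q k y / g y) - ln (q k 0 / g 0)) = (q k y / g y) / A k"
        using q(1) g(1) by (simp add: exp_diff A_def)
      then show ?thesis using A(1)[of k] g(1)[of y] by (simp add: D_def right_diff_distrib)
    qed
    moreover have "(\<lambda>k. A k * g y * (exp (ln (q k y / g y) - ln (q k 0 / g 0)) - 1)) \<longlonglongrightarrow> 0"
    proof (rule Lim_null_comparison)
      show "\<forall>\<^sub>F k in sequentially. norm (A k * g y * (exp (ln (q k y / g y) - ln (q k 0 / g 0)) - 1))
          \<le> K / g 0 * g y * \<bar>exp (ln (q k y / g y) - ln (q k 0 / g 0)) - 1\<bar>"
      proof (intro always_eventually allI)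
        fix k
        define E where "E = exp (ln (q k y / g y) - ln (q k 0 / g 0)) - 1"
        have "A k * g y * \<bar>E\<bar> \<le> K / g 0 * g y * \<bar>E\<bar>"
          using A(2) less_imp_le[OF g(1)] by (intro mult_right_mono) auto
        moreover have "norm (A k * g y * E) = A k * g y * \<bar>E\<bar>"
          using less_imp_le[OF A(1)] less_imp_le[OF g(1)] by (simp add: abs_mult)
        ultimately show "norm (A k * g y * (exp (ln (q k y / g y) - ln (q k 0 / g 0)) - 1))
          \<le> K / g 0 * g y * \<bar>exp (ln (q k y / g y) - ln (q k 0 / g 0)) - 1\<bar>"
          by (simp add: E_def)
      qed
      have "(\<lambda>k. K / g 0 * g y * \<bar>exp (ln (q k y / g y) - ln (q k 0 / g 0)) - 1\<bar>) \<longlonglongrightarrow> K / g 0 * g y * \<bar>exp 0 - 1\<bar>"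
        by (intro tendsto_intros loc)
      then show "(\<lambda>k. K / g 0 * g y * \<bar>exp (ln (q k y / g y) - ln (q k 0 / g 0)) - 1\<bar>) \<longlonglongrightarrow> 0" by simp
    qed
    ultimately show ?thesis by simp
  qed
  have iD: "integrable lborel (D k)" "(\<integral>y. D k y \<partial>lborel) = 1 - A k" for k
    unfolding D_def using q g by auto
  have neg_part: "(\<lambda>k. \<integral>y. max 0 (- D k y) \<partial>lborel) \<longlonglongrightarrow> (\<integral>y. 0 \<partial>(lborel :: 'a measure))"
  proof (rule integral_dominated_convergence[where w="\<lambda>y. K / g 0 * g y"])
    show "AE y in lborel. (\<lambda>k. max 0 (- D k y)) \<longlonglongrightarrow> 0"
    proof (rule AE_I2)
      fix y
      have "(\<lambda>k. max 0 (- D k y)) \<longlonglongrightarrow> max 0 (- 0)" by (intro tendsto_intros D0)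
      then show "(\<lambda>k. max 0 (- D k y)) \<longlonglongrightarrow> 0" by simp
    qed
    show "AE y in lborel. norm (max 0 (- D k y)) \<le> K / g 0 * g y" for k
    proof (rule AE_I2)
      fix y
      have "A k * g y \<le> K / g 0 * g y" using A(2) less_imp_le[OF g(1)] by (intro mult_right_mono)
      moreover have "0 \<le> K / g 0 * g y" using K g(1)[of 0] g(1)[of y] by simp
      ultimately show "norm (max 0 (- D k y)) \<le> K / g 0 * g y" using q(1)[of k y] by (simp add: D_def)
    qed
  qed (use g in auto)
  have meas: "(\<lambda>y. indicator (cball 0 R) y * max 0 (D k y)) \<in> borel_measurable borel" for k R
  proof (rule borel_measurable_times)
    show "(indicator (cball 0 R) :: 'a \<Rightarrow> real) \<in> borel_measurable borel" by (rule borel_measurable_indicator) simp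
    show "(\<lambda>y. max 0 (D k y)) \<in> borel_measurable borel"
      using borel_measurable_integrable[OF iD(1)[of k]] by (intro borel_measurable_max) auto
  qed
  have pos_local: "(\<lambda>k. \<integral>y. indicator (cball 0 R) y * max 0 (D k y) \<partial>lborel) \<longlonglongrightarrow> (\<integral>y. 0 \<partial>(lborel :: 'a measure))" for R
  proof (rule integral_dominated_convergence[where w="\<lambda>y. indicator (cball 0 R) y * K"])
    show "AE y in lborel. (\<lambda>k. indicator (cball 0 R) y * max 0 (D k y)) \<longlonglongrightarrow> 0"
    proof (rule AE_I2)
      fix y
      have "(\<lambda>k. indicator (cball 0 R) y * max 0 (D k y)) \<longlonglongrightarrow> indicator (cball 0 R) y * max 0 0"
        by (intro tendsto_intros D0)
      then show "(\<lambda>k. indicator (cball 0 R) y * max 0 (D k y)) \<longlonglongrightarrow> 0" by simp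
    qed
    show "AE y in lborel. norm (indicator (cball 0 R) y * max 0 (D k y)) \<le> indicator (cball 0 R) y * K" for k
    proof (rule AE_I2)
      fix y
      have "0 \<le> A k * g y" using A(1)[of k] g(1)[of y] by simp
      then have "max 0 (D k y) \<le> K" using q(4)[of k y] K by (simp add: D_def)
      then show "norm (indicator (cball 0 R) y * max 0 (D k y)) \<le> indicator (cball 0 R) y * K"
        by (auto split: split_indicator)
    qed
    have "emeasure lborel (cball 0 R :: 'a set) < \<infinity>" using emeasure_bounded_finite[OF bounded_cball[of 0 R]] by (simp add: top.not_eq_extremum)
    then show "integrable lborel (\<lambda>y::'a. indicator (cball 0 R) y * K)" by (simp add: integrable_indicator_iff)
  qed (use meas in auto)
  have A1: "A \<longlonglongrightarrow> 1"
  proof (rule LIMSEQ_I)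
    fix e :: real assume e: "e > 0"
    \<comment> \<open>Chebyshev: outside radius R each q k has mass at most m / R^2, which this
      choice puts below e / 2 for all k at once.\<close>
    define R where "R = sqrt (2 * (\<bar>m\<bar> + 1) / e)"
    have R: "R > 0" "R\<^sup>2 = 2 * (\<bar>m\<bar> + 1) / e" using e by (auto simp: R_def)
    have mR: "m / R\<^sup>2 < e / 2"
    proof -
      have "m / R\<^sup>2 = e / 2 * (m / (\<bar>m\<bar> + 1))" using e by (simp add: R(2) field_simps)
      also have "\<dots> < e / 2 * 1" using e by (intro mult_strict_left_mono) (auto simp: divide_less_eq)
      finally show ?thesis by simp
    qed
    have "eventually (\<lambda>k. (\<integral>y. max 0 (- D k y) \<partial>lborel) < e) sequentially"
      using neg_part e by (intro order_tendstoD(2)) auto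
    moreover have "eventually (\<lambda>k. (\<integral>y. indicator (cball 0 R) y * max 0 (D k y) \<partial>lborel) < e / 2) sequentially"
      using pos_local[of R] e by (intro order_tendstoD(2)) auto
    ultimately have "eventually (\<lambda>k. norm (A k - 1) < e) sequentially"
    proof eventually_elim
      case (elim k)
      \<comment> \<open>A - 1 is at most the integral of the negative part of \<open>D\<close>,
        which is dominated by a multiple of g. For 1 - A the positive part is controlled on the ball
        by local convergence and outside it by the second moment.\<close>
      have "A k - 1 = (\<integral>y. - D k y \<partial>lborel)" using iD[of k] by simp
      also have "\<dots> \<le> (\<integral>y. max 0 (- D k y) \<partial>lborel)" using iD(1)[of k] by (intro integral_mono) auto
      finally have up: "A k - 1 < e" using elim by simp
      have int: "integrable lborel (\<lambda>y. indicator (cball 0 R) y * max 0 (D k y))"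
        using meas by (intro Bochner_Integration.integrable_bound[OF iD(1)[of k]]) (auto split: split_indicator)
      have "1 - A k = (\<integral>y. D k y \<partial>lborel)" using iD[of k] by simp
      also have "\<dots> \<le> (\<integral>y. indicator (cball 0 R) y * max 0 (D k y) + (1 / R\<^sup>2) * (q k y * (norm y)\<^sup>2) \<partial>lborel)"
      proof (rule integral_mono)
        fix y
        show "D k y \<le> indicator (cball 0 R) y * max 0 (D k y) + (1 / R\<^sup>2) * (q k y * (norm y)\<^sup>2)"
        proof (cases "norm y \<le> R")
          case True
          have "0 \<le> (1 / R\<^sup>2) * (q k y * (norm y)\<^sup>2)" using less_imp_le[OF q(1)] by simp
          then show ?thesis using True by simp
        next
          case False
          have "R\<^sup>2 \<le> (norm y)\<^sup>2" using False R(1) by (intro power_mono) auto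
          then have "1 \<le> (1 / R\<^sup>2) * (norm y)\<^sup>2" using R(1) by simp
          then have "q k y * 1 \<le> q k y * ((1 / R\<^sup>2) * (norm y)\<^sup>2)" using less_imp_le[OF q(1)] by (intro mult_left_mono)
          moreover have "D k y \<le> q k y" using A(1)[of k] g(1)[of y] by (simp add: D_def)
          ultimately show ?thesis using False by simp
        qed
      qed (use iD int mom in auto)
      also have "\<dots> = (\<integral>y. indicator (cball 0 R) y * max 0 (D k y) \<partial>lborel) + (1 / R\<^sup>2) * (\<integral>y. q k y * (norm y)\<^sup>2 \<partial>lborel)"
        using int mom by simp
      also have "(1 / R\<^sup>2) * (\<integral>y. q k y * (norm y)\<^sup>2 \<partial>lborel) \<le> (1 / R\<^sup>2) * m"
        using mom(2) by (intro mult_left_mono) auto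
      also have "(1 / R\<^sup>2) * m = m / R\<^sup>2" by simp
      finally have "1 - A k < e" using elim mR by linarith
      with up show "norm (A k - 1) < e" by auto
    qed
    then show "\<exists>N. \<forall>k\<ge>N. norm (A k - 1) < e" by (simp add: eventually_sequentially)
  qed
  have qg: "(\<lambda>k. q k y) \<longlonglongrightarrow> g y" for y
  proof -
    have "(\<lambda>k. D k y + A k * g y) \<longlonglongrightarrow> 0 + 1 * g y" by (intro tendsto_intros D0 A1)
    then show ?thesis by (simp add: D_def)
  qed
  have "(\<lambda>k. \<integral>y. max 0 (g y - q k y) \<partial>lborel) \<longlonglongrightarrow> (\<integral>y. 0 \<partial>(lborel :: 'a measure))"
  proof (rule integral_dominated_convergence[where w=g])
    show "AE y in lborel. (\<lambda>k. max 0 (g y - q k y)) \<longlonglongrightarrow> 0"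
    proof (rule AE_I2)
      fix y
      have "(\<lambda>k. max 0 (g y - q k y)) \<longlonglongrightarrow> max 0 (g y - g y)" by (intro tendsto_intros qg)
      then show "(\<lambda>k. max 0 (g y - q k y)) \<longlonglongrightarrow> 0" by simp
    qed
    show "AE y in lborel. norm (max 0 (g y - q k y)) \<le> g y" for k
      using less_imp_le[OF q(1)] less_imp_le[OF g(1)] by (intro AE_I2) (simp add: max_def)
  qed (use g in auto)
  then have "(\<lambda>k. 2 * (\<integral>y. max 0 (g y - q k y) \<partial>lborel)) \<longlonglongrightarrow> 2 * 0" by (intro tendsto_intros) simp
  then show ?thesis using q g by (simp add: L1_dist_via_positive_part)
qed

lemma heat_kernel_L1_continuous:
  fixes c :: real
  assumes c: "c > 0" and T: "T \<longlonglongrightarrow> 0" "\<And>j. T j > 0"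
  shows "(\<lambda>j. \<integral>y. \<bar>heat_kernel (c + T j) (y::'a::euclidean_space) - heat_kernel c y\<bar> \<partial>lborel) \<longlonglongrightarrow> 0"
proof -
  have mass: "integrable lborel (heat_kernel t :: 'a \<Rightarrow> real)" "(\<integral>w. heat_kernel t (w::'a) \<partial>lborel) = 1" if "t > 0" for t
    using nn_integral_heat_kernel[OF that, where 'a='a]
    by (auto intro!: integrableI_nonneg simp: integral_eq_nn_integral)
  have cT: "c + T j > 0" for j using c T(2)[of j] by simp
  have "(\<lambda>j. \<integral>y. max 0 (heat_kernel c (y::'a) - heat_kernel (c + T j) y) \<partial>lborel) \<longlonglongrightarrow> (\<integral>y. 0 \<partial>(lborel :: 'a measure))"
  proof (rule integral_dominated_convergence[where w="heat_kernel c"])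
    show "AE y in lborel. (\<lambda>j. max 0 (heat_kernel c (y::'a) - heat_kernel (c + T j) y)) \<longlonglongrightarrow> 0"
    proof (rule AE_I2)
      fix y :: 'a
      have "(\<lambda>j. c + T j) \<longlonglongrightarrow> c + 0" by (intro tendsto_intros T)
      moreover have "isCont (\<lambda>s. heat_kernel s y) c" unfolding heat_kernel_def using c by (intro continuous_intros) auto
      ultimately have "(\<lambda>j. heat_kernel (c + T j) y) \<longlonglongrightarrow> heat_kernel c y"
        by (intro isCont_tendsto_compose[of c "\<lambda>s. heat_kernel s y"]) auto
      then have "(\<lambda>j. max 0 (heat_kernel c y - heat_kernel (c + T j) y)) \<longlonglongrightarrow> max 0 (heat_kernel c y - heat_kernel c y)"
        by (intro tendsto_intros)
      then show "(\<lambda>j. max 0 (heat_kernel c y - heat_kernel (c + T j) y)) \<longlonglongrightarrow> 0" by simp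
    qed
    show "AE y in lborel. norm (max 0 (heat_kernel c (y::'a) - heat_kernel (c + T j) y)) \<le> heat_kernel c y" for j
      by (intro AE_I2) (simp add: max_def)
  qed (use mass[OF c] in auto)
  then have "(\<lambda>j. 2 * (\<integral>y. max 0 (heat_kernel c (y::'a) - heat_kernel (c + T j) y) \<partial>lborel)) \<longlonglongrightarrow> 2 * 0"
    by (intro tendsto_intros) simp
  then show ?thesis using mass[OF c] mass[OF cT] by (simp add: L1_dist_via_positive_part)
qed

text \<open>The order of the choices matters: the oscillation bound at noise t has a factor
  exponential in 1 / t, so t is fixed first, small enough for the smoothing error, which is uniform
  in k; only then does k tend to infinity.\<close>

theorem score_to_zero_imp_L1:
  fixes \<mu> :: "nat \<Rightarrow> 'a::euclidean_space measure"
  assumes sd: "\<And>k. score_density (\<mu> k) c (W k) (p k)"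
    and M: "\<And>k. (\<integral>x. (norm x)\<^sup>2 \<partial>\<mu> k) \<le> M"
    and W0: "(\<lambda>k. \<integral>x. norm (W k x) \<partial>\<mu> k) \<longlonglongrightarrow> 0"
  shows "(\<lambda>k. \<integral>y. \<bar>p k y - heat_kernel c y\<bar> \<partial>lborel) \<longlonglongrightarrow> 0"
proof -
  interpret sd: score_density "\<mu> k" c "W k" "p k" for k by (rule sd)
  have c: "c > 0" by (rule sd.c_pos)
  define q where "q t k = gaussian_channel.smoothed (\<mu> k) t" for t k
  have q_eq: "q t k = sd.smoothed k t" for t k by (simp add: q_def)
  define S where "S k = score_density.variation (\<mu> k) c (W k)" for k
  \<comment> \<open>A bound on the variation uniform in k: E|W| converges along the sequence, and
    E|X| <= 1 + E|X|^2.\<close>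
  obtain B where B: "\<And>k. S k \<le> B"
  proof -
    have "Bseq (\<lambda>k. \<integral>x. norm (W k x) \<partial>\<mu> k)" using W0 by (intro convergent_imp_Bseq) (auto simp: convergent_def)
    then obtain b where b: "\<And>k. \<bar>\<integral>x. norm (W k x) \<partial>\<mu> k\<bar> \<le> b" by (auto simp: Bseq_def)
    have "S k \<le> (b + (1 + M)) / c" for k
    proof -
      have "(\<integral>x. norm x \<partial>\<mu> k) \<le> (\<integral>x. 1 + (norm x)\<^sup>2 \<partial>\<mu> k)"
      proof (rule integral_mono)
        fix x :: 'a
        show "norm x \<le> 1 + (norm x)\<^sup>2" using sum_squares_bound[of "norm x" 1] norm_ge_zero[of x]
          by (simp only: mult_1_right power_one)
      qed (use sd.integrable_id[of k] sd.second_moment[of k] in auto)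
      also have "\<dots> \<le> 1 + M" using M[of k] sd.second_moment[of k] by simp
      finally show ?thesis using b[of k] less_imp_le[OF c] unfolding S_def sd.variation_def
        by (intro divide_right_mono add_mono) (auto simp only: abs_le_iff)
    qed
    then show ?thesis using that by blast
  qed
  have fixed: "(\<lambda>k. \<integral>y. \<bar>q t k y - heat_kernel (c + t) y\<bar> \<partial>lborel) \<longlonglongrightarrow> 0" if t: "t > 0" for t
  proof (rule locally_proportional_imp_L1)
    have ct: "c + t > 0" using t by (simp add: add_pos_pos)
    show "heat_kernel (c + t) (y::'a) > 0" for y using ct by simp
    show "integrable lborel (heat_kernel (c + t) :: 'a \<Rightarrow> real)" "(\<integral>w. heat_kernel (c + t) (w::'a) \<partial>lborel) = 1"
      using nn_integral_heat_kernel[OF ct, where 'a='a]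
      by (auto intro!: integrableI_nonneg simp: integral_eq_nn_integral)
    show "q t k y > 0" for k y unfolding q_eq by (rule sd.smoothed_pos[OF t])
    show "integrable lborel (q t k)" "(\<integral>y. q t k y \<partial>lborel) = 1" for k
      unfolding q_eq by (rule sd.smoothed_mass[OF t])+
    show "q t k y \<le> (2 * pi * t) powr (- (real DIM('a) / 2))" for k y
      unfolding q_eq by (rule sd.smoothed_le[OF t])
    show "integrable lborel (\<lambda>y. q t k y * (norm y)\<^sup>2)" for k
      unfolding q_eq by (rule sd.smoothed_second_moment[OF t])
    show "(\<integral>y. q t k y * (norm y)\<^sup>2 \<partial>lborel) \<le> M + real DIM('a) * t" for k
      unfolding q_eq sd.smoothed_second_moment(2)[OF t] using M[of k] by simp
    fix y :: 'a
    show "(\<lambda>k. ln (q t k y / heat_kernel (c + t) y) - ln (q t k 0 / heat_kernel (c + t) (0::'a))) \<longlonglongrightarrow> 0"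
    proof (rule Lim_null_comparison)
      show "\<forall>\<^sub>F k in sequentially. norm (ln (q t k y / heat_kernel (c + t) y) - ln (q t k 0 / heat_kernel (c + t) (0::'a)))
          \<le> exp (((norm y)\<^sup>2 + M) / t) / (c + t) * norm y * (\<integral>x. norm (W k x) \<partial>\<mu> k)"
        unfolding q_eq real_norm_def
        by (intro always_eventually allI sd.ln_ratio_oscillation[OF t order_refl M])
      have "(\<lambda>k. exp (((norm y)\<^sup>2 + M) / t) / (c + t) * norm y * (\<integral>x. norm (W k x) \<partial>\<mu> k))
          \<longlonglongrightarrow> exp (((norm y)\<^sup>2 + M) / t) / (c + t) * norm y * 0"
        by (rule tendsto_mult_left[OF W0])
      then show "(\<lambda>k. exp (((norm y)\<^sup>2 + M) / t) / (c + t) * norm y * (\<integral>x. norm (W k x) \<partial>\<mu> k)) \<longlonglongrightarrow> 0" by simp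
    qed
  qed
  define T :: "nat \<Rightarrow> real" where "T j = 1 / (Suc j)" for j
  have T: "T \<longlonglongrightarrow> 0" "\<And>j. T j > 0" unfolding T_def by (rule LIMSEQ_Suc[OF lim_1_over_n]) simp
  show ?thesis
  proof (rule LIMSEQ_I)
    fix e :: real assume e: "e > 0"
    have "(\<lambda>j. B * (1 + real DIM('a)) * sqrt (T j)) \<longlonglongrightarrow> B * (1 + real DIM('a)) * sqrt 0"
      by (intro tendsto_intros T)
    then have "eventually (\<lambda>j. B * (1 + real DIM('a)) * sqrt (T j) < e / 3) sequentially"
      using e by (intro order_tendstoD(2)) auto
    moreover have "eventually (\<lambda>j. (\<integral>y. \<bar>heat_kernel (c + T j) (y::'a) - heat_kernel c y\<bar> \<partial>lborel) < e / 3) sequentially"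
      using heat_kernel_L1_continuous[OF c T, where 'a='a] e by (intro order_tendstoD(2)) auto
    ultimately have "eventually (\<lambda>j. B * (1 + real DIM('a)) * sqrt (T j) < e / 3 \<and>
        (\<integral>y. \<bar>heat_kernel (c + T j) (y::'a) - heat_kernel c y\<bar> \<partial>lborel) < e / 3) sequentially"
      by eventually_elim simp
    then obtain j where j: "B * (1 + real DIM('a)) * sqrt (T j) < e / 3"
        "(\<integral>y. \<bar>heat_kernel (c + T j) (y::'a) - heat_kernel c y\<bar> \<partial>lborel) < e / 3"
      by (auto simp: eventually_sequentially)
    define t where "t = T j"
    have t: "t > 0" by (simp add: t_def T)
    have ct: "c + t > 0" using t by (simp add: add_pos_pos)
    have mass: "integrable lborel (heat_kernel s :: 'a \<Rightarrow> real)" if "s > 0" for s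
      using nn_integral_heat_kernel[OF that, where 'a='a] by (auto intro!: integrableI_nonneg)
    have "eventually (\<lambda>k. (\<integral>y. \<bar>q t k y - heat_kernel (c + t) y\<bar> \<partial>lborel) < e / 3) sequentially"
      using fixed[OF t] e by (intro order_tendstoD(2)) auto
    then have "eventually (\<lambda>k. norm ((\<integral>y. \<bar>p k y - heat_kernel c y\<bar> \<partial>lborel) - 0) < e) sequentially"
    proof eventually_elim
      case (elim k)
      have iq: "integrable lborel (q t k)" unfolding q_eq by (rule sd.smoothed_mass[OF t])
      note i = iq sd.integrable_p[of k] mass[OF c] mass[OF ct]
      have "(\<integral>y. \<bar>q t k y - p k y\<bar> \<partial>lborel) \<le> S k * (1 + real DIM('a)) * sqrt t"
        unfolding q_eq S_def by (rule sd.density_smoothed_dist[OF t])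
      also have "\<dots> \<le> B * (1 + real DIM('a)) * sqrt t"
        using B[of k] t by (intro mult_right_mono) auto
      finally have 1: "(\<integral>y. \<bar>q t k y - p k y\<bar> \<partial>lborel) < e / 3" using j(1) by (simp add: t_def)
      have "(\<integral>y. \<bar>p k y - heat_kernel c y\<bar> \<partial>lborel)
          \<le> (\<integral>y. \<bar>q t k y - p k y\<bar> + (\<bar>q t k y - heat_kernel (c + t) y\<bar> + \<bar>heat_kernel (c + t) y - heat_kernel c y\<bar>) \<partial>lborel)"
        using i by (intro integral_mono) auto
      also have "\<dots> = (\<integral>y. \<bar>q t k y - p k y\<bar> \<partial>lborel) + ((\<integral>y. \<bar>q t k y - heat_kernel (c + t) y\<bar> \<partial>lborel)
          + (\<integral>y. \<bar>heat_kernel (c + t) (y::'a) - heat_kernel c y\<bar> \<partial>lborel))"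
        using i by simp
      also have "\<dots> < e" using 1 elim j(2) by (simp add: t_def)
      finally have "(\<integral>y. \<bar>p k y - heat_kernel c y\<bar> \<partial>lborel) < e" .
      moreover have "0 \<le> (\<integral>y. \<bar>p k y - heat_kernel c y\<bar> \<partial>lborel)" by (intro integral_nonneg_AE) auto
      ultimately show ?case by simp
    qed
    then show "\<exists>N. \<forall>k\<ge>N. norm ((\<integral>y. \<bar>p k y - heat_kernel c y\<bar> \<partial>lborel) - 0) < e"
      by (simp add: eventually_sequentially)
  qed
qed

section \<open>Weak gradients tested against Gaussians\<close>

text \<open>The powers of 1 / s are carried along so that the family is closed under differentiation
  up to linear combinations, also at the flat point 0.\<close>

definition flat_exp :: "nat \<Rightarrow> real \<Rightarrow> real" where
  "flat_exp m s = (if s > 0 then exp (- (1 / s)) / s ^ m else 0)"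

lemma flat_exp_pos: "s > 0 \<Longrightarrow> flat_exp m s = exp (- (1 / s)) / s ^ m"
  and flat_exp_nonpos: "s \<le> 0 \<Longrightarrow> flat_exp m s = 0"
  by (auto simp: flat_exp_def)

lemma flat_exp_tendsto_0: "(flat_exp m \<longlongrightarrow> 0) (at 0)"
proof (rule filterlim_split_at)
  have "eventually (\<lambda>s. flat_exp m s = 0) (at_left (0::real))"
    by (auto simp: eventually_at_filter flat_exp_nonpos intro!: always_eventually)
  then show "(flat_exp m \<longlongrightarrow> 0) (at_left 0)" by (rule tendsto_eventually)
  have "((\<lambda>s::real. (inverse s) ^ m / exp (inverse s)) \<longlongrightarrow> 0) (at_right 0)"
    by (rule filterlim_compose[OF tendsto_power_div_exp_0 filterlim_inverse_at_top_right])
  moreover have "eventually (\<lambda>s. (inverse s) ^ m / exp (inverse s) = flat_exp m s) (at_right (0::real))"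
    by (auto simp: eventually_at_filter flat_exp_pos exp_minus field_simps intro!: always_eventually)
  ultimately show "(flat_exp m \<longlongrightarrow> 0) (at_right 0)" by (rule Lim_transform_eventually)
qed

lemma flat_exp_has_derivative:
  "(flat_exp m has_real_derivative (flat_exp (m + 2) s - m * flat_exp (m + 1) s)) (at s)"
proof (cases s "0::real" rule: linorder_cases)
  case less
  have zero: "((\<lambda>_. 0) has_real_derivative 0) (at s)" by simp
  have "(flat_exp m has_real_derivative 0) (at s)"
    by (rule has_field_derivative_transform_within_open[OF zero, where S="{..<0}"]) (use less in \<open>auto simp: flat_exp_nonpos\<close>)
  then show ?thesis using less by (simp add: flat_exp_nonpos)
next
  case equal
  have "((\<lambda>h. (flat_exp m (0 + h) - flat_exp m 0) / h) \<longlongrightarrow> 0) (at 0)"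
  proof (rule Lim_transform_eventually[OF flat_exp_tendsto_0[of "Suc m"]])
    show "eventually (\<lambda>h. flat_exp (Suc m) h = (flat_exp m (0 + h) - flat_exp m 0) / h) (at 0)"
      by (auto simp: eventually_at_filter flat_exp_def intro!: always_eventually)
  qed
  then show ?thesis unfolding DERIV_def using equal by (simp add: flat_exp_nonpos)
next
  case greater
  have "((\<lambda>s. exp (- (1 / s)) / s ^ m) has_real_derivative (flat_exp (m + 2) s - m * flat_exp (m + 1) s)) (at s)"
  proof -
    have "((\<lambda>s. exp (- (1 / s)) * inverse (s ^ m)) has_real_derivative
        (exp (- (1 / s)) * (1 / s ^ 2)) * inverse (s ^ m)
        + exp (- (1 / s)) * (- (inverse (s ^ m) * (real m * s ^ (m - 1)) * inverse (s ^ m)))) (at s)"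
      using greater by (auto intro!: derivative_eq_intros simp: power2_eq_square)
    moreover have "(exp (- (1 / s)) * (1 / s ^ 2)) * inverse (s ^ m)
        + exp (- (1 / s)) * (- (inverse (s ^ m) * (real m * s ^ (m - 1)) * inverse (s ^ m)))
        = flat_exp (m + 2) s - m * flat_exp (m + 1) s"
      using greater by (cases m) (simp_all add: flat_exp_pos power_add power2_eq_square divide_inverse algebra_simps)
    ultimately show ?thesis by (simp add: divide_inverse)
  qed
  then show ?thesis
    using greater by (elim has_field_derivative_transform_within_open[where S="{0<..}"]) (auto simp: flat_exp_pos)
qed

text \<open>Smoothness is established by coinduction, so it needs a class of functions closed under
  directional derivatives that contains Gaussians and compactly supported cutoffs.\<close>

inductive elementary :: "('a::euclidean_space \<Rightarrow> real) \<Rightarrow> bool" where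
  const: "elementary (\<lambda>_. a)"
| inner: "elementary (\<lambda>x. x \<bullet> w)"
| add: "elementary f \<Longrightarrow> elementary g \<Longrightarrow> elementary (\<lambda>x. f x + g x)"
| mult: "elementary f \<Longrightarrow> elementary g \<Longrightarrow> elementary (\<lambda>x. f x * g x)"
| exp: "elementary f \<Longrightarrow> elementary (\<lambda>x. exp (f x))"
| flat_exp: "elementary f \<Longrightarrow> elementary (\<lambda>x. flat_exp m (f x))"

lemma elementary_derivative:
  assumes "elementary f"
  shows "\<exists>D. (\<forall>x. (f has_derivative D x) (at x)) \<and> (\<forall>v. elementary (\<lambda>x. D x v))"
  using assms
proof induction
  case (const a)
  show ?case by (rule exI[of _ "\<lambda>_ _. 0"]) (auto intro: elementary.const)
next
  case (inner w)
  show ?case by (rule exI[of _ "\<lambda>_ v. v \<bullet> w"]) (auto intro!: derivative_eq_intros elementary.const)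
next
  case (add f g)
  then obtain D E where "\<And>x. (f has_derivative D x) (at x)" "\<And>v. elementary (\<lambda>x. D x v)"
    "\<And>x. (g has_derivative E x) (at x)" "\<And>v. elementary (\<lambda>x. E x v)" by blast
  then show ?case
    by (intro exI[of _ "\<lambda>x v. D x v + E x v"]) (auto intro!: derivative_intros elementary.add)
next
  case (mult f g)
  then obtain D E where "\<And>x. (f has_derivative D x) (at x)" "\<And>v. elementary (\<lambda>x. D x v)"
    "\<And>x. (g has_derivative E x) (at x)" "\<And>v. elementary (\<lambda>x. E x v)" by blast
  with mult.hyps show ?case
    by (intro exI[of _ "\<lambda>x v. f x * E x v + D x v * g x"])
      (auto intro!: has_derivative_mult elementary.add elementary.mult)
next
  case (exp f)
  then obtain D where D: "\<And>x. (f has_derivative D x) (at x)" "\<And>v. elementary (\<lambda>x. D x v)" by blast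
  have "((\<lambda>x. exp (f x)) has_derivative (\<lambda>v. exp (f x) * D x v)) (at x)" for x
    using has_derivative_exp[OF D(1)] by (simp add: mult.commute)
  then show ?case using D(2) exp.hyps
    by (intro exI[of _ "\<lambda>x v. exp (f x) * D x v"]) (auto intro!: elementary.mult elementary.exp)
next
  case (flat_exp f m)
  then obtain D where D: "\<And>x. (f has_derivative D x) (at x)" "\<And>v. elementary (\<lambda>x. D x v)" by blast
  let ?D = "\<lambda>x v. (flat_exp (m + 2) (f x) + (- real m) * flat_exp (m + 1) (f x)) * D x v"
  have "((\<lambda>x. flat_exp m (f x)) has_derivative ?D x) (at x)" for x
    using DERIV_compose_FDERIV[OF flat_exp_has_derivative D(1)] by (simp add: mult.commute)
  moreover have "elementary (\<lambda>x. ?D x v)" for v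
    using D(2) flat_exp.hyps by (intro elementary.mult elementary.add elementary.const elementary.flat_exp)
  ultimately show ?case by (intro exI[of _ ?D] conjI allI)
qed

lemma smooth_elementary: "elementary f \<Longrightarrow> smooth f"
proof (coinduction arbitrary: f rule: smooth.coinduct)
  case (smooth f)
  then obtain D where D: "\<And>x. (f has_derivative D x) (at x)" "\<And>v. elementary (\<lambda>x. D x v)"
    using elementary_derivative by blast
  have "frechet_derivative f (at x) = D x" for x using frechet_derivative_at[OF D(1)] by simp
  then show ?case using D by (auto simp: differentiable_def)
qed

lemma elementary_sum: "finite A \<Longrightarrow> (\<And>i. i \<in> A \<Longrightarrow> elementary (f i)) \<Longrightarrow> elementary (\<lambda>x. \<Sum>i\<in>A. f i x)"
  by (induction A rule: finite_induct) (auto intro: elementary.intros)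

lemma elementary_norm_sq: "elementary (\<lambda>x. (norm x)\<^sup>2)"
  unfolding norm_power2_eq_sum unfolding power2_eq_square by (intro elementary_sum elementary.intros) simp

text \<open>All three coefficients are free so that the family contains its products with translated
  heat kernels, see \<open>heat_kernel_mult_gaussian\<close>.\<close>

definition gaussian :: "real \<Rightarrow> 'a::euclidean_space \<Rightarrow> real \<Rightarrow> 'a \<Rightarrow> real" where
  "gaussian a \<beta> d x = exp (- a * (norm x)\<^sup>2 + x \<bullet> \<beta> + d)"

text \<open>The bump exp (1 - 1 / (1 - |x|^2 / R^2)) inside the ball of radius R; the factor exp 1
  makes it equal to 1 at the center.\<close>

definition cutoff :: "real \<Rightarrow> 'a::euclidean_space \<Rightarrow> real" where
  "cutoff R x = exp 1 * flat_exp 0 (1 - (1 / R\<^sup>2) * (norm x)\<^sup>2)"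

lemma gaussian_pos [simp]: "gaussian a \<beta> d x > 0" by (simp add: gaussian_def)

lemma borel_measurable_gaussian [measurable]: "gaussian a \<beta> d \<in> borel_measurable borel"
  unfolding gaussian_def by measurable

lemma elementary_gaussian: "elementary (gaussian a \<beta> d)"
  unfolding gaussian_def[abs_def]
  by (intro elementary.exp elementary.add elementary.mult elementary.const elementary.inner elementary_norm_sq)

lemma elementary_cutoff: "elementary (cutoff R)"
proof -
  have "elementary (\<lambda>x::'a. exp 1 * flat_exp 0 (1 + (- (1 / R\<^sup>2)) * (norm x)\<^sup>2))"
    by (intro elementary.flat_exp elementary.add elementary.mult elementary.const elementary_norm_sq)
  then show ?thesis unfolding cutoff_def[abs_def] by (simp add: algebra_simps)
qed

lemma norm_sq_has_derivative: "((\<lambda>x::'a::euclidean_space. (norm x)\<^sup>2) has_derivative (\<lambda>v. 2 * (x \<bullet> v))) (at x)"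
  unfolding power2_norm_eq_inner by (auto intro!: derivative_eq_intros simp: inner_commute)

lemma gaussian_has_derivative:
  "(gaussian a \<beta> d has_derivative (\<lambda>v. gaussian a \<beta> d x * ((\<beta> - (2 * a) *\<^sub>R x) \<bullet> v))) (at x)"
proof -
  have "((\<lambda>x. - a * (norm x)\<^sup>2 + x \<bullet> \<beta> + d) has_derivative (\<lambda>v. (\<beta> - (2 * a) *\<^sub>R x) \<bullet> v)) (at x)"
    by (auto intro!: derivative_eq_intros norm_sq_has_derivative simp: inner_diff_left inner_diff_right inner_commute)
  from has_derivative_exp[OF this] show ?thesis
    unfolding gaussian_def[abs_def] by (simp add: mult.commute)
qed

lemma cutoff_has_derivative:
  "(cutoff R has_derivative (\<lambda>v. exp 1 * (flat_exp 2 (1 - (1 / R\<^sup>2) * (norm x)\<^sup>2) * (- (2 / R\<^sup>2) * (x \<bullet> v))))) (at x)"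
proof -
  have "((\<lambda>x. 1 - (1 / R\<^sup>2) * (norm x)\<^sup>2) has_derivative (\<lambda>v. - (2 / R\<^sup>2) * (x \<bullet> v))) (at x)"
  proof -
    have "((\<lambda>x::'a. 1 - K * (norm x)\<^sup>2) has_derivative (\<lambda>v. - (2 * K) * (x \<bullet> v))) (at x)" for K
      by (auto intro!: derivative_eq_intros norm_sq_has_derivative)
    from this[of "1 / R\<^sup>2"] show ?thesis by simp
  qed
  from DERIV_compose_FDERIV[OF flat_exp_has_derivative[of 0] this]
  have "((\<lambda>x. flat_exp 0 (1 - (1 / R\<^sup>2) * (norm x)\<^sup>2)) has_derivative
      (\<lambda>v. flat_exp 2 (1 - (1 / R\<^sup>2) * (norm x)\<^sup>2) * (- (2 / R\<^sup>2) * (x \<bullet> v)))) (at x)"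
    by (simp add: numeral_2_eq_2 mult.commute)
  then show ?thesis unfolding cutoff_def[abs_def] by (rule has_derivative_mult_right)
qed

text \<open>Bounds the gradient of \<open>cutoff\<close>; the 2 comes from exp u >= u^2 / 2 with u =
  1 / s.\<close>

lemma flat_exp_2_le: "0 \<le> flat_exp 2 s" "flat_exp 2 s \<le> 2"
proof -
  show "0 \<le> flat_exp 2 s" by (simp add: flat_exp_def)
  show "flat_exp 2 s \<le> 2"
  proof (cases "s > 0")
    case True
    have "1 + 1 / s + (1 / s)\<^sup>2 / 2 \<le> exp (1 / s)" using True by (intro exp_lower_Taylor_quadratic) simp
    moreover have "0 \<le> 1 + 1 / s" using True by simp
    ultimately have le: "(1 / s)\<^sup>2 \<le> 2 * exp (1 / s)" by linarith
    have "flat_exp 2 s = exp (- (1 / s)) * (1 / s)\<^sup>2" using True by (simp add: flat_exp_pos power_divide)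
    also have "\<dots> \<le> exp (- (1 / s)) * (2 * exp (1 / s))" using le by (intro mult_left_mono) auto
    also have "\<dots> = 2" by (simp add: exp_minus)
    finally show ?thesis .
  qed (simp add: flat_exp_def)
qed

lemma cutoff_bounds: "0 \<le> cutoff R x" "cutoff R x \<le> 1"
proof -
  show "0 \<le> cutoff R x" by (simp add: cutoff_def flat_exp_def)
  have "flat_exp 0 s \<le> exp (- 1)" if "s \<le> 1" for s
    using that by (auto simp: flat_exp_def field_simps)
  then have "exp 1 * flat_exp 0 (1 - (1 / R\<^sup>2) * (norm x)\<^sup>2) \<le> exp 1 * exp (- 1)"
    by (intro mult_left_mono) auto
  then show "cutoff R x \<le> 1" by (simp add: cutoff_def exp_minus)
qed

lemma cutoff_outside: "R > 0 \<Longrightarrow> norm x \<ge> R \<Longrightarrow> cutoff R x = 0"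
proof -
  assume R: "R > 0" and x: "norm x \<ge> R"
  have "R\<^sup>2 \<le> (norm x)\<^sup>2" using R x by (intro power_mono) auto
  then have "1 - (1 / R\<^sup>2) * (norm x)\<^sup>2 \<le> 0" using R by simp
  then show ?thesis by (simp add: cutoff_def flat_exp_nonpos)
qed

lemma cutoff_tendsto: "(\<lambda>N. cutoff (real (Suc N)) x) \<longlonglongrightarrow> 1"
proof -
  have "(\<lambda>N. 1 - (1 / (real (Suc N))\<^sup>2) * (norm x)\<^sup>2) \<longlonglongrightarrow> 1 - 0\<^sup>2 * (norm x)\<^sup>2"
    unfolding power_one_over[symmetric]
    by (intro tendsto_intros LIMSEQ_Suc[OF lim_1_over_n])
  moreover have "isCont (flat_exp 0) 1" by (rule DERIV_isCont[OF flat_exp_has_derivative])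
  ultimately have "(\<lambda>N. flat_exp 0 (1 - (1 / (real (Suc N))\<^sup>2) * (norm x)\<^sup>2)) \<longlonglongrightarrow> flat_exp 0 1"
    by (intro isCont_tendsto_compose[of 1 "flat_exp 0"]) auto
  then have "(\<lambda>N. cutoff (real (Suc N)) x) \<longlonglongrightarrow> exp 1 * flat_exp 0 1"
    unfolding cutoff_def by (intro tendsto_intros)
  then show ?thesis by (simp add: flat_exp_def exp_minus)
qed

lemma test_function_cutoff_gaussian:
  assumes R: "R > 0"
  shows "test_function (\<lambda>x. cutoff R x * gaussian a \<beta> d x)"
proof -
  have "{x. cutoff R x * gaussian a \<beta> d x \<noteq> 0} \<subseteq> cball 0 R"
    using cutoff_outside[OF R] by (force simp: not_le[symmetric])
  then have "bounded {x. cutoff R x * gaussian a \<beta> d x \<noteq> 0}" by (rule bounded_subset[OF bounded_cball])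
  then have "compact (closure {x. cutoff R x * gaussian a \<beta> d x \<noteq> 0})" by (simp add: compact_closure)
  moreover have "smooth (\<lambda>x. cutoff R x * gaussian a \<beta> d x)"
    by (intro smooth_elementary elementary.mult elementary_cutoff elementary_gaussian)
  ultimately show ?thesis by (simp add: test_function_def)
qed

lemma test_derivative:
  "frechet_derivative (\<lambda>x. cutoff R x * gaussian a \<beta> d x) (at x) v =
    cutoff R x * (gaussian a \<beta> d x * ((\<beta> - (2 * a) *\<^sub>R x) \<bullet> v))
    + exp 1 * (flat_exp 2 (1 - (1 / R\<^sup>2) * (norm x)\<^sup>2) * (- (2 / R\<^sup>2) * (x \<bullet> v))) * gaussian a \<beta> d x"
  using frechet_derivative_at[OF has_derivative_mult[OF cutoff_has_derivative[of R x] gaussian_has_derivative[of a \<beta> d x]]]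
  by (metis (no_types, lifting))

text \<open>One quarter of the decay rate a absorbs the linear term, another quarter the polynomial
  weight, and the remaining half is \<open>heat_kernel (1 / a)\<close> up to a constant.\<close>

lemma gaussian_weight_le:
  fixes \<beta> :: "'a::euclidean_space"
  assumes a: "a > 0"
  shows "\<exists>K\<ge>0. \<forall>x. gaussian a \<beta> d x * (1 + (norm x)\<^sup>2) \<le> K * heat_kernel (1 / a) x"
proof -
  define C where "C = max 1 (4 / a) * exp ((norm \<beta>)\<^sup>2 / a + d)"
  define s where "s = 1 / a"
  have s: "s > 0" using a by (simp add: s_def)
  define K where "K = C / (2 * pi * s) powr (- (real DIM('a) / 2))"
  have "gaussian a \<beta> d x * (1 + (norm x)\<^sup>2) \<le> K * heat_kernel s x" for x
  proof -
    define u where "u = (norm x)\<^sup>2"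
    have u: "u \<ge> 0" by (simp add: u_def)
    have "1 + u \<le> max 1 (4 / a) * (1 + a / 4 * u)"
    proof -
      have "1 * 1 \<le> max 1 (4 / a) * 1" by simp
      moreover have "4 / a * (a / 4 * u) \<le> max 1 (4 / a) * (a / 4 * u)" using a u by (intro mult_right_mono) auto
      moreover have "4 / a * (a / 4 * u) = u" using a by simp
      moreover have "max 1 (4 / a) * (1 + a / 4 * u) = max 1 (4 / a) * 1 + max 1 (4 / a) * (a / 4 * u)"
        by (rule distrib_left)
      ultimately show ?thesis by linarith
    qed
    also have "\<dots> \<le> max 1 (4 / a) * exp (a / 4 * u)" by (intro mult_left_mono exp_ge_add_one_self) auto
    finally have 1: "1 + u \<le> max 1 (4 / a) * exp (a / 4 * u)" .
    have "x \<bullet> \<beta> \<le> norm x * norm \<beta>" by (rule norm_cauchy_schwarz)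
    also have "\<dots> \<le> a / 4 * u + (norm \<beta>)\<^sup>2 / a"
    proof -
      have "0 \<le> (a / 2 * norm x - norm \<beta>)\<^sup>2 / a" using a by simp
      also have "(a / 2 * norm x - norm \<beta>)\<^sup>2 / a = a / 4 * u + (norm \<beta>)\<^sup>2 / a - norm x * norm \<beta>"
        using a by (simp add: u_def power2_eq_square field_simps)
      finally show ?thesis by simp
    qed
    finally have "- a * u + x \<bullet> \<beta> + d \<le> - (3 * a / 4) * u + ((norm \<beta>)\<^sup>2 / a + d)" by (simp add: field_simps)
    then have "gaussian a \<beta> d x \<le> exp (- (3 * a / 4) * u) * exp ((norm \<beta>)\<^sup>2 / a + d)"
      unfolding gaussian_def u_def[symmetric] exp_add[symmetric] by simp
    then have "gaussian a \<beta> d x * (1 + u) \<le> exp (- (3 * a / 4) * u) * exp ((norm \<beta>)\<^sup>2 / a + d) * (max 1 (4 / a) * exp (a / 4 * u))"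
      using 1 u by (intro mult_mono) auto
    also have "\<dots> = C * exp (- (a / 2) * u)"
    proof -
      have "exp (- (3 * a / 4) * u) * exp (a / 4 * u) = exp (- (a / 2) * u)"
        unfolding exp_add[symmetric] by (simp add: field_simps)
      then show ?thesis by (simp add: C_def mult_ac)
    qed
    also have "\<dots> = K * heat_kernel s x"
      using a s by (simp add: K_def heat_kernel_def u_def s_def)
    finally show ?thesis by (simp add: u_def)
  qed
  moreover have "K \<ge> 0" by (simp add: K_def C_def)
  ultimately show ?thesis unfolding s_def by blast
qed

lemma integrable_gaussian_weight:
  fixes \<beta> :: "'a::euclidean_space"
  assumes a: "a > 0"
  shows "integrable lborel (\<lambda>x. gaussian a \<beta> d x * (1 + (norm x)\<^sup>2))"
proof -
  have s: "1 / a > 0" using a by simp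
  obtain K where bound: "\<And>x. gaussian a \<beta> d x * (1 + (norm x)\<^sup>2) \<le> K * heat_kernel (1 / a) x"
    using gaussian_weight_le[OF a] by blast
  have hk: "integrable lborel (heat_kernel (1 / a) :: 'a \<Rightarrow> real)"
    using nn_integral_heat_kernel[OF s, where 'a='a] by (auto intro!: integrableI_nonneg)
  show ?thesis
  proof (rule Bochner_Integration.integrable_bound)
    show "integrable lborel (\<lambda>x::'a. K * heat_kernel (1 / a) x)" using hk by simp
    show "AE x in lborel. norm (gaussian a \<beta> d x * (1 + (norm x)\<^sup>2)) \<le> norm (K * heat_kernel (1 / a) x)"
    proof (rule AE_I2)
      fix x :: 'a
      have "norm (gaussian a \<beta> d x * (1 + (norm x)\<^sup>2)) = gaussian a \<beta> d x * (1 + (norm x)\<^sup>2)"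
        using less_imp_le[OF gaussian_pos[of a \<beta> d x]] by simp
      with bound[of x] show "norm (gaussian a \<beta> d x * (1 + (norm x)\<^sup>2)) \<le> norm (K * heat_kernel (1 / a) x)"
        unfolding real_norm_def by linarith
    qed
  qed measurable
qed

text \<open>The condition a > 1 / (4c) says that the square of the Gaussian decays strictly faster
  than \<open>heat_kernel c\<close>; the excess rate \<open>a'\<close> absorbs the weight.\<close>

lemma gaussian_sq_weight_le:
  fixes \<beta> :: "'a::euclidean_space"
  assumes c: "c > 0" and a: "a > 1 / (4 * c)"
  shows "\<exists>K\<ge>0. \<forall>x. (gaussian a \<beta> d x)\<^sup>2 * (1 + (norm x)\<^sup>2) \<le> K * heat_kernel c x"
proof -
  define a' where "a' = 2 * a - 1 / (2 * c)"
  have a': "a' > 0" using a c by (simp add: a'_def field_simps)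
  define k where "k = (2 * pi * c) powr (- (real DIM('a) / 2))"
  have k: "k > 0" using c by (simp add: k_def)
  define K' where "K' = (2 * pi * (1 / a')) powr (- (real DIM('a) / 2))"
  obtain K where K: "K \<ge> 0" "\<And>x. gaussian a' (2 *\<^sub>R \<beta>) (2 * d) x * (1 + (norm x)\<^sup>2) \<le> K * heat_kernel (1 / a') x"
    using gaussian_weight_le[OF a', of "2 *\<^sub>R \<beta>" "2 * d"] by blast
  have "(gaussian a \<beta> d x)\<^sup>2 * (1 + (norm x)\<^sup>2) \<le> (K * K' / k) * heat_kernel c x" for x
  proof -
    have "(gaussian a \<beta> d x)\<^sup>2 = gaussian a' (2 *\<^sub>R \<beta>) (2 * d) x * exp (- (norm x)\<^sup>2 / (2 * c))"
      unfolding gaussian_def power2_eq_square exp_add[symmetric] a'_def by (simp add: algebra_simps)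
    then have "(gaussian a \<beta> d x)\<^sup>2 * (1 + (norm x)\<^sup>2)
        = (gaussian a' (2 *\<^sub>R \<beta>) (2 * d) x * (1 + (norm x)\<^sup>2)) * exp (- (norm x)\<^sup>2 / (2 * c))"
      by (simp add: mult_ac)
    also have "\<dots> \<le> (K * K') * exp (- (norm x)\<^sup>2 / (2 * c))"
    proof (intro mult_right_mono)
      have "K * heat_kernel (1 / a') x \<le> K * K'"
        using heat_kernel_le[of "1 / a'" x] a' K(1) unfolding K'_def by (intro mult_left_mono) auto
      then show "gaussian a' (2 *\<^sub>R \<beta>) (2 * d) x * (1 + (norm x)\<^sup>2) \<le> K * K'"
        using K(2)[of x] by linarith
    qed simp
    also have "exp (- (norm x)\<^sup>2 / (2 * c)) = heat_kernel c x / k"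
      using k by (simp add: heat_kernel_def k_def)
    finally show ?thesis by simp
  qed
  moreover have "K * K' / k \<ge> 0" using K(1) k by (simp add: K'_def)
  ultimately show ?thesis by blast
qed

text \<open>h is only square integrable against \<open>heat_kernel c\<close>, so h is paired with
  the square root of that kernel, and the rest is divided by it. The square of the quotient is a
  weighted Gaussian that still decays.\<close>

lemma integrable_gaussian_times:
  fixes h :: "'a::euclidean_space \<Rightarrow> real"
  assumes c: "c > 0" and a: "a > 1 / (4 * c)"
    and h[measurable]: "h \<in> borel_measurable borel" and h2: "integrable lborel (\<lambda>x. (h x)\<^sup>2 * heat_kernel c x)"
  shows "integrable lborel (\<lambda>x. gaussian a \<beta> d x * (1 + norm x) * h x)"
proof -
  define a' where "a' = 2 * a - 1 / (2 * c)"
  have a': "a' > 0" using a c by (simp add: a'_def field_simps)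
  define k where "k = (2 * pi * c) powr (- (real DIM('a) / 2))"
  have k: "k > 0" using c by (simp add: k_def)
  let ?G = "gaussian a \<beta> d" and ?G' = "gaussian a' (2 *\<^sub>R \<beta>) (2 * d)"
  have GG: "(?G x)\<^sup>2 = (?G' x / k) * heat_kernel c x" for x
  proof -
    have "(?G x)\<^sup>2 = ?G' x * exp (- (norm x)\<^sup>2 / (2 * c))"
      unfolding gaussian_def power2_eq_square exp_add[symmetric] a'_def by (simp add: algebra_simps)
    then show ?thesis using k by (simp add: heat_kernel_def k_def)
  qed
  show ?thesis
  proof (rule Bochner_Integration.integrable_bound)
    show "integrable lborel (\<lambda>x. (h x)\<^sup>2 * heat_kernel c x + (2 / k) * (?G' x * (1 + (norm x)\<^sup>2)))"
      using h2 integrable_gaussian_weight[OF a', of "2 *\<^sub>R \<beta>" "2 * d"] by simp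
    show "AE x in lborel. norm (?G x * (1 + norm x) * h x)
        \<le> norm ((h x)\<^sup>2 * heat_kernel c x + (2 / k) * (?G' x * (1 + (norm x)\<^sup>2)))"
    proof (rule AE_I2)
      fix x :: 'a
      define q where "q = sqrt (heat_kernel c x)"
      have q: "q > 0" "q\<^sup>2 = heat_kernel c x" using c by (auto simp: q_def)
      define u where "u = ?G x * (1 + norm x) / q"
      have u0: "u \<ge> 0" using q less_imp_le[OF gaussian_pos[of a \<beta> d x]] by (simp add: u_def)
      have "norm (?G x * (1 + norm x) * h x) = u * (\<bar>h x\<bar> * q)"
        using q less_imp_le[OF gaussian_pos[of a \<beta> d x]] by (simp add: u_def abs_mult)
      also have "\<dots> \<le> (\<bar>h x\<bar> * q)\<^sup>2 + u\<^sup>2"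
        using sum_squares_bound[of u "\<bar>h x\<bar> * q"] mult_nonneg_nonneg[OF u0, of "\<bar>h x\<bar> * q"] q by simp
      also have "(\<bar>h x\<bar> * q)\<^sup>2 = (h x)\<^sup>2 * heat_kernel c x" by (simp add: power_mult_distrib q)
      also have "u\<^sup>2 \<le> (2 / k) * (?G' x * (1 + (norm x)\<^sup>2))"
      proof -
        have "(1 + norm x)\<^sup>2 \<le> 2 * (1 + (norm x)\<^sup>2)"
          using sum_squares_bound[of 1 "norm x"] by (simp add: power2_sum)
        then have "(?G' x / k) * (1 + norm x)\<^sup>2 \<le> (?G' x / k) * (2 * (1 + (norm x)\<^sup>2))"
          using k less_imp_le[OF gaussian_pos[of a' "2 *\<^sub>R \<beta>" "2 * d" x]] by (intro mult_left_mono) auto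
        also have "\<dots> = (2 / k) * (?G' x * (1 + (norm x)\<^sup>2))" by simp
        also have "(?G' x / k) * (1 + norm x)\<^sup>2 = u\<^sup>2"
          using q(1) less_imp_neq[OF heat_kernel_pos[OF c, of x]] by (simp add: u_def power_divide power_mult_distrib q(2) GG)
        finally show ?thesis .
      qed
      finally show "norm (?G x * (1 + norm x) * h x)
        \<le> norm ((h x)\<^sup>2 * heat_kernel c x + (2 / k) * (?G' x * (1 + (norm x)\<^sup>2)))"
        unfolding real_norm_def by linarith
    qed
  qed measurable
qed

text \<open>Multiplying by \<open>cutoff\<close> gives an admissible test function. As the radius R
  grows, the gradient of the cutoff is of order |x| / R^2 and disappears, while
  \<open>integrable_gaussian_times\<close> provides the dominating functions.\<close>

lemma weak_gradient_gaussian: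
  fixes f :: "'a::euclidean_space \<Rightarrow> real" and g :: "'a \<Rightarrow> 'a"
  assumes wg: "has_weak_gradient f g" and c: "c > 0" and a: "a > 1 / (4 * c)"
    and f2: "integrable lborel (\<lambda>x. (f x)\<^sup>2 * heat_kernel c x)"
    and g2: "integrable lborel (\<lambda>x. (norm (g x))\<^sup>2 * heat_kernel c x)"
  shows "(\<integral>x. f x * (gaussian a \<beta> d x * ((\<beta> - (2 * a) *\<^sub>R x) \<bullet> v)) \<partial>lborel)
    = - (\<integral>x. (g x \<bullet> v) * gaussian a \<beta> d x \<partial>lborel)"
proof -
  have [measurable]: "f \<in> borel_measurable borel" "g \<in> borel_measurable borel"
    using wg by (auto simp: has_weak_gradient_def locally_integrable_def)
  let ?G = "gaussian a \<beta> d"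
  let ?R = "\<lambda>N. real (Suc N)"
  have G0: "?G x \<ge> 0" for x by (rule less_imp_le) simp
  note fi = integrable_gaussian_times[OF c a _ f2, of \<beta> d]
  have gi: "integrable lborel (\<lambda>x. ?G x * (1 + norm x) * norm (g x))"
    using g2 by (intro integrable_gaussian_times[OF c a]) auto
  have eq: "(\<integral>x. f x * frechet_derivative (\<lambda>x. cutoff (?R N) x * ?G x) (at x) v \<partial>lborel)
      = - (\<integral>x. (g x \<bullet> v) * (cutoff (?R N) x * ?G x) \<partial>lborel)" for N
    using wg test_function_cutoff_gaussian[of "?R N" a \<beta> d] by (simp add: has_weak_gradient_def)
  have [measurable]: "cutoff R \<in> borel_measurable borel" "flat_exp m \<in> borel_measurable borel" for R and m
    unfolding cutoff_def[abs_def] flat_exp_def[abs_def] by measurable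
  \<comment> \<open>Collects the drift of the Gaussian, linear in x, and the gradient of the cutoff,
    whose 4 is the bound 2 of \<open>flat_exp_2_le\<close> times 2 / R^2 <= 2.\<close>
  define C where "C = norm \<beta> * norm v + 2 * \<bar>a\<bar> * norm v + exp 1 * (4 * norm v)"
  have lim1: "(\<lambda>N. \<integral>x. f x * frechet_derivative (\<lambda>x. cutoff (?R N) x * ?G x) (at x) v \<partial>lborel)
      \<longlonglongrightarrow> (\<integral>x. f x * (?G x * ((\<beta> - (2 * a) *\<^sub>R x) \<bullet> v)) \<partial>lborel)"
    unfolding test_derivative
  proof (rule integral_dominated_convergence[where w="\<lambda>x. C * \<bar>?G x * (1 + norm x) * f x\<bar>"])
    show "integrable lborel (\<lambda>x. C * \<bar>?G x * (1 + norm x) * f x\<bar>)" using fi by simp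
    let ?F = "\<lambda>N x. f x * (cutoff (?R N) x * (?G x * ((\<beta> - (2 * a) *\<^sub>R x) \<bullet> v))
      + exp 1 * (flat_exp 2 (1 - (1 / (?R N)\<^sup>2) * (norm x)\<^sup>2) * (- (2 / (?R N)\<^sup>2) * (x \<bullet> v))) * ?G x)"
    show "AE x in lborel. (\<lambda>N. ?F N x) \<longlonglongrightarrow> f x * (?G x * ((\<beta> - (2 * a) *\<^sub>R x) \<bullet> v))"
    proof (rule AE_I2)
      fix x :: 'a
      have inv: "(\<lambda>N. 1 / (?R N)\<^sup>2) \<longlonglongrightarrow> 0\<^sup>2"
        unfolding power_one_over[symmetric] by (intro tendsto_intros LIMSEQ_Suc[OF lim_1_over_n])
      have small: "(\<lambda>N. flat_exp 2 (1 - (1 / (?R N)\<^sup>2) * (norm x)\<^sup>2) * (- (2 / (?R N)\<^sup>2) * (x \<bullet> v))) \<longlonglongrightarrow> 0"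
      proof (rule Lim_null_comparison)
        show "\<forall>\<^sub>F N in sequentially. norm (flat_exp 2 (1 - (1 / (?R N)\<^sup>2) * (norm x)\<^sup>2) * (- (2 / (?R N)\<^sup>2) * (x \<bullet> v)))
            \<le> 4 * \<bar>x \<bullet> v\<bar> * (1 / (?R N)\<^sup>2)"
        proof (intro always_eventually allI)
          fix N
          define s where "s = 1 - (1 / (?R N)\<^sup>2) * (norm x)\<^sup>2"
          have "norm (flat_exp 2 s * (- (2 / (?R N)\<^sup>2) * (x \<bullet> v))) = flat_exp 2 s * (2 * \<bar>x \<bullet> v\<bar> * (1 / (?R N)\<^sup>2))"
            using flat_exp_2_le(1)[of s] by (simp add: abs_mult)
          also have "\<dots> \<le> 2 * (2 * \<bar>x \<bullet> v\<bar> * (1 / (?R N)\<^sup>2))"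
            using flat_exp_2_le(2)[of s] by (intro mult_right_mono) auto
          finally show "norm (flat_exp 2 (1 - (1 / (?R N)\<^sup>2) * (norm x)\<^sup>2) * (- (2 / (?R N)\<^sup>2) * (x \<bullet> v)))
            \<le> 4 * \<bar>x \<bullet> v\<bar> * (1 / (?R N)\<^sup>2)" by (simp add: s_def)
        qed
        show "(\<lambda>N. 4 * \<bar>x \<bullet> v\<bar> * (1 / (?R N)\<^sup>2)) \<longlonglongrightarrow> 0"
          using tendsto_mult_left[OF inv, of "4 * \<bar>x \<bullet> v\<bar>"] by simp
      qed
      have "(\<lambda>N. ?F N x) \<longlonglongrightarrow> f x * (1 * (?G x * ((\<beta> - (2 * a) *\<^sub>R x) \<bullet> v)) + exp 1 * 0 * ?G x)"
        by (intro tendsto_intros cutoff_tendsto small)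
      then show "(\<lambda>N. ?F N x) \<longlonglongrightarrow> f x * (?G x * ((\<beta> - (2 * a) *\<^sub>R x) \<bullet> v))" by simp
    qed
    show "AE x in lborel. norm (?F N x) \<le> C * \<bar>?G x * (1 + norm x) * f x\<bar>" for N
    proof (rule AE_I2)
      fix x :: 'a
      define s where "s = 1 - (1 / (?R N)\<^sup>2) * (norm x)\<^sup>2"
      have 1: "\<bar>(\<beta> - (2 * a) *\<^sub>R x) \<bullet> v\<bar> \<le> (norm \<beta> * norm v + 2 * \<bar>a\<bar> * norm v) * (1 + norm x)"
      proof -
        have "\<bar>(\<beta> - (2 * a) *\<^sub>R x) \<bullet> v\<bar> \<le> norm (\<beta> - (2 * a) *\<^sub>R x) * norm v" by (rule Cauchy_Schwarz_ineq2)
        also have "\<dots> \<le> (norm \<beta> + 2 * \<bar>a\<bar> * norm x) * norm v"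
          using norm_triangle_ineq4[of \<beta> "(2 * a) *\<^sub>R x"] by (intro mult_right_mono) auto
        also have "\<dots> \<le> (norm \<beta> * norm v + 2 * \<bar>a\<bar> * norm v) * (1 + norm x)"
          by (simp add: algebra_simps)
        finally show ?thesis .
      qed
      have c1: "\<bar>cutoff (?R N) x * ((\<beta> - (2 * a) *\<^sub>R x) \<bullet> v)\<bar> \<le> 1 * ((norm \<beta> * norm v + 2 * \<bar>a\<bar> * norm v) * (1 + norm x))"
        unfolding abs_mult using cutoff_bounds[of "?R N" x] 1 by (intro mult_mono) auto
      have r1: "2 / (?R N)\<^sup>2 \<le> 2" by (simp add: divide_le_eq)
      have "\<bar>x \<bullet> v\<bar> \<le> (1 + norm x) * norm v"
        using Cauchy_Schwarz_ineq2[of x v] mult_right_mono[of "norm x" "1 + norm x" "norm v"] by simp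
      then have c2: "\<bar>flat_exp 2 s * (- (2 / (?R N)\<^sup>2) * (x \<bullet> v))\<bar> \<le> 2 * (2 * ((1 + norm x) * norm v))"
        unfolding abs_mult abs_minus_cancel using flat_exp_2_le[of s] r1 by (intro mult_mono) auto
      have "\<bar>cutoff (?R N) x * ((\<beta> - (2 * a) *\<^sub>R x) \<bullet> v) + exp 1 * (flat_exp 2 s * (- (2 / (?R N)\<^sup>2) * (x \<bullet> v)))\<bar>
          \<le> (norm \<beta> * norm v + 2 * \<bar>a\<bar> * norm v) * (1 + norm x) + exp 1 * (2 * (2 * ((1 + norm x) * norm v)))"
        using c1 mult_left_mono[OF c2, of "exp 1"]
        by (intro order_trans[OF abs_triangle_ineq] add_mono) (auto simp: abs_mult)
      also have "\<dots> = C * (1 + norm x)" by (simp add: C_def algebra_simps)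
      finally have 2: "\<bar>cutoff (?R N) x * ((\<beta> - (2 * a) *\<^sub>R x) \<bullet> v) + exp 1 * (flat_exp 2 s * (- (2 / (?R N)\<^sup>2) * (x \<bullet> v)))\<bar> \<le> C * (1 + norm x)" .
      have "?F N x = (f x * ?G x) * (cutoff (?R N) x * ((\<beta> - (2 * a) *\<^sub>R x) \<bullet> v) + exp 1 * (flat_exp 2 s * (- (2 / (?R N)\<^sup>2) * (x \<bullet> v))))"
        by (simp add: s_def algebra_simps)
      then have "norm (?F N x) = \<bar>f x * ?G x\<bar> * \<bar>cutoff (?R N) x * ((\<beta> - (2 * a) *\<^sub>R x) \<bullet> v) + exp 1 * (flat_exp 2 s * (- (2 / (?R N)\<^sup>2) * (x \<bullet> v)))\<bar>"
        by (simp only: real_norm_def abs_mult)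
      also have "\<dots> \<le> \<bar>f x * ?G x\<bar> * (C * (1 + norm x))"
        by (rule mult_left_mono[OF 2]) simp
      also have "\<dots> = C * \<bar>?G x * (1 + norm x) * f x\<bar>" by (simp add: abs_mult)
      finally show "norm (?F N x) \<le> C * \<bar>?G x * (1 + norm x) * f x\<bar>" .
    qed
  qed measurable
  have lim2: "(\<lambda>N. - (\<integral>x. (g x \<bullet> v) * (cutoff (?R N) x * ?G x) \<partial>lborel)) \<longlonglongrightarrow> - (\<integral>x. (g x \<bullet> v) * (1 * ?G x) \<partial>lborel)"
  proof (intro tendsto_minus integral_dominated_convergence[where w="\<lambda>x. norm v * (?G x * (1 + norm x) * norm (g x))"])
    show "integrable lborel (\<lambda>x. norm v * (?G x * (1 + norm x) * norm (g x)))" using gi by simp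
    show "AE x in lborel. (\<lambda>N. (g x \<bullet> v) * (cutoff (?R N) x * ?G x)) \<longlonglongrightarrow> (g x \<bullet> v) * (1 * ?G x)"
      by (intro AE_I2 tendsto_intros cutoff_tendsto)
    show "AE x in lborel. norm ((g x \<bullet> v) * (cutoff (?R N) x * ?G x)) \<le> norm v * (?G x * (1 + norm x) * norm (g x))" for N
    proof (rule AE_I2)
      fix x :: 'a
      have "norm ((g x \<bullet> v) * (cutoff (?R N) x * ?G x)) = \<bar>g x \<bullet> v\<bar> * (cutoff (?R N) x * ?G x)"
        using cutoff_bounds(1)[of "?R N" x] G0[of x] by (simp add: abs_mult)
      also have "\<dots> \<le> (norm (g x) * norm v) * ((1 + norm x) * ?G x)"
      proof (intro mult_mono Cauchy_Schwarz_ineq2)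
        show "cutoff (?R N) x \<le> 1 + norm x" using cutoff_bounds(2)[of "?R N" x] norm_ge_zero[of x] by linarith
      qed (use cutoff_bounds(1)[of "?R N" x] G0[of x] in auto)
      finally show "norm ((g x \<bullet> v) * (cutoff (?R N) x * ?G x)) \<le> norm v * (?G x * (1 + norm x) * norm (g x))"
        by (simp add: mult_ac)
    qed
  qed measurable
  from LIMSEQ_unique[OF lim1[unfolded eq] lim2] show ?thesis by simp
qed

section \<open>The weak derivative of a square\<close>

lemma integrable_sq_kernel:
  fixes w :: "'a::euclidean_space \<Rightarrow> real"
  assumes [measurable]: "w \<in> borel_measurable borel" and w: "integrable lborel (\<lambda>x. (w x)\<^sup>2)"
    and k: "integrable lborel \<kappa>" "\<And>z. \<kappa> z \<ge> 0"
  shows "integrable (lborel \<Otimes>\<^sub>M lborel) (\<lambda>(x, z). (w x)\<^sup>2 * \<kappa> (x - z))"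
    and "(\<integral>(x, z). (w x)\<^sup>2 * \<kappa> (x - z) \<partial>(lborel \<Otimes>\<^sub>M lborel)) = (\<integral>x. (w x)\<^sup>2 \<partial>lborel) * (\<integral>z. \<kappa> z \<partial>lborel)"
    and "integrable (lborel \<Otimes>\<^sub>M lborel) (\<lambda>(x, z). (w z)\<^sup>2 * \<kappa> (x - z))"
proof -
  have [measurable]: "\<kappa> \<in> borel_measurable borel" using k by auto
  define I where "I = (\<integral>z. \<kappa> z \<partial>lborel)"
  define V where "V = (\<integral>x. (w x)\<^sup>2 \<partial>lborel)"
  have I: "I \<ge> 0" unfolding I_def using k by (intro integral_nonneg_AE) auto
  have V: "V \<ge> 0" unfolding V_def by (intro integral_nonneg_AE) auto
  have kI: "(\<integral>\<^sup>+z. ennreal (\<kappa> z) \<partial>lborel) = ennreal I" unfolding I_def using k by (intro nn_integral_eq_integral) auto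
  have wV: "(\<integral>\<^sup>+x. ennreal ((w x)\<^sup>2) \<partial>lborel) = ennreal V" unfolding V_def using w by (intro nn_integral_eq_integral) auto
  have nn1: "(\<integral>\<^sup>+(x, z). ennreal ((w x)\<^sup>2 * \<kappa> (x - z)) \<partial>(lborel \<Otimes>\<^sub>M lborel)) = ennreal (V * I)"
  proof -
    have "(\<integral>\<^sup>+(x, z). ennreal ((w x)\<^sup>2 * \<kappa> (x - z)) \<partial>(lborel \<Otimes>\<^sub>M lborel))
        = (\<integral>\<^sup>+x. (\<integral>\<^sup>+z. ennreal ((w x)\<^sup>2 * \<kappa> (x - z)) \<partial>lborel) \<partial>lborel)"
      by (subst lborel.nn_integral_fst[symmetric]) auto
    also have "\<dots> = (\<integral>\<^sup>+x. ennreal ((w x)\<^sup>2) * ennreal I \<partial>lborel)"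
    proof (rule nn_integral_cong)
      fix x :: 'a
      have "(\<integral>\<^sup>+z. ennreal ((w x)\<^sup>2 * \<kappa> (x - z)) \<partial>lborel) = ennreal ((w x)\<^sup>2) * (\<integral>\<^sup>+z. ennreal (\<kappa> (x - z)) \<partial>lborel)"
        using k(2) by (simp add: ennreal_mult nn_integral_cmult)
      also have "(\<integral>\<^sup>+z. ennreal (\<kappa> (x - z)) \<partial>lborel) = (\<integral>\<^sup>+z. ennreal (\<kappa> z) \<partial>lborel)"
        by (rule nn_integral_lborel_reflect) measurable
      finally show "(\<integral>\<^sup>+z. ennreal ((w x)\<^sup>2 * \<kappa> (x - z)) \<partial>lborel) = ennreal ((w x)\<^sup>2) * ennreal I" by (simp add: kI)
    qed
    also have "\<dots> = ennreal (V * I)" using V I by (simp add: nn_integral_multc wV ennreal_mult)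
    finally show ?thesis .
  qed
  have nn2: "(\<integral>\<^sup>+(x, z). ennreal ((w z)\<^sup>2 * \<kappa> (x - z)) \<partial>(lborel \<Otimes>\<^sub>M lborel)) = ennreal (V * I)"
  proof -
    have "(\<integral>\<^sup>+(x, z). ennreal ((w z)\<^sup>2 * \<kappa> (x - z)) \<partial>(lborel \<Otimes>\<^sub>M lborel))
        = (\<integral>\<^sup>+z. (\<integral>\<^sup>+x. ennreal ((w z)\<^sup>2 * \<kappa> (x - z)) \<partial>lborel) \<partial>lborel)"
      by (subst lborel_pair.nn_integral_snd[symmetric]) auto
    also have "\<dots> = (\<integral>\<^sup>+z. ennreal ((w z)\<^sup>2) * ennreal I \<partial>lborel)"
    proof (rule nn_integral_cong)
      fix z :: 'a
      have "(\<integral>\<^sup>+x. ennreal ((w z)\<^sup>2 * \<kappa> (x - z)) \<partial>lborel) = ennreal ((w z)\<^sup>2) * (\<integral>\<^sup>+x. ennreal (\<kappa> (x + - z)) \<partial>lborel)"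
        using k(2) by (simp add: ennreal_mult nn_integral_cmult)
      also have "(\<integral>\<^sup>+x. ennreal (\<kappa> (x + - z)) \<partial>lborel) = (\<integral>\<^sup>+z. ennreal (\<kappa> z) \<partial>lborel)"
        by (rule nn_integral_lborel_shift) measurable
      finally show "(\<integral>\<^sup>+x. ennreal ((w z)\<^sup>2 * \<kappa> (x - z)) \<partial>lborel) = ennreal ((w z)\<^sup>2) * ennreal I" by (simp add: kI)
    qed
    also have "\<dots> = ennreal (V * I)" using V I by (simp add: nn_integral_multc wV ennreal_mult)
    finally show ?thesis .
  qed
  show "integrable (lborel \<Otimes>\<^sub>M lborel) (\<lambda>(x, z). (w x)\<^sup>2 * \<kappa> (x - z))"
    using nn1 k(2) by (intro integrableI_nonneg) (auto simp: case_prod_unfold)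
  show "integrable (lborel \<Otimes>\<^sub>M lborel) (\<lambda>(x, z). (w z)\<^sup>2 * \<kappa> (x - z))"
    using nn2 k(2) by (intro integrableI_nonneg) (auto simp: case_prod_unfold)
  show "(\<integral>(x, z). (w x)\<^sup>2 * \<kappa> (x - z) \<partial>(lborel \<Otimes>\<^sub>M lborel)) = (\<integral>x. (w x)\<^sup>2 \<partial>lborel) * (\<integral>z. \<kappa> z \<partial>lborel)"
    using nn1 k(2) V I unfolding V_def[symmetric] I_def[symmetric]
    by (subst integral_eq_nn_integral) (auto simp: case_prod_unfold)
qed

lemma integrable_product_kernel:
  fixes u w \<kappa> :: "'a::euclidean_space \<Rightarrow> real"
  assumes [measurable]: "u \<in> borel_measurable borel" "w \<in> borel_measurable borel"
    and u: "integrable lborel (\<lambda>x. (u x)\<^sup>2)" and w: "integrable lborel (\<lambda>x. (w x)\<^sup>2)"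
    and k: "integrable lborel \<kappa>"
  shows "integrable (lborel \<Otimes>\<^sub>M lborel) (\<lambda>(x, z). u z * w x * \<kappa> (x - z))"
    and "integrable (lborel \<Otimes>\<^sub>M lborel) (\<lambda>(x, z). u x * w x * \<kappa> (x - z))"
proof -
  have [measurable]: "\<kappa> \<in> borel_measurable borel" using k by auto
  have ka: "integrable lborel (\<lambda>z. \<bar>\<kappa> z\<bar>)" using k by simp
  note iu = integrable_sq_kernel[OF _ u ka] and iw = integrable_sq_kernel[OF _ w ka]
  have am: "\<bar>a * b\<bar> \<le> a\<^sup>2 + b\<^sup>2" for a b :: real
    using sum_squares_bound[of "\<bar>a\<bar>" "\<bar>b\<bar>"] mult_nonneg_nonneg[OF abs_ge_zero[of a] abs_ge_zero[of b]]
    unfolding abs_mult power2_abs by linarith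
  have am2: "\<bar>a * b * c\<bar> \<le> b\<^sup>2 * \<bar>c\<bar> + a\<^sup>2 * \<bar>c\<bar>" for a b c :: real
  proof -
    have "\<bar>a * b * c\<bar> \<le> (a\<^sup>2 + b\<^sup>2) * \<bar>c\<bar>" unfolding abs_mult[of _ c] using am[of a b] by (intro mult_right_mono) auto
    then show ?thesis by (simp add: algebra_simps)
  qed
  show "integrable (lborel \<Otimes>\<^sub>M lborel) (\<lambda>(x, z). u z * w x * \<kappa> (x - z))"
  proof (rule Bochner_Integration.integrable_bound)
    show "integrable (lborel \<Otimes>\<^sub>M lborel) (\<lambda>y. (case y of (x, z) \<Rightarrow> (w x)\<^sup>2 * \<bar>\<kappa> (x - z)\<bar>) + (case y of (x, z) \<Rightarrow> (u z)\<^sup>2 * \<bar>\<kappa> (x - z)\<bar>))"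
      using iu(3) iw(1) by (intro Bochner_Integration.integrable_add) auto
    show "AE y in lborel \<Otimes>\<^sub>M lborel. norm (case y of (x, z) \<Rightarrow> u z * w x * \<kappa> (x - z))
      \<le> norm ((case y of (x, z) \<Rightarrow> (w x)\<^sup>2 * \<bar>\<kappa> (x - z)\<bar>) + (case y of (x, z) \<Rightarrow> (u z)\<^sup>2 * \<bar>\<kappa> (x - z)\<bar>))"
      using am2 by (intro AE_I2) (auto simp: case_prod_unfold)
  qed measurable
  show "integrable (lborel \<Otimes>\<^sub>M lborel) (\<lambda>(x, z). u x * w x * \<kappa> (x - z))"
  proof (rule Bochner_Integration.integrable_bound)
    show "integrable (lborel \<Otimes>\<^sub>M lborel) (\<lambda>y. (case y of (x, z) \<Rightarrow> (w x)\<^sup>2 * \<bar>\<kappa> (x - z)\<bar>) + (case y of (x, z) \<Rightarrow> (u x)\<^sup>2 * \<bar>\<kappa> (x - z)\<bar>))"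
      using iu(1) iw(1) by (intro Bochner_Integration.integrable_add) auto
    show "AE y in lborel \<Otimes>\<^sub>M lborel. norm (case y of (x, z) \<Rightarrow> u x * w x * \<kappa> (x - z))
      \<le> norm ((case y of (x, z) \<Rightarrow> (w x)\<^sup>2 * \<bar>\<kappa> (x - z)\<bar>) + (case y of (x, z) \<Rightarrow> (u x)\<^sup>2 * \<bar>\<kappa> (x - z)\<bar>))"
      using am2 by (intro AE_I2) (auto simp: case_prod_unfold)
  qed measurable
qed

lemma heat_kernel_integrals:
  assumes "t > 0"
  shows "integrable lborel (heat_kernel t :: 'a::euclidean_space \<Rightarrow> real)" "(\<integral>w. heat_kernel t (w::'a) \<partial>lborel) = 1"
    "integrable lborel (\<lambda>w::'a. heat_kernel t w * (w \<bullet> v))"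
proof -
  show i: "integrable lborel (heat_kernel t :: 'a \<Rightarrow> real)" and "(\<integral>w. heat_kernel t (w::'a) \<partial>lborel) = 1"
    using nn_integral_heat_kernel[OF assms, where 'a='a]
    by (auto intro!: integrableI_nonneg simp: integral_eq_nn_integral)
  have i2: "integrable lborel (\<lambda>w::'a. heat_kernel t w * (norm w)\<^sup>2)"
    using nn_integral_heat_kernel_norm_sq[OF assms, where 'a='a] by (intro integrableI_nonneg) auto
  show "integrable lborel (\<lambda>w::'a. heat_kernel t w * (w \<bullet> v))"
  proof (rule Bochner_Integration.integrable_bound)
    show "integrable lborel (\<lambda>w::'a. norm v * (heat_kernel t w + heat_kernel t w * (norm w)\<^sup>2))" using i i2 by simp
    show "AE w::'a in lborel. norm (heat_kernel t w * (w \<bullet> v)) \<le> norm (norm v * (heat_kernel t w + heat_kernel t w * (norm w)\<^sup>2))"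
    proof (rule AE_I2)
      fix w :: 'a
      have "norm w \<le> 1 + (norm w)\<^sup>2" using sum_squares_bound[of "norm w" 1] norm_ge_zero[of w]
        by (simp only: mult_1_right power_one)
      then have "\<bar>w \<bullet> v\<bar> \<le> (1 + (norm w)\<^sup>2) * norm v"
        using Cauchy_Schwarz_ineq2[of w v] by (meson mult_right_mono norm_ge_zero order_trans)
      then have "heat_kernel t w * \<bar>w \<bullet> v\<bar> \<le> heat_kernel t w * ((1 + (norm w)\<^sup>2) * norm v)"
        by (intro mult_left_mono) auto
      also have "\<dots> = norm v * (heat_kernel t w + heat_kernel t w * (norm w)\<^sup>2)" by (simp add: algebra_simps)
      finally show "norm (heat_kernel t w * (w \<bullet> v)) \<le> norm (norm v * (heat_kernel t w + heat_kernel t w * (norm w)\<^sup>2))"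
        by (simp add: abs_mult)
    qed
  qed measurable
qed

text \<open>If \<open>G\<close> is the weak derivative of \<open>F\<close> in a direction, then formally the integral of \<open>F G\<close> is that of
  half the derivative of \<open>F\<^sup>2\<close>, hence zero. Smoothing one factor by an even kernel makes this rigorous:
  the double integral vanishes because the derivative of the kernel is odd.\<close>

lemma integral_times_weak_derivative:
  fixes F G :: "'a::euclidean_space \<Rightarrow> real"
  assumes [measurable]: "F \<in> borel_measurable borel" "G \<in> borel_measurable borel"
    and F0: "\<And>x. F x \<ge> 0" and F: "integrable lborel (\<lambda>x. (F x)\<^sup>2)" and G: "integrable lborel (\<lambda>x. (G x)\<^sup>2)"
    and weak: "\<And>\<epsilon> z. \<epsilon> > 0 \<Longrightarrow> (\<integral>x. G x * heat_kernel \<epsilon> (x - z) \<partial>lborel)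
      = (\<integral>x. F x * (heat_kernel \<epsilon> (x - z) * ((x - z) \<bullet> v)) \<partial>lborel) / \<epsilon>"
  shows "(\<integral>x. F x * G x \<partial>lborel) = 0"
proof -
  \<comment> \<open>F is only in L^2, but its square P is in L^1, where a modulus of translation is
    available.\<close>
  define P where "P = (\<lambda>x. (F x)\<^sup>2)"
  define I where "I = (\<integral>x. F x * G x \<partial>lborel)"
  define V where "V = (\<integral>x. (G x)\<^sup>2 \<partial>lborel)"
  let ?LL = "lborel \<Otimes>\<^sub>M lborel :: ('a \<times> 'a) measure"
  have bound: "\<bar>I\<bar> \<le> l * (V / 2 + 1)" if l: "l > 0" for l
  proof -
    have iP: "integrable lborel P" using F by (simp add: P_def)
    obtain C where C: "C \<ge> 0" "\<And>w. (\<integral>x. \<bar>P (x + w) - P x\<bar> \<partial>lborel) \<le> l\<^sup>2 + C * (norm w)\<^sup>2"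
      using shift_dist_modulus[OF iP, of "l\<^sup>2"] l by auto
    \<comment> \<open>Keeps the second moment contribution C n \<epsilon> below l^2, so that the
      smoothed average of |P z - P x| is at most 2 l^2.\<close>
    define \<epsilon> where "\<epsilon> = l\<^sup>2 / (C * real DIM('a) + 1)"
    have den: "C * real DIM('a) + 1 > 0" using C(1) by (intro add_nonneg_pos mult_nonneg_nonneg) auto
    have e: "\<epsilon> > 0" using l den by (simp add: \<epsilon>_def)
    have Ce: "C * (real DIM('a) * \<epsilon>) \<le> l\<^sup>2"
    proof -
      have "C * (real DIM('a) * \<epsilon>) = (C * real DIM('a)) / (C * real DIM('a) + 1) * l\<^sup>2" by (simp add: \<epsilon>_def)
      also have "\<dots> \<le> 1 * l\<^sup>2" using den by (intro mult_right_mono) auto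
      finally show ?thesis by simp
    qed
    let ?k = "heat_kernel \<epsilon> :: 'a \<Rightarrow> real"
    note hk = heat_kernel_integrals[OF e, where 'a='a]
    define A B H J Q where "A = (\<lambda>(x, z). F z * G x * ?k (x - z))" and "B = (\<lambda>(x, z). F x * G x * ?k (x - z))"
      and "H = (\<lambda>(x, z). F z * F x * (?k (x - z) * ((x - z) \<bullet> v)))"
      and "J = (\<lambda>(x, z). \<bar>P z - P x\<bar> * ?k (x - z))" and "Q = (\<lambda>(x, z). (G x)\<^sup>2 * ?k (x - z))"
    have iA: "integrable ?LL A" and iB: "integrable ?LL B"
      unfolding A_def B_def using F G hk(1) by (intro integrable_product_kernel; simp)+
    have iH: "integrable ?LL H"
      unfolding H_def using F hk(3)[of v] by (intro integrable_product_kernel(1)[where \<kappa>="\<lambda>w. ?k w * (w \<bullet> v)"]) auto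
    have iQ: "integrable ?LL Q" "(\<integral>y. Q y \<partial>?LL) = V"
      unfolding Q_def V_def using integrable_sq_kernel[OF _ G hk(1)] hk(2) by auto
    \<comment> \<open>H changes sign when x and z are exchanged: the kernel is even and x - z is
      odd.\<close>
    have H0: "(\<integral>y. H y \<partial>?LL) = 0"
    proof -
      have "(\<integral>y. H y \<partial>?LL) = (\<integral>(x, z). H (z, x) \<partial>?LL)"
        using iH by (subst lborel_pair.integral_product_swap) auto
      also have "\<dots> = (\<integral>y. - H y \<partial>?LL)"
        unfolding H_def by (intro Bochner_Integration.integral_cong) (auto simp: heat_kernel_commute inner_diff_left algebra_simps)
      finally show ?thesis by simp
    qed
    have A0: "(\<integral>y. A y \<partial>?LL) = 0"
    proof -
      have "(\<integral>y. A y \<partial>?LL) = (\<integral>z. (\<integral>x. F z * (G x * ?k (x - z)) \<partial>lborel) \<partial>lborel)"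
        using lborel_pair.integral_snd[of "\<lambda>x z. A (x, z)"] iA by (simp add: A_def mult_ac)
      also have "\<dots> = (\<integral>z. (\<integral>x. F z * F x * (?k (x - z) * ((x - z) \<bullet> v)) \<partial>lborel) / \<epsilon> \<partial>lborel)"
        by (simp add: weak[OF e] mult.assoc)
      also have "\<dots> = (\<integral>y. H y \<partial>?LL) / \<epsilon>"
        using lborel_pair.integral_snd[of "\<lambda>x z. H (x, z)"] iH by (simp add: H_def)
      finally show ?thesis by (simp add: H0)
    qed
    have BI: "(\<integral>y. B y \<partial>?LL) = I"
    proof -
      have kz: "(\<integral>z. ?k (x - z) \<partial>lborel) = 1" for x
        using integral_lborel_reflect[of ?k x] hk(2) by simp
      have "(\<integral>y. B y \<partial>?LL) = (\<integral>x. (\<integral>z. F x * G x * ?k (x - z) \<partial>lborel) \<partial>lborel)"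
        using lborel_pair.integral_fst[of "\<lambda>x z. B (x, z)"] iB by (simp add: B_def)
      also have "\<dots> = I" by (simp add: kz I_def)
      finally show ?thesis .
    qed
    have nnJ: "(\<integral>\<^sup>+y. ennreal (J y) \<partial>?LL) \<le> ennreal (l\<^sup>2 + C * (real DIM('a) * \<epsilon>))"
    proof -
      have [measurable]: "P \<in> borel_measurable borel" unfolding P_def by measurable
      have "(\<integral>\<^sup>+y. ennreal (J y) \<partial>?LL) = (\<integral>\<^sup>+x. (\<integral>\<^sup>+z. ennreal (\<bar>P z - P x\<bar> * ?k (x - z)) \<partial>lborel) \<partial>lborel)"
        unfolding J_def by (subst lborel.nn_integral_fst[symmetric]) auto
      also have "\<dots> = (\<integral>\<^sup>+x. (\<integral>\<^sup>+w. ennreal (?k w * \<bar>P (x + w) - P x\<bar>) \<partial>lborel) \<partial>lborel)"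
      proof (rule nn_integral_cong)
        fix x :: 'a
        have "(\<integral>\<^sup>+z. ennreal (\<bar>P z - P x\<bar> * ?k (x - z)) \<partial>lborel) = (\<integral>\<^sup>+w. ennreal (\<bar>P (w + x) - P x\<bar> * ?k (x - (w + x))) \<partial>lborel)"
          by (rule nn_integral_lborel_shift[symmetric]) measurable
        then show "(\<integral>\<^sup>+z. ennreal (\<bar>P z - P x\<bar> * ?k (x - z)) \<partial>lborel) = (\<integral>\<^sup>+w. ennreal (?k w * \<bar>P (x + w) - P x\<bar>) \<partial>lborel)"
          by (simp add: add.commute mult.commute)
      qed
      also have "\<dots> \<le> ennreal (l\<^sup>2 + C * (real DIM('a) * \<epsilon>))"
        using C by (intro kernel_shift_le[OF iP e]) auto
      finally show ?thesis .
    qed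
    have Jm: "J \<in> borel_measurable ?LL" and J0: "J y \<ge> 0" for y
      unfolding J_def P_def by (measurable, auto simp: case_prod_unfold)
    have iJ: "integrable ?LL J"
      using Jm J0 nnJ by (intro integrableI_nonneg) (auto simp: top_unique less_top[symmetric] intro: le_less_trans)
    have "ennreal (\<integral>y. J y \<partial>?LL) \<le> ennreal (l\<^sup>2 + C * (real DIM('a) * \<epsilon>))"
      using nnJ iJ J0 by (subst nn_integral_eq_integral[symmetric]) auto
    moreover have "0 \<le> l\<^sup>2 + C * (real DIM('a) * \<epsilon>)" using C e by simp
    ultimately have J: "(\<integral>y. J y \<partial>?LL) \<le> 2 * l\<^sup>2" using Ce by (simp add: ennreal_le_iff)
    have pw: "\<bar>B y - A y\<bar> \<le> l / 2 * Q y + 1 / (2 * l) * J y" for y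
    proof -
      obtain x z where y: "y = (x, z)" by (cases y)
      define D where "D = \<bar>F x - F z\<bar>"
      \<comment> \<open>For nonnegative F the squared difference of two values is at most the
        difference of their squares, so the L^1 modulus of F^2 controls the L^2 modulus of
        F.\<close>
      have D2: "D\<^sup>2 \<le> \<bar>P z - P x\<bar>"
      proof -
        have "D \<le> F x + F z" using F0[of x] F0[of z] by (simp add: D_def abs_le_iff)
        then have "D * D \<le> D * (F x + F z)" by (intro mult_left_mono) (auto simp: D_def)
        also have "\<dots> = \<bar>(F x - F z) * (F x + F z)\<bar>" using F0[of x] F0[of z] by (simp add: D_def abs_mult)
        also have "\<dots> = \<bar>P z - P x\<bar>" by (simp add: P_def power2_eq_square algebra_simps abs_minus_commute)
        finally show ?thesis by (simp add: power2_eq_square)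
      qed
      have "D * \<bar>G x\<bar> \<le> l / 2 * (G x)\<^sup>2 + 1 / (2 * l) * D\<^sup>2"
      proof -
        have "0 \<le> (l * \<bar>G x\<bar> - D)\<^sup>2 / (2 * l)" using l by simp
        also have "(l * \<bar>G x\<bar> - D)\<^sup>2 / (2 * l) = l / 2 * (G x)\<^sup>2 + 1 / (2 * l) * D\<^sup>2 - D * \<bar>G x\<bar>"
        proof -
          have "(l * m - D)\<^sup>2 / (2 * l) = l / 2 * m\<^sup>2 + 1 / (2 * l) * D\<^sup>2 - D * m" for m
            using l by (simp add: power2_eq_square field_simps)
          from this[of "\<bar>G x\<bar>"] show ?thesis by (simp only: power2_abs)
        qed
        finally show ?thesis by simp
      qed
      also have "\<dots> \<le> l / 2 * (G x)\<^sup>2 + 1 / (2 * l) * \<bar>P z - P x\<bar>"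
        using D2 l by (intro add_left_mono mult_left_mono) auto
      finally have "D * \<bar>G x\<bar> * ?k (x - z) \<le> (l / 2 * (G x)\<^sup>2 + 1 / (2 * l) * \<bar>P z - P x\<bar>) * ?k (x - z)"
        by (intro mult_right_mono) auto
      moreover have "B y - A y = (F x - F z) * G x * ?k (x - z)" by (simp add: y A_def B_def algebra_simps)
      then have "\<bar>B y - A y\<bar> = D * \<bar>G x\<bar> * ?k (x - z)" by (simp add: D_def abs_mult)
      moreover have "(l / 2 * (G x)\<^sup>2 + 1 / (2 * l) * \<bar>P z - P x\<bar>) * ?k (x - z) = l / 2 * Q y + 1 / (2 * l) * J y"
        by (simp add: y Q_def J_def distrib_right)
      ultimately show ?thesis by simp
    qed
    have "\<bar>I\<bar> = \<bar>\<integral>y. B y - A y \<partial>?LL\<bar>" using iA iB A0 BI by simp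
    also have "\<dots> \<le> (\<integral>y. \<bar>B y - A y\<bar> \<partial>?LL)" by (rule integral_abs_bound)
    also have "\<dots> \<le> (\<integral>y. l / 2 * Q y + 1 / (2 * l) * J y \<partial>?LL)"
      using iA iB iQ iJ pw by (intro integral_mono) auto
    also have "\<dots> = l / 2 * V + 1 / (2 * l) * (\<integral>y. J y \<partial>?LL)" using iQ iJ by simp
    also have "\<dots> \<le> l / 2 * V + 1 / (2 * l) * (2 * l\<^sup>2)" using J l by (intro add_left_mono mult_left_mono) auto
    also have "\<dots> = l * (V / 2 + 1)" using l by (simp add: power2_eq_square field_simps)
    finally show ?thesis .
  qed
  have V0: "V \<ge> 0" unfolding V_def by (intro integral_nonneg_AE) auto
  have "\<bar>I\<bar> \<le> 0"
  proof (rule field_le_epsilon)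
    fix e :: real assume e: "e > 0"
    have p: "V / 2 + 1 > 0" using V0 by simp
    then have "\<bar>I\<bar> \<le> e / (V / 2 + 1) * (V / 2 + 1)" using e by (intro bound divide_pos_pos)
    then show "\<bar>I\<bar> \<le> 0 + e" using p by simp
  qed
  then show ?thesis by (simp add: I_def)
qed

lemma heat_kernel_eq_exp:
  fixes z :: "'a::euclidean_space"
  assumes "s > 0"
  shows "heat_kernel s z = exp (ln ((2 * pi * s) powr (- (real DIM('a) / 2))) - (norm z)\<^sup>2 / (2 * s))"
proof -
  have "(2 * pi * s) powr (- (real DIM('a) / 2)) > 0" using assms by simp
  then show ?thesis
    unfolding heat_kernel_def diff_conv_add_uminus exp_add by (simp only: exp_ln minus_divide_left)
qed

lemma heat_kernel_mult_gaussian: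
  assumes "\<epsilon> > 0"
  shows "gaussian a \<beta> d x * heat_kernel \<epsilon> (x - z)
    = gaussian (a + 1 / (2 * \<epsilon>)) (\<beta> + (1 / \<epsilon>) *\<^sub>R z)
        (d - (norm z)\<^sup>2 / (2 * \<epsilon>) + ln ((2 * pi * \<epsilon>) powr (- (real DIM('a) / 2)))) (x :: 'a::euclidean_space)"
proof -
  have sq: "(norm (x - z))\<^sup>2 = (norm x)\<^sup>2 - 2 * (x \<bullet> z) + (norm z)\<^sup>2"
    by (simp add: power2_norm_eq_inner inner_diff_left inner_diff_right inner_commute)
  define L where "L = ln ((2 * pi * \<epsilon>) powr (- (real DIM('a) / 2)))"
  have exponent: "- a * N + p + d + (L - (N - 2 * r + Z) / (2 * \<epsilon>))
      = - (a + 1 / (2 * \<epsilon>)) * N + (p + (1 / \<epsilon>) * r) + (d - Z / (2 * \<epsilon>) + L)" for N p r Z :: real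
  proof -
    have 1: "(N - 2 * r + Z) / (2 * \<epsilon>) = N / (2 * \<epsilon>) - (1 / \<epsilon>) * r + Z / (2 * \<epsilon>)"
      by (simp add: add_divide_distrib diff_divide_distrib)
    have 2: "- (a + 1 / (2 * \<epsilon>)) * N = - a * N - N / (2 * \<epsilon>)"
      by (simp add: left_diff_distrib)
    show ?thesis unfolding 1 2 by linarith
  qed
  have "gaussian a \<beta> d x * heat_kernel \<epsilon> (x - z)
      = exp (- a * (norm x)\<^sup>2 + x \<bullet> \<beta> + d) * exp (L - ((norm x)\<^sup>2 - 2 * (x \<bullet> z) + (norm z)\<^sup>2) / (2 * \<epsilon>))"
    unfolding gaussian_def heat_kernel_eq_exp[OF assms] sq L_def by (rule refl)
  also have "\<dots> = exp (- a * (norm x)\<^sup>2 + x \<bullet> \<beta> + d + (L - ((norm x)\<^sup>2 - 2 * (x \<bullet> z) + (norm z)\<^sup>2) / (2 * \<epsilon>)))"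
    by (rule exp_add[symmetric])
  also have "\<dots> = gaussian (a + 1 / (2 * \<epsilon>)) (\<beta> + (1 / \<epsilon>) *\<^sub>R z) (d - (norm z)\<^sup>2 / (2 * \<epsilon>) + L) x"
    unfolding exponent gaussian_def inner_add_right inner_scaleR_right by (rule refl)
  finally show ?thesis unfolding L_def .
qed

text \<open>Formally the derivative of f^2 \<open>heat_kernel c x\<close>
  \<open>heat_kernel t (y - x)\<close> in direction v integrates to zero. The product of the two
  kernels is the square of one Gaussian \<open>?G\<close>, so this says that F = f \<open>?G\<close>
  is orthogonal to its own weak derivative, which is
  \<open>integral_times_weak_derivative\<close>.\<close>

lemma weak_gradient_sq:
  fixes f :: "'a::euclidean_space \<Rightarrow> real" and g :: "'a \<Rightarrow> 'a"
  assumes wg: "has_weak_gradient f g" and c: "c > 0" and t: "t > 0" and f0: "\<And>x. f x \<ge> 0"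
    and f2: "integrable lborel (\<lambda>x. (f x)\<^sup>2 * heat_kernel c x)"
    and g2: "integrable lborel (\<lambda>x. (norm (g x))\<^sup>2 * heat_kernel c x)"
  shows "integrable lborel (\<lambda>x. heat_kernel t (y - x) * ((2 * c * f x * heat_kernel c x) * (g x \<bullet> v)))"
    and "integrable lborel (\<lambda>x. heat_kernel t (y - x) * (((f x)\<^sup>2 * heat_kernel c x) * ((x - (c / t) *\<^sub>R (y - x)) \<bullet> v)))"
    and "(\<integral>x. heat_kernel t (y - x) * ((2 * c * f x * heat_kernel c x) * (g x \<bullet> v)) \<partial>lborel)
      = (\<integral>x. heat_kernel t (y - x) * (((f x)\<^sup>2 * heat_kernel c x) * ((x - (c / t) *\<^sub>R (y - x)) \<bullet> v)) \<partial>lborel)"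
proof -
  have [measurable]: "f \<in> borel_measurable borel" "g \<in> borel_measurable borel"
    using wg by (auto simp: has_weak_gradient_def locally_integrable_def)
  \<comment> \<open>Halves of the coefficients in the exponents of the two kernels, so that
    \<open>?G\<close> is the square root of their product. The summand 1 / (4 t) pushes a strictly
    above the threshold 1 / (4c).\<close>
  define a where "a = 1 / (4 * c) + 1 / (4 * t)"
  define \<beta> where "\<beta> = (1 / (2 * t)) *\<^sub>R y"
  define d where "d = (ln ((2 * pi * c) powr (- (real DIM('a) / 2))) + ln ((2 * pi * t) powr (- (real DIM('a) / 2)))) / 2
    - (norm y)\<^sup>2 / (4 * t)"
  have a: "a > 1 / (4 * c)" using t by (simp add: a_def)
  let ?G = "gaussian a \<beta> d"
  have G0: "?G x > 0" for x by simp
  have G2: "(?G x)\<^sup>2 = heat_kernel c x * heat_kernel t (y - x)" for x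
  proof -
    have sq: "(norm (y - x))\<^sup>2 = (norm x)\<^sup>2 - 2 * (x \<bullet> y) + (norm y)\<^sup>2"
      by (simp add: power2_norm_eq_inner inner_diff_left inner_diff_right inner_commute)
    have "(?G x)\<^sup>2 = exp (2 * (- a * (norm x)\<^sup>2 + x \<bullet> \<beta> + d))"
      unfolding gaussian_def exp_double by (rule refl)
    also have "2 * (- a * (norm x)\<^sup>2 + x \<bullet> \<beta> + d) = (ln ((2 * pi * c) powr (- (real DIM('a) / 2))) - (norm x)\<^sup>2 / (2 * c))
        + (ln ((2 * pi * t) powr (- (real DIM('a) / 2))) - (norm (y - x))\<^sup>2 / (2 * t))"
    proof -
      have "2 * (- (1 / (4 * c) + 1 / (4 * t)) * N + (1 / (2 * t)) * p + ((A + B) / 2 - Y / (4 * t)))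
          = (A - N / (2 * c)) + (B - (N - 2 * p + Y) / (2 * t))" for N p A B Y
      proof -
        have 1: "(N - 2 * p + Y) / (2 * t) = N / (2 * t) - p / t + Y / (2 * t)"
          by (simp add: add_divide_distrib diff_divide_distrib)
        have 2: "- (1 / (4 * c) + 1 / (4 * t)) * N = - (N / (4 * c)) - N / (4 * t)"
          by (simp add: left_diff_distrib)
        have 3: "N / (2 * c) = 2 * (N / (4 * c))" "N / (2 * t) = 2 * (N / (4 * t))" "Y / (2 * t) = 2 * (Y / (4 * t))"
            "p / t = 2 * (1 / (2 * t) * p)" by simp_all
        have "2 * (- n1 - n2 + q + ((A + B) / 2 - y')) = A - 2 * n1 + (B - (2 * n2 - 2 * q + 2 * y'))" for n1 n2 q y' :: real
          by (simp add: algebra_simps)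
        then show ?thesis unfolding 1 2 3 .
      qed
      from this[of "(norm x)\<^sup>2" "x \<bullet> y" "ln ((2 * pi * c) powr (- (real DIM('a) / 2)))"
          "ln ((2 * pi * t) powr (- (real DIM('a) / 2)))" "(norm y)\<^sup>2"]
      show ?thesis unfolding a_def \<beta>_def d_def sq inner_scaleR_right .
    qed
    finally show ?thesis unfolding heat_kernel_eq_exp[OF c] heat_kernel_eq_exp[OF t] exp_add .
  qed
  \<comment> \<open>Logarithmic derivative of \<open>?G\<close> in direction v. By the product rule
    \<open>E\<close> + \<open>U\<close> is then the weak derivative of \<open>F\<close>, with
    \<open>E\<close> from f and \<open>U\<close> from \<open>?G\<close>.\<close>
  define l where "l x = (\<beta> - (2 * a) *\<^sub>R x) \<bullet> v" for x
  have [measurable]: "l \<in> borel_measurable borel" unfolding l_def by measurable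
  obtain K where K: "K \<ge> 0" "\<And>x. (?G x)\<^sup>2 * (1 + (norm x)\<^sup>2) \<le> K * heat_kernel c x"
    using gaussian_sq_weight_le[OF c a, of \<beta> d] by blast
  have weight1: "(?G x)\<^sup>2 \<le> K * heat_kernel c x" for x
    using K(2)[of x] mult_left_mono[of 1 "1 + (norm x)\<^sup>2" "(?G x)\<^sup>2"] by simp
  define L where "L = 2 * (norm v)\<^sup>2 * ((norm \<beta>)\<^sup>2 + (2 * a)\<^sup>2)"
  have l2: "(l x)\<^sup>2 \<le> L * (1 + (norm x)\<^sup>2)" for x
  proof -
    define r s where "r = norm \<beta>" and "s = \<bar>2 * a\<bar> * norm x"
    have "\<bar>l x\<bar> \<le> norm (\<beta> - (2 * a) *\<^sub>R x) * norm v" unfolding l_def by (rule Cauchy_Schwarz_ineq2)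
    also have "\<dots> \<le> (r + s) * norm v"
      using norm_triangle_ineq4[of \<beta> "(2 * a) *\<^sub>R x"] by (intro mult_right_mono) (auto simp: r_def s_def)
    finally have "(l x)\<^sup>2 \<le> ((r + s) * norm v)\<^sup>2" by (rule abs_le_square_iff[THEN iffD1, OF order_trans[OF _ abs_ge_self]])
    also have "\<dots> = (r + s)\<^sup>2 * (norm v)\<^sup>2" by (rule power_mult_distrib)
    also have "\<dots> \<le> (2 * (r\<^sup>2 + s\<^sup>2)) * (norm v)\<^sup>2"
      using sum_squares_bound[of r s] by (intro mult_right_mono) (auto simp: power2_sum)
    also have "\<dots> = 2 * (norm v)\<^sup>2 * (r\<^sup>2 + (2 * a)\<^sup>2 * (norm x)\<^sup>2)"
      by (simp add: s_def power_mult_distrib mult_ac)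
    also have "\<dots> \<le> 2 * (norm v)\<^sup>2 * ((r\<^sup>2 + (2 * a)\<^sup>2) * (1 + (norm x)\<^sup>2))"
      by (intro mult_left_mono) (auto simp: algebra_simps)
    finally show ?thesis by (simp add: L_def r_def mult_ac)
  qed
  define F where "F x = f x * ?G x" for x
  define E where "E x = (g x \<bullet> v) * ?G x" for x
  define U where "U x = F x * l x" for x
  have [measurable]: "F \<in> borel_measurable borel" "E \<in> borel_measurable borel" "U \<in> borel_measurable borel"
    unfolding F_def E_def U_def by measurable
  have F2: "integrable lborel (\<lambda>x. (F x)\<^sup>2)"
  proof (rule Bochner_Integration.integrable_bound)
    show "integrable lborel (\<lambda>x. K * ((f x)\<^sup>2 * heat_kernel c x))" using f2 by simp
    show "AE x in lborel. norm ((F x)\<^sup>2) \<le> norm (K * ((f x)\<^sup>2 * heat_kernel c x))"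
    proof (rule AE_I2)
      fix x
      have "(F x)\<^sup>2 = (f x)\<^sup>2 * (?G x)\<^sup>2" by (simp add: F_def power_mult_distrib)
      also have "\<dots> \<le> (f x)\<^sup>2 * (K * heat_kernel c x)" by (intro mult_left_mono weight1) auto
      finally show "norm ((F x)\<^sup>2) \<le> norm (K * ((f x)\<^sup>2 * heat_kernel c x))"
        using K(1) by (simp add: mult_ac)
    qed
  qed measurable
  have E2: "integrable lborel (\<lambda>x. (E x)\<^sup>2)"
  proof (rule Bochner_Integration.integrable_bound)
    show "integrable lborel (\<lambda>x. (norm v)\<^sup>2 * K * ((norm (g x))\<^sup>2 * heat_kernel c x))" using g2 by simp
    show "AE x in lborel. norm ((E x)\<^sup>2) \<le> norm ((norm v)\<^sup>2 * K * ((norm (g x))\<^sup>2 * heat_kernel c x))"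
    proof (rule AE_I2)
      fix x
      have "(g x \<bullet> v)\<^sup>2 \<le> (norm (g x) * norm v)\<^sup>2"
        using Cauchy_Schwarz_ineq2[of "g x" v] by (intro abs_le_square_iff[THEN iffD1]) auto
      then have "(E x)\<^sup>2 \<le> (norm (g x) * norm v)\<^sup>2 * (K * heat_kernel c x)"
        unfolding E_def power_mult_distrib[of "g x \<bullet> v"] by (intro mult_mono weight1) auto
      then show "norm ((E x)\<^sup>2) \<le> norm ((norm v)\<^sup>2 * K * ((norm (g x))\<^sup>2 * heat_kernel c x))"
        using K(1) by (simp add: power_mult_distrib mult_ac)
    qed
  qed measurable
  have U2: "integrable lborel (\<lambda>x. (U x)\<^sup>2)"
  proof (rule Bochner_Integration.integrable_bound)
    show "integrable lborel (\<lambda>x. L * K * ((f x)\<^sup>2 * heat_kernel c x))" using f2 by simp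
    have L0: "L \<ge> 0" by (simp add: L_def)
    show "AE x in lborel. norm ((U x)\<^sup>2) \<le> norm (L * K * ((f x)\<^sup>2 * heat_kernel c x))"
    proof (rule AE_I2)
      fix x
      have "(U x)\<^sup>2 = (f x)\<^sup>2 * ((?G x)\<^sup>2 * (l x)\<^sup>2)" by (simp add: U_def F_def power_mult_distrib)
      also have "\<dots> \<le> (f x)\<^sup>2 * ((?G x)\<^sup>2 * (L * (1 + (norm x)\<^sup>2)))" by (intro mult_left_mono l2) auto
      also have "\<dots> = (f x)\<^sup>2 * (L * ((?G x)\<^sup>2 * (1 + (norm x)\<^sup>2)))" by (simp add: mult_ac)
      also have "\<dots> \<le> (f x)\<^sup>2 * (L * (K * heat_kernel c x))" using L0 by (intro mult_left_mono K) auto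
      finally show "norm ((U x)\<^sup>2) \<le> norm (L * K * ((f x)\<^sup>2 * heat_kernel c x))"
        using K(1) L0 by (simp add: mult_ac)
    qed
  qed measurable
  have EU2: "integrable lborel (\<lambda>x. (E x + U x)\<^sup>2)"
  proof (rule Bochner_Integration.integrable_bound)
    show "integrable lborel (\<lambda>x. 2 * (E x)\<^sup>2 + 2 * (U x)\<^sup>2)" using E2 U2 by simp
    have "(E x + U x)\<^sup>2 \<le> 2 * (E x)\<^sup>2 + 2 * (U x)\<^sup>2" for x
      using sum_squares_bound[of "E x" "U x"] by (simp add: power2_sum)
    then show "AE x in lborel. norm ((E x + U x)\<^sup>2) \<le> norm (2 * (E x)\<^sup>2 + 2 * (U x)\<^sup>2)" by simp
  qed measurable
  have prod: "integrable lborel (\<lambda>x. F x * H x)" if "integrable lborel (\<lambda>x. (H x)\<^sup>2)" and [measurable]: "H \<in> borel_measurable borel" for H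
  proof (rule Bochner_Integration.integrable_bound)
    show "integrable lborel (\<lambda>x. (F x)\<^sup>2 + (H x)\<^sup>2)" using F2 that by simp
    have "\<bar>a * b\<bar> \<le> a\<^sup>2 + b\<^sup>2" for a b :: real
      using sum_squares_bound[of "\<bar>a\<bar>" "\<bar>b\<bar>"] mult_nonneg_nonneg[OF abs_ge_zero[of a] abs_ge_zero[of b]]
      unfolding abs_mult power2_abs by linarith
    then show "AE x in lborel. norm (F x * H x) \<le> norm ((F x)\<^sup>2 + (H x)\<^sup>2)" by simp
  qed measurable
  have "(\<integral>x. F x * (E x + U x) \<partial>lborel) = 0"
  proof (rule integral_times_weak_derivative[OF _ _ _ F2 EU2, where v=v])
    show "F x \<ge> 0" for x using f0[of x] less_imp_le[OF G0[of x]] by (simp add: F_def)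
    fix \<epsilon> :: real and z :: 'a
    assume e: "\<epsilon> > 0"
    \<comment> \<open>The test function is \<open>?G\<close> times a translated heat kernel, again a
      Gaussian. Its logarithmic derivative is that of \<open>?G\<close> plus that of the kernel,
      which is where the division by \<epsilon> comes from.\<close>
    define a' where "a' = a + 1 / (2 * \<epsilon>)"
    define \<beta>' where "\<beta>' = \<beta> + (1 / \<epsilon>) *\<^sub>R z"
    define d' where "d' = d - (norm z)\<^sup>2 / (2 * \<epsilon>) + ln ((2 * pi * \<epsilon>) powr (- (real DIM('a) / 2)))"
    let ?k = "\<lambda>x. heat_kernel \<epsilon> (x - z)"
    have G': "gaussian a' \<beta>' d' x = ?G x * ?k x" for x
      unfolding a'_def \<beta>'_def d'_def by (rule heat_kernel_mult_gaussian[OF e, symmetric])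
    have a': "a' > 1 / (4 * c)"
    proof -
      have "1 / (2 * \<epsilon>) > 0" using e by simp
      then show ?thesis using a unfolding a'_def by linarith
    qed
    have drift: "(\<beta>' - (2 * a') *\<^sub>R x) \<bullet> v = l x - ((x - z) \<bullet> v) / \<epsilon>" for x
      by (simp add: a'_def \<beta>'_def l_def inner_diff_left inner_add_left distrib_right diff_divide_distrib)
    have bounded: "integrable lborel (\<lambda>x. w x * gaussian a' \<beta>' d' x * h x)"
      if "integrable lborel (\<lambda>x. (h x)\<^sup>2 * heat_kernel c x)" and [measurable]: "h \<in> borel_measurable borel" "w \<in> borel_measurable borel"
        and w: "\<And>x. \<bar>w x\<bar> \<le> C * (1 + norm x)" for h w :: "'a \<Rightarrow> real" and C
    proof (rule Bochner_Integration.integrable_bound)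
      show "integrable lborel (\<lambda>x. C * \<bar>gaussian a' \<beta>' d' x * (1 + norm x) * h x\<bar>)"
        using integrable_gaussian_times[OF c a' _ that(1), of \<beta>' d'] by simp
      show "AE x in lborel. norm (w x * gaussian a' \<beta>' d' x * h x) \<le> norm (C * \<bar>gaussian a' \<beta>' d' x * (1 + norm x) * h x\<bar>)"
      proof (rule AE_I2)
        fix x
        have "norm (w x * gaussian a' \<beta>' d' x * h x) = \<bar>w x\<bar> * \<bar>gaussian a' \<beta>' d' x * h x\<bar>" by (simp add: abs_mult)
        also have "\<dots> \<le> C * (1 + norm x) * \<bar>gaussian a' \<beta>' d' x * h x\<bar>" by (intro mult_right_mono w) auto
        also have "\<dots> = C * \<bar>gaussian a' \<beta>' d' x * (1 + norm x) * h x\<bar>" by (simp add: abs_mult mult_ac)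
        finally show "norm (w x * gaussian a' \<beta>' d' x * h x) \<le> norm (C * \<bar>gaussian a' \<beta>' d' x * (1 + norm x) * h x\<bar>)"
          unfolding real_norm_def by linarith
      qed
    qed measurable
    have lin: "\<bar>w \<bullet> v + x \<bullet> u\<bar> \<le> (norm w * norm v + norm u) * (1 + norm x)" for w u x :: 'a
    proof -
      have "\<bar>w \<bullet> v + x \<bullet> u\<bar> \<le> norm w * norm v + norm x * norm u"
        using Cauchy_Schwarz_ineq2[of w v] Cauchy_Schwarz_ineq2[of x u] by linarith
      also have "\<dots> \<le> (norm w * norm v + norm u) * (1 + norm x)" by (simp add: algebra_simps)
      finally show ?thesis .
    qed
    have gv2: "integrable lborel (\<lambda>x. (g x \<bullet> v)\<^sup>2 * heat_kernel c x)"
    proof (rule Bochner_Integration.integrable_bound)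
      show "integrable lborel (\<lambda>x. (norm v)\<^sup>2 * ((norm (g x))\<^sup>2 * heat_kernel c x))" using g2 by simp
      show "AE x in lborel. norm ((g x \<bullet> v)\<^sup>2 * heat_kernel c x) \<le> norm ((norm v)\<^sup>2 * ((norm (g x))\<^sup>2 * heat_kernel c x))"
      proof (rule AE_I2)
        fix x
        have "(g x \<bullet> v)\<^sup>2 \<le> (norm (g x) * norm v)\<^sup>2"
          using Cauchy_Schwarz_ineq2[of "g x" v] by (intro abs_le_square_iff[THEN iffD1]) auto
        then have "(g x \<bullet> v)\<^sup>2 * heat_kernel c x \<le> (norm (g x) * norm v)\<^sup>2 * heat_kernel c x" by (intro mult_right_mono) auto
        then show "norm ((g x \<bullet> v)\<^sup>2 * heat_kernel c x) \<le> norm ((norm v)\<^sup>2 * ((norm (g x))\<^sup>2 * heat_kernel c x))"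
          by (simp add: power_mult_distrib mult_ac)
      qed
    qed measurable
    have i1: "integrable lborel (\<lambda>x. 1 * gaussian a' \<beta>' d' x * (g x \<bullet> v))"
      by (rule bounded[OF gv2, where C=1]) auto
    have i2: "integrable lborel (\<lambda>x. l x * gaussian a' \<beta>' d' x * f x)"
    proof (rule bounded[OF f2])
      fix x
      show "\<bar>l x\<bar> \<le> (norm \<beta> * norm v + norm ((- 2 * a) *\<^sub>R v)) * (1 + norm x)"
        using lin[of \<beta> x "(- 2 * a) *\<^sub>R v"] by (simp add: l_def inner_diff_left)
    qed measurable
    have i3: "integrable lborel (\<lambda>x. ((x - z) \<bullet> v) * gaussian a' \<beta>' d' x * f x)"
    proof (rule bounded[OF f2])
      fix x
      show "\<bar>(x - z) \<bullet> v\<bar> \<le> (norm (- z) * norm v + norm v) * (1 + norm x)"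
        using lin[of "- z" x v] by (simp add: inner_diff_left)
    qed measurable
    have "(\<integral>x. (l x * gaussian a' \<beta>' d' x * f x) - (((x - z) \<bullet> v) * gaussian a' \<beta>' d' x * f x) / \<epsilon> \<partial>lborel)
        = - (\<integral>x. 1 * gaussian a' \<beta>' d' x * (g x \<bullet> v) \<partial>lborel)"
      using weak_gradient_gaussian[OF wg c a' f2 g2, of \<beta>' d' v] unfolding drift
      by (simp add: algebra_simps)
    then have "(\<integral>x. 1 * gaussian a' \<beta>' d' x * (g x \<bullet> v) \<partial>lborel) + (\<integral>x. l x * gaussian a' \<beta>' d' x * f x \<partial>lborel)
        = (\<integral>x. ((x - z) \<bullet> v) * gaussian a' \<beta>' d' x * f x \<partial>lborel) / \<epsilon>"
      using i2 i3 by simp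
    moreover have "(\<integral>x. (E x + U x) * ?k x \<partial>lborel)
        = (\<integral>x. 1 * gaussian a' \<beta>' d' x * (g x \<bullet> v) \<partial>lborel) + (\<integral>x. l x * gaussian a' \<beta>' d' x * f x \<partial>lborel)"
      unfolding Bochner_Integration.integral_add[OF i1 i2, symmetric] unfolding G'
      by (intro Bochner_Integration.integral_cong) (auto simp: E_def U_def F_def algebra_simps)
    moreover have "(\<integral>x. F x * (?k x * ((x - z) \<bullet> v)) \<partial>lborel) = (\<integral>x. ((x - z) \<bullet> v) * gaussian a' \<beta>' d' x * f x \<partial>lborel)"
      unfolding G' by (intro Bochner_Integration.integral_cong) (auto simp: F_def mult_ac)
    ultimately show "(\<integral>x. (E x + U x) * ?k x \<partial>lborel) = (\<integral>x. F x * (?k x * ((x - z) \<bullet> v)) \<partial>lborel) / \<epsilon>"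
      by simp
  qed measurable
  moreover have iE: "integrable lborel (\<lambda>x. F x * E x)" and iU: "integrable lborel (\<lambda>x. F x * U x)"
    using prod[OF E2] prod[OF U2] by auto
  ultimately have sum0: "(\<integral>x. F x * E x \<partial>lborel) + (\<integral>x. F x * U x \<partial>lborel) = 0"
    by (simp add: distrib_left)
  have e1: "heat_kernel t (y - x) * ((2 * c * f x * heat_kernel c x) * (g x \<bullet> v)) = 2 * c * (F x * E x)" for x
  proof -
    have "F x * E x = f x * (g x \<bullet> v) * (?G x)\<^sup>2" by (simp add: F_def E_def power2_eq_square mult_ac)
    then show ?thesis unfolding G2 by (simp add: mult_ac)
  qed
  have e2: "heat_kernel t (y - x) * (((f x)\<^sup>2 * heat_kernel c x) * ((x - (c / t) *\<^sub>R (y - x)) \<bullet> v)) = - (2 * c) * (F x * U x)" for x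
  proof -
    have FU: "F x * U x = (f x)\<^sup>2 * l x * (?G x)\<^sup>2" by (simp add: F_def U_def power2_eq_square mult_ac)
    have drift: "(- (2 * c)) * l x = (x - (c / t) *\<^sub>R (y - x)) \<bullet> v"
    proof -
      have "- (2 * c) * l x = (x \<bullet> v) * (2 * c * (2 * a)) - (y \<bullet> v) * (2 * c / (2 * t))"
        unfolding l_def \<beta>_def by (simp add: inner_diff_left algebra_simps)
      also have "2 * c * (2 * a) = 1 + c / t" using c by (simp add: a_def distrib_left)
      finally show ?thesis by (simp add: inner_diff_left algebra_simps)
    qed
    have "b * (F2 * m * (h * k)) = k * (F2 * h * (b * m))" for b F2 m h k :: real by (simp add: mult_ac)
    from this[of "- (2 * c)" "(f x)\<^sup>2" "l x" "heat_kernel c x" "heat_kernel t (y - x)"]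
    show ?thesis unfolding FU G2 drift by (rule sym)
  qed
  show "integrable lborel (\<lambda>x. heat_kernel t (y - x) * ((2 * c * f x * heat_kernel c x) * (g x \<bullet> v)))"
    unfolding e1 using iE by simp
  show "integrable lborel (\<lambda>x. heat_kernel t (y - x) * (((f x)\<^sup>2 * heat_kernel c x) * ((x - (c / t) *\<^sub>R (y - x)) \<bullet> v)))"
    unfolding e2 using iU by simp
  show "(\<integral>x. heat_kernel t (y - x) * ((2 * c * f x * heat_kernel c x) * (g x \<bullet> v)) \<partial>lborel)
      = (\<integral>x. heat_kernel t (y - x) * (((f x)\<^sup>2 * heat_kernel c x) * ((x - (c / t) *\<^sub>R (y - x)) \<bullet> v)) \<partial>lborel)"
    unfolding e1 e2 integral_mult_right_zero using sum0
    by (simp add: eq_neg_iff_add_eq_0 distrib_left[symmetric])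
qed

section \<open>Functions of small deficit\<close>

text \<open>The bound \<delta> serves twice: through the comparison with variance c / 2 it bounds
  E|W|^2 by a constant \<open>L\<close>, and through the remainder it makes the spread at most 2(c +
  t) \<delta>. In \<open>expectation_norm_W_le\<close> t is then taken large, and k large depending
  on t.\<close>

lemma score_tendsto_zero:
  fixes \<mu> :: "nat \<Rightarrow> 'a::euclidean_space measure"
  assumes sd: "\<And>k. score_density (\<mu> k) c (W k) (p k)"
    and M: "\<And>k. (\<integral>x. (norm x)\<^sup>2 \<partial>\<mu> k) \<le> M"
    and centered: "\<And>k. (\<integral>x. x \<partial>\<mu> k) = 0"
    and rel: "\<And>k. integrable lborel (\<lambda>y. score_density.relative_density c y (p k y))"
    and \<delta>: "\<And>k. (\<integral>x. (norm (W k x))\<^sup>2 \<partial>\<mu> k) / (2 * c)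
      - (\<integral>y. score_density.relative_density c y (p k y) \<partial>lborel) \<le> \<delta> k"
    and \<delta>0: "\<delta> \<longlonglongrightarrow> 0"
  shows "(\<lambda>k. \<integral>x. norm (W k x) \<partial>\<mu> k) \<longlonglongrightarrow> 0"
proof -
  interpret sd: score_density "\<mu> k" c "W k" "p k" for k by (rule sd)
  have c: "c > 0" by (rule sd.c_pos)
  define B where "B k = (\<integral>x. (norm (W k x))\<^sup>2 \<partial>\<mu> k)" for k
  define K where "K = 2 powr (real DIM('a) / 2)"
  obtain b where b: "\<And>k. \<bar>\<delta> k\<bar> \<le> b"
    using convergent_imp_Bseq[of \<delta>] \<delta>0 by (auto simp: Bseq_def convergent_def)
  define L where "L = 8 * c * (b + (real DIM('a) / 2) * ln 2 + M / (4 * c))"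
  have B: "B k \<le> L" for k
  proof -
    have N2: "(\<integral>x. (norm x)\<^sup>2 \<partial>\<mu> k) / (4 * c) \<le> M / (4 * c)"
      by (rule divide_right_mono[OF M]) (simp add: less_imp_le[OF c])
    have "B k / (8 * c) \<le> b + (real DIM('a) / 2) * ln 2 + M / (4 * c)"
    proof -
      have "q \<le> b + e + m" if "q \<le> w - h + e + N" "w - h \<le> d" "\<bar>d\<bar> \<le> b" "N \<le> m" for q w h e N d m :: real
        using that by linarith
      from this[OF sd.expectation_W_sq_le[OF rel, of k] \<delta> b N2] show ?thesis unfolding B_def .
    qed
    then have "8 * c * (B k / (8 * c)) \<le> L" unfolding L_def by (rule mult_left_mono) (simp add: less_imp_le[OF c])
    then show ?thesis using less_imp_neq[OF c] by simp
  qed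
  have spread: "sd.spread k t \<le> 2 * (c + t) * \<delta> k" if t: "t > 0" for k t
  proof -
    have ct: "2 * (c + t) > 0" using add_pos_pos[OF c t] by simp
    have "ennreal (\<integral>y. sd.relative_density y (p k y) \<partial>lborel)
        = (\<integral>\<^sup>+y. ennreal (sd.relative_density y (p k y)) \<partial>lborel)"
      by (rule nn_integral_eq_integral[symmetric, OF rel]) (auto intro!: sd.relative_density_nonneg)
    also note sd.log_sobolev_remainder(1)[OF t, of k]
    finally have "(\<integral>y. sd.relative_density y (p k y) \<partial>lborel) \<le> B k / (2 * c) - sd.spread k t / (2 * (c + t))"
      using sd.log_sobolev_remainder(2)[OF t, of k] unfolding B_def by (simp only: ennreal_le_iff)
    moreover have "B k / (2 * c) - (\<integral>y. sd.relative_density y (p k y) \<partial>lborel) \<le> \<delta> k"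
      using \<delta>[of k] by (simp only: B_def)
    moreover have "s \<le> d" if "h \<le> w - s" "w - h \<le> d" for h w s d :: real using that by linarith
    ultimately have "sd.spread k t / (2 * (c + t)) \<le> \<delta> k" by blast
    then show ?thesis using ct by (simp only: pos_divide_le_eq mult.commute)
  qed
  have main: "(\<integral>x. norm (W k x) \<partial>\<mu> k) \<le> l / 2 + K * (2 * (c + t)) / l * \<delta> k + 2 * (M + L) / sqrt (8 * t)"
    if t: "t > 0" and l: "l > 0" for k t l
  proof -
    have "K * sd.spread k t / l \<le> K * (2 * (c + t) * \<delta> k) / l"
      using l spread[OF t, of k] by (intro divide_right_mono mult_left_mono) (auto simp: K_def)
    moreover have "2 * ((\<integral>x. (norm x)\<^sup>2 \<partial>\<mu> k) + B k) / sqrt (8 * t) \<le> 2 * (M + L) / sqrt (8 * t)"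
      using t M[of k] B[of k] by (intro divide_right_mono mult_left_mono add_mono) auto
    moreover have "(\<integral>x. norm (W k x) \<partial>\<mu> k) \<le> l / 2 + K * sd.spread k t / l
        + 2 * ((\<integral>x. (norm x)\<^sup>2 \<partial>\<mu> k) + B k) / sqrt (8 * t)"
      using sd.expectation_norm_W_le[OF centered t l] unfolding K_def B_def .
    moreover have "x \<le> w + d + n" if "s \<le> d" "r \<le> n" "x \<le> w + s + r" for x w d n s r :: real using that by linarith
    ultimately have "(\<integral>x. norm (W k x) \<partial>\<mu> k) \<le> l / 2 + K * (2 * (c + t) * \<delta> k) / l + 2 * (M + L) / sqrt (8 * t)"
      by blast
    then show ?thesis by (simp add: mult_ac)
  qed
  show ?thesis
  proof (rule LIMSEQ_I)
    fix \<epsilon> :: real assume e: "\<epsilon> > 0"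
    \<comment> \<open>Budget: the choice l = \<epsilon> costs \<epsilon> / 2, and the term in t and
      the term in \<delta> get \<epsilon> / 4 each.\<close>
    have "((\<lambda>t. 2 * (M + L) / sqrt (8 * t)) \<longlongrightarrow> 0) at_top" by real_asymp
    then have "eventually (\<lambda>t. 2 * (M + L) / sqrt (8 * t) < \<epsilon> / 4) at_top"
      by (rule order_tendstoD(2)) (use e in auto)
    then obtain t where t: "t > 0" "2 * (M + L) / sqrt (8 * t) < \<epsilon> / 4"
      using eventually_happens[OF eventually_conj[OF _ eventually_gt_at_top[of 0]]] by auto
    have "(\<lambda>k. K * (2 * (c + t)) / \<epsilon> * \<delta> k) \<longlonglongrightarrow> K * (2 * (c + t)) / \<epsilon> * 0"
      by (intro tendsto_intros \<delta>0)
    then have "eventually (\<lambda>k. K * (2 * (c + t)) / \<epsilon> * \<delta> k < \<epsilon> / 4) sequentially"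
      by (rule order_tendstoD(2)) (use e in auto)
    then obtain k0 where k0: "\<And>k. k \<ge> k0 \<Longrightarrow> K * (2 * (c + t)) / \<epsilon> * \<delta> k < \<epsilon> / 4"
      by (auto simp: eventually_sequentially)
    have "norm ((\<integral>x. norm (W k x) \<partial>\<mu> k) - 0) < \<epsilon>" if "k \<ge> k0" for k
    proof -
      have "(\<integral>x. norm (W k x) \<partial>\<mu> k) \<ge> 0" by (intro integral_nonneg_AE) auto
      moreover have "\<bar>x - 0\<bar> < \<epsilon>" if "x \<ge> 0" "x \<le> \<epsilon> / 2 + a + b" "a < \<epsilon> / 4" "b < \<epsilon> / 4" for x a b
        using that by linarith
      ultimately show ?thesis using main[OF t(1) e, of k] k0[OF that] t(2) unfolding real_norm_def by blast
    qed
    then show "\<exists>no. \<forall>k\<ge>no. norm ((\<integral>x. norm (W k x) \<partial>\<mu> k) - 0) < \<epsilon>" by blast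
  qed
qed

section \<open>From functions of small deficit to score fields\<close>

lemma smooth_imp_continuous_on: "smooth \<phi> \<Longrightarrow> continuous_on UNIV \<phi>"
  by (auto elim!: smooth.cases intro!: continuous_at_imp_continuous_on differentiable_imp_continuous_within)

lemma borel_measurable_test_function:
  assumes "test_function \<phi>"
  shows "\<phi> \<in> borel_measurable borel" "(\<lambda>x. frechet_derivative \<phi> (at x) v) \<in> borel_measurable borel"
proof -
  have s: "smooth \<phi>" using assms by (simp add: test_function_def)
  then have "smooth (\<lambda>x. frechet_derivative \<phi> (at x) v)" by (auto elim: smooth.cases)
  with s show "\<phi> \<in> borel_measurable borel" "(\<lambda>x. frechet_derivative \<phi> (at x) v) \<in> borel_measurable borel"
    by (auto intro!: borel_measurable_continuous_onI smooth_imp_continuous_on)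
qed

text \<open>Allows f to be replaced by |f|, equal to it almost everywhere under the sign hypothesis,
  while keeping the same weak gradient.\<close>

lemma has_weak_gradient_cong_AE:
  assumes wg: "has_weak_gradient f g" and [measurable]: "f' \<in> borel_measurable borel"
    and eq: "AE x in lborel. f x = f' x"
  shows "has_weak_gradient f' g"
proof -
  have [measurable]: "f \<in> borel_measurable borel"
    using wg by (auto simp: has_weak_gradient_def locally_integrable_def)
  have "locally_integrable f'"
    unfolding locally_integrable_def
  proof (intro conjI allI impI)
    fix K :: "'a set" assume K: "compact K"
    then have [measurable]: "K \<in> sets borel" by (simp add: borel_closed compact_imp_closed)
    have "integrable lborel (\<lambda>x. indicator K x *\<^sub>R f x)"
      using wg K by (auto simp: has_weak_gradient_def locally_integrable_def set_integrable_def)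
    then show "set_integrable lborel K f'"
      unfolding set_integrable_def by (rule integrable_cong_AE_imp) (use eq in auto)
  qed measurable
  moreover have "(\<integral>x. f' x * frechet_derivative \<phi> (at x) v \<partial>lborel) = - (\<integral>x. (g x \<bullet> v) * \<phi> x \<partial>lborel)"
    if "test_function \<phi>" for \<phi> v
  proof -
    note borel_measurable_test_function[OF that, measurable]
    have "(\<integral>x. f' x * frechet_derivative \<phi> (at x) v \<partial>lborel) = (\<integral>x. f x * frechet_derivative \<phi> (at x) v \<partial>lborel)"
      by (rule integral_cong_AE) (use eq in auto)
    then show ?thesis using wg that by (simp add: has_weak_gradient_def)
  qed
  ultimately show ?thesis using wg by (simp add: has_weak_gradient_def)
qed

lemma sets_gauss [measurable_cong, simp]: "sets gauss = sets borel" "space gauss = UNIV"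
  by (simp_all add: gauss_def)

lemma integral_gauss:
  fixes h :: "'a::euclidean_space \<Rightarrow> 'b::{banach, second_countable_topology}"
  assumes [measurable]: "h \<in> borel_measurable borel"
  shows "(\<integral>x. h x \<partial>gauss) = (\<integral>x. heat_kernel (1 / (4 * pi)) x *\<^sub>R h x \<partial>lborel)"
    and "integrable gauss h \<longleftrightarrow> integrable lborel (\<lambda>x. heat_kernel (1 / (4 * pi)) x *\<^sub>R h x)"
  unfolding gauss_eq_heat_kernel by (subst integral_density integrable_density; simp)+

lemma AE_gauss_iff: "(AE x in gauss. P x) \<longleftrightarrow> (AE x in lborel. P x)"
  unfolding gauss_eq_heat_kernel by (subst AE_density) auto

lemma emeasure_gauss_UNIV: "emeasure (gauss :: 'a::euclidean_space measure) UNIV = 1"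
  unfolding gauss_eq_heat_kernel by (simp add: emeasure_density nn_integral_heat_kernel)

text \<open>The energy is an infimum, so a gradient that nearly attains it is enough; this makes do
  without the uniqueness of weak gradients and costs \<eta>. A finite deficit rules out infinite
  energy and infinite entropy under the \<open>ereal\<close> conventions.\<close>

lemma deficit_realize:
  fixes f :: "'a::euclidean_space \<Rightarrow> real"
  assumes [measurable]: "f \<in> borel_measurable borel" and D: "deficit f = ereal D" and "\<eta> > 0"
  obtains g where "has_weak_gradient f g" "integrable gauss (\<lambda>x. (norm (g x))\<^sup>2)"
    "integrable gauss (\<lambda>x. (f x)\<^sup>2 * ln ((f x)\<^sup>2))"
    "1 / (2 * pi) * (\<integral>x. (norm (g x))\<^sup>2 \<partial>gauss) - (\<integral>x. (f x)\<^sup>2 * ln ((f x)\<^sup>2) \<partial>gauss) \<le> D + \<eta>"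
proof -
  define u where "u x = (f x)\<^sup>2 * ln ((f x)\<^sup>2)" for x
  have [measurable]: "u \<in> borel_measurable borel" unfolding u_def by measurable
  define P where "P = (\<integral>\<^sup>+x. ennreal (u x) \<partial>gauss)"
  define N where "N = (\<integral>\<^sup>+x. ennreal (- u x) \<partial>gauss)"
  have u_ge: "- u x \<le> 1" for x
  proof (cases "f x = 0")
    case False
    then have "(f x)\<^sup>2 * ln (1 / (f x)\<^sup>2) \<le> (f x)\<^sup>2 * (1 / (f x)\<^sup>2 - 1)"
      by (intro mult_left_mono ln_le_minus_one) auto
    then have "- u x \<le> 1 - (f x)\<^sup>2" using False by (simp add: u_def ln_div right_diff_distrib)
    then show ?thesis using zero_le_power2[of "f x"] by linarith
  qed (simp add: u_def)
  have "N \<le> (\<integral>\<^sup>+x. 1 \<partial>(gauss :: 'a measure))"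
    unfolding N_def by (intro nn_integral_mono) (use u_ge in \<open>simp add: ennreal_le_1\<close>)
  then have "N \<le> 1" by (simp add: emeasure_gauss_UNIV)
  then have "N \<noteq> \<infinity>" by (auto simp: top_unique)
  then obtain n where n: "N = ennreal n" "n \<ge> 0" by (cases N) auto
  have def: "deficit f = ereal (1 / (2 * pi)) * enn2ereal (dirichlet_energy f) - (enn2ereal P - ereal n)"
    unfolding deficit_def gauss_entropy_def P_def using n unfolding N_def by (simp add: u_def enn2ereal_ennreal)
  have "dirichlet_energy f \<noteq> \<infinity>"
  proof
    assume "dirichlet_energy f = \<infinity>"
    then have "deficit f = \<infinity>" unfolding def by simp
    then show False using D by simp
  qed
  then obtain e where e: "dirichlet_energy f = ennreal e" "e \<ge> 0" by (cases "dirichlet_energy f") auto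
  \<comment> \<open>The energy is already known to be finite, so an infinite entropy would make the
    deficit minus infinity and not the ambiguous difference of two infinities.\<close>
  have "P \<noteq> \<infinity>"
  proof
    assume "P = \<infinity>"
    then have "deficit f = - \<infinity>" unfolding def e(1) using e(2) by (simp add: enn2ereal_ennreal)
    then show False using D by simp
  qed
  then obtain q where q: "P = ennreal q" "q \<ge> 0" by (cases P) auto
  have De: "D = 1 / (2 * pi) * e - (q - n)"
    using D unfolding def e(1) q(1) using e(2) q(2) by (simp add: enn2ereal_ennreal)
  have iu: "integrable gauss u"
    using n q unfolding real_integrable_def N_def P_def by simp
  have vu: "(\<integral>x. u x \<partial>gauss) = q - n"
    using n q unfolding real_lebesgue_integral_def[OF iu] N_def[symmetric] P_def[symmetric] by simp
  have "dirichlet_energy f < ennreal (e + 2 * pi * \<eta>)"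
    unfolding e(1) using e(2) \<open>\<eta> > 0\<close> by (intro ennreal_lessI add_nonneg_pos) auto
  then obtain g where g: "has_weak_gradient f g" "(\<integral>\<^sup>+x. ennreal ((norm (g x))\<^sup>2) \<partial>gauss) < ennreal (e + 2 * pi * \<eta>)"
    unfolding dirichlet_energy_def by (auto simp: INF_less_iff)
  have [measurable]: "g \<in> borel_measurable borel"
    using g by (auto simp: has_weak_gradient_def locally_integrable_def)
  have ig: "integrable gauss (\<lambda>x. (norm (g x))\<^sup>2)"
    by (rule integrableI_nonneg) (use g(2) in \<open>auto intro: order.strict_trans\<close>)
  have "ennreal (\<integral>x. (norm (g x))\<^sup>2 \<partial>gauss) < ennreal (e + 2 * pi * \<eta>)"
    using g(2) by (subst (asm) nn_integral_eq_integral[OF ig]) auto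
  then have "(\<integral>x. (norm (g x))\<^sup>2 \<partial>gauss) \<le> e + 2 * pi * \<eta>"
    by (subst (asm) ennreal_less_iff) auto
  then have "1 / (2 * pi) * (\<integral>x. (norm (g x))\<^sup>2 \<partial>gauss) \<le> 1 / (2 * pi) * (e + 2 * pi * \<eta>)"
    by (intro mult_left_mono) auto
  also have "\<dots> = 1 / (2 * pi) * e + \<eta>" by (simp add: add_divide_distrib)
  finally have "1 / (2 * pi) * (\<integral>x. (norm (g x))\<^sup>2 \<partial>gauss) - (\<integral>x. u x \<partial>gauss) \<le> D + \<eta>"
    unfolding De vu by linarith
  with that[OF g(1) ig] iu show ?thesis unfolding u_def by blast
qed

locale finite_energy =
  fixes f :: "'a::euclidean_space \<Rightarrow> real" and g :: "'a \<Rightarrow> 'a"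
  assumes wg: "has_weak_gradient f g"
    and f_nonneg: "\<And>x. f x \<ge> 0"
    and normalized: "(\<integral>x. (f x)\<^sup>2 \<partial>gauss) = 1"
    and norm_sq: "integrable gauss (\<lambda>x. (norm x)\<^sup>2 * (f x)\<^sup>2)"
    and energy: "integrable gauss (\<lambda>x. (norm (g x))\<^sup>2)"
begin

definition variance :: real where "variance = 1 / (4 * pi)"

definition law :: "'a \<Rightarrow> real" where "law x = (f x)\<^sup>2 * heat_kernel variance x"

text \<open>Where \<open>f x = 0\<close>, the convention \<open>1 / 0 = 0\<close> makes the drift vanish; this is harmless because the law
  vanishes there as well.\<close>

definition drift :: "'a \<Rightarrow> 'a" where "drift x = (2 * variance / f x) *\<^sub>R g x"

lemma measurable_fg [measurable]: "f \<in> borel_measurable borel" "g \<in> borel_measurable borel"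
  using wg by (auto simp: has_weak_gradient_def locally_integrable_def)

lemma variance_pos: "variance > 0" by (simp add: variance_def)

lemma borel_measurable_law [measurable]: "law \<in> borel_measurable borel"
  unfolding law_def by measurable

lemma borel_measurable_drift [measurable]: "drift \<in> borel_measurable borel"
  unfolding drift_def by measurable

lemma law_nonneg: "law x \<ge> 0" by (simp add: law_def)

lemma law_drift: "law x *\<^sub>R drift x = (2 * variance * f x * heat_kernel variance x) *\<^sub>R g x"
  by (cases "f x = 0") (simp_all add: law_def drift_def power2_eq_square)

lemma channel: "channel_density (density lborel law) law"
proof -
  have f2: "integrable gauss (\<lambda>x. (f x)\<^sup>2)"
    using normalized not_integrable_integral_eq[of gauss "\<lambda>x. (f x)\<^sup>2"] by fastforce
  have "integrable lborel law" and "(\<integral>x. law x \<partial>lborel) = 1"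
    using f2 normalized unfolding integral_gauss[of "\<lambda>x. (f x)\<^sup>2", simplified]
    by (simp_all add: law_def[abs_def] variance_def mult.commute)
  then have "(\<integral>\<^sup>+x. ennreal (law x) \<partial>lborel) = 1"
    using law_nonneg by (subst nn_integral_eq_integral) auto
  then interpret prob_space "density lborel law" by (intro prob_spaceI) (simp add: emeasure_density)
  have "integrable (density lborel law) (\<lambda>x. (norm x)\<^sup>2)"
    using norm_sq integral_gauss(2)[of "\<lambda>x. (norm x)\<^sup>2 * (f x)\<^sup>2"] law_nonneg
    by (subst integrable_density) (auto simp: law_def variance_def mult_ac)
  then show ?thesis by unfold_locales (auto simp: law_nonneg)
qed

sublocale channel: channel_density "density lborel law" law by (rule channel)

text \<open>Only an inequality, since the drift is zero where f vanishes while nothing is claimed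
  about g there; a bound from above is all that the deficit estimate asks for.\<close>

lemma drift_sq:
  shows "integrable (density lborel law) (\<lambda>x. (norm (drift x))\<^sup>2)"
    and "(\<integral>x. (norm (drift x))\<^sup>2 \<partial>density lborel law) \<le> (2 * variance)\<^sup>2 * (\<integral>x. (norm (g x))\<^sup>2 \<partial>gauss)"
proof -
  have le: "law x * (norm (drift x))\<^sup>2 \<le> (2 * variance)\<^sup>2 * (heat_kernel variance x * (norm (g x))\<^sup>2)" for x
    by (cases "f x = 0") (simp_all add: law_def drift_def power_divide power_mult_distrib)
  have i: "integrable lborel (\<lambda>x. (2 * variance)\<^sup>2 * (heat_kernel variance x * (norm (g x))\<^sup>2))"
    using energy integral_gauss(2)[of "\<lambda>x. (norm (g x))\<^sup>2"] by (simp add: variance_def)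
  have j: "integrable lborel (\<lambda>x. law x * (norm (drift x))\<^sup>2)"
    by (rule Bochner_Integration.integrable_bound[OF i])
      (use le in \<open>auto simp: law_nonneg intro!: AE_I2 elim: order_trans\<close>)
  then show "integrable (density lborel law) (\<lambda>x. (norm (drift x))\<^sup>2)" by (subst channel.integrable_\<mu>) auto
  show "(\<integral>x. (norm (drift x))\<^sup>2 \<partial>density lborel law) \<le> (2 * variance)\<^sup>2 * (\<integral>x. (norm (g x))\<^sup>2 \<partial>gauss)"
    using integral_mono[OF j i le] channel.integral_\<mu>[of "\<lambda>x. (norm (drift x))\<^sup>2"]
      integral_gauss(1)[of "\<lambda>x. (norm (g x))\<^sup>2"] by (simp add: variance_def)
qed

text \<open>In each coordinate this is \<open>weak_gradient_sq\<close>: by \<open>law_drift\<close>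
  the law times the drift is a multiple of f g and the Gaussian density, also at the zeros of
  f.\<close>

lemma drift_law:
  assumes t: "t > 0"
  shows "(\<integral>x. heat_kernel t (y - x) *\<^sub>R drift x \<partial>density lborel law)
    = (\<integral>x. heat_kernel t (y - x) *\<^sub>R (x - (variance / t) *\<^sub>R (y - x)) \<partial>density lborel law)"
proof (rule euclidean_eqI)
  fix b :: 'a
  have f2: "integrable lborel (\<lambda>x. (f x)\<^sup>2 * heat_kernel variance x)"
    using channel.integrable_p unfolding law_def[abs_def] .
  have g2: "integrable lborel (\<lambda>x. (norm (g x))\<^sup>2 * heat_kernel variance x)"
    using energy integral_gauss(2)[of "\<lambda>x. (norm (g x))\<^sup>2"] by (simp add: variance_def mult.commute)
  note eq = weak_gradient_sq(3)[OF wg variance_pos t f_nonneg f2 g2, of y b]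
  have "integrable (density lborel law) (\<lambda>x. x - (variance / t) *\<^sub>R (y - x))" using channel.integrable_id by simp
  note i = channel.integrable_kernel[OF t this, of y]
    channel.integrable_kernel[OF t channel.integrable_of_sq[OF borel_measurable_drift drift_sq(1)], of y]
  have "(\<integral>x. heat_kernel t (y - x) *\<^sub>R drift x \<partial>density lborel law) \<bullet> b
      = (\<integral>x. (heat_kernel t (y - x) *\<^sub>R drift x) \<bullet> b \<partial>density lborel law)"
    by (rule integral_inner_left[symmetric]) (rule i(2))
  also have "\<dots> = (\<integral>x. law x *\<^sub>R ((heat_kernel t (y - x) *\<^sub>R drift x) \<bullet> b) \<partial>lborel)"
    by (rule channel.integral_\<mu>) measurable
  also have "\<dots> = (\<integral>x. heat_kernel t (y - x) * ((2 * variance * f x * heat_kernel variance x) * (g x \<bullet> b)) \<partial>lborel)"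
  proof (rule Bochner_Integration.integral_cong[OF refl])
    fix x
    have "law x *\<^sub>R ((heat_kernel t (y - x) *\<^sub>R drift x) \<bullet> b) = heat_kernel t (y - x) * ((law x *\<^sub>R drift x) \<bullet> b)" by simp
    then show "law x *\<^sub>R ((heat_kernel t (y - x) *\<^sub>R drift x) \<bullet> b)
        = heat_kernel t (y - x) * ((2 * variance * f x * heat_kernel variance x) * (g x \<bullet> b))"
      unfolding law_drift by simp
  qed
  also have "\<dots> = (\<integral>x. law x *\<^sub>R ((heat_kernel t (y - x) *\<^sub>R (x - (variance / t) *\<^sub>R (y - x))) \<bullet> b) \<partial>lborel)"
    unfolding eq law_def[symmetric] by (intro Bochner_Integration.integral_cong) (auto simp: mult_ac)
  also have "\<dots> = (\<integral>x. (heat_kernel t (y - x) *\<^sub>R (x - (variance / t) *\<^sub>R (y - x))) \<bullet> b \<partial>density lborel law)"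
    by (rule channel.integral_\<mu>[symmetric]) measurable
  also have "\<dots> = (\<integral>x. heat_kernel t (y - x) *\<^sub>R (x - (variance / t) *\<^sub>R (y - x)) \<partial>density lborel law) \<bullet> b"
    by (rule integral_inner_left) (rule i(1))
  finally show "(\<integral>x. heat_kernel t (y - x) *\<^sub>R drift x \<partial>density lborel law) \<bullet> b
    = (\<integral>x. heat_kernel t (y - x) *\<^sub>R (x - (variance / t) *\<^sub>R (y - x)) \<partial>density lborel law) \<bullet> b" .
qed

sublocale score_density "density lborel law" variance drift law
  by unfold_locales (use variance_pos drift_sq drift_law in auto)

lemma relative_density_law:
  "relative_density y (law y) = heat_kernel variance y * ((f y)\<^sup>2 * ln ((f y)\<^sup>2) - (f y)\<^sup>2 + 1)"
proof (cases "f y = 0")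
  case False
  have h: "heat_kernel variance y > 0" using variance_pos by simp
  have "ln (law y) = ln ((f y)\<^sup>2) + ln (heat_kernel variance y)"
    unfolding law_def using False h by (intro ln_mult_pos) auto
  then show ?thesis by (simp add: relative_density_def law_def algebra_simps)
qed (simp add: relative_density_def law_def)

text \<open>The extra terms - f^2 + 1 in \<open>relative_density_law\<close> integrate to zero by
  normalization, leaving the entropy that occurs in the deficit.\<close>

lemma integral_relative_density:
  assumes "integrable gauss (\<lambda>x. (f x)\<^sup>2 * ln ((f x)\<^sup>2))"
  shows "integrable lborel (\<lambda>y. relative_density y (law y))"
    and "(\<integral>y. relative_density y (law y) \<partial>lborel) = (\<integral>x. (f x)\<^sup>2 * ln ((f x)\<^sup>2) \<partial>gauss)"
proof -
  have i: "integrable lborel (\<lambda>y. heat_kernel variance y * ((f y)\<^sup>2 * ln ((f y)\<^sup>2)))"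
    using assms integral_gauss(2)[of "\<lambda>x. (f x)\<^sup>2 * ln ((f x)\<^sup>2)"] by (simp add: variance_def)
  have eq: "relative_density y (law y) = heat_kernel variance y * ((f y)\<^sup>2 * ln ((f y)\<^sup>2)) - law y + heat_kernel variance y" for y
    unfolding relative_density_law by (simp add: law_def algebra_simps)
  note j = i channel.integrable_p channel.integral_p heat_kernel_mass[OF variance_pos]
  show "integrable lborel (\<lambda>y. relative_density y (law y))" unfolding eq using j by simp
  show "(\<integral>y. relative_density y (law y) \<partial>lborel) = (\<integral>x. (f x)\<^sup>2 * ln ((f x)\<^sup>2) \<partial>gauss)"
    unfolding eq using j integral_gauss(1)[of "\<lambda>x. (f x)\<^sup>2 * ln ((f x)\<^sup>2)"] by (simp add: variance_def)
qed

text \<open>With c = 1 / (4 pi) the factor (2c)^2 / (2c) is 1 / (2 pi), the constant of the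
  deficit.\<close>

lemma energy_ge:
  "(\<integral>x. (norm (drift x))\<^sup>2 \<partial>density lborel law) / (2 * variance) \<le> 1 / (2 * pi) * (\<integral>x. (norm (g x))\<^sup>2 \<partial>gauss)"
proof -
  have "(\<integral>x. (norm (drift x))\<^sup>2 \<partial>density lborel law) / (2 * variance)
      \<le> (2 * variance)\<^sup>2 * (\<integral>x. (norm (g x))\<^sup>2 \<partial>gauss) / (2 * variance)"
    by (intro divide_right_mono drift_sq) (simp add: less_imp_le[OF variance_pos])
  also have "\<dots> = (2 * variance) * (\<integral>x. (norm (g x))\<^sup>2 \<partial>gauss)"
    using less_imp_neq[OF variance_pos] by (simp add: power2_eq_square)
  finally show ?thesis by (simp add: variance_def)
qed

text \<open>Factor f^2 - 1 = (f - 1)(f + 1) and use |f - 1| <= f + 1. The sign of f is essential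
  here: the constant -1 has the same law as 1.\<close>

lemma dist_one_le: "(\<integral>x. \<bar>f x - 1\<bar>\<^sup>2 \<partial>gauss) \<le> (\<integral>y. \<bar>law y - heat_kernel variance y\<bar> \<partial>lborel)"
proof -
  have le: "heat_kernel variance x * \<bar>f x - 1\<bar>\<^sup>2 \<le> \<bar>law x - heat_kernel variance x\<bar>" for x
  proof -
    have "\<bar>f x - 1\<bar> * \<bar>f x - 1\<bar> \<le> \<bar>f x - 1\<bar> * \<bar>f x + 1\<bar>"
      using f_nonneg[of x] by (intro mult_left_mono) auto
    then have "\<bar>f x - 1\<bar>\<^sup>2 \<le> \<bar>(f x)\<^sup>2 - 1\<bar>"
      by (simp add: power2_eq_square abs_mult[symmetric] algebra_simps)
    then have "heat_kernel variance x * \<bar>f x - 1\<bar>\<^sup>2 \<le> heat_kernel variance x * \<bar>(f x)\<^sup>2 - 1\<bar>"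
      by (intro mult_left_mono) auto
    also have "\<dots> = \<bar>heat_kernel variance x * ((f x)\<^sup>2 - 1)\<bar>" by (simp add: abs_mult)
    also have "heat_kernel variance x * ((f x)\<^sup>2 - 1) = law x - heat_kernel variance x"
      by (simp add: law_def algebra_simps)
    finally show ?thesis .
  qed
  have i: "integrable lborel (\<lambda>x. \<bar>law x - heat_kernel variance x\<bar>)"
    using channel.integrable_p heat_kernel_mass[OF variance_pos] by simp
  have j: "integrable lborel (\<lambda>x. heat_kernel variance x * \<bar>f x - 1\<bar>\<^sup>2)"
    by (rule Bochner_Integration.integrable_bound[OF i]) (use le in auto)
  show ?thesis
    using integral_mono[OF j i le] integral_gauss(1)[of "\<lambda>x. \<bar>f x - 1\<bar>\<^sup>2"] by (simp add: variance_def)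
qed

lemma first_moment: "(\<integral>x. x \<partial>density lborel law) = (\<integral>x. (f x)\<^sup>2 *\<^sub>R x \<partial>gauss)"
  using channel.integral_\<mu>[of "\<lambda>x. x"] integral_gauss(1)[of "\<lambda>x. (f x)\<^sup>2 *\<^sub>R x"]
  by (simp add: law_def variance_def mult.commute)

lemma second_moment_eq: "(\<integral>x. (norm x)\<^sup>2 \<partial>density lborel law) = (\<integral>x. (norm x)\<^sup>2 * (f x)\<^sup>2 \<partial>gauss)"
  using channel.integral_\<mu>[of "\<lambda>x. (norm x)\<^sup>2"] integral_gauss(1)[of "\<lambda>x. (norm x)\<^sup>2 * (f x)\<^sup>2"]
  by (simp add: law_def variance_def mult_ac)

end

theorem corollary1p15:
  fixes f :: "nat \<Rightarrow> real ^ 'n \<Rightarrow> real" and M :: real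
  assumes "M \<ge> real CARD('n) / (4 * pi)"
    and "\<And>k. f k \<in> borel_measurable borel"
    and "\<And>k. AE x in gauss. 0 \<le> f k x"
    and "\<And>k. (\<integral>x. \<bar>f k x\<bar>\<^sup>2 \<partial>gauss) = 1"
    and "\<And>k. (\<integral>x. \<bar>f k x\<bar>\<^sup>2 *\<^sub>R x \<partial>gauss) = 0"
    and "\<And>k. (\<integral>\<^sup>+x. ennreal ((norm x)\<^sup>2 * \<bar>f k x\<bar>\<^sup>2) \<partial>gauss) \<le> ennreal M"
    and "(\<lambda>k. deficit (f k)) \<longlonglongrightarrow> 0"
  shows "(\<lambda>k. \<integral>x. \<bar>f k x - 1\<bar>\<^sup>2 \<partial>gauss) \<longlonglongrightarrow> 0"
proof -
  note [measurable] = assms(2)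
  have M0: "M \<ge> 0" using order_trans[OF _ assms(1)] by simp
  \<comment> \<open>Finitely many deficits may be infinite; the sequence is cut at \<open>k0\<close>
    so that all later ones are real numbers.\<close>
  have "eventually (\<lambda>k. deficit (f k) < 1) sequentially" "eventually (\<lambda>k. - 1 < deficit (f k)) sequentially"
    using order_tendstoD[OF assms(7)] by auto
  then have "eventually (\<lambda>k. \<bar>deficit (f k)\<bar> \<noteq> \<infinity>) sequentially"
    by eventually_elim auto
  then obtain k0 where "\<forall>k\<ge>k0. \<bar>deficit (f k)\<bar> \<noteq> \<infinity>" by (auto simp: eventually_sequentially)
  then have k0: "\<bar>deficit (f (k + k0))\<bar> \<noteq> \<infinity>" for k by simp
  define D where "D k = real_of_ereal (deficit (f (k + k0)))" for k
  have D: "deficit (f (k + k0)) = ereal (D k)" for k using k0[of k] by (simp add: D_def ereal_real)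
  have "(\<lambda>k. deficit (f (k + k0))) \<longlonglongrightarrow> 0" by (rule LIMSEQ_ignore_initial_segment[OF assms(7)])
  then have D0: "D \<longlonglongrightarrow> 0" unfolding D zero_ereal_def by simp
  \<comment> \<open>Slack for \<open>deficit_realize\<close>, chosen to vanish in the limit.\<close>
  define \<eta> :: "nat \<Rightarrow> real" where "\<eta> k = 1 / (Suc k)" for k
  have \<eta>: "\<eta> \<longlonglongrightarrow> 0" "\<And>k. \<eta> k > 0" unfolding \<eta>_def by (rule LIMSEQ_Suc[OF lim_1_over_n]) simp
  \<comment> \<open>A representative that is nonnegative everywhere, as \<open>finite_energy\<close>
    demands; it differs from f only on a null set.\<close>
  define F where "F k x = \<bar>f (k + k0) x\<bar>" for k x
  have "\<forall>k. \<exists>g. has_weak_gradient (f (k + k0)) g \<and> integrable gauss (\<lambda>x. (norm (g x))\<^sup>2)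
      \<and> integrable gauss (\<lambda>x. (F k x)\<^sup>2 * ln ((F k x)\<^sup>2))
      \<and> 1 / (2 * pi) * (\<integral>x. (norm (g x))\<^sup>2 \<partial>gauss) - (\<integral>x. (F k x)\<^sup>2 * ln ((F k x)\<^sup>2) \<partial>gauss) \<le> D k + \<eta> k"
    (is "\<forall>k. \<exists>g. ?P k g")
  proof
    fix k
    from deficit_realize[OF assms(2) D \<eta>(2), of k k]
    show "\<exists>g. ?P k g" unfolding F_def power2_abs by blast
  qed
  then obtain g where gP: "\<forall>k. ?P k (g k)" by (rule exE[OF choice])
  from gP have g: "has_weak_gradient (f (k + k0)) (g k)" "integrable gauss (\<lambda>x. (norm (g k x))\<^sup>2)"
    and H: "integrable gauss (\<lambda>x. (F k x)\<^sup>2 * ln ((F k x)\<^sup>2))"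
    and le: "1 / (2 * pi) * (\<integral>x. (norm (g k x))\<^sup>2 \<partial>gauss) - (\<integral>x. (F k x)\<^sup>2 * ln ((F k x)\<^sup>2) \<partial>gauss) \<le> D k + \<eta> k" for k
    by blast+
  have AE: "AE x in gauss. f (k + k0) x = F k x" for k
    using assms(3)[of "k + k0"] unfolding F_def by eventually_elim simp
  have sq: "integrable gauss (\<lambda>x. (norm x)\<^sup>2 * (F k x)\<^sup>2)" "(\<integral>x. (norm x)\<^sup>2 * (F k x)\<^sup>2 \<partial>gauss) \<le> M" for k
  proof -
    show i: "integrable gauss (\<lambda>x. (norm x)\<^sup>2 * (F k x)\<^sup>2)"
      unfolding F_def by (rule integrableI_nonneg) (use assms(6)[of "k + k0"] in \<open>auto intro: le_less_trans\<close>)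
    have "ennreal (\<integral>x. (norm x)\<^sup>2 * (F k x)\<^sup>2 \<partial>gauss) \<le> ennreal M"
      by (subst nn_integral_eq_integral[OF i, symmetric]) (use assms(6)[of "k + k0"] in \<open>auto simp: F_def\<close>)
    then show "(\<integral>x. (norm x)\<^sup>2 * (F k x)\<^sup>2 \<partial>gauss) \<le> M" using M0 by (simp only: ennreal_le_iff)
  qed
  interpret en: finite_energy "F k" "g k" for k
  proof
    show "has_weak_gradient (F k) (g k)"
    proof (rule has_weak_gradient_cong_AE[OF g(1)])
      show "F k \<in> borel_measurable borel" unfolding F_def by measurable
      show "AE x in lborel. f (k + k0) x = F k x" using AE[of k] by (simp only: AE_gauss_iff)
    qed
  qed (use assms(4) g(2) sq in \<open>auto simp: F_def\<close>)
  define c :: real where "c = 1 / (4 * pi)"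
  have c: "en.variance = c" by (simp add: c_def en.variance_def)
  define \<mu> where "\<mu> k = density lborel (en.law k)" for k
  have sd: "score_density (\<mu> k) c (en.drift k) (en.law k)" for k
    unfolding \<mu>_def c[symmetric] by (rule en.score_density_axioms)
  have M: "(\<integral>x. (norm x)\<^sup>2 \<partial>\<mu> k) \<le> M" for k
    using sq(2)[of k] en.second_moment_eq[of k] by (simp add: \<mu>_def)
  have "(\<lambda>k. \<integral>x. norm (en.drift k x) \<partial>\<mu> k) \<longlonglongrightarrow> 0"
  proof (rule score_tendsto_zero[OF sd M, where \<delta>="\<lambda>k. D k + \<eta> k"])
    fix k
    show "(\<integral>x. x \<partial>\<mu> k) = 0" using assms(5)[of "k + k0"] en.first_moment[of k] by (simp add: \<mu>_def F_def)
    show "integrable lborel (\<lambda>y. score_density.relative_density c y (en.law k y))"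
      unfolding c[symmetric] by (rule en.integral_relative_density(1)[OF H])
    show "(\<integral>x. (norm (en.drift k x))\<^sup>2 \<partial>\<mu> k) / (2 * c)
      - (\<integral>y. score_density.relative_density c y (en.law k y) \<partial>lborel) \<le> D k + \<eta> k"
      using en.integral_relative_density(2)[OF H, of k] en.energy_ge[of k] le[of k]
      unfolding c[symmetric] \<mu>_def by linarith
  next
    show "(\<lambda>k. D k + \<eta> k) \<longlonglongrightarrow> 0" using tendsto_add[OF D0 \<eta>(1)] by simp
  qed
  then have lim: "(\<lambda>k. \<integral>y. \<bar>en.law k y - heat_kernel c y\<bar> \<partial>lborel) \<longlonglongrightarrow> 0"
    by (rule score_to_zero_imp_L1[OF sd M])
  have "(\<lambda>k. \<integral>x. \<bar>F k x - 1\<bar>\<^sup>2 \<partial>gauss) \<longlonglongrightarrow> 0"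
    by (rule tendsto_sandwich[OF _ _ tendsto_const lim]) (use en.dist_one_le in \<open>simp_all add: c\<close>)
  moreover have "(\<integral>x. \<bar>f (k + k0) x - 1\<bar>\<^sup>2 \<partial>gauss) = (\<integral>x. \<bar>F k x - 1\<bar>\<^sup>2 \<partial>gauss)" for k
    by (rule integral_cong_AE) (use AE[of k] in \<open>auto simp: F_def\<close>)
  ultimately have "(\<lambda>k. \<integral>x. \<bar>f (k + k0) x - 1\<bar>\<^sup>2 \<partial>gauss) \<longlonglongrightarrow> 0" by simp
  then show ?thesis by (rule LIMSEQ_offset)
qed

end
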